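(* Let $A,A',B,B'$ be convex polyhedral cones in $\mathbb{R}^3$ (with apex $O$) with non-empty interior such that $A,A',-B,-B'\subset\{x:x_3\ge 0\}$ and each of $A,B,A',B'$ meets $\{x:x_3=0\}$ only in $O$. Put $F=A\cap\{x_3=1\}$, $F'=A'\cap\{x_3=1\}$, $G=(-B)\cap\{x_3=1\}$, $G'=(-B')\cap\{x_3=1\}$. Assume $g_{A,B}=g_{A',B'}$, and let $H=\operatorname{conv}(F\cup G)=\operatorname{conv}(F'\cup G')$. Let $z_1,\dots,z_n$ denote the vertices of the polygon $H$ in counterclockwise order (indices modulo $n$). Assume that for each $i=1,\dots,n$: (1) $z_i\in F\cap G$ if and only if $z_i\in F'\cap G'$; (2) the segment $[z_i,z_{i+1}]$ is an edge of $F$ or of $G$ if and only if it is an edge of $F'$ or of $G'$; (3) if $z_i\notin F\cap G$, then the one of the two polygons $F,G$ which contains $z_i$ coincides in a neighbourhood of $z_i$ with the one of the two polygons $F',G'$ which contains $z_i$. Then either $A=A'$ and $B=B'$, or else $A=-B'$ and $B=-A'$.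
   Context: The origin is $O$, and $x=(x_1,x_2,x_3)\in\mathbb{R}^3$. "Cone" always means cone with apex $O$. The cross covariogram of two convex sets $K,L\subset\mathbb{R}^3$ is $g_{K,L}(x)=\lambda_3(K\cap(L+x))$, for those $x\in\mathbb{R}^3$ for which this volume is finite (in the present setting it is finite for all $x$). The equality $\operatorname{conv}(F\cup G)=\operatorname{conv}(F'\cup G')$ used in defining $H$ is a consequence of $g_{A,B}=g_{A',B'}$, since the support of $g_{A,B}$ is $A+(-B)=\operatorname{conv}(A\cup(-B))$. *)

theory Defs
  imports "HOL-Analysis.Analysis"
begin

text \<open>The values are taken in \<^typ>\<open>ennreal\<close>, so that an infinite volume is not confused with the
  volume 0. Convex sets are Lebesgue measurable but need not be Borel, hence \<^const>\<open>lebesgue\<close>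
  rather than \<^const>\<open>lborel\<close>.\<close>

definition cross_covariogram :: "(real^3) set \<Rightarrow> (real^3) set \<Rightarrow> real^3 \<Rightarrow> ennreal" where
  "cross_covariogram K L x = emeasure lebesgue (K \<inter> (\<lambda>y. y + x) ` L)"

text \<open>Twice the signed area of the triangle spanned by the projections of \<open>p\<close>, \<open>q\<close>, \<open>r\<close> to the
  first two coordinates. It is positive iff the projections form a counterclockwise triangle.\<close>

definition orient :: "real^3 \<Rightarrow> real^3 \<Rightarrow> real^3 \<Rightarrow> real" where
  "orient p q r = (q$1 - p$1) * (r$2 - p$2) - (q$2 - p$2) * (r$1 - p$1)"

text \<open>For a convex polygon \<open>P\<close> in a horizontal plane, oriented by the first two coordinates:
  \<open>z 0, \<dots>, z (n - 1)\<close> are its vertices, without repetition, in counterclockwise order,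
  i.e. any three of them taken in the order of their indices form a counterclockwise triangle.\<close>

definition ccw_vertices :: "(real^3) set \<Rightarrow> nat \<Rightarrow> (nat \<Rightarrow> real^3) \<Rightarrow> bool" where
  "ccw_vertices P n z \<longleftrightarrow>
     bij_betw z {..<n} {v. v extreme_point_of P} \<and>
     (\<forall>i j k. i < j \<and> j < k \<and> k < n \<longrightarrow> orient (z i) (z j) (z k) > 0)"

definition coincide_near :: "real^3 \<Rightarrow> (real^3) set \<Rightarrow> (real^3) set \<Rightarrow> bool" where
  "coincide_near p P Q \<longleftrightarrow> (\<exists>U. open U \<and> p \<in> U \<and> P \<inter> U = Q \<inter> U)"

end

theory Submission
  imports Defs "HOL-Probability.Distributions" "HOL-Computational_Algebra.Polynomial"
begin

text \<open>Put \<open>C = -B\<close>, \<open>C' = -B'\<close>. Integrating \<open>exp (-\<xi> \<bullet> x)\<close> against the cross covariogram shows that the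
  product of the Laplace transforms of \<open>A\<close> and \<open>C\<close> is that of \<open>A'\<close> and \<open>C'\<close>; nothing else is used of
  the covariogram. Let \<open>\<xi>\<close> tend to a boundary point of the dual cone that exposes a vertex \<open>v\<close> of \<open>H\<close>.
  If \<open>v\<close> lies only in \<open>A\<close> and \<open>A'\<close>, which coincide near \<open>v\<close>, the diverging factors cancel, and the rest is a
  Stieltjes-type transform that determines the X-rays of \<open>C\<close> and \<open>C'\<close> in direction \<open>v\<close>, so these agree.
  If \<open>v\<close> lies in all four cones, the leading term of the expansion gives the angles of the four cones at \<open>v\<close>
  up to naming, and the next term is a linear relation between the differences of the boundary
  functions; by partial fractions it localizes the kinks of these differences.

  If two vertices of \<open>H\<close> are shared, start at a shared vertex with a simple neighbour. Up to the first
  vertex of \<open>C\<close>, the cones \<open>A\<close> and \<open>A'\<close> agree on the part of \<open>H\<close> cut off by a chord, hence so do \<open>C\<close> and \<open>C'\<close>,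
  and the X-ray from the simple neighbour carries this over to all of \<open>C\<close>. If at most one vertex is shared,
  the edge condition forces all vertices to be distributed in the same way, and unless one cone contains
  them all, a chain of vertices of \<open>C\<close> lies between two (possibly equal) vertices of \<open>A\<close>; the X-rays of
  \<open>C\<close> and \<open>C'\<close> from these points agree, and inspecting the first planes through them on which \<open>C\<close> and \<open>C'\<close>
  differ gives \<open>C = C'\<close>.
  Once \<open>C = C'\<close>, the Laplace transforms of \<open>A\<close> and \<open>A'\<close> agree, so \<open>A = A'\<close>.\<close>

section \<open>Laplace transforms of cones\<close>

text \<open>A product of two transforms does not distinguish its factors, so a comparison at a
  vertex either cancels a factor or leaves two unknown differences in one linear relation. In the
  second case agreement of \<open>A\<close> and \<open>A'\<close> on an initial range of directions
  excludes their kinks there; the kinks of the other difference must then vanish too, since poles at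
  different points cannot cancel. The exponent 3 of the kernel is the dimension: radial integration
  over a cone gives 2/m^3. A further integration along a ray of the cone leaves the exponent 2 and a
  factor 1/\<open>ta\<close>, which is the divergence at a vertex.

  X-rays from two points suffice for the following reason. Just beyond the first plane on which two
  cones can differ, equal lengths seen from one point force both ends of a chord to move by the same
  first-order amount. Seen from the other point, this displacement is divided by the positions
  \<open>Lw\<close> and \<open>Hw\<close> of the two ends, which differ, so it is zero.

  All conditions are phrased symmetrically under exchange of cones and under rotation and reversal
  of the vertices, so that each argument is given in one position only.\<close>

definition lap :: "(real^3) set \<Rightarrow> real^3 \<Rightarrow> ennreal" where
  "lap K \<xi> = (\<integral>\<^sup>+x. indicator K x * ennreal (exp (- (\<xi> \<bullet> x))) \<partial>lborel)"

section \<open>Lebesgue measure in linear coordinates\<close>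

text \<open>Splits the measure so that Tonelli applies to one coordinate at a time. It suffices to
  compare both sides on boxes, where the right side is a product of three lengths.\<close>

lemma lborel_vector3:
  "lborel = distr (lborel :: (real \<times> real \<times> real) measure) borel
     (\<lambda>(y, x, t). vector [y, x, t] :: real^3)"
proof (rule lborel_eqI)
  define P where "P = (\<lambda>(y, x, t). vector [y, x, t] :: real^3)"
  have Peq: "P = (\<lambda>p. fst p *\<^sub>R axis 1 1 + fst (snd p) *\<^sub>R axis 2 1 + snd (snd p) *\<^sub>R axis 3 1)"
    by (auto simp: P_def fun_eq_iff vec_eq_iff forall_3 axis_def)
  have meas: "P \<in> borel_measurable borel"
    unfolding Peq by (intro borel_measurable_continuous_onI continuous_intros)
  fix l u :: "real^3" assume le: "\<And>b. b \<in> Basis \<Longrightarrow> l \<bullet> b \<le> u \<bullet> b"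
  have le': "l$i \<le> u$i" for i
    using le[of "axis i 1"] by (auto simp: inner_axis)
  have "P -` box l u = box (l$1) (u$1) \<times> box (l$2) (u$2) \<times> box (l$3) (u$3)"
    by (auto simp: P_def mem_box_cart forall_3)
  hence "emeasure (distr lborel borel P) (box l u)
      = emeasure (lborel \<Otimes>\<^sub>M (lborel \<Otimes>\<^sub>M lborel)) (box (l$1) (u$1) \<times> box (l$2) (u$2) \<times> box (l$3) (u$3))"
    using meas by (subst emeasure_distr) (auto simp: lborel_prod)
  also have "\<dots> = ennreal (u$1 - l$1) * (ennreal (u$2 - l$2) * ennreal (u$3 - l$3))"
  proof -
    have "emeasure ((lborel::real measure) \<Otimes>\<^sub>M (lborel::(real\<times>real) measure)) (box (l$1) (u$1) \<times> (box (l$2) (u$2) \<times> box (l$3) (u$3)))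
       = emeasure lborel (box (l$1) (u$1)) * emeasure (lborel::(real\<times>real) measure) (box (l$2) (u$2) \<times> box (l$3) (u$3))"
      by (intro lborel.emeasure_pair_measure_Times) (auto simp: borel_Times)
    moreover have "emeasure (lborel \<Otimes>\<^sub>M lborel) (box (l$2) (u$2) \<times> box (l$3) (u$3))
       = emeasure lborel (box (l$2) (u$2)) * emeasure lborel (box (l$3) (u$3))"
      by (intro lborel.emeasure_pair_measure_Times) auto
    ultimately show ?thesis using le' by (simp add: lborel_prod)
  qed
  also have "\<dots> = ennreal ((u$1 - l$1) * (u$2 - l$2) * (u$3 - l$3))"
    using le' by (simp add: ennreal_mult mult.assoc)
  also have "(u$1 - l$1) * (u$2 - l$2) * (u$3 - l$3) = (\<Prod>b\<in>Basis. (u - l) \<bullet> b)"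
  proof -
    have B: "(Basis :: (real^3) set) = (\<lambda>i. axis i 1) ` UNIV"
      by (auto simp: Basis_vec_def)
    have inj: "inj (\<lambda>i::3. axis i (1::real))"
      by (auto simp: inj_on_def axis_eq_axis)
    show ?thesis
    proof -
      have "(\<Prod>b\<in>Basis. (u - l) \<bullet> b) = (\<Prod>i\<in>UNIV. (u - l) \<bullet> axis (i::3) 1)"
        unfolding B using prod.reindex[OF inj, of "\<lambda>b. (u - l) \<bullet> b"] by (simp only: o_def)
      also have "\<dots> = (\<Prod>i\<in>UNIV. (u - l) $ (i::3))"
        by (intro prod.cong refl) (simp only: inner_axis inner_real_def mult_1_right)
      also have "\<dots> = (u - l)$1 * ((u - l)$2 * (u - l)$3)"
        unfolding UNIV_3 by (subst prod.insert; simp; subst prod.insert; simp)?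
      finally show ?thesis by (simp add: mult.assoc)
    qed
  qed
  finally show "emeasure (distr lborel borel (\<lambda>(y, x, t). vector [y, x, t] :: real^3)) (box l u)
      = ennreal (\<Prod>b\<in>Basis. (u - l) \<bullet> b)"
    unfolding P_def .
qed auto

text \<open>The factor is the absolute determinant of \<open>L\<close>, obtained as
  1/\<open>d\<close> from the inverse map \<open>M\<close>. It stays anonymous because only its
  positivity and its independence of \<open>f\<close> matter later.\<close>

lemma nn_integral_linear_bij:
  fixes L :: "real^3 \<Rightarrow> real^3"
  assumes L: "linear L" "inj L"
  obtains \<kappa> where "0 < \<kappa>"
    "\<And>f. f \<in> borel_measurable borel \<Longrightarrow>
       (\<integral>\<^sup>+x. f x \<partial>lborel) = ennreal \<kappa> * (\<integral>\<^sup>+x. f (L x) \<partial>lborel)"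
proof -
  obtain M where M: "linear M" "\<And>x. M (L x) = x" "\<And>x. L (M x) = x"
    using linear_injective_isomorphism[OF L] by blast
  define d where "d = \<bar>det (matrix M)\<bar>"
  have "invertible (matrix M)"
    by (metis M L(1) matrix_left_invertible_injective invertible_left_inverse inj_on_def matrix_vector_mul(2))
  hence "det (matrix M) \<noteq> 0"
    by (simp add: invertible_det_nz)
  hence d: "d > 0" by (simp add: d_def)
  have contL: "continuous_on UNIV L" using L(1) by (rule linear_continuous_on[OF linear_conv_bounded_linear[THEN iffD1]])
  have measL: "L \<in> borel_measurable borel"
    by (intro borel_measurable_continuous_onI contL)
  have eq: "lborel = density (distr lborel borel L) (\<lambda>_. ennreal (1/d))"
  proof (rule lborel_eqI)
    fix l u :: "real^3" assume le: "\<And>b. b \<in> Basis \<Longrightarrow> l \<bullet> b \<le> u \<bullet> b"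
    have im: "L -` box l u = M ` box l u"
    proof safe
      fix x assume "L x \<in> box l u"
      thus "x \<in> M ` box l u" using M(2)[of x] by (metis imageI)
    qed (simp add: M)
    have bx: "box l u \<in> lmeasurable" by simp
    have "emeasure (distr lborel borel L) (box l u) = emeasure lborel (M ` box l u)"
      using measL by (subst emeasure_distr) (auto simp: im)
    also have "\<dots> = emeasure lebesgue (M ` box l u)"
    proof -
      have "M ` box l u \<in> sets borel"
        using measurable_sets[OF measL, of "box l u"] im by simp
      thus ?thesis by simp
    qed
    also have "\<dots> = ennreal (measure lebesgue (M ` box l u))"
      using measurable_linear_image[OF M(1) bx] by (simp add: emeasure_eq_measure2 fmeasurableD2 emeasure_eq_ennreal_measure)
    also have "measure lebesgue (M ` box l u) = d * measure lebesgue (box l u)"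
      using measure_linear_image[OF M(1) bx] by (simp add: d_def)
    also have "measure lebesgue (box l u) = (\<Prod>b\<in>Basis. (u - l) \<bullet> b)"
      using le by (simp add: measure_lborel_box_eq inner_diff_left)
    finally have E: "emeasure (distr lborel borel L) (box l u) = ennreal (d * (\<Prod>b\<in>Basis. (u - l) \<bullet> b))" .
    have "emeasure (density (distr lborel borel L) (\<lambda>_. ennreal (1/d))) (box l u)
        = ennreal (1/d) * emeasure (distr lborel borel L) (box l u)"
      by (subst emeasure_density_const) auto
    also have "\<dots> = ennreal (\<Prod>b\<in>Basis. (u - l) \<bullet> b)"
      unfolding E using d by (simp add: ennreal_mult''[symmetric] ennreal_mult'[symmetric])
    finally show "emeasure (density (distr lborel borel L) (\<lambda>_. ennreal (1/d))) (box l u)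
        = ennreal (\<Prod>b\<in>Basis. (u - l) \<bullet> b)" .
  qed auto
  show thesis
  proof (rule that[of "1/d"])
    fix f :: "real^3 \<Rightarrow> ennreal" assume f: "f \<in> borel_measurable borel"
    have "(\<integral>\<^sup>+x. f x \<partial>lborel) = (\<integral>\<^sup>+x. ennreal (1/d) * f (L x) \<partial>lborel)"
      using f measL by (subst eq) (simp add: nn_integral_density nn_integral_distr)
    also have "\<dots> = ennreal (1/d) * (\<integral>\<^sup>+x. f (L x) \<partial>lborel)"
      using measurable_compose[OF measL f] by (intro nn_integral_cmult) auto
    finally show "(\<integral>\<^sup>+x. f x \<partial>lborel) = ennreal (1/d) * (\<integral>\<^sup>+x. f (L x) \<partial>lborel)" .
  qed (use d in auto)
qed

text \<open>The order of the coordinates is the order of use: \<open>y\<close> becomes the radial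
  variable of a cone, and the innermost \<open>t\<close> runs in the direction \<open>v\<close> in
  which the integrals will diverge.\<close>

lemma nn_integral_frame:
  fixes w0 w1 v :: "real^3"
  assumes ind: "\<And>y x t. y *\<^sub>R w0 + x *\<^sub>R w1 + t *\<^sub>R v = 0 \<Longrightarrow> y = 0 \<and> x = 0 \<and> t = 0"
  obtains \<kappa> where "0 < \<kappa>"
    "\<And>f. f \<in> borel_measurable borel \<Longrightarrow>
       (\<integral>\<^sup>+x. f x \<partial>lborel) = ennreal \<kappa> *
         (\<integral>\<^sup>+y. \<integral>\<^sup>+x. \<integral>\<^sup>+t. f (y *\<^sub>R w0 + x *\<^sub>R w1 + t *\<^sub>R v) \<partial>lborel \<partial>lborel \<partial>lborel)"
proof -
  define L where "L = (\<lambda>a::real^3. a$1 *\<^sub>R w0 + a$2 *\<^sub>R w1 + a$3 *\<^sub>R v)"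
  have lin: "linear L"
    by (rule linearI) (auto simp: L_def algebra_simps)
  have inj: "inj L"
    unfolding linear_injective_0[OF lin]
  proof (intro allI impI)
    fix a assume "L a = 0"
    from ind[OF this[unfolded L_def]] show "a = 0" by (simp add: vec_eq_iff forall_3)
  qed
  obtain \<kappa> where k: "0 < \<kappa>" "\<And>f. f \<in> borel_measurable borel \<Longrightarrow>
       (\<integral>\<^sup>+x. f x \<partial>lborel) = ennreal \<kappa> * (\<integral>\<^sup>+x. f (L x) \<partial>lborel)"
    using nn_integral_linear_bij[OF lin inj] by blast
  define P where "P = (\<lambda>(y, x, t). vector [y, x, t] :: real^3)"
  have Peq: "P = (\<lambda>p. fst p *\<^sub>R axis 1 1 + fst (snd p) *\<^sub>R axis 2 1 + snd (snd p) *\<^sub>R axis 3 1)"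
    by (auto simp: P_def fun_eq_iff vec_eq_iff forall_3 axis_def)
  have measP: "P \<in> borel_measurable borel"
    unfolding Peq by (intro borel_measurable_continuous_onI continuous_intros)
  have measL: "L \<in> borel_measurable borel"
    by (intro borel_measurable_continuous_onI linear_continuous_on[OF linear_conv_bounded_linear[THEN iffD1]] lin)
  show thesis
  proof (rule that[OF k(1)])
    fix f :: "real^3 \<Rightarrow> ennreal" assume f: "f \<in> borel_measurable borel"
    have fL: "(\<lambda>x. f (L x)) \<in> borel_measurable borel" using measurable_compose[OF measL f] by simp
    have fLP: "(\<lambda>p. f (L (P p))) \<in> borel_measurable borel" using measurable_compose[OF measP fL] by simp
    have "(\<integral>\<^sup>+x. f (L x) \<partial>lborel) = (\<integral>\<^sup>+p. f (L (P p)) \<partial>lborel)"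
      unfolding P_def using fL measP by (subst lborel_vector3, subst nn_integral_distr) (auto simp: P_def)
    also have "\<dots> = (\<integral>\<^sup>+y. \<integral>\<^sup>+q. f (L (P (y, q))) \<partial>lborel \<partial>lborel)"
      using fLP by (subst lborel_prod[symmetric], subst lborel.nn_integral_fst[symmetric]) (auto simp: lborel_prod)
    also have "\<dots> = (\<integral>\<^sup>+y. \<integral>\<^sup>+x. \<integral>\<^sup>+t. f (L (P (y, x, t))) \<partial>lborel \<partial>lborel \<partial>lborel)"
    proof (intro nn_integral_cong)
      fix y :: real
      have 1: "(\<lambda>q. (y, q)) \<in> borel_measurable (borel :: (real\<times>real) measure)"
        by (intro borel_measurable_continuous_onI continuous_intros)
      have "(\<lambda>q. f (L (P (y, q)))) \<in> borel_measurable borel"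
        using measurable_compose[OF 1 fLP] .
      thus "(\<integral>\<^sup>+q. f (L (P (y, q))) \<partial>lborel) = (\<integral>\<^sup>+x. \<integral>\<^sup>+t. f (L (P (y, x, t))) \<partial>lborel \<partial>lborel)"
        by (subst lborel_prod[symmetric], subst lborel.nn_integral_fst[symmetric]) (auto simp: lborel_prod)
    qed
    finally show "(\<integral>\<^sup>+x. f x \<partial>lborel) = ennreal \<kappa> *
         (\<integral>\<^sup>+y. \<integral>\<^sup>+x. \<integral>\<^sup>+t. f (y *\<^sub>R w0 + x *\<^sub>R w1 + t *\<^sub>R v) \<partial>lborel \<partial>lborel \<partial>lborel)"
      by (simp add: k(2)[OF f] L_def P_def)
  qed
qed

section \<open>Transforms of covariograms and of cones\<close>

text \<open>The covariogram at \<open>w\<close> is the convolution of the indicators of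
  \<open>A\<close> and of the reflected \<open>B\<close>, and a convolution is transformed into a
  product. All integrands are nonnegative, so Tonelli applies even where the transforms are
  infinite.\<close>

lemma lap_mult:
  assumes "closed A" "closed B"
  shows "lap A \<xi> * lap (uminus ` B) \<xi>
    = (\<integral>\<^sup>+w. ennreal (exp (- (\<xi> \<bullet> w))) * cross_covariogram A B w \<partial>lborel)"
proof -
  define C where "C = uminus ` B"
  have clC: "closed C" using assms(2) unfolding C_def by (rule closed_negations)
  have bA[measurable]: "A \<in> sets borel" and bC[measurable]: "C \<in> sets borel"
    using assms(1) clC by auto
  have cov: "cross_covariogram A B w = (\<integral>\<^sup>+x. indicator A x * indicator C (w - x) \<partial>lborel)" for w
  proof -
    have clt: "closed ((\<lambda>y. y + w) ` B)"
      using closed_translation[OF assms(2), of w] by (simp add: add.commute)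
    have mem: "x \<in> (\<lambda>y. y + w) ` B \<longleftrightarrow> w - x \<in> C" for x
    proof -
      have "x \<in> (\<lambda>y. y + w) ` B \<longleftrightarrow> x - w \<in> B" by (force simp: image_iff)
      also have "\<dots> \<longleftrightarrow> w - x \<in> C"
        unfolding C_def by (metis (no_types, lifting) image_iff minus_diff_eq minus_minus)
      finally show ?thesis .
    qed
    have "A \<inter> (\<lambda>y. y + w) ` B \<in> sets borel" using clt assms(1) by auto
    hence "cross_covariogram A B w = emeasure lborel (A \<inter> (\<lambda>y. y + w) ` B)"
      by (simp add: cross_covariogram_def)
    also have "\<dots> = (\<integral>\<^sup>+x. indicator (A \<inter> (\<lambda>y. y + w) ` B) x \<partial>lborel)"
      using \<open>A \<inter> (\<lambda>y. y + w) ` B \<in> sets borel\<close> by simp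
    also have "\<dots> = (\<integral>\<^sup>+x. indicator A x * indicator C (w - x) \<partial>lborel)"
      by (intro nn_integral_cong) (simp add: indicator_def mem)
    finally show ?thesis .
  qed
  have "(\<integral>\<^sup>+w. ennreal (exp (- (\<xi> \<bullet> w))) * cross_covariogram A B w \<partial>lborel)
     = (\<integral>\<^sup>+w. \<integral>\<^sup>+x. ennreal (exp (- (\<xi> \<bullet> w))) * (indicator A x * indicator C (w - x)) \<partial>lborel \<partial>lborel)"
    unfolding cov by (intro nn_integral_cong nn_integral_cmult[symmetric]) measurable
  also have "\<dots> = (\<integral>\<^sup>+x. \<integral>\<^sup>+w. ennreal (exp (- (\<xi> \<bullet> w))) * (indicator A x * indicator C (w - x)) \<partial>lborel \<partial>lborel)"
    by (rule lborel_pair.Fubini') measurable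
  also have "\<dots> = (\<integral>\<^sup>+x. (indicator A x * ennreal (exp (- (\<xi> \<bullet> x)))) * lap C \<xi> \<partial>lborel)"
  proof (intro nn_integral_cong)
    fix x
    have "(\<integral>\<^sup>+w. ennreal (exp (- (\<xi> \<bullet> w))) * (indicator A x * indicator C (w - x)) \<partial>lborel)
        = (\<integral>\<^sup>+w. ennreal (exp (- (\<xi> \<bullet> w))) * (indicator A x * indicator C (w - x)) \<partial>distr lborel borel ((+) x))"
      by (simp add: lborel_distr_plus)
    also have "\<dots> = (\<integral>\<^sup>+y. ennreal (exp (- (\<xi> \<bullet> (x + y)))) * (indicator A x * indicator C y) \<partial>lborel)"
      by (subst nn_integral_distr) auto
    also have "\<dots> = (\<integral>\<^sup>+y. (indicator A x * ennreal (exp (- (\<xi> \<bullet> x)))) * (indicator C y * ennreal (exp (- (\<xi> \<bullet> y)))) \<partial>lborel)"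
    proof (intro nn_integral_cong)
      fix y
      have "ennreal (exp (- (\<xi> \<bullet> (x + y)))) = ennreal (exp (- (\<xi> \<bullet> x))) * ennreal (exp (- (\<xi> \<bullet> y)))"
        by (simp add: ennreal_mult[symmetric] exp_add[symmetric] inner_add_right)
      thus "ennreal (exp (- (\<xi> \<bullet> (x + y)))) * (indicator A x * indicator C y)
         = (indicator A x * ennreal (exp (- (\<xi> \<bullet> x)))) * (indicator C y * ennreal (exp (- (\<xi> \<bullet> y))))"
        by (simp add: mult_ac)
    qed
    also have "\<dots> = (indicator A x * ennreal (exp (- (\<xi> \<bullet> x)))) * lap C \<xi>"
      unfolding lap_def by (rule nn_integral_cmult) measurable
    finally show "(\<integral>\<^sup>+w. ennreal (exp (- (\<xi> \<bullet> w))) * (indicator A x * indicator C (w - x)) \<partial>lborel)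
      = (indicator A x * ennreal (exp (- (\<xi> \<bullet> x)))) * lap C \<xi>" .
  qed
  also have "\<dots> = lap A \<xi> * lap C \<xi>"
    unfolding lap_def[of A] by (rule nn_integral_multc) measurable
  finally show ?thesis by (simp add: C_def)
qed

text \<open>The Laplace transform of a cone, up to a constant, as an integral over the section by the plane
  \<open>w0 + span {w1, v}\<close>; \<open>la\<close> and \<open>\<tau>\<close> are the values at \<open>w1\<close> and \<open>v\<close> of a functional that is 1 at \<open>w0\<close>.\<close>

definition sint :: "(real^3) set \<Rightarrow> real^3 \<Rightarrow> real^3 \<Rightarrow> real^3 \<Rightarrow> real \<Rightarrow> real \<Rightarrow> ennreal" where
  "sint K w0 w1 v la \<tau> = (\<integral>\<^sup>+u. \<integral>\<^sup>+t. indicator K (w0 + u *\<^sub>R w1 + t *\<^sub>R v)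
      * ennreal (2 / (1 + la * u + \<tau> * t) ^ 3) \<partial>lborel \<partial>lborel)"

text \<open>The gamma integral for 2! after rescaling by \<open>m\<close>; the factor y^2 will come
  from the Jacobian of scaling a planar section.\<close>

lemma nn_integral_square_exp:
  assumes "m > (0::real)"
  shows "(\<integral>\<^sup>+y. indicator {0<..} y * ennreal (y\<^sup>2 * exp (- (y * m))) \<partial>lborel) = ennreal (2 / m ^ 3)"
proof -
  have "ennreal 2 = (\<integral>\<^sup>+x. ennreal (x ^ 2 * exp (- x)) * indicator {0..} x \<partial>lborel)"
    using nn_intergal_power_times_exp_Ici[of 2] by (simp add: numeral_2_eq_2)
  also have "\<dots> = ennreal \<bar>m\<bar> * (\<integral>\<^sup>+x. ennreal ((0 + m * x) ^ 2 * exp (- (0 + m * x))) * indicator {0..} (0 + m * x) \<partial>lborel)"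
    using assms by (intro nn_integral_real_affine) auto
  also have "\<dots> = ennreal m * (\<integral>\<^sup>+x. ennreal (m^2) * (indicator {0<..} x * ennreal (x\<^sup>2 * exp (- (x * m)))) \<partial>lborel)"
  proof -
    have "(\<integral>\<^sup>+x. ennreal ((0 + m * x) ^ 2 * exp (- (0 + m * x))) * indicator {0..} (0 + m * x) \<partial>lborel)
       = (\<integral>\<^sup>+x. ennreal (m^2) * (indicator {0<..} x * ennreal (x\<^sup>2 * exp (- (x * m)))) \<partial>lborel)"
    proof (rule nn_integral_cong)
      fix x :: real
      show "ennreal ((0 + m * x) ^ 2 * exp (- (0 + m * x))) * indicator {0..} (0 + m * x)
        = ennreal (m^2) * (indicator {0<..} x * ennreal (x\<^sup>2 * exp (- (x * m))))"
        using assms by (cases "x = 0") (auto simp: indicator_def zero_le_mult_iff ennreal_mult[symmetric] power_mult_distrib mult_ac)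
    qed
    thus ?thesis using assms by simp
  qed
  also have "\<dots> = ennreal m * (ennreal (m^2) * (\<integral>\<^sup>+x. (indicator {0<..} x * ennreal (x\<^sup>2 * exp (- (x * m)))) \<partial>lborel))"
    by (subst nn_integral_cmult) auto
  also have "\<dots> = ennreal (m^3) * (\<integral>\<^sup>+x. (indicator {0<..} x * ennreal (x\<^sup>2 * exp (- (x * m)))) \<partial>lborel)"
    using assms by (simp add: mult.assoc[symmetric] ennreal_mult[symmetric] power3_eq_cube power2_eq_square)
  finally have "ennreal (1/m^3) * ennreal 2 = ennreal (1/m^3) * ennreal (m^3) * (\<integral>\<^sup>+x. (indicator {0<..} x * ennreal (x\<^sup>2 * exp (- (x * m)))) \<partial>lborel)"
    by (simp add: mult.assoc)
  moreover have "ennreal (1/m^3) * ennreal 2 = ennreal (2 / m^3)"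
    using assms by (subst ennreal_mult[symmetric]) auto
  moreover have "ennreal (1/m^3) * ennreal (m^3) = 1"
    using assms by (subst ennreal_mult[symmetric]) auto
  ultimately show ?thesis by simp
qed

text \<open>A cone consists of the multiples of its section at \<open>\<eta>\<close> = 1. Scaling
  the section by \<open>y\<close> has Jacobian y^2, and integrating over \<open>y\<close> first
  leaves the kernel 2/m^3. The factor \<open>\<kappa>\<close> depends on the frame only and
  therefore cancels when products for different cones are compared.\<close>

lemma lap_frame:
  fixes w0 w1 v \<eta> :: "real^3"
  assumes ind: "\<And>y x t. y *\<^sub>R w0 + x *\<^sub>R w1 + t *\<^sub>R v = 0 \<Longrightarrow> y = 0 \<and> x = 0 \<and> t = 0"
    and \<eta>: "\<eta> \<bullet> w0 = 1" "\<eta> \<bullet> w1 = 0" "\<eta> \<bullet> v = 0"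
  obtains \<kappa> where "0 < \<kappa>"
    "\<And>K \<xi>. closed K \<Longrightarrow> cone K \<Longrightarrow> (\<And>x. x \<in> K \<Longrightarrow> \<eta> \<bullet> x \<ge> 0) \<Longrightarrow> \<xi> \<bullet> w0 = 1 \<Longrightarrow>
      (\<And>u t. w0 + u *\<^sub>R w1 + t *\<^sub>R v \<in> K \<Longrightarrow> 1 + (\<xi> \<bullet> w1) * u + (\<xi> \<bullet> v) * t > 0) \<Longrightarrow>
      lap K \<xi> = ennreal \<kappa> * sint K w0 w1 v (\<xi> \<bullet> w1) (\<xi> \<bullet> v)"
proof -
  obtain \<kappa> where k: "0 < \<kappa>" "\<And>f. f \<in> borel_measurable borel \<Longrightarrow>
       (\<integral>\<^sup>+x. f x \<partial>lborel) = ennreal \<kappa> *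
         (\<integral>\<^sup>+y. \<integral>\<^sup>+x. \<integral>\<^sup>+t. f (y *\<^sub>R w0 + x *\<^sub>R w1 + t *\<^sub>R v) \<partial>lborel \<partial>lborel \<partial>lborel)"
    using nn_integral_frame[OF ind] by blast
  show thesis
  proof (rule that[OF k(1)])
    fix K :: "(real^3) set" and \<xi> :: "real^3"
    assume K: "closed K" "cone K" and pos: "\<And>x. x \<in> K \<Longrightarrow> \<eta> \<bullet> x \<ge> 0" and x0: "\<xi> \<bullet> w0 = 1"
      and m: "\<And>u t. w0 + u *\<^sub>R w1 + t *\<^sub>R v \<in> K \<Longrightarrow> 1 + (\<xi> \<bullet> w1) * u + (\<xi> \<bullet> v) * t > 0"
    define la \<tau> where "la = \<xi> \<bullet> w1" and "\<tau> = \<xi> \<bullet> v"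
    have [measurable]: "K \<in> sets borel" using K by auto
    define f where "f = (\<lambda>x::real^3. indicator K x * ennreal (exp (- (\<xi> \<bullet> x))))"
    have f[measurable]: "f \<in> borel_measurable borel" unfolding f_def by measurable
    define g where "g = (\<lambda>y u t::real. indicator {0<..} y * ennreal (y\<^sup>2) * (indicator K (w0 + u *\<^sub>R w1 + t *\<^sub>R v)
        * ennreal (exp (- (y * (1 + la * u + \<tau> * t))))))"
    have gm[measurable]: "(\<lambda>(y,u,t). g y u t) \<in> borel_measurable (borel \<Otimes>\<^sub>M (borel \<Otimes>\<^sub>M borel))"
      unfolding g_def by measurable
    \<comment> \<open>Slices at negative height miss the cone, and slices at positive height are
      multiples of the section at height 1. The slice at height 0 is left out as a null set.\<close>
    have slice: "(\<integral>\<^sup>+x. \<integral>\<^sup>+t. f (y *\<^sub>R w0 + x *\<^sub>R w1 + t *\<^sub>R v) \<partial>lborel \<partial>lborel)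
        = (\<integral>\<^sup>+u. \<integral>\<^sup>+t. g y u t \<partial>lborel \<partial>lborel)" if y: "y \<noteq> 0" for y
    proof (cases "y > 0")
      case False
      hence "y < 0" using y by simp
      have "f (y *\<^sub>R w0 + x *\<^sub>R w1 + t *\<^sub>R v) = 0" for x t
      proof -
        have "\<eta> \<bullet> (y *\<^sub>R w0 + x *\<^sub>R w1 + t *\<^sub>R v) = y" using \<eta> by (simp add: inner_add_right)
        hence "y *\<^sub>R w0 + x *\<^sub>R w1 + t *\<^sub>R v \<notin> K" using pos[of "y *\<^sub>R w0 + x *\<^sub>R w1 + t *\<^sub>R v"] \<open>y < 0\<close> by auto
        thus ?thesis by (simp add: f_def)
      qed
      thus ?thesis using False by (simp add: g_def)
    next
      case True
      have Kc: "y *\<^sub>R z \<in> K \<longleftrightarrow> z \<in> K" for z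
      proof
        assume "y *\<^sub>R z \<in> K"
        hence "(1/y) *\<^sub>R (y *\<^sub>R z) \<in> K" using K(2) True unfolding cone_def by (meson less_imp_le zero_le_divide_1_iff)
        thus "z \<in> K" using True by simp
      qed (use K(2) True in \<open>auto simp: cone_def\<close>)
      have "(\<integral>\<^sup>+x. \<integral>\<^sup>+t. f (y *\<^sub>R w0 + x *\<^sub>R w1 + t *\<^sub>R v) \<partial>lborel \<partial>lborel)
         = ennreal \<bar>y\<bar> * (\<integral>\<^sup>+u. \<integral>\<^sup>+t. f (y *\<^sub>R w0 + (0 + y * u) *\<^sub>R w1 + t *\<^sub>R v) \<partial>lborel \<partial>lborel)"
        using True by (intro nn_integral_real_affine[where f="\<lambda>x. \<integral>\<^sup>+t. f (y *\<^sub>R w0 + x *\<^sub>R w1 + t *\<^sub>R v) \<partial>lborel"]) measurable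
      also have "\<dots> = ennreal y * (\<integral>\<^sup>+u. ennreal y * (\<integral>\<^sup>+t. f (y *\<^sub>R w0 + (0 + y * u) *\<^sub>R w1 + (0 + y * t) *\<^sub>R v) \<partial>lborel) \<partial>lborel)"
      proof -
        have "(\<integral>\<^sup>+t. f (y *\<^sub>R w0 + (0 + y * u) *\<^sub>R w1 + t *\<^sub>R v) \<partial>lborel)
            = ennreal \<bar>y\<bar> * (\<integral>\<^sup>+t. f (y *\<^sub>R w0 + (0 + y * u) *\<^sub>R w1 + (0 + y * t) *\<^sub>R v) \<partial>lborel)" for u
          using True by (intro nn_integral_real_affine[where f="\<lambda>t. f (y *\<^sub>R w0 + (0 + y * u) *\<^sub>R w1 + t *\<^sub>R v)"]) measurable
        thus ?thesis using True by simp
      qed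
      also have "\<dots> = ennreal y * (\<integral>\<^sup>+u. ennreal y * (\<integral>\<^sup>+t. indicator K (w0 + u *\<^sub>R w1 + t *\<^sub>R v)
        * ennreal (exp (- (y * (1 + la * u + \<tau> * t)))) \<partial>lborel) \<partial>lborel)"
      proof -
        have "f (y *\<^sub>R w0 + (0 + y * u) *\<^sub>R w1 + (0 + y * t) *\<^sub>R v) = indicator K (w0 + u *\<^sub>R w1 + t *\<^sub>R v)
          * ennreal (exp (- (y * (1 + la * u + \<tau> * t))))" for u t
        proof -
          have e: "y *\<^sub>R w0 + (0 + y * u) *\<^sub>R w1 + (0 + y * t) *\<^sub>R v = y *\<^sub>R (w0 + u *\<^sub>R w1 + t *\<^sub>R v)"
            by (simp add: algebra_simps)
          have "\<xi> \<bullet> (y *\<^sub>R (w0 + u *\<^sub>R w1 + t *\<^sub>R v)) = y * (1 + la * u + \<tau> * t)"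
            by (simp add: inner_add_right x0 la_def \<tau>_def algebra_simps)
          thus ?thesis unfolding e f_def using Kc by (simp add: indicator_def)
        qed
        thus ?thesis by simp
      qed
      also have "\<dots> = (\<integral>\<^sup>+u. (ennreal y * ennreal y) * (\<integral>\<^sup>+t. indicator K (w0 + u *\<^sub>R w1 + t *\<^sub>R v)
        * ennreal (exp (- (y * (1 + la * u + \<tau> * t)))) \<partial>lborel) \<partial>lborel)"
        by (subst nn_integral_cmult[symmetric]) (auto simp: mult.assoc)
      also have "\<dots> = (\<integral>\<^sup>+u. \<integral>\<^sup>+t. g y u t \<partial>lborel \<partial>lborel)"
        using True by (intro nn_integral_cong, subst nn_integral_cmult[symmetric])
          (auto simp: g_def power2_eq_square ennreal_mult[symmetric])
      finally show ?thesis .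
    qed
    have "lap K \<xi> = ennreal \<kappa> * (\<integral>\<^sup>+y. \<integral>\<^sup>+x. \<integral>\<^sup>+t. f (y *\<^sub>R w0 + x *\<^sub>R w1 + t *\<^sub>R v) \<partial>lborel \<partial>lborel \<partial>lborel)"
      using k(2)[OF f] by (simp add: lap_def f_def)
    also have "(\<integral>\<^sup>+y. \<integral>\<^sup>+x. \<integral>\<^sup>+t. f (y *\<^sub>R w0 + x *\<^sub>R w1 + t *\<^sub>R v) \<partial>lborel \<partial>lborel \<partial>lborel)
       = (\<integral>\<^sup>+y. \<integral>\<^sup>+u. \<integral>\<^sup>+t. g y u t \<partial>lborel \<partial>lborel \<partial>lborel)"
      using AE_lborel_singleton[of "0::real"] by (intro nn_integral_cong_AE) (auto simp: slice)
    also have "\<dots> = (\<integral>\<^sup>+u. \<integral>\<^sup>+y. \<integral>\<^sup>+t. g y u t \<partial>lborel \<partial>lborel \<partial>lborel)"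
      by (rule lborel_pair.Fubini') (unfold g_def, measurable)
    also have "\<dots> = (\<integral>\<^sup>+u. \<integral>\<^sup>+t. \<integral>\<^sup>+y. g y u t \<partial>lborel \<partial>lborel \<partial>lborel)"
    proof (rule nn_integral_cong)
      fix u :: real
      show "(\<integral>\<^sup>+y. \<integral>\<^sup>+t. g y u t \<partial>lborel \<partial>lborel) = (\<integral>\<^sup>+t. \<integral>\<^sup>+y. g y u t \<partial>lborel \<partial>lborel)"
        by (rule lborel_pair.Fubini') (unfold g_def, measurable)
    qed
    also have "\<dots> = sint K w0 w1 v la \<tau>"
      unfolding sint_def
    proof (intro nn_integral_cong)
      fix u t
      show "(\<integral>\<^sup>+y. g y u t \<partial>lborel) = indicator K (w0 + u *\<^sub>R w1 + t *\<^sub>R v) * ennreal (2 / (1 + la * u + \<tau> * t) ^ 3)"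
      proof (cases "w0 + u *\<^sub>R w1 + t *\<^sub>R v \<in> K")
        case True
        hence "1 + la * u + \<tau> * t > 0" using m by (simp add: la_def \<tau>_def)
        from nn_integral_square_exp[OF this] True show ?thesis
          by (simp add: g_def ennreal_mult mult.assoc)
      qed (simp add: g_def)
    qed
    finally show "lap K \<xi> = ennreal \<kappa> * sint K w0 w1 v (\<xi> \<bullet> w1) (\<xi> \<bullet> v)"
      by (simp add: la_def \<tau>_def)
  qed
qed

section \<open>Positivity, divergence and finiteness of the transform\<close>

lemma lap_ge_ball:
  assumes "closed K" "ball b r \<subseteq> K"
  shows "lap K \<xi> \<ge> ennreal (exp (- (\<xi> \<bullet> b) - norm \<xi> * r)) * emeasure lborel (ball b r)"
proof -
  have "ennreal (exp (- (\<xi> \<bullet> b) - norm \<xi> * r)) * emeasure lborel (ball b r)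
     = (\<integral>\<^sup>+x. ennreal (exp (- (\<xi> \<bullet> b) - norm \<xi> * r)) * indicator (ball b r) x \<partial>lborel)"
    by (rule nn_integral_cmult_indicator[symmetric]) auto
  also have "\<dots> \<le> lap K \<xi>"
    unfolding lap_def
  proof (intro nn_integral_mono)
    fix x
    show "ennreal (exp (- (\<xi> \<bullet> b) - norm \<xi> * r)) * indicator (ball b r) x
      \<le> indicator K x * ennreal (exp (- (\<xi> \<bullet> x)))"
    proof (cases "x \<in> ball b r")
      case True
      have "\<xi> \<bullet> (x - b) \<le> norm \<xi> * norm (x - b)" by (rule norm_cauchy_schwarz)
      also have "\<dots> \<le> norm \<xi> * r"
        using True by (intro mult_left_mono) (auto simp: dist_norm norm_minus_commute)
      finally show ?thesis using True assms(2) by (auto simp: inner_diff_right indicator_def intro!: ennreal_leI)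
    qed simp
  qed
  finally show ?thesis .
qed

lemma lap_pos:
  assumes "closed K" "interior K \<noteq> {}"
  shows "lap K \<xi> > 0"
proof -
  obtain b where "b \<in> interior K" using assms(2) by auto
  then obtain r where r: "r > 0" "ball b r \<subseteq> K"
    using mem_interior by blast
  have "emeasure lborel (ball b r) > 0"
    using r(1) by (simp add: emeasure_ball unit_ball_vol_pos)
  thus ?thesis
    using lap_ge_ball[OF assms(1) r(2), of \<xi>]
    by (metis ennreal_zero_less_mult_iff ennreal_less_zero_iff exp_gt_zero less_le_trans)
qed

text \<open>Translates of an inscribed ball along \<open>x\<close> stay inside the cone, and since
  \<open>\<xi> \<bullet> x\<close> is not positive, the exponential weight has the same lower bound
  \<open>c\<close> on all of them. Infinitely many disjoint balls then give an infinite
  integral.\<close>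

lemma lap_top:
  assumes K: "closed K" "convex K" "cone K" "interior K \<noteq> {}"
    and x: "x \<in> K" "x \<noteq> 0" "\<xi> \<bullet> x \<le> 0"
  shows "lap K \<xi> = top"
proof (rule ccontr)
  assume "lap K \<xi> \<noteq> top"
  then obtain l where l: "lap K \<xi> = ennreal l" "l \<ge> 0"
    by (cases "lap K \<xi>") auto
  obtain b where "b \<in> interior K" using K(4) by auto
  then obtain r where r: "r > 0" "ball b r \<subseteq> K"
    using mem_interior by blast
  \<comment> \<open>The spacing puts consecutive centres at distance \<open>2 * r\<close>, which
    makes the open balls disjoint.\<close>
  define k where "k = 2 * r / norm x"
  have k: "k > 0" "k * norm x = 2 * r" using x(2) r(1) by (auto simp: k_def)
  define B where "B = (\<lambda>i::nat. ball (b + (real i * k) *\<^sub>R x) r)"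
  define c where "c = exp (- (\<xi> \<bullet> b) - norm \<xi> * r)"
  define m where "m = unit_ball_vol (DIM(real^3)) * r ^ DIM(real^3)"
  have m: "m > 0" using r(1) by (simp add: m_def unit_ball_vol_pos)
  have emB: "emeasure lborel (B i) = ennreal m" for i
    unfolding B_def m_def using r(1) by (simp add: emeasure_ball)
  have Bs: "B i \<in> sets lborel" for i unfolding B_def by simp
  have sub: "B i \<subseteq> K" for i
  proof
    fix y assume "y \<in> B i"
    hence "y - (real i * k) *\<^sub>R x \<in> ball b r"
      by (simp add: B_def dist_norm algebra_simps)
    hence "y - (real i * k) *\<^sub>R x \<in> K" using r by auto
    moreover have "(real i * k) *\<^sub>R x \<in> K"
      using K(3) x(1) k(1) by (auto simp: cone_def)
    ultimately have "(y - (real i * k) *\<^sub>R x) + (real i * k) *\<^sub>R x \<in> K"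
      using K(2,3) convex_cone by blast
    thus "y \<in> K" by simp
  qed
  have disj: "disjoint_family_on B {..<n}" for n
    unfolding disjoint_family_on_def
  proof (intro ballI impI)
    fix i j assume "i \<in> {..<n}" "j \<in> {..<n}" "i \<noteq> j"
    have "dist (b + (real i * k) *\<^sub>R x) (b + (real j * k) *\<^sub>R x) = \<bar>real i - real j\<bar> * (k * norm x)"
      using k(1) by (simp add: dist_norm scaleR_diff_left[symmetric] left_diff_distrib[symmetric] abs_mult)
    also have "\<dots> \<ge> 1 * (k * norm x)"
      using \<open>i \<noteq> j\<close> r(1) unfolding k(2) by (intro mult_right_mono) auto
    finally have "dist (b + (real i * k) *\<^sub>R x) (b + (real j * k) *\<^sub>R x) \<ge> r + r"
      using k(2) by simp
    thus "B i \<inter> B j = {}"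
      unfolding B_def using disjoint_ballI by blast
  qed
  have ge: "c \<le> exp (- (\<xi> \<bullet> y))" if "y \<in> B i" for y i
  proof -
    define z where "z = y - (b + (real i * k) *\<^sub>R x)"
    have "norm z < r" using that by (simp add: B_def z_def dist_norm norm_minus_commute)
    have "\<xi> \<bullet> z \<le> norm \<xi> * norm z" by (rule norm_cauchy_schwarz)
    also have "\<dots> \<le> norm \<xi> * r" using \<open>norm z < r\<close> by (intro mult_left_mono) auto
    finally have "\<xi> \<bullet> z \<le> norm \<xi> * r" .
    moreover have "\<xi> \<bullet> y = \<xi> \<bullet> z + \<xi> \<bullet> b + (real i * k) * (\<xi> \<bullet> x)"
      by (simp add: z_def inner_diff_right inner_add_right)
    moreover have "(real i * k) * (\<xi> \<bullet> x) \<le> 0"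
      using k(1) x(3) by (intro mult_nonneg_nonpos) auto
    ultimately show ?thesis by (simp add: c_def)
  qed
  have bd: "real n * (c * m) \<le> l" for n
  proof -
    have "ennreal (real n * (c * m)) = (\<Sum>i<n. ennreal c * ennreal m)"
      using m by (simp add: c_def ennreal_mult ennreal_of_nat_eq_real_of_nat)
    also have "\<dots> = (\<Sum>i<n. \<integral>\<^sup>+y. ennreal c * indicator (B i) y \<partial>lborel)"
      by (intro sum.cong refl) (simp only: nn_integral_cmult_indicator[OF Bs] emB)
    also have "\<dots> = (\<integral>\<^sup>+y. (\<Sum>i<n. ennreal c * indicator (B i) y) \<partial>lborel)"
      by (intro nn_integral_sum[symmetric] borel_measurable_times_ennreal borel_measurable_const borel_measurable_indicator Bs)
    also have "\<dots> \<le> lap K \<xi>"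
      unfolding lap_def
    proof (intro nn_integral_mono)
      fix y
      have "(\<Sum>i<n. ennreal c * indicator (B i) y) = ennreal c * indicator (\<Union>(B ` {..<n})) y"
        by (subst indicator_UN_disjoint[OF _ disj]) (auto simp: sum_distrib_left)
      also have "\<dots> \<le> indicator K y * ennreal (exp (- (\<xi> \<bullet> y)))"
        using sub ge by (auto simp: indicator_def intro!: ennreal_leI)
      finally show "(\<Sum>i<n. ennreal c * indicator (B i) y) \<le> indicator K y * ennreal (exp (- (\<xi> \<bullet> y)))" .
    qed
    finally show ?thesis using l by (simp add: ennreal_le_iff)
  qed
  have "c * m > 0" using m by (simp add: c_def)
  then obtain n where "l < real n * (c * m)" using reals_Archimedean3 by blast
  with bd[of n] show False by simp
qed

lemma orthogonal_frame:
  fixes \<xi> :: "real^3"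
  assumes "\<xi> \<noteq> 0"
  obtains w1 v where "\<xi> \<bullet> w1 = 0" "\<xi> \<bullet> v = 0" "w1 \<bullet> v = 0" "w1 \<noteq> 0" "v \<noteq> 0"
proof -
  define w where "w = (if \<xi>$1 = 0 \<and> \<xi>$2 = 0 then vector [1, 0, 0] else vector [\<xi>$2, - \<xi>$1, 0] :: real^3)"
  have w: "\<xi> \<bullet> w = 0" "w \<noteq> 0"
    by (auto simp: w_def inner_vec_def sum_3 vec_eq_iff forall_3)
  define v where "v = cross3 \<xi> w"
  have o: "\<xi> \<bullet> v = 0" "w \<bullet> v = 0" by (simp_all add: v_def dot_cross_self)
  have "(norm v)\<^sup>2 = (norm \<xi>)\<^sup>2 * (norm w)\<^sup>2 - (\<xi> \<bullet> w)\<^sup>2"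
    unfolding v_def by (rule norm_cross)
  hence "v \<noteq> 0" using assms w by auto
  thus thesis using that[of w v] w o by auto
qed

lemma cone_coercive:
  fixes \<xi> :: "real^3"
  assumes K: "closed K" "cone K" and pos: "\<And>x. x \<in> K \<Longrightarrow> x \<noteq> 0 \<Longrightarrow> \<xi> \<bullet> x > 0"
  obtains c where "c > 0" "\<And>x. x \<in> K \<Longrightarrow> \<xi> \<bullet> x \<ge> c * norm x"
proof (cases "K \<inter> sphere 0 1 = {}")
  case True
  have "x = 0" if "x \<in> K" for x
  proof (rule ccontr)
    assume "x \<noteq> 0"
    hence "(1 / norm x) *\<^sub>R x \<in> K \<inter> sphere 0 1" using K(2) that by (auto simp: cone_def)
    with True show False by blast
  qed
  thus thesis using that[of 1] by force
next
  case False
  have "compact (K \<inter> sphere 0 1)" using K(1) by (intro closed_Int_compact) auto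
  moreover have "continuous_on (K \<inter> sphere 0 1) (\<lambda>x. \<xi> \<bullet> x)" by (intro continuous_intros)
  ultimately obtain a where a: "a \<in> K \<inter> sphere 0 1" "\<And>x. x \<in> K \<inter> sphere 0 1 \<Longrightarrow> \<xi> \<bullet> a \<le> \<xi> \<bullet> x"
    using continuous_attains_inf[OF _ False] by blast
  show thesis
  proof (rule that[of "\<xi> \<bullet> a"])
    show "\<xi> \<bullet> a > 0" using a(1) pos[of a] by (cases "a = 0") auto
    fix x assume "x \<in> K"
    show "\<xi> \<bullet> x \<ge> (\<xi> \<bullet> a) * norm x"
    proof (cases "x = 0")
      case False
      have "(1 / norm x) *\<^sub>R x \<in> K \<inter> sphere 0 1" using K(2) \<open>x \<in> K\<close> False by (auto simp: cone_def)
      from a(2)[OF this] False show ?thesis by (simp add: field_simps)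
    qed simp
  qed
qed

text \<open>Coercivity bounds the section of the cone by the plane on which \<open>\<xi>\<close>
  equals 1. In a frame with \<open>w1\<close> and \<open>v\<close> orthogonal to
  \<open>\<xi>\<close> both parameters of the section integral are 0, so a constant is integrated
  over a bounded set.\<close>

lemma lap_finite:
  assumes K: "closed K" "cone K" and pos: "\<And>x. x \<in> K \<Longrightarrow> x \<noteq> 0 \<Longrightarrow> \<xi> \<bullet> x > 0"
    and nz: "\<xi> \<noteq> 0"
  shows "lap K \<xi> < top"
proof -
  obtain c where c: "c > 0" "\<And>x. x \<in> K \<Longrightarrow> \<xi> \<bullet> x \<ge> c * norm x"
    using cone_coercive[OF K pos] by blast
  obtain w1 v where f: "\<xi> \<bullet> w1 = 0" "\<xi> \<bullet> v = 0" "w1 \<bullet> v = 0" "w1 \<noteq> 0" "v \<noteq> 0"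
    using orthogonal_frame[OF nz] by blast
  define w0 where "w0 = (1 / (\<xi> \<bullet> \<xi>)) *\<^sub>R \<xi>"
  have w0: "\<xi> \<bullet> w0 = 1" "w0 \<bullet> w1 = 0" "w0 \<bullet> v = 0" using nz f by (auto simp: w0_def)
  have ind: "y = 0 \<and> x = 0 \<and> t = 0" if "y *\<^sub>R w0 + x *\<^sub>R w1 + t *\<^sub>R v = 0" for y x t
  proof -
    have "\<xi> \<bullet> (y *\<^sub>R w0 + x *\<^sub>R w1 + t *\<^sub>R v) = 0" "w1 \<bullet> (y *\<^sub>R w0 + x *\<^sub>R w1 + t *\<^sub>R v) = 0"
      "v \<bullet> (y *\<^sub>R w0 + x *\<^sub>R w1 + t *\<^sub>R v) = 0" using that by auto
    thus ?thesis using f w0 by (simp add: inner_add_right inner_commute)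
  qed
  obtain \<kappa> where k: "0 < \<kappa>"
    "\<And>K \<xi>'. closed K \<Longrightarrow> cone K \<Longrightarrow> (\<And>x. x \<in> K \<Longrightarrow> \<xi> \<bullet> x \<ge> 0) \<Longrightarrow> \<xi>' \<bullet> w0 = 1 \<Longrightarrow>
      (\<And>u t. w0 + u *\<^sub>R w1 + t *\<^sub>R v \<in> K \<Longrightarrow> 1 + (\<xi>' \<bullet> w1) * u + (\<xi>' \<bullet> v) * t > 0) \<Longrightarrow>
      lap K \<xi>' = ennreal \<kappa> * sint K w0 w1 v (\<xi>' \<bullet> w1) (\<xi>' \<bullet> v)"
    using lap_frame[OF ind w0(1) f(1) f(2)] by blast
  have eq: "lap K \<xi> = ennreal \<kappa> * sint K w0 w1 v 0 0"
  proof -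
    have p: "\<xi> \<bullet> x \<ge> 0" if "x \<in> K" for x
      using pos[OF that] by (cases "x = 0") auto
    from k(2)[OF K p w0(1)] show ?thesis using f by simp
  qed
  define R1 where "R1 = 1 / (c * norm w1)"
  define R2 where "R2 = 1 / (c * norm v)"
  have bd: "\<bar>u\<bar> \<le> R1 \<and> \<bar>t\<bar> \<le> R2" if "w0 + u *\<^sub>R w1 + t *\<^sub>R v \<in> K" for u t
  proof -
    let ?x = "w0 + u *\<^sub>R w1 + t *\<^sub>R v"
    have "\<xi> \<bullet> ?x = 1" using w0 f by (simp add: inner_add_right)
    hence n: "norm ?x \<le> 1 / c" using c(2)[OF that] c(1) by (simp add: field_simps)
    have "\<bar>w1 \<bullet> ?x\<bar> \<le> norm w1 * norm ?x" by (rule Cauchy_Schwarz_ineq2)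
    moreover have "w1 \<bullet> ?x = u * (norm w1)\<^sup>2"
      using w0 f by (simp add: inner_add_right inner_commute power2_norm_eq_inner)
    ultimately have "\<bar>u\<bar> * norm w1 * norm w1 \<le> norm w1 * norm ?x" by (simp add: abs_mult power2_eq_square mult.assoc)
    hence 1: "\<bar>u\<bar> * norm w1 \<le> norm ?x" using f(4) by simp
    have "\<bar>v \<bullet> ?x\<bar> \<le> norm v * norm ?x" by (rule Cauchy_Schwarz_ineq2)
    moreover have "v \<bullet> ?x = t * (norm v)\<^sup>2"
      using w0 f by (simp add: inner_add_right inner_commute power2_norm_eq_inner)
    ultimately have "\<bar>t\<bar> * norm v * norm v \<le> norm v * norm ?x" by (simp add: abs_mult power2_eq_square mult.assoc)
    hence 2: "\<bar>t\<bar> * norm v \<le> norm ?x" using f(5) by simp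
    have "\<bar>u\<bar> * norm w1 \<le> 1 / c" "\<bar>t\<bar> * norm v \<le> 1 / c" using 1 2 n by linarith+
    thus ?thesis using f(4,5) c(1) by (simp add: R1_def R2_def field_simps)
  qed
  have "sint K w0 w1 v 0 0 \<le> (\<integral>\<^sup>+u. \<integral>\<^sup>+t. 2 * indicator {-R1..R1} u * indicator {-R2..R2} t \<partial>lborel \<partial>lborel)"
    unfolding sint_def
  proof (intro nn_integral_mono)
    fix u t
    show "indicator K (w0 + u *\<^sub>R w1 + t *\<^sub>R v) * ennreal (2 / (1 + 0 * u + 0 * t) ^ 3)
       \<le> 2 * indicator {-R1..R1} u * indicator {-R2..R2} t"
    proof (cases "w0 + u *\<^sub>R w1 + t *\<^sub>R v \<in> K")
      case True
      from bd[OF this] have "u \<in> {-R1..R1}" "t \<in> {-R2..R2}" by auto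
      thus ?thesis using True by (simp add: indicator_def)
    qed simp
  qed
  also have "\<dots> = (\<integral>\<^sup>+u. 2 * emeasure lborel {-R2..R2} * indicator {-R1..R1} u \<partial>lborel)"
    by (intro nn_integral_cong, subst nn_integral_cmult_indicator) (auto simp: mult_ac)
  also have "\<dots> = 2 * emeasure lborel {-R2..R2} * emeasure lborel {-R1..R1}"
    by (subst nn_integral_cmult_indicator) auto
  also have "\<dots> < top"
    by (simp add: ennreal_mult_less_top emeasure_lborel_Icc_eq)
  finally show ?thesis unfolding eq by (simp add: ennreal_mult_less_top)
qed

section \<open>Piecewise linear functions and rational identities\<close>

text \<open>A sum of hinges: \<open>\<kappa> u\<close> is the jump of the slope at \<open>u\<close>,
  so that a kink can be read off as a coefficient.\<close>

definition pl_rep :: "real \<Rightarrow> real \<Rightarrow> (real \<Rightarrow> real) \<Rightarrow> real \<Rightarrow> real set \<Rightarrow> (real \<Rightarrow> real) \<Rightarrow> bool" where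
  "pl_rep a b f k U \<kappa> \<longleftrightarrow> finite U \<and> U \<subseteq> {a<..<b} \<and>
     (\<forall>t\<in>{a..b}. f t = f a + k * (t - a) + (\<Sum>u\<in>U. \<kappa> u * max 0 (t - u)))"

text \<open>Weaker than \<open>pl_rep\<close>, as \<open>U\<close> only has to contain the breaks.
  This makes the notion stable under maxima and differences without tracking which kinks
  cancel.\<close>

definition pl_breaks :: "real \<Rightarrow> real \<Rightarrow> (real \<Rightarrow> real) \<Rightarrow> real set \<Rightarrow> bool" where
  "pl_breaks a b f U \<longleftrightarrow> finite U \<and>
     (\<forall>c d. a \<le> c \<longrightarrow> c < d \<longrightarrow> d \<le> b \<longrightarrow> {c<..<d} \<inter> U = {} \<longrightarrow> (\<exists>p q. \<forall>t\<in>{c..d}. f t = p + q * t))"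

text \<open>Induction on the number of possible breaks inside the interval, splitting off the last
  one.\<close>

lemma pl_breaks_rep:
  assumes "a \<le> b" "pl_breaks a b f U"
  obtains k V \<kappa> where "pl_rep a b f k V \<kappa>"
proof -
  have "\<exists>k V \<kappa>. pl_rep a b f k V \<kappa>" using assms
  proof (induction "card (U \<inter> {a<..<b})" arbitrary: b rule: less_induct)
    case less
    have fin: "finite U" using less.prems by (simp add: pl_breaks_def)
    consider "a = b" | "a < b" "U \<inter> {a<..<b} = {}" | "a < b" "U \<inter> {a<..<b} \<noteq> {}"
      using less.prems(1) by linarith
    thus ?case
    proof cases
      case 1
      thus ?thesis by (intro exI[of _ 0] exI[of _ "{}"] exI[of _ "\<lambda>_. 0"]) (auto simp: pl_rep_def)
    next
      case 2
      then obtain p q where pq: "\<forall>t\<in>{a..b}. f t = p + q * t"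
        using less.prems(2) unfolding pl_breaks_def by (metis inf_commute order_refl)
      thus ?thesis
        using 2 by (intro exI[of _ q] exI[of _ "{}"] exI[of _ "\<lambda>_. 0"]) (auto simp: pl_rep_def algebra_simps)
    next
      case 3
      define m where "m = Max (U \<inter> {a<..<b})"
      have m: "m \<in> U" "a < m" "m < b"
        using Max_in[of "U \<inter> {a<..<b}"] 3 fin by (auto simp: m_def)
      have mmax: "u \<le> m" if "u \<in> U" "a < u" "u < b" for u
        unfolding m_def using fin that by (intro Max_ge) auto
      have brk: "pl_breaks a m f U"
        using less.prems(2) m unfolding pl_breaks_def by (meson dual_order.strict_implies_order order_trans)
      have crd: "card (U \<inter> {a<..<m}) < card (U \<inter> {a<..<b})"
        using fin m by (intro psubset_card_mono) auto
      obtain k V \<kappa> where R: "pl_rep a m f k V \<kappa>"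
        using less.hyps[OF crd less_imp_le[OF m(2)] brk] by blast
      have V: "finite V" "V \<subseteq> {a<..<m}"
        and Rt: "\<And>t. t \<in> {a..m} \<Longrightarrow> f t = f a + k * (t - a) + (\<Sum>u\<in>V. \<kappa> u * max 0 (t - u))"
        using R unfolding pl_rep_def by blast+
      have "{m<..<b} \<inter> U = {}" using mmax m by fastforce
      then obtain p q where pq: "\<And>t. t \<in> {m..b} \<Longrightarrow> f t = p + q * t"
        using less.prems(2) m unfolding pl_breaks_def by (meson less_imp_le order_refl)
      have fm: "f t = f m + q * (t - m)" if "t \<in> {m..b}" for t
        using pq[OF that] pq[of m] m by (simp add: algebra_simps)
      \<comment> \<open>The jump at \<open>m\<close> is the new slope \<open>q\<close> minus the
        slope accumulated before: the initial slope plus all earlier jumps.\<close>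
      define \<kappa>' where "\<kappa>' = \<kappa>(m := q - (k + sum \<kappa> V))"
      have mV: "m \<notin> V" using V by auto
      have "pl_rep a b f k (insert m V) \<kappa>'"
        unfolding pl_rep_def
      proof (intro conjI ballI)
        show "finite (insert m V)" "insert m V \<subseteq> {a<..<b}" using V m by auto
        fix t assume t: "t \<in> {a..b}"
        have S: "(\<Sum>u\<in>insert m V. \<kappa>' u * max 0 (t - u))
            = (q - (k + sum \<kappa> V)) * max 0 (t - m) + (\<Sum>u\<in>V. \<kappa> u * max 0 (t - u))"
        proof -
          have "(\<Sum>u\<in>V. \<kappa>' u * max 0 (t - u)) = (\<Sum>u\<in>V. \<kappa> u * max 0 (t - u))"
            using mV by (intro sum.cong) (auto simp: \<kappa>'_def)
          thus ?thesis using V mV by (simp add: \<kappa>'_def)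
        qed
        show "f t = f a + k * (t - a) + (\<Sum>u\<in>insert m V. \<kappa>' u * max 0 (t - u))"
        proof (cases "t \<le> m")
          case True
          thus ?thesis unfolding S using Rt[of t] t by simp
        next
          case False
          have E: "(\<Sum>u\<in>V. \<kappa> u * max 0 (t - u)) = (\<Sum>u\<in>V. \<kappa> u * max 0 (m - u)) + sum \<kappa> V * (t - m)"
          proof -
            have "(\<Sum>u\<in>V. \<kappa> u * max 0 (t - u)) = (\<Sum>u\<in>V. \<kappa> u * max 0 (m - u) + \<kappa> u * (t - m))"
              using V(2) False by (intro sum.cong refl) (force simp: max_def algebra_simps)
            thus ?thesis by (simp add: sum.distrib sum_distrib_right)
          qed
          have "f t = f m + q * (t - m)" by (rule fm) (use False t in simp)
          also have "f m = f a + k * (m - a) + (\<Sum>u\<in>V. \<kappa> u * max 0 (m - u))"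
            using Rt[of m] m by auto
          finally show ?thesis unfolding S E using False by (simp add: algebra_simps)
        qed
      qed
      thus ?thesis by blast
    qed
  qed
  thus thesis using that by blast
qed

lemma pl_breaks_diff:
  assumes "pl_breaks a b f U" "pl_breaks a b g V"
  shows "pl_breaks a b (\<lambda>t. f t - g t) (U \<union> V)"
  unfolding pl_breaks_def
proof (intro conjI allI impI)
  show "finite (U \<union> V)" using assms by (auto simp: pl_breaks_def)
  fix c d assume "a \<le> c" "c < d" "d \<le> b" and e: "{c<..<d} \<inter> (U \<union> V) = {}"
  have "{c<..<d} \<inter> U = {}" "{c<..<d} \<inter> V = {}" using e by auto
  then obtain p q p' q' where "\<forall>t\<in>{c..d}. f t = p + q * t" "\<forall>t\<in>{c..d}. g t = p' + q' * t"
    using assms \<open>a \<le> c\<close> \<open>c < d\<close> \<open>d \<le> b\<close> unfolding pl_breaks_def by meson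
  thus "\<exists>p q. \<forall>t\<in>{c..d}. f t - g t = p + q * t"
    by (intro exI[of _ "p - p'"] exI[of _ "q - q'"]) (auto simp: algebra_simps)
qed

text \<open>Between crossings of two of the lines, no line can overtake the one that is maximal at
  the midpoint.\<close>

lemma pl_breaks_Max:
  fixes \<alpha> \<beta> :: "'i \<Rightarrow> real"
  assumes I: "finite I" "I \<noteq> {}"
    and f: "\<And>t. t \<in> {a..b} \<Longrightarrow> f t = Max ((\<lambda>i. \<alpha> i + \<beta> i * t) ` I)"
  shows "\<exists>U. pl_breaks a b f U"
proof -
  \<comment> \<open>Abscissae of the pairwise crossings. Parallel lines give the quotient 0, a
    harmless extra point.\<close>
  define U where "U = (\<lambda>(i, j). (\<alpha> j - \<alpha> i) / (\<beta> i - \<beta> j)) ` (I \<times> I)"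
  have "pl_breaks a b f U"
    unfolding pl_breaks_def
  proof (intro conjI allI impI)
    show "finite U" using I by (auto simp: U_def)
    fix c d assume cd: "a \<le> c" "c < d" "d \<le> b" and e: "{c<..<d} \<inter> U = {}"
    define m where "m = (c + d) / 2"
    have "Max ((\<lambda>i. \<alpha> i + \<beta> i * m) ` I) \<in> (\<lambda>i. \<alpha> i + \<beta> i * m) ` I"
      using I by (intro Max_in) auto
    then obtain i where i: "i \<in> I" "Max ((\<lambda>i. \<alpha> i + \<beta> i * m) ` I) = \<alpha> i + \<beta> i * m" by auto
    have im: "\<alpha> j + \<beta> j * m \<le> \<alpha> i + \<beta> i * m" if "j \<in> I" for j
      unfolding i(2)[symmetric] using I that by (intro Max_ge) auto
    have "\<alpha> j + \<beta> j * t \<le> \<alpha> i + \<beta> i * t" if j: "j \<in> I" and t: "t \<in> {c..d}" for j t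
    proof (rule ccontr)
      assume H: "\<not> \<alpha> j + \<beta> j * t \<le> \<alpha> i + \<beta> i * t"
      define s where "s = (\<alpha> j - \<alpha> i) / (\<beta> i - \<beta> j)"
      have "s \<in> U" using i(1) j unfolding s_def U_def by (intro image_eqI[of _ _ "(i, j)"]) auto
      hence sn: "s \<le> c \<or> d \<le> s" using e by (metis disjoint_iff greaterThanLessThan_iff linorder_not_le)
      have mc: "c < m" "m < d" using cd by (auto simp: m_def)
      have tm: "t \<noteq> m" using H im[OF j] by auto
      have bne: "\<beta> i \<noteq> \<beta> j" using H im[OF j] by auto
      have z: "\<alpha> j - \<alpha> i = s * (\<beta> i - \<beta> j)" using bne by (simp add: s_def)
      have 1: "(\<beta> i - \<beta> j) * (m - s) \<ge> 0" using im[OF j] z by (simp add: algebra_simps)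
      have 2: "(\<beta> i - \<beta> j) * (t - s) < 0" using H z by (simp add: algebra_simps)
      show False
      proof (cases "\<beta> i > \<beta> j")
        case True
        hence "m \<ge> s" "t < s" using 1 2 by (simp_all add: zero_le_mult_iff mult_less_0_iff)
        thus False using sn mc t by auto
      next
        case False
        hence "\<beta> i < \<beta> j" using bne by simp
        hence "m \<le> s" "t > s" using 1 2 by (simp_all add: zero_le_mult_iff mult_less_0_iff)
        thus False using sn mc t by auto
      qed
    qed
    hence "f t = \<alpha> i + \<beta> i * t" if "t \<in> {c..d}" for t
      using f[of t] that cd I i(1) by (auto intro!: Max_eqI)
    thus "\<exists>p q. \<forall>t\<in>{c..d}. f t = p + q * t" by blast
  qed
  thus ?thesis by blast
qed

section \<open>Integration by parts and partial fractions\<close>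

text \<open>Where the hinge is active, (t - u) h' - h is an antiderivative of the integrand.\<close>

lemma has_integral_hinge:
  fixes h h' h'' :: "real \<Rightarrow> real"
  assumes u: "a \<le> u" "u \<le> b"
    and d1: "\<And>t. t \<in> {a..b} \<Longrightarrow> (h has_real_derivative h' t) (at t within {a..b})"
    and d2: "\<And>t. t \<in> {a..b} \<Longrightarrow> (h' has_real_derivative h'' t) (at t within {a..b})"
  shows "((\<lambda>t. max 0 (t - u) * h'' t) has_integral (b - u) * h' b - h b + h u) {a..b}"
proof -
  have 1: "((\<lambda>t. max 0 (t - u) * h'' t) has_integral 0) {a..u}"
    by (rule has_integral_is_0) auto
  have "((\<lambda>t. (t - u) * h'' t) has_integral ((b - u) * h' b - h b) - ((u - u) * h' u - h u)) {u..b}"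
  proof (rule fundamental_theorem_of_calculus[OF u(2)])
    fix t assume t: "t \<in> {u..b}"
    have D1: "(h has_real_derivative h' t) (at t within {u..b})" "(h' has_real_derivative h'' t) (at t within {u..b})"
      using d1[of t] d2[of t] t u by (auto intro: DERIV_subset)
    have "((\<lambda>t. (t - u) * h' t - h t) has_real_derivative (t - u) * h'' t) (at t within {u..b})"
      by (rule derivative_eq_intros D1 refl)+ (simp add: algebra_simps)
    thus "((\<lambda>t. (t - u) * h' t - h t) has_vector_derivative (t - u) * h'' t) (at t within {u..b})"
      by (simp add: has_real_derivative_iff_has_vector_derivative)
  qed
  hence 2: "((\<lambda>t. max 0 (t - u) * h'' t) has_integral (b - u) * h' b - h b + h u) {u..b}"
    by (subst has_integral_cong[where g = "\<lambda>t. (t - u) * h'' t"]) auto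
  from has_integral_combine[OF u 1 2] show ?thesis by simp
qed

text \<open>Because \<open>h\<close> vanishes at both ends, the affine part of \<open>f\<close>
  contributes boundary terms only, and each kink contributes the value of \<open>h\<close> there. An
  integral of \<open>f\<close> thus becomes a finite sum.\<close>

lemma pl_rep_by_parts:
  fixes h h' h'' :: "real \<Rightarrow> real"
  assumes R: "pl_rep a b f k U \<kappa>" and ab: "a \<le> b"
    and d1: "\<And>t. t \<in> {a..b} \<Longrightarrow> (h has_real_derivative h' t) (at t within {a..b})"
    and d2: "\<And>t. t \<in> {a..b} \<Longrightarrow> (h' has_real_derivative h'' t) (at t within {a..b})"
    and z: "h a = 0" "h b = 0"
  shows "((\<lambda>t. f t * h'' t) has_integral f b * h' b - f a * h' a + (\<Sum>u\<in>U. \<kappa> u * h u)) {a..b}"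
proof -
  have U: "finite U" "U \<subseteq> {a<..<b}"
    and ft: "\<And>t. t \<in> {a..b} \<Longrightarrow> f t = f a + k * (t - a) + (\<Sum>u\<in>U. \<kappa> u * max 0 (t - u))"
    using R unfolding pl_rep_def by blast+
  have "(h'' has_integral h' b - h' a) {a..b}"
    using d2 by (intro fundamental_theorem_of_calculus ab) (auto simp: has_real_derivative_iff_has_vector_derivative)
  hence 1: "((\<lambda>t. f a * h'' t) has_integral f a * (h' b - h' a)) {a..b}"
    by (rule has_integral_mult_right)
  have "((\<lambda>t. max 0 (t - a) * h'' t) has_integral (b - a) * h' b - h b + h a) {a..b}"
    by (rule has_integral_hinge[OF _ ab d1 d2]) auto
  hence "((\<lambda>t. k * (max 0 (t - a) * h'' t)) has_integral k * ((b - a) * h' b)) {a..b}"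
    using z by (auto dest: has_integral_mult_right[of _ _ _ k])
  moreover have "((\<lambda>t. \<Sum>u\<in>U. \<kappa> u * (max 0 (t - u) * h'' t)) has_integral (\<Sum>u\<in>U. \<kappa> u * ((b - u) * h' b - h b + h u))) {a..b}"
    using U by (intro has_integral_sum has_integral_mult_right has_integral_hinge d1 d2) auto
  ultimately have main: "((\<lambda>t. f a * h'' t + (k * (max 0 (t - a) * h'' t) + (\<Sum>u\<in>U. \<kappa> u * (max 0 (t - u) * h'' t)))) has_integral
      f a * (h' b - h' a) + (k * ((b - a) * h' b) + (\<Sum>u\<in>U. \<kappa> u * ((b - u) * h' b - h b + h u)))) {a..b}"
    by (intro has_integral_add 1)
  have e1: "f a * h'' t + (k * (max 0 (t - a) * h'' t) + (\<Sum>u\<in>U. \<kappa> u * (max 0 (t - u) * h'' t))) = f t * h'' t"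
    if "t \<in> {a..b}" for t
  proof -
    have "f t * h'' t = (f a + k * max 0 (t - a) + (\<Sum>u\<in>U. \<kappa> u * max 0 (t - u))) * h'' t"
      using ft[OF that] that by simp
    thus ?thesis by (simp add: distrib_right sum_distrib_right mult.assoc)
  qed
  have e2: "f a * (h' b - h' a) + (k * ((b - a) * h' b) + (\<Sum>u\<in>U. \<kappa> u * ((b - u) * h' b - h b + h u)))
     = f b * h' b - f a * h' a + (\<Sum>u\<in>U. \<kappa> u * h u)"
  proof -
    define S where "S = (\<Sum>u\<in>U. \<kappa> u * (b - u))"
    have "(\<Sum>u\<in>U. \<kappa> u * max 0 (b - u)) = S"
      unfolding S_def using U(2) by (intro sum.cong refl) (force simp: max_def)
    hence fb: "f b = f a + k * (b - a) + S"
      using ft[of b] ab by simp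
    have sm: "(\<Sum>u\<in>U. \<kappa> u * ((b - u) * h' b - h b + h u)) = S * h' b + (\<Sum>u\<in>U. \<kappa> u * h u)"
      unfolding S_def using z by (simp add: distrib_left sum.distrib sum_distrib_right mult.assoc)
    show ?thesis unfolding sm fb by (simp add: algebra_simps)
  qed
  from has_integral_eq[OF e1 main] show ?thesis unfolding e2 .
qed

text \<open>Clearing denominators gives a polynomial with infinitely many zeros, hence the zero
  polynomial. Evaluated at the pole -1/w it keeps the term of \<open>w\<close> only. The term at 0
  has no pole; it is what remains as a constant once the others are known to vanish.\<close>

lemma partial_fractions_zero:
  fixes m :: "real \<Rightarrow> real"
  assumes U: "finite U" "U \<subseteq> {0..1}"
    and z: "\<And>x. 0 < x \<Longrightarrow> x < 1/2 \<Longrightarrow> (\<Sum>u\<in>U. m u / (1 + x * u)) = 0"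
    and u: "u \<in> U"
  shows "m u = 0"
proof -
  define P where "P = (\<Sum>u\<in>U. smult (m u) (\<Prod>w\<in>U - {u}. [:1, w:]))"
  have pP: "poly P x = (\<Sum>u\<in>U. m u * (\<Prod>w\<in>U - {u}. 1 + x * w))" for x
    by (simp add: P_def poly_sum poly_prod)
  have P0: "P = 0"
  proof (rule ccontr)
    assume "P \<noteq> 0"
    hence "finite {x. poly P x = 0}" by (rule poly_roots_finite)
    moreover have "{0<..<1/2} \<subseteq> {x. poly P x = 0}"
    proof
      fix x :: real assume x: "x \<in> {0<..<1/2}"
      have nz: "1 + x * w \<noteq> 0" if "w \<in> U" for w
      proof -
        have "x * w \<ge> 0" using x U that by auto
        thus ?thesis by simp
      qed
      have "poly P x = (\<Sum>u\<in>U. m u / (1 + x * u) * (\<Prod>w\<in>U. 1 + x * w))"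
        unfolding pP
      proof (intro sum.cong refl)
        fix u assume "u \<in> U"
        thus "m u * (\<Prod>w\<in>U - {u}. 1 + x * w) = m u / (1 + x * u) * (\<Prod>w\<in>U. 1 + x * w)"
          using nz[of u] U(1) by (subst prod.remove[of U u "\<lambda>w. 1 + x * w"]) auto
      qed
      also have "\<dots> = (\<Sum>u\<in>U. m u / (1 + x * u)) * (\<Prod>w\<in>U. 1 + x * w)"
        by (simp add: sum_distrib_right)
      also have "\<dots> = 0" using z[of x] x by simp
      finally show "x \<in> {x. poly P x = 0}" by simp
    qed
    ultimately have "finite {0<..<1/2::real}" using finite_subset by blast
    thus False using infinite_Ioo[of 0 "1/2::real"] by simp
  qed
  have nz: "m w = 0" if w: "w \<in> U" "w \<noteq> 0" for w
  proof -
    have "0 = poly P (- 1 / w)" using P0 by simp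
    also have "\<dots> = (\<Sum>u\<in>U. if u = w then m w * (\<Prod>v\<in>U - {w}. 1 - v / w) else 0)"
      unfolding pP
    proof (intro sum.cong refl)
      fix u assume "u \<in> U"
      show "m u * (\<Prod>v\<in>U - {u}. 1 + - 1 / w * v) = (if u = w then m w * (\<Prod>v\<in>U - {w}. 1 - v / w) else 0)"
      proof (cases "u = w")
        case False
        hence "(\<Prod>v\<in>U - {u}. 1 + - 1 / w * v) = 0"
          using U w by (intro prod_zero bexI[of _ w]) auto
        thus ?thesis using False by simp
      qed simp
    qed
    also have "\<dots> = m w * (\<Prod>v\<in>U - {w}. 1 - v / w)" using U w by simp
    finally have "m w * (\<Prod>v\<in>U - {w}. 1 - v / w) = 0" by simp
    moreover have "(\<Prod>v\<in>U - {w}. 1 - v / w) \<noteq> 0"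
      using U w by (subst prod_zero_iff) auto
    ultimately show ?thesis by simp
  qed
  show ?thesis
  proof (cases "u = 0")
    case True
    have "0 = (\<Sum>w\<in>U. m w / (1 + (1/4) * w))" using z[of "1/4"] by simp
    also have "\<dots> = (\<Sum>w\<in>U. if w = 0 then m 0 else 0)"
      by (intro sum.cong refl) (use nz in auto)
    also have "\<dots> = m 0" using U u True by simp
    finally show ?thesis using True by simp
  qed (use nz u in auto)
qed

section \<open>Uniqueness for the transform with kernel of exponent 3\<close>

text \<open>A uniform bound for difference quotients, used as majorant when differentiating under
  the integral. The constant collects n summands of at most 2^(n-1) and two further factors of at
  most 2.\<close>

lemma inverse_power_Lipschitz:
  fixes x y u :: real
  assumes "1/2 \<le> 1 + x * u" "1/2 \<le> 1 + y * u"
  shows "\<bar>1 / (1 + y * u) ^ n - 1 / (1 + x * u) ^ n\<bar> \<le> real n * 2 ^ (n + 1) * \<bar>u\<bar> * \<bar>y - x\<bar>"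
proof -
  define a b where "a = 1 / (1 + y * u)" and "b = 1 / (1 + x * u)"
  have ab: "0 < a" "a \<le> 2" "0 < b" "b \<le> 2" using assms by (auto simp: a_def b_def field_simps)
  have "\<bar>a ^ n - b ^ n\<bar> = \<bar>(a - b) * (\<Sum>i<n. a ^ i * b ^ (n - Suc i))\<bar>"
    by (simp add: power_diff_sumr2 mult.commute)
  also have "\<dots> = \<bar>a - b\<bar> * (\<Sum>i<n. a ^ i * b ^ (n - Suc i))"
    using ab by (simp add: abs_mult sum_nonneg)
  also have "\<dots> \<le> \<bar>a - b\<bar> * (\<Sum>i<n. 2 ^ (n - 1))"
  proof (intro mult_left_mono sum_mono)
    fix i assume i: "i \<in> {..<n}"
    have "a ^ i * b ^ (n - Suc i) \<le> 2 ^ i * 2 ^ (n - Suc i)"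
      using ab by (intro mult_mono power_mono) auto
    also have "\<dots> = 2 ^ (n - 1)" using i by (simp add: power_add[symmetric])
    finally show "a ^ i * b ^ (n - Suc i) \<le> 2 ^ (n - 1)" .
  qed simp
  also have "\<bar>a - b\<bar> = a * b * \<bar>u\<bar> * \<bar>y - x\<bar>"
  proof -
    have "a - b = a * b * ((x - y) * u)" using ab unfolding a_def b_def
      by (simp add: field_simps)
    thus ?thesis using ab by (simp add: abs_mult abs_minus_commute)
  qed
  also have "a * b * \<bar>u\<bar> * \<bar>y - x\<bar> * (\<Sum>i<n. 2 ^ (n - 1)) \<le> 2 * 2 * \<bar>u\<bar> * \<bar>y - x\<bar> * (\<Sum>i<n. 2 ^ (n - 1))"
    using ab by (intro mult_right_mono mult_mono) auto
  also have "\<dots> = real n * 2 ^ (n + 1) * \<bar>u\<bar> * \<bar>y - x\<bar>"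
    by (cases n) auto
  finally show ?thesis by (simp add: a_def b_def power_one_over)
qed

lemma inverse_power_quotient_tendsto:
  fixes x u :: real and s :: "nat \<Rightarrow> real"
  assumes "1 + x * u > 0" "s \<longlonglongrightarrow> x" "\<And>k. s k \<noteq> x"
  shows "(\<lambda>k. (1 / (1 + s k * u) ^ n - 1 / (1 + x * u) ^ n) / (s k - x)) \<longlonglongrightarrow> - real n * u / (1 + x * u) ^ (n + 1)"
proof -
  have "((\<lambda>y. 1 / (1 + y * u) ^ n) has_real_derivative - real n * u / (1 + x * u) ^ (n + 1)) (at x)"
  proof -
    have "((\<lambda>y. (inverse (1 + y * u)) ^ n) has_real_derivative
        real n * (inverse (1 + x * u)) ^ (n - 1) * - (inverse (1 + x * u) * u * inverse (1 + x * u))) (at x)"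
      using assms(1) by (auto intro!: derivative_eq_intros)
    moreover have "real n * (inverse (1 + x * u)) ^ (n - 1) * - (inverse (1 + x * u) * u * inverse (1 + x * u))
       = - real n * u / (1 + x * u) ^ (n + 1)"
    proof (cases n)
      case (Suc k)
      define i where "i = inverse (1 + x * u)"
      have "real n * i ^ (n - 1) * - (i * u * i) = - real n * u * i ^ (n + 1)"
        by (simp add: Suc algebra_simps)
      thus ?thesis by (simp add: i_def divide_inverse power_inverse)
    qed simp
    ultimately have "((\<lambda>y. (inverse (1 + y * u)) ^ n) has_real_derivative - real n * u / (1 + x * u) ^ (n + 1)) (at x)"
      by (rule DERIV_cong)
    thus ?thesis unfolding divide_inverse power_inverse mult_1_left .
  qed
  hence "((\<lambda>y. (1 / (1 + y * u) ^ n - 1 / (1 + x * u) ^ n) / (y - x)) \<longlongrightarrow> - real n * u / (1 + x * u) ^ (n + 1)) (at x)"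
    by (simp add: has_field_derivative_iff)
  moreover have "filterlim s (at x) sequentially"
    using assms(2,3) by (simp add: filterlim_at)
  ultimately show ?thesis by (rule filterlim_compose)
qed

text \<open>Each differentiation in \<open>x\<close> under the integral raises the power of
  \<open>u\<close> and the exponent of the kernel by one and produces the nonzero factor -(n + 3).
  At x = 0 the integrals are the moments of \<open>\<delta>\<close>.\<close>

lemma stieltjes_moments_zero:
  fixes \<delta> :: "real \<Rightarrow> real"
  assumes m: "\<delta> \<in> borel_measurable borel" and bd: "\<And>u. \<bar>\<delta> u\<bar> \<le> M"
    and supp: "\<And>u. \<bar>u\<bar> > R \<Longrightarrow> \<delta> u = 0" and R: "R > 0" and e: "\<epsilon> > 0" "\<epsilon> * R \<le> 1/2"
    and z: "\<And>x. \<bar>x\<bar> < \<epsilon> \<Longrightarrow> (\<integral>u. \<delta> u / (1 + x * u) ^ 3 \<partial>lborel) = 0"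
  shows "\<bar>x\<bar> < \<epsilon> \<Longrightarrow> (\<integral>u. \<delta> u * u ^ n / (1 + x * u) ^ (n + 3) \<partial>lborel) = 0"
proof (induction n arbitrary: x)
  case 0
  thus ?case using z[of x] by simp
next
  case (Suc n)
  have M: "M \<ge> 0" using bd[of 0] by linarith
  have half: "1/2 \<le> 1 + y * u" if "\<bar>u\<bar> \<le> R" "\<bar>y\<bar> < \<epsilon>" for y u
  proof -
    have "\<bar>y * u\<bar> \<le> \<epsilon> * R" unfolding abs_mult using that R e by (intro mult_mono) auto
    thus ?thesis using e by linarith
  qed
  obtain d where d: "d > 0" "\<bar>x\<bar> + d < \<epsilon>"
    using Suc.prems by (metis add.commute dense less_diff_eq zero_less_diff less_add_same_cancel1 field_le_epsilon linorder_not_less add_strict_left_mono diff_gt_0_iff_gt)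
  \<comment> \<open>A sequence of admissible parameters that tends to \<open>x\<close> without
    attaining it; dominated convergence is applied to the difference quotients along it.\<close>
  define s where "s = (\<lambda>k. x + d / real (Suc k))"
  have s1: "s k \<noteq> x" for k using d by (simp add: s_def)
  have s2: "\<bar>s k\<bar> < \<epsilon>" for k
  proof -
    have "d / real (Suc k) \<le> d" using d by (simp add: field_simps)
    moreover have "d / real (Suc k) > 0" using d by simp
    ultimately show ?thesis using d unfolding s_def by linarith
  qed
  have "(\<lambda>k. d / real (Suc k)) \<longlonglongrightarrow> 0"
    using LIMSEQ_Suc[OF lim_const_over_n[of d]] by simp
  hence s3: "s \<longlonglongrightarrow> x"
    unfolding s_def using tendsto_add[OF tendsto_const[of x]] by fastforce
  define C where "C = M * R ^ n * (real (n + 3) * 2 ^ (n + 4) * R)"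
  define F where "F = (\<lambda>k u. \<delta> u * u ^ n * ((1 / (1 + s k * u) ^ (n + 3) - 1 / (1 + x * u) ^ (n + 3)) / (s k - x)))"
  have lim: "(\<lambda>k. \<integral>u. F k u \<partial>lborel) \<longlonglongrightarrow> (\<integral>u. \<delta> u * u ^ n * (- real (n + 3) * u / (1 + x * u) ^ (n + 3 + 1)) \<partial>lborel)"
  proof (rule integral_dominated_convergence[where w = "\<lambda>u. C * indicator {-R..R} u"])
    show "(\<lambda>u. \<delta> u * u ^ n * (- real (n + 3) * u / (1 + x * u) ^ (n + 3 + 1))) \<in> borel_measurable lborel"
      using m by measurable
    show "F k \<in> borel_measurable lborel" for k unfolding F_def using m by measurable
    show "integrable lborel (\<lambda>u. C * indicator {-R..R} u)" by (intro integrable_mult_right) (simp add: emeasure_lborel_Icc_eq)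
    show "AE u in lborel. (\<lambda>k. F k u) \<longlonglongrightarrow> \<delta> u * u ^ n * (- real (n + 3) * u / (1 + x * u) ^ (n + 3 + 1))"
    proof (intro always_eventually allI)
      fix u
      show "(\<lambda>k. F k u) \<longlonglongrightarrow> \<delta> u * u ^ n * (- real (n + 3) * u / (1 + x * u) ^ (n + 3 + 1))"
      proof (cases "\<bar>u\<bar> \<le> R")
        case True
        have "1 + x * u > 0" using half[OF True Suc.prems] by linarith
        thus ?thesis unfolding F_def
          by (intro tendsto_mult tendsto_const inverse_power_quotient_tendsto s1 s3)
      qed (simp add: F_def supp)
    qed
    show "AE u in lborel. norm (F k u) \<le> C * indicator {-R..R} u" for k
    proof (intro always_eventually allI)
      fix u
      show "norm (F k u) \<le> C * indicator {-R..R} u"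
      proof (cases "\<bar>u\<bar> \<le> R")
        case True
        have "\<bar>1 / (1 + s k * u) ^ (n + 3) - 1 / (1 + x * u) ^ (n + 3)\<bar> \<le> real (n + 3) * 2 ^ (n + 3 + 1) * \<bar>u\<bar> * \<bar>s k - x\<bar>"
          using half[OF True Suc.prems] half[OF True s2] by (rule inverse_power_Lipschitz)
        hence "\<bar>(1 / (1 + s k * u) ^ (n + 3) - 1 / (1 + x * u) ^ (n + 3)) / (s k - x)\<bar> \<le> real (n + 3) * 2 ^ (n + 3 + 1) * \<bar>u\<bar>"
          using s1[of k] by (simp add: abs_divide divide_le_eq)
        also have "\<dots> \<le> real (n + 3) * 2 ^ (n + 4) * R"
          using True by (simp add: add.commute mult_left_mono)
        finally have "\<bar>\<delta> u * u ^ n\<bar> * \<bar>(1 / (1 + s k * u) ^ (n + 3) - 1 / (1 + x * u) ^ (n + 3)) / (s k - x)\<bar> \<le> C"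
          unfolding C_def abs_mult power_abs using True bd M R
          by (intro mult_mono power_mono) auto
        thus ?thesis using True by (simp add: F_def abs_mult indicator_def abs_le_iff)
      qed (auto simp: F_def supp indicator_def abs_le_iff)
    qed
  qed
  have int: "integrable lborel (\<lambda>u. \<delta> u * u ^ n / (1 + y * u) ^ (n + 3))" if y: "\<bar>y\<bar> < \<epsilon>" for y
  proof (rule Bochner_Integration.integrable_bound[where f = "\<lambda>u. (M * R ^ n * 2 ^ (n + 3)) * indicator {-R..R} u"])
    show "integrable lborel (\<lambda>u. (M * R ^ n * 2 ^ (n + 3)) * indicator {-R..R} u)"
      by (intro integrable_mult_right) (simp add: emeasure_lborel_Icc_eq)
    show "(\<lambda>u. \<delta> u * u ^ n / (1 + y * u) ^ (n + 3)) \<in> borel_measurable lborel" using m by measurable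
    show "AE u in lborel. norm (\<delta> u * u ^ n / (1 + y * u) ^ (n + 3)) \<le> norm ((M * R ^ n * 2 ^ (n + 3)) * indicator {-R..R} u)"
    proof (intro always_eventually allI)
      fix u
      show "norm (\<delta> u * u ^ n / (1 + y * u) ^ (n + 3)) \<le> norm ((M * R ^ n * 2 ^ (n + 3)) * indicator {-R..R} u)"
      proof (cases "\<bar>u\<bar> \<le> R")
        case True
        have h: "1/2 \<le> 1 + y * u" by (rule half[OF True y])
        have "1 / (1 + y * u) \<le> 2" using h by (simp add: field_simps)
        hence "(1 / (1 + y * u)) ^ (n + 3) \<le> 2 ^ (n + 3)" using h by (intro power_mono) auto
        hence "\<bar>\<delta> u\<bar> * \<bar>u\<bar> ^ n * (1 / (1 + y * u)) ^ (n + 3) \<le> M * R ^ n * 2 ^ (n + 3)"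
          using True bd M R h by (intro mult_mono power_mono) auto
        thus ?thesis using True h M R by (simp add: abs_mult power_abs power_one_over indicator_def abs_le_iff)
      qed (simp add: supp)
    qed
  qed
  have "(\<integral>u. F k u \<partial>lborel) = 0" for k
  proof -
    have "(\<integral>u. F k u \<partial>lborel) = (\<integral>u. (\<delta> u * u ^ n / (1 + s k * u) ^ (n + 3) - \<delta> u * u ^ n / (1 + x * u) ^ (n + 3)) / (s k - x) \<partial>lborel)"
      by (intro Bochner_Integration.integral_cong refl) (simp add: F_def right_diff_distrib diff_divide_distrib)
    also have "\<dots> = ((\<integral>u. \<delta> u * u ^ n / (1 + s k * u) ^ (n + 3) \<partial>lborel) - (\<integral>u. \<delta> u * u ^ n / (1 + x * u) ^ (n + 3) \<partial>lborel)) / (s k - x)"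
      using int[OF s2] int[OF Suc.prems] by simp
    also have "\<dots> = 0" using Suc.IH[OF s2] Suc.IH[OF Suc.prems] by simp
    finally show ?thesis .
  qed
  hence "(\<integral>u. \<delta> u * u ^ n * (- real (n + 3) * u / (1 + x * u) ^ (n + 3 + 1)) \<partial>lborel) = 0"
    using lim LIMSEQ_unique[OF tendsto_const lim[unfolded \<open>\<And>k. (\<integral>u. F k u \<partial>lborel) = 0\<close>]] by simp
  moreover have "(\<integral>u. \<delta> u * u ^ n * (- real (n + 3) * u / (1 + x * u) ^ (n + 3 + 1)) \<partial>lborel)
     = - real (n + 3) * (\<integral>u. \<delta> u * u ^ Suc n / (1 + x * u) ^ (Suc n + 3) \<partial>lborel)"
    by (subst integral_mult_right_zero[symmetric]) (simp add: mult_ac)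
  ultimately show ?case by simp
qed

text \<open>All moments vanish, so by polynomial approximation \<open>\<delta>\<close> is orthogonal
  to continuous functions, in particular to a tent at \<open>u0\<close> with the sign of
  \<open>\<delta> u0\<close>. If that value were nonzero, continuity would make this integral
  positive for a narrow tent.\<close>

lemma stieltjes_unique:
  fixes \<delta> :: "real \<Rightarrow> real"
  assumes m: "\<delta> \<in> borel_measurable borel" and bd: "\<And>u. \<bar>\<delta> u\<bar> \<le> M"
    and supp: "\<And>u. \<bar>u\<bar> > R \<Longrightarrow> \<delta> u = 0" and R: "R > 0" and e: "\<epsilon> > 0" "\<epsilon> * R \<le> 1/2"
    and z: "\<And>x. \<bar>x\<bar> < \<epsilon> \<Longrightarrow> (\<integral>u. \<delta> u / (1 + x * u) ^ 3 \<partial>lborel) = 0"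
    and c: "isCont \<delta> u0"
  shows "\<delta> u0 = 0"
proof (rule ccontr)
  assume nz: "\<delta> u0 \<noteq> 0"
  define R' where "R' = max R (\<bar>u0\<bar> + 1)"
  have M: "M \<ge> 0" using bd[of 0] by linarith
  have intb: "integrable lborel (\<lambda>u. \<delta> u * g u)" if g: "g \<in> borel_measurable borel" "\<And>u. \<bar>u\<bar> \<le> R \<Longrightarrow> \<bar>g u\<bar> \<le> B" for g :: "real \<Rightarrow> real" and B
  proof (rule Bochner_Integration.integrable_bound[where f = "\<lambda>u. (M * \<bar>B\<bar>) * indicator {-R..R} u"])
    show "integrable lborel (\<lambda>u. (M * \<bar>B\<bar>) * indicator {-R..R} u)"
      by (intro integrable_mult_right) (simp add: emeasure_lborel_Icc_eq)
    show "(\<lambda>u. \<delta> u * g u) \<in> borel_measurable lborel" using m g(1) by measurable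
    show "AE u in lborel. norm (\<delta> u * g u) \<le> norm ((M * \<bar>B\<bar>) * indicator {-R..R} u)"
    proof (intro always_eventually allI)
      fix u
      show "norm (\<delta> u * g u) \<le> norm ((M * \<bar>B\<bar>) * indicator {-R..R} u)"
      proof (cases "\<bar>u\<bar> \<le> R")
        case True
        have "\<bar>\<delta> u\<bar> * \<bar>g u\<bar> \<le> M * \<bar>B\<bar>" using bd g(2)[OF True] M by (intro mult_mono) auto
        thus ?thesis using True M by (simp add: abs_mult indicator_def abs_le_iff)
      qed (simp add: supp)
    qed
  qed
  have mom: "(\<integral>u. \<delta> u * u ^ n \<partial>lborel) = 0" for n
    using stieltjes_moments_zero[OF m bd supp R e z, of 0 n] e by simp
  obtain r where r: "r > 0" "\<And>u. \<bar>u - u0\<bar> < r \<Longrightarrow> \<bar>\<delta> u - \<delta> u0\<bar> < \<bar>\<delta> u0\<bar> / 2"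
    using c nz unfolding continuous_at_eps_delta by (metis dist_real_def half_gt_zero zero_less_abs_iff)
  define bp where "bp = (\<lambda>u. sgn (\<delta> u0) * max 0 (1 - \<bar>u - u0\<bar> / r))"
  have cont: "continuous_on A bp" for A unfolding bp_def using r by (intro continuous_intros) auto
  have bpm: "bp \<in> borel_measurable borel" by (intro borel_measurable_continuous_onI cont)
  have zero: "(\<integral>u. \<delta> u * bp u \<partial>lborel) = 0"
  proof (rule ccontr)
    assume H: "(\<integral>u. \<delta> u * bp u \<partial>lborel) \<noteq> 0"
    define I where "I = \<bar>\<integral>u. \<delta> u * bp u \<partial>lborel\<bar>"
    have I: "I > 0" using H by (simp add: I_def)
    \<comment> \<open>Small enough that the approximation error, at most \<open>M * e0\<close> on an
      interval of length \<open>2 * R\<close>, stays below half of \<open>I\<close>; writing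
      \<open>M + 1\<close> avoids a division by 0.\<close>
    define e0 where "e0 = I / (2 * (M + 1) * (2 * R))"
    have e0: "e0 > 0" using I M R by (simp add: e0_def)
    obtain p where p: "real_polynomial_function p" "\<And>u. u \<in> {-R..R} \<Longrightarrow> \<bar>bp u - p u\<bar> < e0"
      using Stone_Weierstrass_real_polynomial_function[OF compact_Icc cont e0] by blast
    obtain a n where pa: "p = (\<lambda>x. \<Sum>i\<le>n. a i * x ^ i)"
      using p(1) unfolding real_polynomial_function_iff_sum by blast
    have ip: "integrable lborel (\<lambda>u. \<delta> u * u ^ i)" for i
      by (rule intb[where B = "R ^ i"]) (auto simp: power_abs intro!: power_mono)
    have "(\<integral>u. \<delta> u * p u \<partial>lborel) = (\<integral>u. (\<Sum>i\<le>n. a i * (\<delta> u * u ^ i)) \<partial>lborel)"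
      by (simp add: pa sum_distrib_left mult_ac)
    also have "\<dots> = (\<Sum>i\<le>n. a i * (\<integral>u. \<delta> u * u ^ i \<partial>lborel))"
      using ip by simp
    also have "\<dots> = 0" by (simp add: mom)
    finally have p0: "(\<integral>u. \<delta> u * p u \<partial>lborel) = 0" .
    have pm: "p \<in> borel_measurable borel" unfolding pa by measurable
    have ic: "integrable lborel (\<lambda>u. \<delta> u * bp u)"
      by (rule intb[OF bpm, where B = 1]) (use r in \<open>auto simp: bp_def sgn_if\<close>)
    have ipp: "integrable lborel (\<lambda>u. \<delta> u * p u)"
    proof -
      have "integrable lborel (\<lambda>u. (\<Sum>i\<le>n. a i * (\<delta> u * u ^ i)))" using ip by simp
      thus ?thesis by (simp add: pa sum_distrib_left mult_ac)
    qed
    have "I = \<bar>\<integral>u. \<delta> u * bp u - \<delta> u * p u \<partial>lborel\<bar>"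
      using ic ipp p0 by (simp add: I_def)
    also have "\<dots> \<le> (\<integral>u. \<bar>\<delta> u * bp u - \<delta> u * p u\<bar> \<partial>lborel)"
      using integral_norm_bound[of lborel "\<lambda>u. \<delta> u * bp u - \<delta> u * p u"] by simp
    also have "\<dots> \<le> (\<integral>u. (M * e0) * indicator {-R..R} u \<partial>lborel)"
    proof (rule integral_mono)
      show "integrable lborel (\<lambda>u. \<bar>\<delta> u * bp u - \<delta> u * p u\<bar>)" using ic ipp by simp
      show "integrable lborel (\<lambda>u. (M * e0) * indicator {-R..R} u)"
        by (intro integrable_mult_right) (simp add: emeasure_lborel_Icc_eq)
      fix u
      show "\<bar>\<delta> u * bp u - \<delta> u * p u\<bar> \<le> (M * e0) * indicator {-R..R} u"
      proof (cases "\<bar>u\<bar> \<le> R")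
        case True
        hence "\<bar>bp u - p u\<bar> \<le> e0" using p(2)[of u] by (auto simp: abs_le_iff)
        hence "\<bar>\<delta> u\<bar> * \<bar>bp u - p u\<bar> \<le> M * e0" using bd M by (intro mult_mono) auto
        thus ?thesis using True by (simp add: right_diff_distrib[symmetric] abs_mult indicator_def abs_le_iff)
      qed (auto simp: supp indicator_def abs_le_iff)
    qed
    also have "\<dots> = M * e0 * (2 * R)"
      using R by simp
    also have "\<dots> \<le> I / 2"
    proof -
      have "M * e0 * (2 * R) = I / 2 * (M / (M + 1))"
      proof -
        have "e0 * (2 * R) = I / (2 * (M + 1))" using R by (simp add: e0_def)
        thus ?thesis by (simp add: mult.assoc)
      qed
      also have "\<dots> \<le> I / 2 * 1" using I M by (intro mult_left_mono) auto
      finally show ?thesis by simp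
    qed
    finally show False using I by simp
  qed
  have nn: "0 \<le> \<delta> u * bp u" for u
  proof (cases "\<bar>u - u0\<bar> < r")
    case True
    have "0 \<le> \<delta> u * sgn (\<delta> u0)" using r(2)[OF True] by (auto simp: sgn_if abs_if split: if_splits)
    hence "0 \<le> (\<delta> u * sgn (\<delta> u0)) * max 0 (1 - \<bar>u - u0\<bar> / r)" by (rule mult_nonneg_nonneg) simp
    thus ?thesis by (simp only: bp_def mult.assoc)
  next
    case False
    hence "1 - \<bar>u - u0\<bar> / r \<le> 0" using r by (simp add: field_simps)
    thus ?thesis by (simp add: bp_def)
  qed
  have lb: "\<delta> u * bp u \<ge> \<bar>\<delta> u0\<bar> / 4 * indicator {u0 - r/2..u0 + r/2} u" for u
  proof (cases "u \<in> {u0 - r/2..u0 + r/2}")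
    case True
    hence h: "\<bar>u - u0\<bar> \<le> r / 2" by (auto simp: abs_real_def)
    hence "\<bar>u - u0\<bar> < r" using r(1) by linarith
    hence a: "\<bar>\<delta> u0\<bar> / 2 \<le> \<delta> u * sgn (\<delta> u0)" using r(2) by (fastforce simp: sgn_if abs_if split: if_splits)
    have b: "1/2 \<le> max 0 (1 - \<bar>u - u0\<bar> / r)" using h r(1) by (simp add: field_simps max_def)
    have "\<bar>\<delta> u0\<bar> / 2 * (1/2) \<le> (\<delta> u * sgn (\<delta> u0)) * max 0 (1 - \<bar>u - u0\<bar> / r)"
      by (rule mult_mono[OF a b order_trans[OF _ a]]) simp_all
    thus ?thesis using True by (simp only: bp_def mult.assoc indicator_simps)
  qed (simp add: nn)
  have "(\<integral>u. \<bar>\<delta> u0\<bar> / 4 * indicator {u0 - r/2..u0 + r/2} u \<partial>lborel) \<le> (\<integral>u. \<delta> u * bp u \<partial>lborel)"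
  proof (rule integral_mono)
    show "integrable lborel (\<lambda>u. \<bar>\<delta> u0\<bar> / 4 * indicator {u0 - r/2..u0 + r/2} u)"
      by (intro integrable_mult_right) (simp add: emeasure_lborel_Icc_eq)
    show "integrable lborel (\<lambda>u. \<delta> u * bp u)"
      by (rule intb[OF bpm, where B = 1]) (use r in \<open>auto simp: bp_def sgn_if\<close>)
  qed (rule lb)
  moreover have "(\<integral>u. \<bar>\<delta> u0\<bar> / 4 * indicator {u0 - r/2..u0 + r/2} u \<partial>lborel) = \<bar>\<delta> u0\<bar> / 4 * r"
    using r(1) by simp
  ultimately show False using zero nz r(1) by (simp add: mult_le_0_iff)
qed

section \<open>Localization of kinks\<close>

text \<open>Up to its first nonzero kink the function is 0 with slope 0; directly after it the
  function would be linear with nonzero slope.\<close>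

lemma pl_rep_no_kinks:
  assumes R: "pl_rep a b f k V \<kappa>" and z: "\<And>t. t \<in> {a..y} \<Longrightarrow> f t = 0" and y: "y \<le> b"
    and u: "u \<in> V" "u < y"
  shows "\<kappa> u = 0"
proof (rule ccontr)
  assume nz: "\<kappa> u \<noteq> 0"
  have V: "finite V" "V \<subseteq> {a<..<b}"
    and ft: "\<And>t. t \<in> {a..b} \<Longrightarrow> f t = f a + k * (t - a) + (\<Sum>u\<in>V. \<kappa> u * max 0 (t - u))"
    using R unfolding pl_rep_def by blast+
  define u0 where "u0 = Min {w \<in> V. w < y \<and> \<kappa> w \<noteq> 0}"
  have ne: "{w \<in> V. w < y \<and> \<kappa> w \<noteq> 0} \<noteq> {}" "finite {w \<in> V. w < y \<and> \<kappa> w \<noteq> 0}" using u nz V by auto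
  have u0: "u0 \<in> V" "u0 < y" "\<kappa> u0 \<noteq> 0" using Min_in[OF ne(2,1)] by (auto simp: u0_def)
  have low: "\<kappa> w = 0" if "w \<in> V" "w < u0" for w
  proof (rule ccontr)
    assume "\<kappa> w \<noteq> 0"
    hence "w \<in> {w \<in> V. w < y \<and> \<kappa> w \<noteq> 0}" using that u0 by auto
    hence "u0 \<le> w" unfolding u0_def using ne by (intro Min_le)
    thus False using that by simp
  qed
  have au: "a < u0" "u0 < b" using u0 V by auto
  have fa: "f a = 0" using z[of a] au u0 by auto
  have s0: "(\<Sum>w\<in>V. \<kappa> w * max 0 (u0 - w)) = 0"
  proof (intro sum.neutral ballI)
    fix w assume "w \<in> V" thus "\<kappa> w * max 0 (u0 - w) = 0" using low[of w] by (cases "w < u0") auto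
  qed
  have "f u0 = 0" using z[of u0] au u0 by auto
  hence k: "k = 0" using ft[of u0] s0 fa au by simp
  define t where "t = Min (insert y {w \<in> V. w > u0})"
  have tin: "t \<in> insert y {w \<in> V. w > u0}" unfolding t_def using V by (intro Min_in) auto
  have t: "u0 < t" using tin u0 by auto
  have ty: "t \<le> y" unfolding t_def using V by (intro Min_le) auto
  have tm: "t \<le> w" if "w \<in> V" "w > u0" for w unfolding t_def using V that by (intro Min_le) auto
  have "(\<Sum>w\<in>V. \<kappa> w * max 0 (t - w)) = (\<Sum>w\<in>V. if w = u0 then \<kappa> u0 * (t - u0) else 0)"
  proof (intro sum.cong refl)
    fix w assume w: "w \<in> V"
    consider "w < u0" | "w = u0" | "w > u0" by linarith
    thus "\<kappa> w * max 0 (t - w) = (if w = u0 then \<kappa> u0 * (t - u0) else 0)"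
      using low[OF w] tm[OF w] t by cases auto
  qed
  also have "\<dots> = \<kappa> u0 * (t - u0)" using V u0 by simp
  finally have "f t = \<kappa> u0 * (t - u0)" using ft[of t] fa k ty y t au by simp
  moreover have "f t = 0" using z[of t] ty t au by auto
  ultimately show False using u0 t by simp
qed

text \<open>Up to the factor \<open>2 * q\<close> the kernel is the second derivative of (t - g1)(t
  - g2)/(1 + xt), which vanishes at both ends. Integration by parts turns every kink and both end
  points into simple fractions in \<open>x\<close>, and \<open>m\<close> collects their
  numerators.\<close>

lemma pl_stieltjes:
  fixes D :: "real \<Rightarrow> real"
  assumes R: "pl_rep g1 g2 D k V \<kappa>" and g: "0 \<le> g1" "g1 < g2"
  defines "m \<equiv> \<lambda>u. if u = g1 \<or> u = g2 then D u * (g2 - g1) else if u \<in> V then \<kappa> u * ((u - g1) * (u - g2)) else 0"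
  assumes x: "0 < x"
  shows "((\<lambda>t. D t / (1 + x * t) ^ 3) has_integral
    (\<Sum>u\<in>insert g1 (insert g2 V). m u / (1 + x * u)) / (2 * ((1 + x * g1) * (1 + x * g2)))) {g1..g2}"
proof -
  have V: "finite V" "V \<subseteq> {g1<..<g2}" using R unfolding pl_rep_def by blast+
  have pos: "1 + x * t > 0" if "t \<in> {g1..g2}" for t
    using that x g by (smt (verit) atLeastAtMost_iff mult_nonneg_nonneg)
  define q where "q = (1 + x * g1) * (1 + x * g2)"
  have q: "q > 0" unfolding q_def using pos[of g1] pos[of g2] g by simp
  define h where "h = (\<lambda>t. (t - g1) * (t - g2) / (1 + x * t))"
  define h' where "h' = (\<lambda>t. ((2 * t - g1 - g2) * (1 + x * t) - x * ((t - g1) * (t - g2))) / (1 + x * t)^2)"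
  define h'' where "h'' = (\<lambda>t. 2 * q / (1 + x * t)^3)"
  have d1: "(h has_real_derivative h' t) (at t within {g1..g2})" if t: "t \<in> {g1..g2}" for t
    unfolding h_def h'_def using pos[OF t]
    by (auto intro!: derivative_eq_intros simp: power2_eq_square algebra_simps)
  have d2: "(h' has_real_derivative h'' t) (at t within {g1..g2})" if t: "t \<in> {g1..g2}" for t
  proof -
    define c where "c = 1 + x * t"
    have c: "c > 0" using pos[OF t] by (simp add: c_def)
    have "(h' has_real_derivative
        ((2 * c + (2 * t - g1 - g2) * x - x * (2 * t - g1 - g2)) * c^2
         - ((2 * t - g1 - g2) * c - x * ((t - g1) * (t - g2))) * (2 * c * x)) / (c^2 * c^2)) (at t within {g1..g2})"
      unfolding h'_def c_def using pos[OF t]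
      by (auto intro!: derivative_eq_intros simp: algebra_simps)
    moreover have "((2 * c + (2 * t - g1 - g2) * x - x * (2 * t - g1 - g2)) * c^2
         - ((2 * t - g1 - g2) * c - x * ((t - g1) * (t - g2))) * (2 * c * x)) / (c^2 * c^2) = h'' t"
    proof -
      have n: "(2 * c + (2 * t - g1 - g2) * x - x * (2 * t - g1 - g2)) * c^2
         - ((2 * t - g1 - g2) * c - x * ((t - g1) * (t - g2))) * (2 * c * x) = 2 * q * c"
        unfolding c_def q_def by (simp add: power2_eq_square) algebra
      have "2 * q * c / (c^2 * c^2) = 2 * q / c^3" using c by (simp add: field_simps power2_eq_square power3_eq_cube)
      thus ?thesis unfolding n h''_def c_def[symmetric] .
    qed
    ultimately show ?thesis by simp
  qed
  have z: "h g1 = 0" "h g2 = 0" by (simp_all add: h_def)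
  have I: "((\<lambda>t. D t * h'' t) has_integral D g2 * h' g2 - D g1 * h' g1 + (\<Sum>u\<in>V. \<kappa> u * h u)) {g1..g2}"
    by (rule pl_rep_by_parts[OF R _ d1 d2 z]) (use g in auto)
  have e1: "D g1 * h' g1 = - (m g1 / (1 + x * g1))"
  proof -
    have "h' g1 = (g1 - g2) / (1 + x * g1)" using pos[of g1] g by (simp add: h'_def power2_eq_square)
    moreover have "D g1 * ((g1 - g2) / (1 + x * g1)) + D g1 * (g2 - g1) / (1 + x * g1) = 0"
      by (simp add: add_divide_distrib[symmetric] distrib_left[symmetric])
    ultimately show ?thesis by (simp add: m_def)
  qed
  have e2: "D g2 * h' g2 = m g2 / (1 + x * g2)"
    using pos[of g2] g by (simp add: h'_def m_def power2_eq_square)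
  have g12: "g1 \<notin> insert g2 V" "g2 \<notin> V" using V g by auto
  have "(\<Sum>u\<in>insert g1 (insert g2 V). m u / (1 + x * u))
     = m g1 / (1 + x * g1) + (m g2 / (1 + x * g2) + (\<Sum>u\<in>V. m u / (1 + x * u)))"
    using V g12 by simp
  also have "(\<Sum>u\<in>V. m u / (1 + x * u)) = (\<Sum>u\<in>V. \<kappa> u * h u)"
    using g12 by (intro sum.cong refl) (auto simp: m_def h_def)
  finally have e: "D g2 * h' g2 - D g1 * h' g1 + (\<Sum>u\<in>V. \<kappa> u * h u) = (\<Sum>u\<in>insert g1 (insert g2 V). m u / (1 + x * u))"
    by (simp add: e1 e2)
  have "((\<lambda>t. (1 / (2 * q)) * (D t * h'' t)) has_integral (1 / (2 * q)) * (\<Sum>u\<in>insert g1 (insert g2 V). m u / (1 + x * u))) {g1..g2}"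
    using has_integral_mult_right[OF I, of "1 / (2 * q)"] unfolding e .
  moreover have "(1 / (2 * q)) * (D t * h'' t) = D t / (1 + x * t) ^ 3" for t
    using q by (simp add: h''_def)
  ultimately show ?thesis by (simp add: q_def)
qed

text \<open>After integration by parts the identity becomes a sum of simple poles at the kinks and end points,
  so the residues vanish; below \<open>y\<close> only \<open>DG\<close> contributes kinks.\<close>

lemma kink_localization:
  fixes DF DG :: "real \<Rightarrow> real"
  assumes f: "0 \<le> f1" "f1 < f2" "f2 \<le> 1" and g: "0 \<le> g1" "g1 < g2" "g2 \<le> 1"
    and F: "pl_breaks f1 f2 DF UF" and G: "pl_breaks g1 g2 DG UG"
    and y: "f1 \<le> y" "y \<le> f2" "g1 \<le> y" "y \<le> g2"
    and F0: "\<And>t. t \<in> {f1..y} \<Longrightarrow> DF t = 0" and G0: "DG y = 0"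
    and I: "\<And>x. 0 < x \<Longrightarrow> x < 1/2 \<Longrightarrow>
      (f2 - f1) / ((1 + x * f1) * (1 + x * f2)) * integral {g1..g2} (\<lambda>t. DG t / (1 + x * t) ^ 3)
      + (g2 - g1) / ((1 + x * g1) * (1 + x * g2)) * integral {f1..f2} (\<lambda>t. DF t / (1 + x * t) ^ 3) = 0"
    and t: "t \<in> {g1..y}"
  shows "DG t = 0"
proof -
  obtain kF VF \<kappa>F where RF: "pl_rep f1 f2 DF kF VF \<kappa>F" using pl_breaks_rep[OF _ F] f by auto
  obtain kG VG \<kappa>G where RG: "pl_rep g1 g2 DG kG VG \<kappa>G" using pl_breaks_rep[OF _ G] g by auto
  have VF: "finite VF" "VF \<subseteq> {f1<..<f2}" using RF unfolding pl_rep_def by blast+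
  have VG: "finite VG" "VG \<subseteq> {g1<..<g2}"
    and Gt: "\<And>t. t \<in> {g1..g2} \<Longrightarrow> DG t = DG g1 + kG * (t - g1) + (\<Sum>u\<in>VG. \<kappa>G u * max 0 (t - u))"
    using RG unfolding pl_rep_def by blast+
  define mF where "mF = (\<lambda>u. if u = f1 \<or> u = f2 then DF u * (f2 - f1) else if u \<in> VF then \<kappa>F u * ((u - f1) * (u - f2)) else 0)"
  define mG where "mG = (\<lambda>u. if u = g1 \<or> u = g2 then DG u * (g2 - g1) else if u \<in> VG then \<kappa>G u * ((u - g1) * (u - g2)) else 0)"
  have mFe: "mF u = (if u = f1 \<or> u = f2 then DF u * (f2 - f1) else if u \<in> VF then \<kappa>F u * ((u - f1) * (u - f2)) else 0)"
    and mGe: "mG u = (if u = g1 \<or> u = g2 then DG u * (g2 - g1) else if u \<in> VG then \<kappa>G u * ((u - g1) * (u - g2)) else 0)" for u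
    by (simp_all add: mF_def mG_def)
  define WF where "WF = insert f1 (insert f2 VF)"
  define WG where "WG = insert g1 (insert g2 VG)"
  \<comment> \<open>Extended by 0, both families of numerators live on one common set of
    poles.\<close>
  define W where "W = WF \<union> WG"
  have W: "finite W" "W \<subseteq> {0..1}" using VF VG f g by (fastforce simp: W_def WF_def WG_def)+
  have sF: "(\<Sum>u\<in>WF. mF u / (1 + x * u)) = (\<Sum>u\<in>W. mF u / (1 + x * u))" for x
    using W by (intro sum.mono_neutral_left) (auto simp: W_def WF_def mF_def)
  have sG: "(\<Sum>u\<in>WG. mG u / (1 + x * u)) = (\<Sum>u\<in>W. mG u / (1 + x * u))" for x
    using W by (intro sum.mono_neutral_left) (auto simp: W_def WG_def mG_def)
  \<comment> \<open>Together with their prefactors both integrals have the denominator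
    \<open>2 * qF * qG\<close>, so the relation says that a single sum of simple fractions
    vanishes.\<close>
  have m0: "(f2 - f1) * mG u + (g2 - g1) * mF u = 0" if "u \<in> W" for u
  proof (rule partial_fractions_zero[OF W _ that])
    fix x :: real assume x: "0 < x" "x < 1/2"
    define SF SG where "SF = (\<Sum>u\<in>W. mF u / (1 + x * u))" and "SG = (\<Sum>u\<in>W. mG u / (1 + x * u))"
    define qF qG where "qF = (1 + x * f1) * (1 + x * f2)" and "qG = (1 + x * g1) * (1 + x * g2)"
    have q: "qF > 0" "qG > 0" unfolding qF_def qG_def using x f g by (auto intro!: mult_pos_pos add_pos_nonneg)
    have "((\<lambda>t. DF t / (1 + x * t) ^ 3) has_integral SF / (2 * qF)) {f1..f2}"
      using pl_stieltjes[OF RF f(1,2) x(1), folded mFe WF_def qF_def] unfolding SF_def sF .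
    moreover have "((\<lambda>t. DG t / (1 + x * t) ^ 3) has_integral SG / (2 * qG)) {g1..g2}"
      using pl_stieltjes[OF RG g(1,2) x(1), folded mGe WG_def qG_def] unfolding SG_def sG .
    ultimately have "(f2 - f1) / qF * (SG / (2 * qG)) + (g2 - g1) / qG * (SF / (2 * qF)) = 0"
      using I[OF x] by (simp add: integral_unique qF_def qG_def)
    hence "((f2 - f1) * SG + (g2 - g1) * SF) / (2 * qF * qG) = 0"
      by (simp add: add_divide_distrib mult_ac)
    hence "(f2 - f1) * SG + (g2 - g1) * SF = 0" using q by simp
    thus "(\<Sum>u\<in>W. ((f2 - f1) * mG u + (g2 - g1) * mF u) / (1 + x * u)) = 0"
      by (simp add: SF_def SG_def add_divide_distrib sum.distrib sum_distrib_left)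
  qed
  have mF0: "mF u = 0" if "u < y" for u
  proof -
    have "u \<noteq> f2" using that y by auto
    moreover have "DF f1 = 0" using F0[of f1] y by auto
    moreover have "\<kappa>F u = 0" if "u \<in> VF" using pl_rep_no_kinks[OF RF F0 y(2) that] \<open>u < y\<close> by auto
    ultimately show ?thesis by (auto simp: mF_def)
  qed
  have mG0: "mG u = 0" if "u < y" "u \<in> W" for u
    using m0[OF that(2)] mF0[OF that(1)] f by simp
  show ?thesis
  proof (cases "g1 < y")
    case True
    have a: "DG g1 = 0" using mG0[OF True] g by (auto simp: mG_def W_def WG_def)
    have b: "\<kappa>G u = 0" if "u \<in> VG" "u < y" for u
    proof -
      have "mG u = 0" "g1 < u" "u < g2" using mG0[OF that(2)] that VG by (auto simp: W_def WG_def)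
      thus ?thesis using that by (simp add: mG_def)
    qed
    have s: "(\<Sum>u\<in>VG. \<kappa>G u * max 0 (s - u)) = 0" if "s \<le> y" for s
    proof (intro sum.neutral ballI)
      fix u assume "u \<in> VG" thus "\<kappa>G u * max 0 (s - u) = 0" using b[of u] that by (cases "u < y") auto
    qed
    \<comment> \<open>\<open>DG\<close> starts at 0, has no kink below \<open>y\<close> and is 0 at
      \<open>y\<close>, which leaves no room for an initial slope.\<close>
    have "kG = 0" using Gt[of y] G0 a s[of y] y True by simp
    thus ?thesis using Gt[of t] a s[of t] t y by simp
  next
    case False
    hence "t = y" using t by simp
    thus ?thesis using G0 by simp
  qed
qed

lemma pl_breaks_continuous:
  assumes "a \<le> b" "pl_breaks a b f U"
  shows "continuous_on {a..b} f"
proof -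
  obtain k V \<kappa> where "pl_rep a b f k V \<kappa>" using pl_breaks_rep[OF assms] by blast
  hence ft: "\<And>t. t \<in> {a..b} \<Longrightarrow> f t = f a + k * (t - a) + (\<Sum>u\<in>V. \<kappa> u * max 0 (t - u))"
    unfolding pl_rep_def by blast
  have "continuous_on {a..b} (\<lambda>t. f a + k * (t - a) + (\<Sum>u\<in>V. \<kappa> u * max 0 (t - u)))"
    by (intro continuous_intros)
  thus ?thesis by (rule continuous_on_eq) (rule ft[symmetric])
qed

section \<open>Planar sections of polyhedral cones\<close>

text \<open>Each triple encodes one inequality: coefficient of \<open>u\<close>, coefficient of
  \<open>t\<close>, right-hand side.\<close>

lemma polyhedron_section_ineqs:
  fixes w0 w1 v :: "real^3"
  assumes "polyhedron K"
  obtains I :: "(real \<times> real \<times> real) set" where "finite I"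
    "\<And>u t. w0 + u *\<^sub>R w1 + t *\<^sub>R v \<in> K \<longleftrightarrow> (\<forall>i\<in>I. fst i * u + fst (snd i) * t \<le> snd (snd i))"
proof -
  obtain F where F: "finite F" "K = \<Inter>F" "\<And>h. h \<in> F \<Longrightarrow> \<exists>a b. a \<noteq> 0 \<and> h = {x. a \<bullet> x \<le> b}"
    using assms unfolding polyhedron_def by blast
  obtain a b where ab: "\<And>h. h \<in> F \<Longrightarrow> h = {x. a h \<bullet> x \<le> b h}"
    using F(3) by metis
  define I where "I = (\<lambda>h. (a h \<bullet> w1, a h \<bullet> v, b h - a h \<bullet> w0)) ` F"
  show thesis
  proof (rule that[of I])
    show "finite I" using F by (simp add: I_def)
    fix u t
    have "w0 + u *\<^sub>R w1 + t *\<^sub>R v \<in> K \<longleftrightarrow> (\<forall>h\<in>F. a h \<bullet> (w0 + u *\<^sub>R w1 + t *\<^sub>R v) \<le> b h)"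
      unfolding F(2) using ab by blast
    thus "w0 + u *\<^sub>R w1 + t *\<^sub>R v \<in> K \<longleftrightarrow> (\<forall>i\<in>I. fst i * u + fst (snd i) * t \<le> snd (snd i))"
      by (simp add: I_def inner_add_right algebra_simps)
  qed
qed

lemma compact_convex_real_interval:
  fixes S :: "real set"
  assumes "closed S" "convex S" "S \<noteq> {}" "S \<subseteq> {a..b}"
  obtains k1 k2 where "k1 \<le> k2" "S = {k1..k2}"
proof -
  have "compact S" using assms(1,4) by (meson bounded_closed_interval bounded_subset compact_eq_bounded_closed)
  moreover have "connected S" using assms(2) by (rule convex_connected)
  ultimately obtain k1 k2 where "S = {k1..k2}" using connected_compact_interval_1 by (metis box_real(2))
  thus thesis using that[of k1 k2] assms(3) by force
qed

text \<open>Being closed upwards in \<open>t\<close>, the section admits no inequality with positive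
  coefficient of \<open>t\<close>. Those with negative coefficient bound \<open>t\<close> from below
  by a maximum of affine functions, and the remaining ones only confine \<open>u\<close>.\<close>

lemma section_ray:
  fixes w0 w1 v :: "real^3"
  assumes K: "polyhedron K"
    and up: "\<And>u t t'. w0 + u *\<^sub>R w1 + t *\<^sub>R v \<in> K \<Longrightarrow> t \<le> t' \<Longrightarrow> w0 + u *\<^sub>R w1 + t' *\<^sub>R v \<in> K"
    and bd: "\<And>u t. w0 + u *\<^sub>R w1 + t *\<^sub>R v \<in> K \<Longrightarrow> a \<le> u \<and> u \<le> b \<and> 0 < t"
    and ne: "w0 + u0 *\<^sub>R w1 + t0 *\<^sub>R v \<in> K"
  obtains k1 k2 E U where "k1 \<le> k2"
    "\<And>u t. w0 + u *\<^sub>R w1 + t *\<^sub>R v \<in> K \<longleftrightarrow> k1 \<le> u \<and> u \<le> k2 \<and> E u \<le> t" "pl_breaks k1 k2 E U"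
proof -
  obtain I where I: "finite I"
    "\<And>u t. w0 + u *\<^sub>R w1 + t *\<^sub>R v \<in> K \<longleftrightarrow> (\<forall>i\<in>I. fst i * u + fst (snd i) * t \<le> snd (snd i))"
    using polyhedron_section_ineqs[OF K] by blast
  have neg: "fst (snd i) \<le> 0" if "i \<in> I" for i
  proof (rule ccontr)
    assume H: "\<not> fst (snd i) \<le> 0"
    define T where "T = max t0 ((snd (snd i) - fst i * u0 + 1) / fst (snd i))"
    have "fst i * u0 + fst (snd i) * T \<le> snd (snd i)" using up[OF ne, of T] I(2) that by (auto simp: T_def)
    moreover have "fst (snd i) * T \<ge> snd (snd i) - fst i * u0 + 1"
    proof -
      have "T \<ge> (snd (snd i) - fst i * u0 + 1) / fst (snd i)" by (simp add: T_def)
      thus ?thesis using H by (simp add: divide_le_eq mult.commute)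
    qed
    ultimately show False by linarith
  qed
  define J where "J = {i \<in> I. fst (snd i) < 0}"
  define Z where "Z = {i \<in> I. fst (snd i) = 0}"
  have IJZ: "I = J \<union> Z" using neg by (force simp: J_def Z_def)
  have finJ: "finite J" using I(1) by (simp add: J_def)
  have ZI: "\<And>i u. i \<in> Z \<Longrightarrow> fst i * u + fst (snd i) * t = fst i * u" for t by (simp add: Z_def)
  \<comment> \<open>Without a lower bound the point with t = -1 would belong to the section, whose
    points have positive \<open>t\<close>.\<close>
  have neJ: "J \<noteq> {}"
  proof
    assume "J = {}"
    hence "w0 + u0 *\<^sub>R w1 + (-1) *\<^sub>R v \<in> K" using ne unfolding I(2) IJZ by (auto simp: Z_def)
    from bd[OF this] show False by simp
  qed
  define E where "E = (\<lambda>u. Max ((\<lambda>i. snd (snd i) / fst (snd i) + (- fst i / fst (snd i)) * u) ` J))"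
  have EJ: "E u \<le> t \<longleftrightarrow> (\<forall>i\<in>J. fst i * u + fst (snd i) * t \<le> snd (snd i))" for u t
  proof -
    have "E u \<le> t \<longleftrightarrow> (\<forall>i\<in>J. snd (snd i) / fst (snd i) + (- fst i / fst (snd i)) * u \<le> t)"
      unfolding E_def using finJ neJ by (subst Max_le_iff) auto
    also have "\<dots> \<longleftrightarrow> (\<forall>i\<in>J. fst i * u + fst (snd i) * t \<le> snd (snd i))"
    proof (intro ball_cong refl)
      fix i assume "i \<in> J"
      hence n: "fst (snd i) < 0" by (simp add: J_def)
      have "snd (snd i) / fst (snd i) + (- fst i / fst (snd i)) * u = (snd (snd i) - fst i * u) / fst (snd i)"
        by (simp add: diff_divide_distrib)
      also have "\<dots> \<le> t \<longleftrightarrow> snd (snd i) - fst i * u \<ge> t * fst (snd i)"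
        using n by (simp add: divide_le_eq)
      finally show "snd (snd i) / fst (snd i) + (- fst i / fst (snd i)) * u \<le> t \<longleftrightarrow> fst i * u + fst (snd i) * t \<le> snd (snd i)"
        by (simp add: algebra_simps)
    qed
    finally show ?thesis .
  qed
  define S where "S = {u. \<forall>i\<in>Z. fst i * u \<le> snd (snd i)}"
  have sec: "w0 + u *\<^sub>R w1 + t *\<^sub>R v \<in> K \<longleftrightarrow> u \<in> S \<and> E u \<le> t" for u t
  proof -
    have "(\<forall>i\<in>Z. fst i * u + fst (snd i) * t \<le> snd (snd i)) \<longleftrightarrow> (\<forall>i\<in>Z. fst i * u \<le> snd (snd i))"
      by (intro ball_cong refl) (simp add: ZI)
    thus ?thesis unfolding I(2) EJ S_def IJZ ball_Un by auto
  qed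
  have "closed S"
  proof -
    have "S = (\<Inter>i\<in>Z. {u. fst i * u \<le> snd (snd i)})" by (auto simp: S_def)
    moreover have "closed {u. fst i * u \<le> snd (snd i)}" for i :: "real \<times> real \<times> real"
      by (intro closed_Collect_le continuous_intros)
    ultimately show ?thesis by (simp add: closed_INT)
  qed
  moreover have "convex S"
    unfolding convex_def S_def
  proof (clarify)
    fix x y p q :: real and A B C :: real
    assume h: "\<forall>i\<in>Z. fst i * x \<le> snd (snd i)" "\<forall>i\<in>Z. fst i * y \<le> snd (snd i)" "0 \<le> p" "0 \<le> q" "p + q = 1"
      and i: "(A, B, C) \<in> Z"
    have "p * (A * x) + q * (A * y) \<le> p * C + q * C"
      using h i by (intro add_mono mult_left_mono) auto
    also have "\<dots> = C" using h by (simp add: distrib_right[symmetric])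
    finally show "fst (A, B, C) * (p *\<^sub>R x + q *\<^sub>R y) \<le> snd (snd (A, B, C))" by (simp add: algebra_simps)
  qed
  moreover have "S \<noteq> {}" using ne sec by blast
  moreover have "S \<subseteq> {a..b}" using bd sec by (metis atLeastAtMost_iff order_refl subsetI)
  ultimately obtain k1 k2 where k: "k1 \<le> k2" "S = {k1..k2}" by (rule compact_convex_real_interval)
  obtain U where U: "pl_breaks k1 k2 E U"
    using pl_breaks_Max[OF finJ neJ, of k1 k2 E "\<lambda>i. snd (snd i) / fst (snd i)" "\<lambda>i. - fst i / fst (snd i)"]
    by (auto simp: E_def)
  show thesis by (rule that[OF k(1) _ U]) (simp add: sec k(2))
qed

text \<open>Now there are upper bounds as well, and upper and lower bounds jointly restrict
  \<open>u\<close>. The range of \<open>u\<close> is therefore obtained as the projection of the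
  compact convex section.\<close>

lemma section_compact:
  fixes w0 w1 v :: "real^3"
  assumes K: "polyhedron K"
    and bd: "\<And>u t. w0 + u *\<^sub>R w1 + t *\<^sub>R v \<in> K \<Longrightarrow> a \<le> u \<and> u \<le> b \<and> c \<le> t \<and> t \<le> d"
    and ne: "w0 + u0 *\<^sub>R w1 + t0 *\<^sub>R v \<in> K"
  obtains k1 k2 lo hi where "k1 \<le> k2"
    "\<And>u t. w0 + u *\<^sub>R w1 + t *\<^sub>R v \<in> K \<longleftrightarrow> k1 \<le> u \<and> u \<le> k2 \<and> lo u \<le> t \<and> t \<le> hi u"
    "continuous_on {k1..k2} lo" "continuous_on {k1..k2} hi" "\<And>u. k1 \<le> u \<Longrightarrow> u \<le> k2 \<Longrightarrow> lo u \<le> hi u"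
proof -
  obtain I where I: "finite I"
    "\<And>u t. w0 + u *\<^sub>R w1 + t *\<^sub>R v \<in> K \<longleftrightarrow> (\<forall>i\<in>I. fst i * u + fst (snd i) * t \<le> snd (snd i))"
    using polyhedron_section_ineqs[OF K] by blast
  define J where "J = {i \<in> I. fst (snd i) < 0}"
  define P where "P = {i \<in> I. fst (snd i) > 0}"
  define Z where "Z = {i \<in> I. fst (snd i) = 0}"
  have I3: "I = J \<union> P \<union> Z" by (force simp: J_def Z_def P_def)
  have fin: "finite J" "finite P" using I(1) by (simp_all add: J_def P_def)
  have neJ: "J \<noteq> {}"
  proof
    assume J: "J = {}"
    have "w0 + u0 *\<^sub>R w1 + (min t0 (c - 1)) *\<^sub>R v \<in> K"
      unfolding I(2)
    proof
      fix i assume i: "i \<in> I"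
      have "i \<notin> J" using J by simp
      hence "fst (snd i) \<ge> 0" using i by (simp add: J_def not_less)
      hence "fst (snd i) * min t0 (c - 1) \<le> fst (snd i) * t0" by (intro mult_left_mono) auto
      moreover have "fst i * u0 + fst (snd i) * t0 \<le> snd (snd i)" using ne i unfolding I(2) by blast
      ultimately show "fst i * u0 + fst (snd i) * min t0 (c - 1) \<le> snd (snd i)" by linarith
    qed
    from bd[OF this] show False by simp
  qed
  have neP: "P \<noteq> {}"
  proof
    assume P: "P = {}"
    have "w0 + u0 *\<^sub>R w1 + (max t0 (d + 1)) *\<^sub>R v \<in> K"
      unfolding I(2)
    proof
      fix i assume i: "i \<in> I"
      have "i \<notin> P" using P by simp
      hence "fst (snd i) \<le> 0" using i by (simp add: P_def not_less)
      hence "fst (snd i) * max t0 (d + 1) \<le> fst (snd i) * t0" by (intro mult_left_mono_neg) auto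
      moreover have "fst i * u0 + fst (snd i) * t0 \<le> snd (snd i)" using ne i unfolding I(2) by blast
      ultimately show "fst i * u0 + fst (snd i) * max t0 (d + 1) \<le> snd (snd i)" by linarith
    qed
    from bd[OF this] show False by simp
  qed
  define lo where "lo = (\<lambda>u. Max ((\<lambda>i. snd (snd i) / fst (snd i) + (- fst i / fst (snd i)) * u) ` J))"
  \<comment> \<open>The upper boundary is minus this maximum, so that \<open>pl_breaks_Max\<close>
    serves for both sides.\<close>
  define hi' where "hi' = (\<lambda>u. Max ((\<lambda>i. - snd (snd i) / fst (snd i) + (fst i / fst (snd i)) * u) ` P))"
  have loJ: "lo u \<le> t \<longleftrightarrow> (\<forall>i\<in>J. fst i * u + fst (snd i) * t \<le> snd (snd i))" for u t
  proof -
    have "lo u \<le> t \<longleftrightarrow> (\<forall>i\<in>J. snd (snd i) / fst (snd i) + (- fst i / fst (snd i)) * u \<le> t)"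
      unfolding lo_def using fin neJ by (subst Max_le_iff) auto
    also have "\<dots> \<longleftrightarrow> (\<forall>i\<in>J. fst i * u + fst (snd i) * t \<le> snd (snd i))"
    proof (intro ball_cong refl)
      fix i assume "i \<in> J"
      hence n: "fst (snd i) < 0" by (simp add: J_def)
      have "snd (snd i) / fst (snd i) + (- fst i / fst (snd i)) * u = (snd (snd i) - fst i * u) / fst (snd i)"
        by (simp add: diff_divide_distrib)
      also have "\<dots> \<le> t \<longleftrightarrow> snd (snd i) - fst i * u \<ge> t * fst (snd i)"
        using n by (simp add: divide_le_eq)
      finally show "snd (snd i) / fst (snd i) + (- fst i / fst (snd i)) * u \<le> t \<longleftrightarrow> fst i * u + fst (snd i) * t \<le> snd (snd i)"
        by (simp add: algebra_simps)
    qed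
    finally show ?thesis .
  qed
  have hiP: "t \<le> - hi' u \<longleftrightarrow> (\<forall>i\<in>P. fst i * u + fst (snd i) * t \<le> snd (snd i))" for u t
  proof -
    have "t \<le> - hi' u \<longleftrightarrow> hi' u \<le> - t" by linarith
    also have "\<dots> \<longleftrightarrow> (\<forall>i\<in>P. - snd (snd i) / fst (snd i) + (fst i / fst (snd i)) * u \<le> - t)"
      unfolding hi'_def using fin neP by (subst Max_le_iff) auto
    also have "\<dots> \<longleftrightarrow> (\<forall>i\<in>P. fst i * u + fst (snd i) * t \<le> snd (snd i))"
    proof (intro ball_cong refl)
      fix i assume "i \<in> P"
      hence n: "fst (snd i) > 0" by (simp add: P_def)
      have "- snd (snd i) / fst (snd i) + (fst i / fst (snd i)) * u = (fst i * u - snd (snd i)) / fst (snd i)"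
        by (simp add: diff_divide_distrib)
      also have "\<dots> \<le> - t \<longleftrightarrow> fst i * u - snd (snd i) \<le> - t * fst (snd i)"
        using n by (simp add: divide_le_eq)
      finally show "- snd (snd i) / fst (snd i) + (fst i / fst (snd i)) * u \<le> - t \<longleftrightarrow> fst i * u + fst (snd i) * t \<le> snd (snd i)"
        by (simp add: algebra_simps)
    qed
    finally show ?thesis .
  qed
  define S where "S = {u. \<exists>t. w0 + u *\<^sub>R w1 + t *\<^sub>R v \<in> K}"
  have ZI: "\<And>i u. i \<in> Z \<Longrightarrow> fst i * u + fst (snd i) * t = fst i * u" for t by (simp add: Z_def)
  have sec: "w0 + u *\<^sub>R w1 + t *\<^sub>R v \<in> K \<longleftrightarrow> u \<in> S \<and> lo u \<le> t \<and> t \<le> - hi' u" for u t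
  proof
    assume "w0 + u *\<^sub>R w1 + t *\<^sub>R v \<in> K"
    thus "u \<in> S \<and> lo u \<le> t \<and> t \<le> - hi' u"
      unfolding loJ hiP S_def using I(2) I3 by blast
  next
    assume H: "u \<in> S \<and> lo u \<le> t \<and> t \<le> - hi' u"
    then obtain t' where "w0 + u *\<^sub>R w1 + t' *\<^sub>R v \<in> K" by (auto simp: S_def)
    hence "\<forall>i\<in>Z. fst i * u + fst (snd i) * t' \<le> snd (snd i)" unfolding I(2) I3 by blast
    hence "\<forall>i\<in>Z. fst i * u + fst (snd i) * t \<le> snd (snd i)" by (simp add: ZI)
    thus "w0 + u *\<^sub>R w1 + t *\<^sub>R v \<in> K" using H unfolding I(2) I3 loJ hiP by blast
  qed
  define Q where "Q = {p :: real \<times> real. w0 + fst p *\<^sub>R w1 + snd p *\<^sub>R v \<in> K}"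
  have Qeq: "Q = (\<Inter>i\<in>I. {p. fst i * fst p + fst (snd i) * snd p \<le> snd (snd i)})"
    unfolding Q_def I(2) by auto
  have clQ: "closed Q" unfolding Qeq
    by (intro closed_INT ballI closed_Collect_le continuous_intros)
  have "Q = ({a..b} \<times> {c..d}) \<inter> Q" unfolding Q_def using bd by auto
  moreover have "compact (({a..b} \<times> {c..d}) \<inter> Q)"
    by (intro compact_Int_closed compact_Times compact_Icc clQ)
  ultimately have "compact Q" by simp
  hence "compact (fst ` Q)" by (intro compact_continuous_image continuous_intros)
  moreover have "fst ` Q = S"
  proof (intro equalityI subsetI)
    fix x assume "x \<in> S"
    then obtain t where "(x, t) \<in> Q" by (auto simp: S_def Q_def)
    thus "x \<in> fst ` Q" by (rule rev_image_eqI) simp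
  qed (auto simp: S_def Q_def)
  ultimately have cS: "closed S" by (simp add: compact_imp_closed)
  have "convex Q"
    unfolding Qeq
  proof (intro convex_INT ballI)
    fix i :: "real \<times> real \<times> real"
    have "{p. fst i * fst p + fst (snd i) * snd p \<le> snd (snd i)} = {p. (fst i, fst (snd i)) \<bullet> p \<le> snd (snd i)}"
      by (auto simp: inner_prod_def)
    thus "convex {p. fst i * fst p + fst (snd i) * snd p \<le> snd (snd i)}" by (simp add: convex_halfspace_le)
  qed
  hence "convex S" unfolding \<open>fst ` Q = S\<close>[symmetric] by (intro convex_linear_image linear_fst)
  moreover have "S \<noteq> {}" using ne by (auto simp: S_def)
  moreover have "S \<subseteq> {a..b}" using bd by (auto simp: S_def)
  ultimately obtain k1 k2 where k: "k1 \<le> k2" "S = {k1..k2}" using cS compact_convex_real_interval by blast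
  obtain U where U: "pl_breaks k1 k2 lo U"
    using pl_breaks_Max[OF fin(1) neJ, of k1 k2 lo "\<lambda>i. snd (snd i) / fst (snd i)" "\<lambda>i. - fst i / fst (snd i)"]
    by (auto simp: lo_def)
  obtain U' where U': "pl_breaks k1 k2 hi' U'"
    using pl_breaks_Max[OF fin(2) neP, of k1 k2 hi' "\<lambda>i. - snd (snd i) / fst (snd i)" "\<lambda>i. fst i / fst (snd i)"]
    by (auto simp: hi'_def)
  show thesis
  proof (rule that[OF k(1)])
    show "w0 + u *\<^sub>R w1 + t *\<^sub>R v \<in> K \<longleftrightarrow> k1 \<le> u \<and> u \<le> k2 \<and> lo u \<le> t \<and> t \<le> - hi' u" for u t
      unfolding sec k(2) by auto
    show "continuous_on {k1..k2} lo" by (rule pl_breaks_continuous[OF k(1) U])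
    show "continuous_on {k1..k2} (\<lambda>u. - hi' u)" by (intro continuous_on_minus pl_breaks_continuous[OF k(1) U'])
    show "lo u \<le> - hi' u" if "k1 \<le> u" "u \<le> k2" for u
    proof -
      have "u \<in> S" using that k by auto
      then obtain t where "w0 + u *\<^sub>R w1 + t *\<^sub>R v \<in> K" by (auto simp: S_def)
      thus ?thesis unfolding sec by linarith
    qed
  qed
qed

section \<open>Section integrals and their expansions\<close>

text \<open>Integrating the cubic kernel from \<open>E u\<close> to infinity leaves an inverse
  square divided by \<open>ta\<close>. This division is the divergence of the transform as the
  functional tends to one that vanishes on \<open>v\<close>.\<close>

lemma sint_ray:
  assumes sec: "\<And>u t. w0 + u *\<^sub>R w1 + t *\<^sub>R v \<in> K \<longleftrightarrow> k1 \<le> u \<and> u \<le> k2 \<and> E u \<le> t"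
    and k: "0 \<le> k1" "k2 \<le> 1" and E: "continuous_on {k1..k2} E" "\<And>u. u \<in> {k1..k2} \<Longrightarrow> 0 < E u"
    and la: "\<bar>la\<bar> < 1/2" and ta: "0 < ta"
  shows "sint K w0 w1 v la ta = ennreal (integral {k1..k2} (\<lambda>u. 1 / (1 + la * u + ta * E u)^2) / ta)"
proof -
  have mu: "1 + la * u > 0" if "u \<in> {k1..k2}" for u
  proof -
    have "\<bar>la * u\<bar> \<le> 1/2 * 1" unfolding abs_mult using that k la by (intro mult_mono) auto
    thus ?thesis by linarith
  qed
  have inner: "(\<integral>\<^sup>+t. indicator K (w0 + u *\<^sub>R w1 + t *\<^sub>R v) * ennreal (2 / (1 + la * u + ta * t) ^ 3) \<partial>lborel)
     = ennreal ((1 / (1 + la * u + ta * E u)^2) / ta) * indicator {k1..k2} u" for u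
  proof (cases "u \<in> {k1..k2}")
    case False
    hence "indicator K (w0 + u *\<^sub>R w1 + t *\<^sub>R v) = (0 :: ennreal)" for t by (auto simp: sec indicator_def)
    thus ?thesis using False by simp
  next
    case True
    define \<mu> where "\<mu> = 1 + la * u"
    have mu0: "\<mu> > 0" using mu[OF True] by (simp add: \<mu>_def)
    have pos: "\<mu> + ta * t > 0" if "E u \<le> t" for t
      using mu0 ta E(2)[OF True] that by (intro add_pos_nonneg) auto
    define F where "F = (\<lambda>t. - (1 / ta) * (inverse (\<mu> + ta * t))^2)"
    have "(\<integral>\<^sup>+t. ennreal (2 / (\<mu> + ta * t) ^ 3) * indicator {E u..} t \<partial>lborel) = ennreal (0 - F (E u))"
    proof (rule nn_integral_FTC_atLeast)
      show "(\<lambda>t. 2 / (\<mu> + ta * t) ^ 3) \<in> borel_measurable borel" by measurable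
      fix t assume t: "E u \<le> t"
      define c where "c = \<mu> + ta * t"
      have c: "c > 0" using pos[OF t] by (simp add: c_def)
      have "(F has_real_derivative - (1 / ta) * (2 * inverse c * - (inverse c * ta * inverse c))) (at t)"
        unfolding F_def c_def using pos[OF t] ta
        by (auto intro!: derivative_eq_intros)
      moreover have "- (1 / ta) * (2 * inverse c * - (inverse c * ta * inverse c)) = 2 / c^3"
        using c ta by (simp add: divide_inverse power3_eq_cube)
      ultimately show "(F has_real_derivative 2 / (\<mu> + ta * t) ^ 3) (at t)" by (simp add: c_def)
      show "0 \<le> 2 / (\<mu> + ta * t) ^ 3" using pos[OF t] by simp
    next
      have "filterlim (\<lambda>t. \<mu> + ta * t) at_top at_top"
        using ta by (intro filterlim_tendsto_add_at_top[OF tendsto_const] filterlim_tendsto_pos_mult_at_top[OF tendsto_const] filterlim_ident)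
      hence "((\<lambda>t. inverse (\<mu> + ta * t)) \<longlongrightarrow> 0) at_top"
        by (rule tendsto_inverse_0_at_top)
      hence "((\<lambda>t. - (1 / ta) * (inverse (\<mu> + ta * t))^2) \<longlongrightarrow> - (1 / ta) * 0^2) at_top"
        by (intro tendsto_intros)
      thus "(F \<longlongrightarrow> 0) at_top" unfolding F_def by simp
    qed
    moreover have "indicator K (w0 + u *\<^sub>R w1 + t *\<^sub>R v) = (indicator {E u..} t :: ennreal)" for t
      using True by (auto simp: sec indicator_def)
    ultimately show ?thesis using True by (simp add: F_def \<mu>_def mult.commute divide_inverse power_inverse)
  qed
  have cont: "continuous_on {k1..k2} (\<lambda>u. (1 / (1 + la * u + ta * E u)^2) / ta)"
  proof (intro continuous_intros E(1) ballI)
    fix u assume u: "u \<in> {k1..k2}"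
    show "(1 + la * u + ta * E u)\<^sup>2 \<noteq> 0" using mu[OF u] mult_pos_pos[OF ta E(2)[OF u]] by auto
    show "ta \<noteq> 0" using ta by simp
  qed
  have "sint K w0 w1 v la ta = (\<integral>\<^sup>+u. ennreal ((1 / (1 + la * u + ta * E u)^2) / ta) * indicator {k1..k2} u \<partial>lborel)"
    unfolding sint_def inner ..
  also have "\<dots> = ennreal (integral {k1..k2} (\<lambda>u. (1 / (1 + la * u + ta * E u)^2) / ta))"
    using cont ta by (intro nn_integral_has_integral_lebesgue' integrable_integral integrable_continuous_real) auto
  also have "integral {k1..k2} (\<lambda>u. (1 / (1 + la * u + ta * E u)^2) / ta) = integral {k1..k2} (\<lambda>u. 1 / (1 + la * u + ta * E u)^2) / ta"
    by (simp add: divide_inverse)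
  finally show ?thesis .
qed

lemma sint_compact:
  assumes sec: "\<And>u t. w0 + u *\<^sub>R w1 + t *\<^sub>R v \<in> K \<longleftrightarrow> k1 \<le> u \<and> u \<le> k2 \<and> lo u \<le> t \<and> t \<le> hi u"
    and c: "continuous_on {k1..k2} lo" "continuous_on {k1..k2} hi" "\<And>u. k1 \<le> u \<Longrightarrow> u \<le> k2 \<Longrightarrow> lo u \<le> hi u"
    and mu: "\<And>u. k1 \<le> u \<Longrightarrow> u \<le> k2 \<Longrightarrow> 1 + la * u > 0"
  shows "sint K w0 w1 v la 0 = ennreal (integral {k1..k2} (\<lambda>u. 2 * (hi u - lo u) / (1 + la * u)^3))"
proof -
  have inner: "(\<integral>\<^sup>+t. indicator K (w0 + u *\<^sub>R w1 + t *\<^sub>R v) * ennreal (2 / (1 + la * u + 0 * t) ^ 3) \<partial>lborel)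
     = ennreal (2 * (hi u - lo u) / (1 + la * u)^3) * indicator {k1..k2} u" for u
  proof (cases "u \<in> {k1..k2}")
    case False
    hence "indicator K (w0 + u *\<^sub>R w1 + t *\<^sub>R v) = (0 :: ennreal)" for t by (auto simp: sec indicator_def)
    thus ?thesis using False by simp
  next
    case True
    have "indicator K (w0 + u *\<^sub>R w1 + t *\<^sub>R v) = (indicator {lo u..hi u} t :: ennreal)" for t
      using True by (auto simp: sec indicator_def)
    hence "(\<integral>\<^sup>+t. indicator K (w0 + u *\<^sub>R w1 + t *\<^sub>R v) * ennreal (2 / (1 + la * u + 0 * t) ^ 3) \<partial>lborel)
      = (\<integral>\<^sup>+t. ennreal (2 / (1 + la * u) ^ 3) * indicator {lo u..hi u} t \<partial>lborel)"
      by (simp add: mult.commute)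
    also have "\<dots> = ennreal (2 / (1 + la * u) ^ 3) * emeasure lborel {lo u..hi u}"
      by (rule nn_integral_cmult_indicator) auto
    also have "\<dots> = ennreal (2 / (1 + la * u) ^ 3 * (hi u - lo u))"
      using True c(3) mu[of u] by (subst ennreal_mult) auto
    finally show ?thesis using True by simp
  qed
  have cont: "continuous_on {k1..k2} (\<lambda>u. 2 * (hi u - lo u) / (1 + la * u)^3)"
  proof (intro continuous_intros c(1,2) ballI)
    fix u assume "u \<in> {k1..k2}"
    thus "(1 + la * u)^3 \<noteq> 0" using mu[of u] by auto
  qed
  have "sint K w0 w1 v la 0 = (\<integral>\<^sup>+u. ennreal (2 * (hi u - lo u) / (1 + la * u)^3) * indicator {k1..k2} u \<partial>lborel)"
    unfolding sint_def inner ..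
  also have "\<dots> = ennreal (integral {k1..k2} (\<lambda>u. 2 * (hi u - lo u) / (1 + la * u)^3))"
    using cont mu c(3) by (intro nn_integral_has_integral_lebesgue' integrable_integral integrable_continuous_real)
      (auto intro!: divide_nonneg_pos)
  finally show ?thesis .
qed

text \<open>The Taylor remainder is an explicit fraction times s^2; the constant 48 is 3 / ((1/2)^3
  * (1/2)).\<close>

lemma inverse_square_expansion:
  fixes \<mu> s :: real
  assumes "1/2 \<le> \<mu>" "0 \<le> s"
  shows "\<bar>1 / (\<mu> + s)^2 - 1 / \<mu>^2 + 2 * s / \<mu>^3\<bar> \<le> 48 * s^2"
proof -
  have e: "1 / (\<mu> + s)^2 - 1 / \<mu>^2 + 2 * s / \<mu>^3 = s^2 * ((3 * \<mu> + 2 * s) / (\<mu>^3 * (\<mu> + s)^2))"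
    using assms by (simp add: divide_simps) algebra
  have "(3 * \<mu> + 2 * s) / (\<mu>^3 * (\<mu> + s)^2) \<le> (3 * (\<mu> + s)) / (\<mu>^3 * (\<mu> + s)^2)"
    using assms by (intro divide_right_mono) auto
  also have "\<dots> = 3 / (\<mu>^3 * (\<mu> + s))"
  proof -
    have "3 * m / (\<mu>^3 * m^2) = 3 / (\<mu>^3 * m)" if "m > 0" for m using that by (simp add: power2_eq_square)
    from this[of "\<mu> + s"] show ?thesis using assms by simp
  qed
  also have "\<dots> \<le> 3 / ((1/2)^3 * (1/2 + 0))"
    using assms by (intro divide_left_mono mult_mono power_mono add_mono mult_pos_pos) auto
  finally have "(3 * \<mu> + 2 * s) / (\<mu>^3 * (\<mu> + s)^2) \<le> 48" by (simp add: power3_eq_cube)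
  hence "s^2 * ((3 * \<mu> + 2 * s) / (\<mu>^3 * (\<mu> + s)^2)) \<le> s^2 * 48" by (intro mult_left_mono) auto
  moreover have "0 \<le> s^2 * ((3 * \<mu> + 2 * s) / (\<mu>^3 * (\<mu> + s)^2))"
    using assms by (intro mult_nonneg_nonneg divide_nonneg_nonneg) auto
  ultimately show ?thesis unfolding e by (simp add: mult.commute)
qed

lemma integral_inverse_square:
  fixes k1 k2 la :: real
  assumes "k1 \<le> k2" "\<And>u. u \<in> {k1..k2} \<Longrightarrow> 1 + la * u > 0"
  shows "integral {k1..k2} (\<lambda>u. 1 / (1 + la * u)^2) = (k2 - k1) / ((1 + la * k1) * (1 + la * k2))"
proof -
  define F where "F = (\<lambda>u. (u - k1) / ((1 + la * k1) * (1 + la * u)))"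
  have "((\<lambda>u. 1 / (1 + la * u)^2) has_integral F k2 - F k1) {k1..k2}"
  proof (rule fundamental_theorem_of_calculus[OF assms(1)])
    fix u assume u: "u \<in> {k1..k2}"
    have p: "1 + la * u > 0" "1 + la * k1 > 0" using assms u by auto
    have "(F has_real_derivative ((1 + la * k1) * (1 + la * u) - (u - k1) * ((1 + la * k1) * la)) / ((1 + la * k1) * (1 + la * u))^2) (at u within {k1..k2})"
      unfolding F_def using p by (auto intro!: derivative_eq_intros simp: power2_eq_square)
    moreover have "((1 + la * k1) * (1 + la * u) - (u - k1) * ((1 + la * k1) * la)) / ((1 + la * k1) * (1 + la * u))^2 = 1 / (1 + la * u)^2"
    proof -
      have "(1 + la * k1) * (1 + la * u) - (u - k1) * ((1 + la * k1) * la) = (1 + la * k1)^2"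
        by (simp add: power2_eq_square algebra_simps)
      thus ?thesis using p by (simp add: power_mult_distrib)
    qed
    ultimately show "(F has_vector_derivative 1 / (1 + la * u)^2) (at u within {k1..k2})"
      by (simp add: has_real_derivative_iff_has_vector_derivative)
  qed
  thus ?thesis by (simp add: integral_unique F_def)
qed

text \<open>The remainder is uniform because \<open>E\<close> is bounded on its compact range. The
  leading coefficient knows only the range, that is the angle of the cone; the boundary function
  enters in the first-order term.\<close>

lemma ray_expansion:
  fixes E :: "real \<Rightarrow> real"
  assumes k: "k1 \<le> k2" "0 \<le> k1" "k2 \<le> 1" and E: "continuous_on {k1..k2} E" "\<And>u. u \<in> {k1..k2} \<Longrightarrow> 0 < E u"
    and la: "\<bar>la\<bar> < 1/2"
  obtains C where "\<And>ta. 0 < ta \<Longrightarrow>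
     \<bar>integral {k1..k2} (\<lambda>u. 1 / (1 + la * u + ta * E u)^2) - (k2 - k1) / ((1 + la * k1) * (1 + la * k2))
       + 2 * ta * integral {k1..k2} (\<lambda>u. E u / (1 + la * u)^3)\<bar> \<le> C * ta^2"
proof -
  have mu: "1/2 \<le> 1 + la * u" if "u \<in> {k1..k2}" for u
  proof -
    have "\<bar>la * u\<bar> \<le> 1/2 * 1" unfolding abs_mult using that k la by (intro mult_mono) auto
    thus ?thesis by linarith
  qed
  have mu': "1 + la * u > 0" if "u \<in> {k1..k2}" for u using mu[OF that] by linarith
  obtain d where d: "\<And>u. u \<in> {k1..k2} \<Longrightarrow> E u \<le> d"
    using continuous_attains_sup[OF compact_Icc _ E(1)] k(1) by (metis atLeastAtMost_iff empty_iff order_refl)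
  have nz: "(1 + la * u) ^ n \<noteq> 0" if "u \<in> {k1..k2}" for u n using mu'[OF that] by simp
  have c0: "continuous_on {k1..k2} (\<lambda>u. 1 / (1 + la * u)^2)"
    by (intro continuous_intros ballI nz)
  have c1: "continuous_on {k1..k2} (\<lambda>u. E u / (1 + la * u)^3)"
    by (intro continuous_intros E ballI nz)
  show thesis
  proof (rule that[of "48 * d^2 * (k2 - k1)"])
    fix ta :: real assume ta: "0 < ta"
    have c2: "continuous_on {k1..k2} (\<lambda>u. 1 / (1 + la * u + ta * E u)^2)"
    proof (intro continuous_intros E(1) ballI)
      fix u assume u: "u \<in> {k1..k2}"
      show "(1 + la * u + ta * E u)\<^sup>2 \<noteq> 0" using mu'[OF u] mult_pos_pos[OF ta E(2)[OF u]] by auto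
    qed
    define g where "g = (\<lambda>u. 1 / (1 + la * u + ta * E u)^2 - 1 / (1 + la * u)^2 + 2 * ta * (E u / (1 + la * u)^3))"
    have "integral {k1..k2} g = integral {k1..k2} (\<lambda>u. 1 / (1 + la * u + ta * E u)^2) - integral {k1..k2} (\<lambda>u. 1 / (1 + la * u)^2)
       + 2 * ta * integral {k1..k2} (\<lambda>u. E u / (1 + la * u)^3)"
    proof -
      note i0 = integrable_continuous_real[OF c0] and i1 = integrable_continuous_real[OF c1] and i2 = integrable_continuous_real[OF c2]
      have "integral {k1..k2} g = integral {k1..k2} (\<lambda>u. 1 / (1 + la * u + ta * E u)^2 - 1 / (1 + la * u)^2)
          + integral {k1..k2} (\<lambda>u. 2 * ta * (E u / (1 + la * u)^3))"
        unfolding g_def by (intro integral_add integrable_diff i0 i2 integrable_on_mult_right i1)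
      also have "integral {k1..k2} (\<lambda>u. 2 * ta * (E u / (1 + la * u)^3)) = 2 * ta * integral {k1..k2} (\<lambda>u. E u / (1 + la * u)^3)"
        by (rule integral_mult_right)
      finally show ?thesis using integral_diff[OF i2 i0] by simp
    qed
    moreover have "\<bar>integral {k1..k2} g\<bar> \<le> integral {k1..k2} (\<lambda>u. 48 * d^2 * ta^2)"
    proof -
      have cg: "continuous_on {k1..k2} g" unfolding g_def by (intro continuous_intros c0 c1 c2)
      have "norm (integral {k1..k2} g) \<le> integral {k1..k2} (\<lambda>u. 48 * d^2 * ta^2)"
      proof (rule integral_norm_bound_integral)
        show "g integrable_on {k1..k2}" by (rule integrable_continuous_real[OF cg])
        show "(\<lambda>u. 48 * d^2 * ta^2) integrable_on {k1..k2}" by (rule integrable_const_ivl)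
        fix u assume u: "u \<in> {k1..k2}"
        have "\<bar>1 / (1 + la * u + ta * E u)^2 - 1 / (1 + la * u)^2 + 2 * (ta * E u) / (1 + la * u)^3\<bar> \<le> 48 * (ta * E u)^2"
          using mu[OF u] ta E(2)[OF u] by (intro inverse_square_expansion) auto
        also have "(ta * E u)^2 \<le> (ta * d)^2"
          using ta E(2)[OF u] d[OF u] by (intro power_mono mult_left_mono) auto
        finally show "norm (g u) \<le> 48 * d^2 * ta^2" by (simp add: g_def power_mult_distrib mult_ac)
      qed
      thus ?thesis by simp
    qed
    moreover have "integral {k1..k2} (\<lambda>u. 48 * d^2 * ta^2) = 48 * d^2 * (k2 - k1) * ta^2"
      using k by simp
    ultimately show "\<bar>integral {k1..k2} (\<lambda>u. 1 / (1 + la * u + ta * E u)^2) - (k2 - k1) / ((1 + la * k1) * (1 + la * k2))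
       + 2 * ta * integral {k1..k2} (\<lambda>u. E u / (1 + la * u)^3)\<bar> \<le> 48 * d^2 * (k2 - k1) * ta^2"
      using integral_inverse_square[OF k(1) mu'] by (simp only:)
  qed
qed

lemma expansion_tendsto:
  fixes f :: "real \<Rightarrow> real"
  assumes "\<And>t. 0 < t \<Longrightarrow> \<bar>f t - R + 2 * t * J\<bar> \<le> C * t^2"
  shows "(f \<longlongrightarrow> R) (at_right 0)" "((\<lambda>t. (f t - R) / t) \<longlongrightarrow> - 2 * J) (at_right 0)"
proof -
  have id0: "((\<lambda>t::real. t) \<longlongrightarrow> 0) (at_right 0)" by (rule tendsto_ident_at)
  have "((\<lambda>t. C * t) \<longlongrightarrow> C * 0) (at_right 0)" by (intro tendsto_intros id0)
  hence c: "((\<lambda>t. C * t) \<longlongrightarrow> 0) (at_right 0)" by simp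
  have "((\<lambda>t. (f t - R) / t - (- 2 * J)) \<longlongrightarrow> 0) (at_right 0)"
  proof (rule Lim_null_comparison[OF _ c])
    show "\<forall>\<^sub>F t in at_right 0. norm ((f t - R) / t - - 2 * J) \<le> C * t"
      unfolding eventually_at_right_field
    proof (intro exI[of _ 1] conjI allI impI)
      fix t :: real assume t: "0 < t" "t < 1"
      have "(f t - R) / t - - 2 * J = (f t - R + 2 * t * J) / t" using t by (simp add: field_simps)
      hence "norm ((f t - R) / t - - 2 * J) = \<bar>f t - R + 2 * t * J\<bar> / t"
        using t by (simp only: real_norm_def abs_divide abs_of_pos)
      also have "\<dots> \<le> C * t^2 / t" using assms[of t] t by (intro divide_right_mono) auto
      finally show "norm ((f t - R) / t - - 2 * J) \<le> C * t" using t by (simp add: power2_eq_square)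
    qed simp
  qed
  from Lim_transform[OF tendsto_const this]
  show 2: "((\<lambda>t. (f t - R) / t) \<longlongrightarrow> - 2 * J) (at_right 0)"
    using LIM_zero_cancel[OF \<open>((\<lambda>t. (f t - R) / t - (- 2 * J)) \<longlongrightarrow> 0) (at_right 0)\<close>] by blast
  have "((\<lambda>t. R + (f t - R) / t * t) \<longlongrightarrow> R + - 2 * J * 0) (at_right 0)"
    by (intro tendsto_intros 2 id0)
  moreover have "\<forall>\<^sub>F t in at_right 0. R + (f t - R) / t * t = f t"
    by (auto simp: eventually_at_right_field intro!: exI[of _ 1])
  ultimately show "(f \<longlongrightarrow> R) (at_right 0)"
    using tendsto_cong by fastforce
qed

text \<open>Compares the values at 0 and, by the product rule, the right derivatives at 0 of the two
  equal products.\<close>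

lemma product_expansion:
  fixes f g f' g' :: "real \<Rightarrow> real"
  assumes "\<And>t. 0 < t \<Longrightarrow> \<bar>f t - R1 + 2 * t * J1\<bar> \<le> C1 * t^2"
    and "\<And>t. 0 < t \<Longrightarrow> \<bar>g t - R2 + 2 * t * J2\<bar> \<le> C2 * t^2"
    and "\<And>t. 0 < t \<Longrightarrow> \<bar>f' t - R1' + 2 * t * J1'\<bar> \<le> C1' * t^2"
    and "\<And>t. 0 < t \<Longrightarrow> \<bar>g' t - R2' + 2 * t * J2'\<bar> \<le> C2' * t^2"
    and eq: "\<And>t. 0 < t \<Longrightarrow> f t * g t = f' t * g' t"
  shows "R1 * R2 = R1' * R2'" "R1 * J2 + R2 * J1 = R1' * J2' + R2' * J1'"
proof -
  note F = expansion_tendsto[OF assms(1)] and G = expansion_tendsto[OF assms(2)]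
    and F' = expansion_tendsto[OF assms(3)] and G' = expansion_tendsto[OF assms(4)]
  have ev: "\<forall>\<^sub>F t in at_right 0. f t * g t = f' t * g' t"
    using eq by (auto simp: eventually_at_right_field intro!: exI[of _ 1])
  have nb: "at_right (0::real) \<noteq> bot" by simp
  have "((\<lambda>t. f' t * g' t) \<longlongrightarrow> R1 * R2) (at_right 0)"
    using tendsto_cong[OF ev] tendsto_mult[OF F(1) G(1)] by blast
  from tendsto_unique[OF nb this tendsto_mult[OF F'(1) G'(1)]]
  show R: "R1 * R2 = R1' * R2'" .
  have gen: "((\<lambda>t. (a t * b t - r * s) / t) \<longlongrightarrow> - 2 * (r * j + s * i)) (at_right 0)"
    if "(a \<longlongrightarrow> r) (at_right 0)" "((\<lambda>t. (a t - r) / t) \<longlongrightarrow> - 2 * i) (at_right 0)"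
       "((\<lambda>t. (b t - s) / t) \<longlongrightarrow> - 2 * j) (at_right 0)" for a b :: "real \<Rightarrow> real" and r s i j
  proof -
    have "((\<lambda>t. a t * ((b t - s) / t) + s * ((a t - r) / t)) \<longlongrightarrow> r * (- 2 * j) + s * (- 2 * i)) (at_right 0)"
      by (intro tendsto_intros that)
    moreover have "a t * ((b t - s) / t) + s * ((a t - r) / t) = (a t * b t - r * s) / t" for t
      by (simp add: add_divide_distrib[symmetric] algebra_simps)
    ultimately show ?thesis by (simp add: algebra_simps)
  qed
  have ev2: "\<forall>\<^sub>F t in at_right 0. (f t * g t - R1 * R2) / t = (f' t * g' t - R1' * R2') / t"
    using ev by eventually_elim (simp add: R)
  have "((\<lambda>t. (f' t * g' t - R1' * R2') / t) \<longlongrightarrow> - 2 * (R1 * J2 + R2 * J1)) (at_right 0)"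
    using tendsto_cong[OF ev2] gen[OF F(1,2) G(2)] by blast
  from tendsto_unique[OF nb this gen[OF F'(1,2) G'(2)]]
  show "R1 * J2 + R2 * J1 = R1' * J2' + R2' * J1'" by simp
qed

section \<open>Expansion at a vertex\<close>

text \<open>For a cone containing \<open>v\<close> the section is an epigraph. The interval from
  \<open>k1\<close> to \<open>k2\<close> is the angle of the cone at \<open>v\<close>, and
  \<open>E\<close> is the boundary facing away from the end at infinity, which corresponds to
  \<open>v\<close> itself.\<close>

definition ray_section :: "(real^3) set \<Rightarrow> real^3 \<Rightarrow> real^3 \<Rightarrow> real^3 \<Rightarrow> real \<Rightarrow> real \<Rightarrow> (real \<Rightarrow> real) \<Rightarrow> bool" where
  "ray_section K w0 w1 v k1 k2 E \<longleftrightarrow> 0 \<le> k1 \<and> k1 < k2 \<and> k2 \<le> 1 \<and>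
     (\<forall>u t. w0 + u *\<^sub>R w1 + t *\<^sub>R v \<in> K \<longleftrightarrow> k1 \<le> u \<and> u \<le> k2 \<and> E u \<le> t) \<and>
     (\<exists>U. pl_breaks k1 k2 E U) \<and> (\<forall>u\<in>{k1..k2}. 0 < E u)"

lemma ray_section_sint:
  assumes S: "ray_section K w0 w1 v k1 k2 E" and la: "\<bar>la\<bar> < 1/2" and ta: "0 < ta"
  shows "sint K w0 w1 v la ta = ennreal (integral {k1..k2} (\<lambda>u. 1 / (1 + la * u + ta * E u)^2) / ta)"
proof -
  obtain U where U: "pl_breaks k1 k2 E U" using S by (auto simp: ray_section_def)
  have E: "continuous_on {k1..k2} E" using S by (intro pl_breaks_continuous[OF _ U]) (auto simp: ray_section_def)
  show "sint K w0 w1 v la ta = ennreal (integral {k1..k2} (\<lambda>u. 1 / (1 + la * u + ta * E u)^2) / ta)"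
    by (rule sint_ray[OF _ _ _ E _ la ta]) (use S in \<open>auto simp: ray_section_def\<close>)
qed

text \<open>All four cones contain \<open>v\<close>, so each integral diverges like
  1/\<open>ta\<close>. After multiplication by \<open>ta\<close> the products agree to first order:
  \<open>R\<close> collects the angles and \<open>J\<close> the boundary functions.\<close>

lemma shared_vertex_expansion:
  assumes A: "ray_section A w0 w1 v a1 a2 EA" and C: "ray_section C w0 w1 v c1 c2 EC"
    and A': "ray_section A' w0 w1 v a1' a2' EA'" and C': "ray_section C' w0 w1 v c1' c2' EC'"
    and la: "\<bar>la\<bar> < 1/2"
    and eq: "\<And>ta. 0 < ta \<Longrightarrow> sint A w0 w1 v la ta * sint C w0 w1 v la ta = sint A' w0 w1 v la ta * sint C' w0 w1 v la ta"
  defines "R \<equiv> \<lambda>k1 k2. (k2 - k1) / ((1 + la * k1) * (1 + la * k2))"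
    and "J \<equiv> \<lambda>k1 k2 E. integral {k1..k2} (\<lambda>u. E u / (1 + la * u)^3)"
  shows "R a1 a2 * R c1 c2 = R a1' a2' * R c1' c2'"
    "R a1 a2 * J c1 c2 EC + R c1 c2 * J a1 a2 EA = R a1' a2' * J c1' c2' EC' + R c1' c2' * J a1' a2' EA'"
proof -
  define I where "I = (\<lambda>k1 k2 E ta. integral {k1..k2} (\<lambda>u. 1 / (1 + la * u + ta * E u)^2))"
  have ex: "\<exists>C. \<forall>ta>0. \<bar>I k1 k2 E ta - R k1 k2 + 2 * ta * J k1 k2 E\<bar> \<le> C * ta^2" if S: "ray_section K w0 w1 v k1 k2 E" for K k1 k2 E
  proof -
    obtain U where U: "pl_breaks k1 k2 E U" using S by (auto simp: ray_section_def)
    have E: "continuous_on {k1..k2} E" using S by (intro pl_breaks_continuous[OF _ U]) (auto simp: ray_section_def)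
    have k: "k1 \<le> k2" "0 \<le> k1" "k2 \<le> 1" and pos: "\<And>u. u \<in> {k1..k2} \<Longrightarrow> 0 < E u" using S by (auto simp: ray_section_def)
    from ray_expansion[OF k E pos la] show ?thesis unfolding I_def R_def J_def by blast
  qed
  have nn: "I k1 k2 E ta \<ge> 0" for k1 k2 E ta
    unfolding I_def by (cases "(\<lambda>u. 1 / (1 + la * u + ta * E u)^2) integrable_on {k1..k2}")
      (auto intro!: integral_nonneg simp: not_integrable_integral)
  have prod: "I a1 a2 EA ta * I c1 c2 EC ta = I a1' a2' EA' ta * I c1' c2' EC' ta" if ta: "0 < ta" for ta
  proof -
    have "ennreal (I a1 a2 EA ta / ta) * ennreal (I c1 c2 EC ta / ta) = ennreal (I a1' a2' EA' ta / ta) * ennreal (I c1' c2' EC' ta / ta)"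
      using eq[OF ta] ray_section_sint[OF A la ta] ray_section_sint[OF C la ta] ray_section_sint[OF A' la ta] ray_section_sint[OF C' la ta]
      unfolding I_def by simp
    hence "ennreal ((I a1 a2 EA ta / ta) * (I c1 c2 EC ta / ta)) = ennreal ((I a1' a2' EA' ta / ta) * (I c1' c2' EC' ta / ta))"
      using nn ta by (simp add: ennreal_mult[symmetric])
    hence "(I a1 a2 EA ta / ta) * (I c1 c2 EC ta / ta) = (I a1' a2' EA' ta / ta) * (I c1' c2' EC' ta / ta)"
      using nn ta by (subst (asm) ennreal_inj) auto
    thus ?thesis using ta by simp
  qed
  obtain C1 C2 C3 C4 where
    b: "\<And>ta. 0 < ta \<Longrightarrow> \<bar>I a1 a2 EA ta - R a1 a2 + 2 * ta * J a1 a2 EA\<bar> \<le> C1 * ta^2"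
    "\<And>ta. 0 < ta \<Longrightarrow> \<bar>I c1 c2 EC ta - R c1 c2 + 2 * ta * J c1 c2 EC\<bar> \<le> C2 * ta^2"
    "\<And>ta. 0 < ta \<Longrightarrow> \<bar>I a1' a2' EA' ta - R a1' a2' + 2 * ta * J a1' a2' EA'\<bar> \<le> C3 * ta^2"
    "\<And>ta. 0 < ta \<Longrightarrow> \<bar>I c1' c2' EC' ta - R c1' c2' + 2 * ta * J c1' c2' EC'\<bar> \<le> C4 * ta^2"
    using ex[OF A] ex[OF C] ex[OF A'] ex[OF C'] by blast
  from product_expansion[OF b prod]
  show "R a1 a2 * R c1 c2 = R a1' a2' * R c1' c2'"
    "R a1 a2 * J c1 c2 EC + R c1 c2 * J a1 a2 EA = R a1' a2' * J c1' c2' EC' + R c1' c2' * J a1' a2' EA'" by auto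
qed

text \<open>A pointwise comparison of the kernels that yields continuity at \<open>ta\<close> = 0.
  As \<open>\<mu>\<close> is at least 1/2, adding \<open>ta * t\<close> increases it by at most the
  factor \<open>1 + 2 * ta * d\<close>.\<close>

lemma sint_compact_tau:
  assumes K: "closed K"
    and bd: "\<And>u t. w0 + u *\<^sub>R w1 + t *\<^sub>R v \<in> K \<Longrightarrow> 0 \<le> u \<and> u \<le> 1 \<and> 0 \<le> t \<and> t \<le> d"
    and la: "\<bar>la\<bar> < 1/2" and ta: "0 < ta"
  shows "sint K w0 w1 v la ta \<le> sint K w0 w1 v la 0"
    "sint K w0 w1 v la 0 \<le> ennreal ((1 + 2 * ta * d)^3) * sint K w0 w1 v la ta"
proof -
  have [measurable]: "K \<in> sets borel" using K by auto
  have mu: "1/2 \<le> 1 + la * u" if "0 \<le> u" "u \<le> 1" for u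
  proof -
    have "\<bar>la * u\<bar> \<le> 1/2 * 1" unfolding abs_mult using that la by (intro mult_mono) auto
    thus ?thesis by linarith
  qed
  show "sint K w0 w1 v la ta \<le> sint K w0 w1 v la 0"
    unfolding sint_def
  proof (intro nn_integral_mono)
    fix u t
    show "indicator K (w0 + u *\<^sub>R w1 + t *\<^sub>R v) * ennreal (2 / (1 + la * u + ta * t) ^ 3)
        \<le> indicator K (w0 + u *\<^sub>R w1 + t *\<^sub>R v) * ennreal (2 / (1 + la * u + 0 * t) ^ 3)"
    proof (cases "w0 + u *\<^sub>R w1 + t *\<^sub>R v \<in> K")
      case True
      have "2 / (1 + la * u + ta * t) ^ 3 \<le> 2 / (1 + la * u + 0 * t) ^ 3"
      proof -
        have p: "0 < 1 + la * u" "0 \<le> ta * t" using mu[of u] bd[OF True] ta by auto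
        thus ?thesis by (intro divide_left_mono power_mono mult_pos_pos zero_less_power) auto
      qed
      thus ?thesis by (intro mult_left_mono ennreal_leI) auto
    qed simp
  qed
  have "sint K w0 w1 v la 0 \<le> (\<integral>\<^sup>+u. \<integral>\<^sup>+t. ennreal ((1 + 2 * ta * d)^3) * (indicator K (w0 + u *\<^sub>R w1 + t *\<^sub>R v)
      * ennreal (2 / (1 + la * u + ta * t) ^ 3)) \<partial>lborel \<partial>lborel)"
    unfolding sint_def
  proof (intro nn_integral_mono)
    fix u t
    show "indicator K (w0 + u *\<^sub>R w1 + t *\<^sub>R v) * ennreal (2 / (1 + la * u + 0 * t) ^ 3)
      \<le> ennreal ((1 + 2 * ta * d)^3) * (indicator K (w0 + u *\<^sub>R w1 + t *\<^sub>R v) * ennreal (2 / (1 + la * u + ta * t) ^ 3))"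
    proof (cases "w0 + u *\<^sub>R w1 + t *\<^sub>R v \<in> K")
      case True
      note b = bd[OF True]
      define \<mu> where "\<mu> = 1 + la * u"
      have m: "1/2 \<le> \<mu>" using mu b by (simp add: \<mu>_def)
      have d: "0 \<le> d" using b by linarith
      have "ta * t \<le> ta * d" using b ta by simp
      also have "\<dots> \<le> \<mu> * (2 * (ta * d))" using m d ta mult_right_mono[of "1/2" \<mu> "2 * (ta * d)"] by simp
      finally have le: "\<mu> + ta * t \<le> \<mu> * (1 + 2 * ta * d)" by (simp add: distrib_left)
      have pos: "0 < \<mu> + ta * t" "0 < \<mu>" "0 < 1 + 2 * ta * d" using m b ta d by (auto intro!: add_pos_nonneg)
      have "(\<mu> + ta * t)^3 \<le> \<mu>^3 * (1 + 2 * ta * d)^3"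
        using le pos by (subst power_mult_distrib[symmetric], intro power_mono) auto
      hence "2 / \<mu>^3 \<le> (1 + 2 * ta * d)^3 * (2 / (\<mu> + ta * t)^3)"
        using pos by (simp add: divide_simps mult_ac)
      hence "ennreal (2 / \<mu>^3) \<le> ennreal ((1 + 2 * ta * d)^3) * ennreal (2 / (\<mu> + ta * t)^3)"
        using pos by (subst ennreal_mult[symmetric]) (auto intro!: ennreal_leI)
      thus ?thesis using True by (simp add: \<mu>_def)
    qed simp
  qed
  also have "\<dots> = ennreal ((1 + 2 * ta * d)^3) * sint K w0 w1 v la ta"
  proof -
    have "(\<integral>\<^sup>+u. \<integral>\<^sup>+t. ennreal ((1 + 2 * ta * d)^3) * (indicator K (w0 + u *\<^sub>R w1 + t *\<^sub>R v)
        * ennreal (2 / (1 + la * u + ta * t) ^ 3)) \<partial>lborel \<partial>lborel)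
      = (\<integral>\<^sup>+u. ennreal ((1 + 2 * ta * d)^3) * (\<integral>\<^sup>+t. (indicator K (w0 + u *\<^sub>R w1 + t *\<^sub>R v)
        * ennreal (2 / (1 + la * u + ta * t) ^ 3)) \<partial>lborel) \<partial>lborel)"
      by (rule nn_integral_cong, rule nn_integral_cmult) measurable
    also have "\<dots> = ennreal ((1 + 2 * ta * d)^3) * sint K w0 w1 v la ta"
      unfolding sint_def by (rule nn_integral_cmult) measurable
    finally show ?thesis .
  qed
  finally show "sint K w0 w1 v la 0 \<le> ennreal ((1 + 2 * ta * d)^3) * sint K w0 w1 v la ta" .
qed

text \<open>Multiplied by \<open>ta\<close>, the integrals of \<open>A\<close> and \<open>A'\<close>
  tend to the same positive limit, because the limit depends on their common range alone. It can be
  cancelled, which leaves the convergent integrals of \<open>C\<close> and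
  \<open>C'\<close>.\<close>

lemma simple_vertex_limit:
  assumes A: "ray_section A w0 w1 v a1 a2 EA" and A': "ray_section A' w0 w1 v a1 a2 EA'"
    and C: "closed C" "closed C'"
    and bd: "\<And>u t. w0 + u *\<^sub>R w1 + t *\<^sub>R v \<in> C \<union> C' \<Longrightarrow> 0 \<le> u \<and> u \<le> 1 \<and> 0 \<le> t \<and> t \<le> d"
    and fin: "sint C w0 w1 v la 0 < top" "sint C' w0 w1 v la 0 < top"
    and la: "\<bar>la\<bar> < 1/2"
    and eq: "\<And>ta. 0 < ta \<Longrightarrow> sint A w0 w1 v la ta * sint C w0 w1 v la ta = sint A' w0 w1 v la ta * sint C' w0 w1 v la ta"
  shows "sint C w0 w1 v la 0 = sint C' w0 w1 v la 0"
proof -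
  define R where "R = (a2 - a1) / ((1 + la * a1) * (1 + la * a2))"
  have mu: "0 < 1 + la * u" if "0 \<le> u" "u \<le> 1" for u
  proof -
    have "\<bar>la * u\<bar> \<le> 1/2 * 1" unfolding abs_mult using that la by (intro mult_mono) auto
    thus ?thesis by linarith
  qed
  have R: "R > 0" using A mu[of a1] mu[of a2] unfolding R_def ray_section_def by (intro divide_pos_pos mult_pos_pos) auto
  define I where "I = (\<lambda>E ta. integral {a1..a2} (\<lambda>u. 1 / (1 + la * u + ta * E u)^2))"
  have lim: "(I E \<longlongrightarrow> R) (at_right 0)" if S: "ray_section K w0 w1 v a1 a2 E" for K E
  proof -
    obtain U where U: "pl_breaks a1 a2 E U" using S by (auto simp: ray_section_def)
    have E: "continuous_on {a1..a2} E" using S by (intro pl_breaks_continuous[OF _ U]) (auto simp: ray_section_def)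
    have k: "a1 \<le> a2" "0 \<le> a1" "a2 \<le> 1" and pos: "\<And>u. u \<in> {a1..a2} \<Longrightarrow> 0 < E u" using S by (auto simp: ray_section_def)
    from ray_expansion[OF k E pos la] obtain B where "\<And>ta. 0 < ta \<Longrightarrow>
      \<bar>I E ta - R + 2 * ta * integral {a1..a2} (\<lambda>u. E u / (1 + la * u)^3)\<bar> \<le> B * ta^2" unfolding I_def R_def by blast
    from expansion_tendsto(1)[OF this] show ?thesis .
  qed
  have nn: "I E ta \<ge> 0" for E ta
    unfolding I_def by (cases "(\<lambda>u. 1 / (1 + la * u + ta * E u)^2) integrable_on {a1..a2}")
      (auto intro!: integral_nonneg simp: not_integrable_integral)
  \<comment> \<open>\<open>d\<close> can be negative only if both sections are empty.\<close>
  define d' where "d' = max d 0"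
  define x where "x = (\<lambda>K. enn2real (sint K w0 w1 v la 0))"
  define y where "y = (\<lambda>K ta. enn2real (sint K w0 w1 v la ta))"
  have K: "\<And>ta. 0 < ta \<Longrightarrow> sint K w0 w1 v la ta = ennreal (y K ta)" "\<And>ta. 0 < ta \<Longrightarrow> 0 \<le> y K ta"
      "sint K w0 w1 v la 0 = ennreal (x K)" "(y K \<longlongrightarrow> x K) (at_right 0)"
    if c: "closed K" and f: "sint K w0 w1 v la 0 < top" and b: "\<forall>u t. w0 + u *\<^sub>R w1 + t *\<^sub>R v \<in> K \<longrightarrow> 0 \<le> u \<and> u \<le> 1 \<and> 0 \<le> t \<and> t \<le> d'" for K
  proof -
    have T: "sint K w0 w1 v la ta \<le> sint K w0 w1 v la 0"
      "sint K w0 w1 v la 0 \<le> ennreal ((1 + 2 * ta * d')^3) * sint K w0 w1 v la ta" if "0 < ta" for ta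
      by (rule sint_compact_tau[OF c _ la that]; use b in blast)+
    show x: "sint K w0 w1 v la 0 = ennreal (x K)" using f by (simp add: x_def)
    show y: "sint K w0 w1 v la ta = ennreal (y K ta)" if "0 < ta" for ta
      using le_less_trans[OF T(1)[OF that] f] by (simp add: y_def)
    show "0 \<le> y K ta" for ta by (simp add: y_def)
    have x0: "0 \<le> x K" by (simp add: x_def)
    have le: "y K ta \<le> x K" if "0 < ta" for ta
      using T(1)[OF that] x0 unfolding x y[OF that] by (simp add: ennreal_le_iff)
    have ge: "x K / (1 + 2 * ta * d')^3 \<le> y K ta" if "0 < ta" for ta
    proof -
      have p: "0 < 1 + 2 * ta * d'" using that by (intro add_pos_nonneg) (auto simp: d'_def)
      have "ennreal (x K) \<le> ennreal ((1 + 2 * ta * d')^3 * y K ta)"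
        using T(2)[OF that] p unfolding x y[OF that] by (simp add: ennreal_mult' y_def)
      hence "x K \<le> (1 + 2 * ta * d')^3 * y K ta"
        using p by (subst (asm) ennreal_le_iff) (auto simp: y_def)
      thus ?thesis using p by (simp add: divide_le_eq mult.commute)
    qed
    have l: "((\<lambda>ta. x K / (1 + 2 * ta * d')^3) \<longlongrightarrow> x K / (1 + 2 * 0 * d')^3) (at_right 0)"
      by (intro tendsto_intros) auto
    show "(y K \<longlongrightarrow> x K) (at_right 0)"
    proof (rule tendsto_sandwich[OF _ _ _ tendsto_const])
      show "((\<lambda>ta. x K / (1 + 2 * ta * d')^3) \<longlongrightarrow> x K) (at_right 0)" using l by simp
      show "\<forall>\<^sub>F ta in at_right 0. x K / (1 + 2 * ta * d')^3 \<le> y K ta"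
        using ge by (auto simp: eventually_at_right_field intro!: exI[of _ 1])
      show "\<forall>\<^sub>F ta in at_right 0. y K ta \<le> x K"
        using le by (auto simp: eventually_at_right_field intro!: exI[of _ 1])
    qed
  qed
  have b: "\<forall>u t. w0 + u *\<^sub>R w1 + t *\<^sub>R v \<in> C \<longrightarrow> 0 \<le> u \<and> u \<le> 1 \<and> 0 \<le> t \<and> t \<le> d'"
    and b': "\<forall>u t. w0 + u *\<^sub>R w1 + t *\<^sub>R v \<in> C' \<longrightarrow> 0 \<le> u \<and> u \<le> 1 \<and> 0 \<le> t \<and> t \<le> d'"
    using bd unfolding d'_def by (meson UnI1 UnI2 max.coboundedI1)+
  note P = K[OF C(1) fin(1) b] and P' = K[OF C(2) fin(2) b']
  have prod: "I EA ta * y C ta = I EA' ta * y C' ta" if ta: "0 < ta" for ta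
  proof -
    have "ennreal (I EA ta / ta) * ennreal (y C ta) = ennreal (I EA' ta / ta) * ennreal (y C' ta)"
      using eq[OF ta] ray_section_sint[OF A la ta] ray_section_sint[OF A' la ta] P(1)[OF ta] P'(1)[OF ta]
      unfolding I_def by simp
    hence "ennreal ((I EA ta / ta) * y C ta) = ennreal ((I EA' ta / ta) * y C' ta)"
      using nn ta P(2)[OF ta] P'(2)[OF ta] by (simp add: ennreal_mult[symmetric])
    hence "(I EA ta / ta) * y C ta = (I EA' ta / ta) * y C' ta"
      using nn ta P(2)[OF ta] P'(2)[OF ta] by (subst (asm) ennreal_inj) auto
    thus ?thesis using ta by simp
  qed
  have ev: "\<forall>\<^sub>F t in at_right 0. I EA t * y C t = I EA' t * y C' t"
    using prod by (auto simp: eventually_at_right_field intro!: exI[of _ 1])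
  have "((\<lambda>t. I EA' t * y C' t) \<longlongrightarrow> R * x C) (at_right 0)"
    using tendsto_cong[OF ev] tendsto_mult[OF lim[OF A] P(4)] by blast
  from tendsto_unique[OF _ this tendsto_mult[OF lim[OF A'] P'(4)]]
  have "R * x C = R * x C'" by simp
  thus ?thesis using R P(3) P'(3) by simp
qed

text \<open>The section by every line of direction \<open>v\<close> that meets \<open>C\<close> in a bounded interval, possibly a single
  point, has the same length for \<open>C'\<close>; lines missing \<open>C\<close> are not constrained.\<close>

definition xray_le :: "real^3 \<Rightarrow> (real^3) set \<Rightarrow> (real^3) set \<Rightarrow> bool" where
  "xray_le v C C' \<longleftrightarrow> (\<forall>x lo hi. lo \<le> hi \<longrightarrow> {\<tau>. x + \<tau> *\<^sub>R v \<in> C} = {lo..hi} \<longrightarrow>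
     (\<exists>lo'. {\<tau>. x + \<tau> *\<^sub>R v \<in> C'} = {lo'..lo' + (hi - lo)}))"

section \<open>From section integrals to X-rays\<close>

lemma cone_scale:
  assumes "cone K" "0 < c"
  shows "c *\<^sub>R x \<in> K \<longleftrightarrow> x \<in> K"
proof
  assume "c *\<^sub>R x \<in> K"
  hence "(1 / c) *\<^sub>R (c *\<^sub>R x) \<in> K" using assms unfolding cone_def by (meson less_imp_le zero_le_divide_1_iff)
  thus "x \<in> K" using assms by simp
next
  assume "x \<in> K" thus "c *\<^sub>R x \<in> K" using assms by (simp add: cone_def)
qed

text \<open>Extended by 0, the two functions agree wherever both are continuous. If the intervals
  differed, one function would be positive at such a point and the other 0. The values at the ends
  of the interval, where the extensions may jump, follow by continuity from inside.\<close>

lemma stieltjes_unique_section: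
  fixes \<phi> \<psi> :: "real \<Rightarrow> real"
  assumes k: "k1 < k2" "k1' < k2'" "-R \<le> k1" "k2 \<le> R" "-R \<le> k1'" "k2' \<le> R"
    and c: "continuous_on {k1..k2} \<phi>" "continuous_on {k1'..k2'} \<psi>"
    and p: "\<And>u. k1 < u \<Longrightarrow> u < k2 \<Longrightarrow> \<phi> u > 0" "\<And>u. k1' < u \<Longrightarrow> u < k2' \<Longrightarrow> \<psi> u > 0"
    and e: "0 < \<epsilon>" "\<epsilon> * R \<le> 1/2"
    and eq: "\<And>la. \<bar>la\<bar> < \<epsilon> \<Longrightarrow> integral {k1..k2} (\<lambda>u. \<phi> u / (1 + la * u)^3) = integral {k1'..k2'} (\<lambda>u. \<psi> u / (1 + la * u)^3)"
  shows "k1 = k1'" "k2 = k2'" "\<And>u. u \<in> {k1..k2} \<Longrightarrow> \<phi> u = \<psi> u"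
proof -
  have R: "R > 0" using k by linarith
  define f where "f = (\<lambda>u. indicator {k1..k2} u *\<^sub>R \<phi> u)"
  define g where "g = (\<lambda>u. indicator {k1'..k2'} u *\<^sub>R \<psi> u)"
  have fm: "f \<in> borel_measurable borel" unfolding f_def by (rule borel_measurable_continuous_on_indicator[OF _ c(1)]) simp
  have gm: "g \<in> borel_measurable borel" unfolding g_def by (rule borel_measurable_continuous_on_indicator[OF _ c(2)]) simp
  obtain M where M: "\<And>u. u \<in> {k1..k2} \<Longrightarrow> \<bar>\<phi> u\<bar> \<le> M"
    using compact_imp_bounded[OF compact_continuous_image[OF c(1) compact_Icc]] unfolding bounded_iff by (metis imageI real_norm_def)
  obtain N where N: "\<And>u. u \<in> {k1'..k2'} \<Longrightarrow> \<bar>\<psi> u\<bar> \<le> N"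
    using compact_imp_bounded[OF compact_continuous_image[OF c(2) compact_Icc]] unfolding bounded_iff by (metis imageI real_norm_def)
  have half: "1/2 \<le> 1 + la * u" if "\<bar>la\<bar> < \<epsilon>" "\<bar>u\<bar> \<le> R" for la u
  proof -
    have "\<bar>la * u\<bar> \<le> \<epsilon> * R" unfolding abs_mult using that R e by (intro mult_mono) auto
    thus ?thesis using e by linarith
  qed
  have conv: "(\<integral>u. (indicator {a..b} u *\<^sub>R h u) / (1 + la * u)^3 \<partial>lborel) = integral {a..b} (\<lambda>u. h u / (1 + la * u)^3)"
      "integrable lborel (\<lambda>u. (indicator {a..b} u *\<^sub>R h u) / (1 + la * u)^3)"
    if "continuous_on {a..b} h" "-R \<le> a" "b \<le> R" "\<bar>la\<bar> < \<epsilon>" for a b la and h :: "real \<Rightarrow> real"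
  proof -
    have "continuous_on {a..b} (\<lambda>u. h u / (1 + la * u)^3)"
    proof (intro continuous_intros that ballI)
      fix u assume "u \<in> {a..b}"
      hence "\<bar>u\<bar> \<le> R" using that by auto
      from half[OF that(4) this] show "(1 + la * u)^3 \<noteq> 0" by simp
    qed
    hence si: "set_integrable lborel {a..b} (\<lambda>u. h u / (1 + la * u)^3)"
      by (rule borel_integrable_atLeastAtMost')
    from set_borel_integral_eq_integral(2)[OF this]
    show "(\<integral>u. (indicator {a..b} u *\<^sub>R h u) / (1 + la * u)^3 \<partial>lborel) = integral {a..b} (\<lambda>u. h u / (1 + la * u)^3)"
      by (simp add: set_lebesgue_integral_def)
    show "integrable lborel (\<lambda>u. (indicator {a..b} u *\<^sub>R h u) / (1 + la * u)^3)"
      using si by (simp add: set_integrable_def)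
  qed
  have z: "(\<integral>u. (f u - g u) / (1 + la * u)^3 \<partial>lborel) = 0" if la: "\<bar>la\<bar> < \<epsilon>" for la
  proof -
    note 1 = conv[OF c(1) k(3,4) la] and 2 = conv[OF c(2) k(5,6) la]
    have "(\<integral>u. (f u - g u) / (1 + la * u)^3 \<partial>lborel) = (\<integral>u. f u / (1 + la * u)^3 - g u / (1 + la * u)^3 \<partial>lborel)"
      by (simp add: diff_divide_distrib)
    also have "\<dots> = 0" using 1 2 eq[OF la] unfolding f_def g_def by (subst Bochner_Integration.integral_diff) auto
    finally show ?thesis .
  qed
  have bd: "\<bar>f u - g u\<bar> \<le> \<bar>M\<bar> + \<bar>N\<bar>" for u
  proof -
    have "\<bar>f u\<bar> \<le> \<bar>M\<bar>" using M[of u] by (auto simp: f_def indicator_def)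
    moreover have "\<bar>g u\<bar> \<le> \<bar>N\<bar>" using N[of u] by (auto simp: g_def indicator_def)
    ultimately show ?thesis by linarith
  qed
  have supp: "f u - g u = 0" if "\<bar>u\<bar> > R" for u using that k by (auto simp: f_def g_def indicator_def)
  have dm: "(\<lambda>u. f u - g u) \<in> borel_measurable borel" using fm gm by simp
  have main: "f u = g u" if "isCont f u" "isCont g u" for u
  proof -
    have "isCont (\<lambda>u. f u - g u) u" using that by (intro continuous_intros)
    from stieltjes_unique[OF dm bd supp R e z this] show ?thesis by simp
  qed
  have cin: "isCont (\<lambda>u. indicator {a..b} u *\<^sub>R h u) u" if "continuous_on {a..b} h" "a < u" "u < b" for a b u and h :: "real \<Rightarrow> real"
  proof -
    have "continuous_on {a<..<b} h" using that(1) by (rule continuous_on_subset) auto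
    hence "isCont h u" using that by (simp add: continuous_on_eq_continuous_at)
    moreover have "\<forall>\<^sub>F x in nhds u. (indicator {a..b} x *\<^sub>R h x) = h x"
    proof -
      have "\<forall>\<^sub>F x in nhds u. x \<in> {a<..<b}" using that by (intro eventually_nhds_in_open) auto
      thus ?thesis by eventually_elim auto
    qed
    ultimately show ?thesis by (subst isCont_cong) auto
  qed
  have cout: "isCont (\<lambda>u. indicator {a..b} u *\<^sub>R h u) u" if "u < a \<or> b < u" for a b u and h :: "real \<Rightarrow> real"
  proof -
    have "\<forall>\<^sub>F x in nhds u. (indicator {a..b} x *\<^sub>R h x) = 0"
    proof -
      have "\<forall>\<^sub>F x in nhds u. x \<in> {..<a} \<union> {b<..}" using that by (intro eventually_nhds_in_open open_Un) auto
      thus ?thesis by eventually_elim auto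
    qed
    from isCont_cong[OF this] show ?thesis by simp
  qed
  have no: False if ab: "a < b" "a' < b'" and h: "(\<lambda>u. indicator {a..b} u *\<^sub>R h u) = F" "(\<lambda>u. indicator {a'..b'} u *\<^sub>R h' u) = G"
      and ch: "continuous_on {a..b} h" and ph: "\<And>u. a < u \<Longrightarrow> u < b \<Longrightarrow> h u > 0"
      and mn: "\<And>u. isCont F u \<Longrightarrow> isCont G u \<Longrightarrow> F u = G u" and out: "a < a' \<or> b' < b"
    for a b a' b' :: real and h h' F G :: "real \<Rightarrow> real"
  proof -
    obtain u where u: "a < u" "u < b" "u < a' \<or> b' < u"
    proof (cases "a < a'")
      case True
      obtain u where "a < u" "u < min b a'" using dense[of a "min b a'"] True ab by auto
      thus thesis using that[of u] by auto
    next
      case False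
      hence "b' < b" using out by simp
      obtain u where "max a b' < u" "u < b" using dense[of "max a b'" b] \<open>b' < b\<close> ab by auto
      thus thesis using that[of u] by auto
    qed
    have "isCont F u" using cin[OF ch u(1,2)] unfolding h .
    moreover have "isCont G u" using cout[OF u(3), of h'] unfolding h .
    ultimately have "F u = G u" by (rule mn)
    moreover have "F u = h u" unfolding h(1)[symmetric] using u by simp
    moreover have "G u = 0" unfolding h(2)[symmetric] using u by auto
    ultimately show False using ph[OF u(1,2)] by simp
  qed
  have fd: "(\<lambda>u. indicator {k1..k2} u *\<^sub>R \<phi> u) = f" and gd: "(\<lambda>u. indicator {k1'..k2'} u *\<^sub>R \<psi> u) = g"
    by (simp_all add: f_def g_def)
  have "\<not> (k1 < k1' \<or> k2' < k2)" using no[OF k(1,2) fd gd c(1) p(1) main] by blast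
  moreover have "\<not> (k1' < k1 \<or> k2 < k2')" using no[OF k(2,1) gd fd c(2) p(2)] main by (metis (full_types))
  ultimately show kk: "k1 = k1'" "k2 = k2'" by linarith+
  have ins: "\<phi> u - \<psi> u = 0" if "u \<in> {k1<..<k2}" for u
  proof -
    have "isCont f u" using cin[OF c(1), of u] that unfolding fd by simp
    moreover have "isCont g u" using cin[OF c(2), of u] that kk unfolding gd by simp
    ultimately have "f u = g u" by (rule main)
    thus ?thesis using that by (simp add: f_def g_def kk[symmetric])
  qed
  show "\<phi> u = \<psi> u" if "u \<in> {k1..k2}" for u
  proof -
    have cl: "closure {k1<..<k2} = {k1..k2}" using k by simp
    have "continuous_on (closure {k1<..<k2}) (\<lambda>u. \<phi> u - \<psi> u)"
      unfolding cl using c unfolding kk[symmetric] by (intro continuous_intros)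
    from continuous_constant_on_closure[OF this ins, of u] show ?thesis using that unfolding cl by simp
  qed
qed

definition frame :: "real^3 \<Rightarrow> real^3 \<Rightarrow> real^3 \<Rightarrow> real^3 \<Rightarrow> bool" where
  "frame w0 w1 v \<eta> \<longleftrightarrow> (\<forall>y x t. y *\<^sub>R w0 + x *\<^sub>R w1 + t *\<^sub>R v = 0 \<longrightarrow> y = 0 \<and> x = 0 \<and> t = 0)
     \<and> \<eta> \<bullet> w0 = 1 \<and> \<eta> \<bullet> w1 = 0 \<and> \<eta> \<bullet> v = 0"

lemma frame_span:
  fixes w0 w1 v :: "real^3"
  assumes fr: "frame w0 w1 v \<eta>"
  obtains y a t where "z = y *\<^sub>R w0 + a *\<^sub>R w1 + t *\<^sub>R v"
proof -
  define L where "L = (\<lambda>a::real^3. a$1 *\<^sub>R w0 + a$2 *\<^sub>R w1 + a$3 *\<^sub>R v)"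
  have lin: "linear L"
    by (rule linearI) (auto simp: L_def algebra_simps)
  have inj: "inj L"
    unfolding linear_injective_0[OF lin]
  proof (intro allI impI)
    fix a assume "L a = 0"
    hence "a$1 = 0 \<and> a$2 = 0 \<and> a$3 = 0" using fr unfolding L_def frame_def by blast
    thus "a = 0" by (simp add: vec_eq_iff forall_3)
  qed
  have "surj L" by (rule linear_injective_imp_surjective[OF lin inj]) (rule refl)
  then obtain a where "z = L a" by (auto simp: surj_def)
  thus thesis using that unfolding L_def by blast
qed

text \<open>A ball inside the cone is rescaled to the plane on which \<open>\<eta>\<close> is 1; a
  whole square around the rescaled centre survives.\<close>

lemma section_interior_point:
  fixes w0 w1 v \<eta> :: "real^3"
  assumes fr: "frame w0 w1 v \<eta>"
    and K: "cone K" "interior K \<noteq> {}" and pos: "\<forall>x\<in>K. \<eta> \<bullet> x \<ge> 0"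
  obtains u1 t1 e :: real where "e > 0"
    "\<forall>u t. \<bar>u - u1\<bar> \<le> e \<longrightarrow> \<bar>t - t1\<bar> \<le> e \<longrightarrow> w0 + u *\<^sub>R w1 + t *\<^sub>R v \<in> K"
proof -
  have \<eta>: "\<eta> \<bullet> w0 = 1" "\<eta> \<bullet> w1 = 0" "\<eta> \<bullet> v = 0" using fr by (auto simp: frame_def)
  obtain b where "b \<in> interior K" using K(2) by auto
  then obtain r where r: "r > 0" "ball b r \<subseteq> K" using mem_interior by blast
  have \<eta>0: "\<eta> \<noteq> 0" using \<eta>(1) by auto
  define y where "y = \<eta> \<bullet> b"
  \<comment> \<open>A step from the centre against \<open>\<eta>\<close> stays in the cone, where
    \<open>\<eta>\<close> is nonnegative, so \<open>\<eta>\<close> is strictly positive at the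
    centre.\<close>
  have y: "y > 0"
  proof -
    define b' where "b' = b - (r / (2 * norm \<eta>)) *\<^sub>R \<eta>"
    have "dist b b' = r / 2" using \<eta>0 r by (simp add: b'_def dist_norm)
    hence "b' \<in> K" using r by auto
    hence "0 \<le> \<eta> \<bullet> b'" using pos by blast
    also have "\<eta> \<bullet> b' = y - (r / (2 * norm \<eta>)) * (\<eta> \<bullet> \<eta>)" by (simp add: b'_def y_def inner_diff_right)
    moreover have "(r / (2 * norm \<eta>)) * (\<eta> \<bullet> \<eta>) > 0" using \<eta>0 r by simp
    ultimately show ?thesis by linarith
  qed
  obtain y' a t where b: "b = y' *\<^sub>R w0 + a *\<^sub>R w1 + t *\<^sub>R v" by (rule frame_span[OF fr])
  have y': "y' = y" unfolding y_def b using \<eta> by (simp add: inner_add_right)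
  define e where "e = r / (2 * y * (norm w1 + norm v + 1))"
  have np: "0 < norm w1 + norm v + 1" by (simp add: add_nonneg_pos)
  have e: "e > 0" using r y np by (simp add: e_def)
  show thesis
  proof (rule that[OF e], intro allI impI)
    fix u s assume h: "\<bar>u - a / y\<bar> \<le> e" "\<bar>s - t / y\<bar> \<le> e"
    have "y *\<^sub>R (w0 + u *\<^sub>R w1 + s *\<^sub>R v) - b = (y * (u - a / y)) *\<^sub>R w1 + (y * (s - t / y)) *\<^sub>R v"
      using y unfolding b y' by (simp add: algebra_simps)
    hence "norm (y *\<^sub>R (w0 + u *\<^sub>R w1 + s *\<^sub>R v) - b) \<le> \<bar>y * (u - a / y)\<bar> * norm w1 + \<bar>y * (s - t / y)\<bar> * norm v"
      by (metis norm_scaleR norm_triangle_ineq)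
    also have "\<dots> = y * (\<bar>u - a / y\<bar> * norm w1 + \<bar>s - t / y\<bar> * norm v)"
    proof -
      have "\<bar>y * z\<bar> = y * \<bar>z\<bar>" for z using y by (simp add: abs_mult)
      thus ?thesis by (simp only: distrib_left mult.assoc)
    qed
    also have "\<dots> \<le> y * (e * norm w1 + e * norm v)"
      using h y by (intro mult_left_mono add_mono mult_right_mono) auto
    also have "\<dots> = y * e * (norm w1 + norm v)" by (simp add: algebra_simps)
    also have "\<dots> \<le> y * e * (norm w1 + norm v + 1)" using y e by (intro mult_left_mono) auto
    also have "\<dots> = r / 2"
    proof -
      have "y * (r / (2 * y * N)) * N = r / 2" if "N > 0" for N using that y by simp
      from this[OF np] show ?thesis unfolding e_def .
    qed
    also have "\<dots> < r" using r by simp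
    finally have "y *\<^sub>R (w0 + u *\<^sub>R w1 + s *\<^sub>R v) \<in> K" using r by (auto simp: dist_norm norm_minus_commute)
    thus "w0 + u *\<^sub>R w1 + s *\<^sub>R v \<in> K" using cone_scale[OF K(1) y] by simp
  qed
qed

text \<open>Every interior abscissa lies between an end of the range and \<open>u1\<close>, where
  the section contains a square; convexity carries a positive part of its height over.\<close>

lemma compact_section_strict:
  fixes w0 w1 v \<eta> :: "real^3"
  assumes fr: "frame w0 w1 v \<eta>"
    and K: "cone K" "interior K \<noteq> {}" "convex K" and pos: "\<forall>x\<in>K. \<eta> \<bullet> x \<ge> 0"
    and sec': "\<forall>u t. w0 + u *\<^sub>R w1 + t *\<^sub>R v \<in> K \<longleftrightarrow> k1 \<le> u \<and> u \<le> k2 \<and> lo u \<le> t \<and> t \<le> hi u"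
    and ord': "\<forall>u. k1 \<le> u \<longrightarrow> u \<le> k2 \<longrightarrow> lo u \<le> hi u"
  shows "k1 < k2" "\<And>u. k1 < u \<Longrightarrow> u < k2 \<Longrightarrow> lo u < hi u"
proof -
  have sec: "w0 + u *\<^sub>R w1 + t *\<^sub>R v \<in> K \<longleftrightarrow> k1 \<le> u \<and> u \<le> k2 \<and> lo u \<le> t \<and> t \<le> hi u" for u t using sec' by blast
  have ord: "lo u \<le> hi u" if "k1 \<le> u" "u \<le> k2" for u using ord' that by blast
  obtain u1 t1 e :: real where e0: "e > 0"
    "\<forall>u t. \<bar>u - u1\<bar> \<le> e \<longrightarrow> \<bar>t - t1\<bar> \<le> e \<longrightarrow> w0 + u *\<^sub>R w1 + t *\<^sub>R v \<in> K"
    by (rule section_interior_point[OF fr K(1,2) pos])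
  hence e: "e > 0" "\<And>u t. \<bar>u - u1\<bar> \<le> e \<Longrightarrow> \<bar>t - t1\<bar> \<le> e \<Longrightarrow> w0 + u *\<^sub>R w1 + t *\<^sub>R v \<in> K" by auto
  have "k1 \<le> u1 - e" using e(1) e(2)[of "u1 - e" t1] unfolding sec by auto
  moreover have "u1 + e \<le> k2" using e(1) e(2)[of "u1 + e" t1] unfolding sec by auto
  ultimately have k: "k1 < u1" "u1 < k2" using e(1) by auto
  thus "k1 < k2" by simp
  have l1: "lo u1 \<le> t1 - e" "t1 + e \<le> hi u1" using e(1) e(2)[of u1 "t1 - e"] e(2)[of u1 "t1 + e"] unfolding sec by auto
  have comb: "lo u < hi u" if a: "k1 \<le> a" "a \<le> k2" and th: "0 < \<theta>" "\<theta> \<le> 1" and u: "u = (1 - \<theta>) * a + \<theta> * u1" for u a \<theta>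
  proof -
    have pt: "w0 + u *\<^sub>R w1 + ((1 - \<theta>) * lo a + \<theta> * s) *\<^sub>R v \<in> K" if s: "w0 + u1 *\<^sub>R w1 + s *\<^sub>R v \<in> K" for s
    proof -
      have "w0 + a *\<^sub>R w1 + lo a *\<^sub>R v \<in> K" unfolding sec using a ord[OF a] by simp
      hence "(1 - \<theta>) *\<^sub>R (w0 + a *\<^sub>R w1 + lo a *\<^sub>R v) + \<theta> *\<^sub>R (w0 + u1 *\<^sub>R w1 + s *\<^sub>R v) \<in> K"
        using s K(3) th by (intro convexD) auto
      also have "(1 - \<theta>) *\<^sub>R (w0 + a *\<^sub>R w1 + lo a *\<^sub>R v) + \<theta> *\<^sub>R (w0 + u1 *\<^sub>R w1 + s *\<^sub>R v)
         = w0 + u *\<^sub>R w1 + ((1 - \<theta>) * lo a + \<theta> * s) *\<^sub>R v" unfolding u by (simp add: algebra_simps)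
      finally show ?thesis .
    qed
    have "lo u \<le> (1 - \<theta>) * lo a + \<theta> * (t1 - e)" using pt[of "t1 - e"] e(1) e(2)[of u1 "t1 - e"] unfolding sec by auto
    moreover have "(1 - \<theta>) * lo a + \<theta> * (t1 + e) \<le> hi u" using pt[of "t1 + e"] e(1) e(2)[of u1 "t1 + e"] unfolding sec by auto
    moreover have "\<theta> * (t1 - e) < \<theta> * (t1 + e)" using th e(1) by simp
    ultimately show ?thesis by linarith
  qed
  fix u assume u: "k1 < u" "u < k2"
  show "lo u < hi u"
  proof (cases "u \<le> u1")
    case True
    define \<theta> where "\<theta> = (u - k1) / (u1 - k1)"
    have "\<theta> * (u1 - k1) = u - k1" "0 < \<theta>" "\<theta> \<le> 1" using u k True by (simp_all add: \<theta>_def)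
    hence "u = (1 - \<theta>) * k1 + \<theta> * u1" by (simp add: algebra_simps)
    from comb[OF _ _ \<open>0 < \<theta>\<close> \<open>\<theta> \<le> 1\<close> this] show ?thesis using u by simp
  next
    case False
    define \<theta> where "\<theta> = (k2 - u) / (k2 - u1)"
    have "\<theta> * (k2 - u1) = k2 - u" "0 < \<theta>" "\<theta> \<le> 1" using u k False by (simp_all add: \<theta>_def)
    hence "u = (1 - \<theta>) * k2 + \<theta> * u1" by (simp add: algebra_simps)
    from comb[OF _ _ \<open>0 < \<theta>\<close> \<open>\<theta> \<le> 1\<close> this] show ?thesis using u by simp
  qed
qed

text \<open>With second parameter 0 the kernel does not depend on \<open>t\<close>, so the section
  integral is the transform of the chord lengths in direction \<open>v\<close> and determines them.
  Homogeneity extends the result from the section to all parallel lines.\<close>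

lemma xray_from_sint:
  fixes w0 w1 v \<eta> :: "real^3"
  assumes fr: "frame w0 w1 v \<eta>"
    and C: "polyhedron C" "cone C" "interior C \<noteq> {}" "\<forall>x\<in>C. \<eta> \<bullet> x \<ge> 0" "\<forall>x\<in>C. \<eta> \<bullet> x = 0 \<longrightarrow> x = 0"
    and C': "polyhedron C'" "cone C'" "interior C' \<noteq> {}" "\<forall>x\<in>C'. \<eta> \<bullet> x \<ge> 0" "\<forall>x\<in>C'. \<eta> \<bullet> x = 0 \<longrightarrow> x = 0"
    and bd: "\<forall>u t. w0 + u *\<^sub>R w1 + t *\<^sub>R v \<in> C \<union> C' \<longrightarrow> -R \<le> u \<and> u \<le> R \<and> c \<le> t \<and> t \<le> d"
    and e: "0 < \<epsilon>" "\<epsilon> * R \<le> 1/2"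
    and eq: "\<forall>la. \<bar>la\<bar> < \<epsilon> \<longrightarrow> sint C w0 w1 v la 0 = sint C' w0 w1 v la 0"
  shows "xray_le v C C'"
proof -
  have \<eta>: "\<eta> \<bullet> w0 = 1" "\<eta> \<bullet> w1 = 0" "\<eta> \<bullet> v = 0" using fr by (auto simp: frame_def)
  obtain u0 t0 e0 :: real where ne: "e0 > 0" "\<forall>u t. \<bar>u - u0\<bar> \<le> e0 \<longrightarrow> \<bar>t - t0\<bar> \<le> e0 \<longrightarrow> w0 + u *\<^sub>R w1 + t *\<^sub>R v \<in> C"
    by (rule section_interior_point[OF fr C(2,3,4)])
  obtain u0' t0' e0' :: real where ne': "e0' > 0" "\<forall>u t. \<bar>u - u0'\<bar> \<le> e0' \<longrightarrow> \<bar>t - t0'\<bar> \<le> e0' \<longrightarrow> w0 + u *\<^sub>R w1 + t *\<^sub>R v \<in> C'"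
    by (rule section_interior_point[OF fr C'(2,3,4)])
  have n: "w0 + u0 *\<^sub>R w1 + t0 *\<^sub>R v \<in> C" "w0 + u0' *\<^sub>R w1 + t0' *\<^sub>R v \<in> C'" using ne ne' by auto
  have bC: "\<And>u t. w0 + u *\<^sub>R w1 + t *\<^sub>R v \<in> C \<Longrightarrow> -R \<le> u \<and> u \<le> R \<and> c \<le> t \<and> t \<le> d"
    and bC': "\<And>u t. w0 + u *\<^sub>R w1 + t *\<^sub>R v \<in> C' \<Longrightarrow> -R \<le> u \<and> u \<le> R \<and> c \<le> t \<and> t \<le> d"
    using bd by blast+
  obtain k1 k2 lo hi where S: "k1 \<le> k2"
    "\<forall>u t. w0 + u *\<^sub>R w1 + t *\<^sub>R v \<in> C \<longleftrightarrow> k1 \<le> u \<and> u \<le> k2 \<and> lo u \<le> t \<and> t \<le> hi u"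
    "continuous_on {k1..k2} lo" "continuous_on {k1..k2} hi" "\<forall>u. k1 \<le> u \<longrightarrow> u \<le> k2 \<longrightarrow> lo u \<le> hi u"
  proof (rule section_compact[OF C(1) _ n(1)])
    show "-R \<le> u \<and> u \<le> R \<and> c \<le> t \<and> t \<le> d" if "w0 + u *\<^sub>R w1 + t *\<^sub>R v \<in> C" for u t by (rule bC[OF that])
  next
    fix a b l h
    assume "a \<le> b" "\<And>u t. w0 + u *\<^sub>R w1 + t *\<^sub>R v \<in> C \<longleftrightarrow> a \<le> u \<and> u \<le> b \<and> l u \<le> t \<and> t \<le> h u"
      "continuous_on {a..b} l" "continuous_on {a..b} h" "\<And>u. a \<le> u \<Longrightarrow> u \<le> b \<Longrightarrow> l u \<le> h u"
    thus thesis by (intro that[of a b l h]) blast+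
  qed
  have sec: "w0 + u *\<^sub>R w1 + t *\<^sub>R v \<in> C \<longleftrightarrow> k1 \<le> u \<and> u \<le> k2 \<and> lo u \<le> t \<and> t \<le> hi u" for u t using S(2) by blast
  have ord: "lo u \<le> hi u" if "k1 \<le> u" "u \<le> k2" for u using S(5) that by blast
  obtain k1' k2' lo' hi' where S': "k1' \<le> k2'"
    "\<forall>u t. w0 + u *\<^sub>R w1 + t *\<^sub>R v \<in> C' \<longleftrightarrow> k1' \<le> u \<and> u \<le> k2' \<and> lo' u \<le> t \<and> t \<le> hi' u"
    "continuous_on {k1'..k2'} lo'" "continuous_on {k1'..k2'} hi'" "\<forall>u. k1' \<le> u \<longrightarrow> u \<le> k2' \<longrightarrow> lo' u \<le> hi' u"
  proof (rule section_compact[OF C'(1) _ n(2)])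
    show "-R \<le> u \<and> u \<le> R \<and> c \<le> t \<and> t \<le> d" if "w0 + u *\<^sub>R w1 + t *\<^sub>R v \<in> C'" for u t by (rule bC'[OF that])
  next
    fix a b l h
    assume "a \<le> b" "\<And>u t. w0 + u *\<^sub>R w1 + t *\<^sub>R v \<in> C' \<longleftrightarrow> a \<le> u \<and> u \<le> b \<and> l u \<le> t \<and> t \<le> h u"
      "continuous_on {a..b} l" "continuous_on {a..b} h" "\<And>u. a \<le> u \<Longrightarrow> u \<le> b \<Longrightarrow> l u \<le> h u"
    thus thesis by (intro that[of a b l h]) blast+
  qed
  have sec': "w0 + u *\<^sub>R w1 + t *\<^sub>R v \<in> C' \<longleftrightarrow> k1' \<le> u \<and> u \<le> k2' \<and> lo' u \<le> t \<and> t \<le> hi' u" for u t using S'(2) by blast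
  have ord': "lo' u \<le> hi' u" if "k1' \<le> u" "u \<le> k2'" for u using S'(5) that by blast
  have cv: "convex C" "convex C'" using C(1) C'(1) polyhedron_imp_convex by auto
  note st = compact_section_strict[OF fr C(2,3) cv(1) C(4) S(2) S(5)]
  note st' = compact_section_strict[OF fr C'(2,3) cv(2) C'(4) S'(2) S'(5)]
  have kR: "-R \<le> k1" "k2 \<le> R" "-R \<le> k1'" "k2' \<le> R"
    using bC[of k1 "lo k1"] bC[of k2 "lo k2"] bC'[of k1' "lo' k1'"] bC'[of k2' "lo' k2'"] S(1) S'(1) ord[of k1] ord[of k2] ord'[of k1'] ord'[of k2']
    unfolding sec sec' by auto
  have R0: "R > 0" using kR st(1) by linarith
  have mu: "0 < 1 + la * u" if "\<bar>la\<bar> < \<epsilon>" "-R \<le> u" "u \<le> R" for la u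
  proof -
    have "\<bar>la * u\<bar> \<le> \<epsilon> * R" unfolding abs_mult using that R0 e by (intro mult_mono) auto
    thus ?thesis using e by linarith
  qed
  have ieq: "integral {k1..k2} (\<lambda>u. (2 * (hi u - lo u)) / (1 + la * u)^3) = integral {k1'..k2'} (\<lambda>u. (2 * (hi' u - lo' u)) / (1 + la * u)^3)"
    if la: "\<bar>la\<bar> < \<epsilon>" for la
  proof -
    have m: "\<And>u. k1 \<le> u \<Longrightarrow> u \<le> k2 \<Longrightarrow> 0 < 1 + la * u" "\<And>u. k1' \<le> u \<Longrightarrow> u \<le> k2' \<Longrightarrow> 0 < 1 + la * u"
      using mu[OF la] kR by auto
    have nn: "integral {k1..k2} (\<lambda>u. (2 * (hi u - lo u)) / (1 + la * u)^3) \<ge> 0"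
    proof (cases "(\<lambda>u. (2 * (hi u - lo u)) / (1 + la * u)^3) integrable_on {k1..k2}")
      case True thus ?thesis using ord m(1) by (intro integral_nonneg) (auto intro!: divide_nonneg_pos)
    qed (simp add: not_integrable_integral)
    have nn': "integral {k1'..k2'} (\<lambda>u. (2 * (hi' u - lo' u)) / (1 + la * u)^3) \<ge> 0"
    proof (cases "(\<lambda>u. (2 * (hi' u - lo' u)) / (1 + la * u)^3) integrable_on {k1'..k2'}")
      case True thus ?thesis using ord' m(2) by (intro integral_nonneg) (auto intro!: divide_nonneg_pos)
    qed (simp add: not_integrable_integral)
    have "ennreal (integral {k1..k2} (\<lambda>u. (2 * (hi u - lo u)) / (1 + la * u)^3)) = ennreal (integral {k1'..k2'} (\<lambda>u. (2 * (hi' u - lo' u)) / (1 + la * u)^3))"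
    proof -
      have "sint C w0 w1 v la 0 = ennreal (integral {k1..k2} (\<lambda>u. (2 * (hi u - lo u)) / (1 + la * u)^3))"
        by (rule sint_compact[OF _ S(3,4)]) (use sec ord m(1) in auto)
      moreover have "sint C' w0 w1 v la 0 = ennreal (integral {k1'..k2'} (\<lambda>u. (2 * (hi' u - lo' u)) / (1 + la * u)^3))"
        by (rule sint_compact[OF _ S'(3,4)]) (use sec' ord' m(2) in auto)
      ultimately show ?thesis using eq la by simp
    qed
    thus ?thesis using nn nn' by simp
  qed
  have cc: "continuous_on {k1..k2} (\<lambda>u. 2 * (hi u - lo u))" "continuous_on {k1'..k2'} (\<lambda>u. 2 * (hi' u - lo' u))"
    using S S' by (auto intro!: continuous_intros)
  have pp: "\<And>u. k1 < u \<Longrightarrow> u < k2 \<Longrightarrow> 2 * (hi u - lo u) > 0" "\<And>u. k1' < u \<Longrightarrow> u < k2' \<Longrightarrow> 2 * (hi' u - lo' u) > 0"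
    using st(2) st'(2) by auto
  note U = stieltjes_unique_section[OF st(1) st'(1) kR cc pp e ieq]
  show ?thesis
    unfolding xray_le_def
  proof (intro allI impI)
    fix x a b assume ab: "a \<le> b" and col: "{\<tau>. x + \<tau> *\<^sub>R v \<in> C} = {a..b}"
    have "a \<in> {\<tau>. x + \<tau> *\<^sub>R v \<in> C}" unfolding col using ab by simp
    hence xa: "x + a *\<^sub>R v \<in> C" by simp
    have nx: "\<eta> \<bullet> (x + \<tau> *\<^sub>R v) = \<eta> \<bullet> x" for \<tau> by (simp add: inner_add_right \<eta>)
    show "\<exists>lo'. {\<tau>. x + \<tau> *\<^sub>R v \<in> C'} = {lo'..lo' + (b - a)}"
    proof (cases "\<eta> \<bullet> x = 0")
      \<comment> \<open>A line in the plane through the apex can meet either cone in the apex only,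
        so both columns are the same point.\<close>
      case True
      have "0 \<in> C" "0 \<in> C'" using C(2) C'(2) n unfolding cone_def by (metis order_refl scaleR_zero_left)+
      hence "x + \<tau> *\<^sub>R v \<in> C \<longleftrightarrow> x + \<tau> *\<^sub>R v = 0" "x + \<tau> *\<^sub>R v \<in> C' \<longleftrightarrow> x + \<tau> *\<^sub>R v = 0" for \<tau>
        using C(5)[rule_format, of "x + \<tau> *\<^sub>R v"] C'(5)[rule_format, of "x + \<tau> *\<^sub>R v"] nx True by auto
      hence "{\<tau>. x + \<tau> *\<^sub>R v \<in> C'} = {a..b}" using col by simp
      thus ?thesis by (intro exI[of _ a]) simp
    next
      case False
      define y where "y = \<eta> \<bullet> x"
      have y: "y > 0" using C(4)[rule_format, OF xa] False unfolding nx y_def by simp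
      obtain y' p q where x: "x = y' *\<^sub>R w0 + p *\<^sub>R w1 + q *\<^sub>R v" by (rule frame_span[OF fr])
      have y': "y' = y" unfolding y_def x using \<eta> by (simp add: inner_add_right)
      have tr: "x + \<tau> *\<^sub>R v \<in> K \<longleftrightarrow> w0 + (p / y) *\<^sub>R w1 + ((q + \<tau>) / y) *\<^sub>R v \<in> K" if "cone K" for K \<tau>
      proof -
        have eq: "x + \<tau> *\<^sub>R v = y *\<^sub>R (w0 + (p / y) *\<^sub>R w1 + ((q + \<tau>) / y) *\<^sub>R v)"
        proof -
          have "y * (p / y) = p" "y * ((q + \<tau>) / y) = q + \<tau>" using y by simp_all
          thus ?thesis unfolding x y' by (simp add: scaleR_add_right scaleR_add_left)
        qed
        show ?thesis unfolding eq by (rule cone_scale[OF that y])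
      qed
      have pin: "k1 \<le> p / y" "p / y \<le> k2" using xa unfolding tr[OF C(2)] sec by auto
      have le: "(lo (p/y) \<le> (q + \<tau>) / y) \<longleftrightarrow> y * lo (p/y) - q \<le> \<tau>" "((q + \<tau>) / y \<le> hi (p/y)) \<longleftrightarrow> \<tau> \<le> y * hi (p/y) - q"
         "(lo' (p/y) \<le> (q + \<tau>) / y) \<longleftrightarrow> y * lo' (p/y) - q \<le> \<tau>" "((q + \<tau>) / y \<le> hi' (p/y)) \<longleftrightarrow> \<tau> \<le> y * hi' (p/y) - q" for \<tau>
        using y by (auto simp: field_simps)
      have c1: "{\<tau>. x + \<tau> *\<^sub>R v \<in> C} = {y * lo (p/y) - q..y * hi (p/y) - q}"
        unfolding tr[OF C(2)] sec using pin le by auto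
      have c2: "{\<tau>. x + \<tau> *\<^sub>R v \<in> C'} = {y * lo' (p/y) - q..y * hi' (p/y) - q}"
        unfolding tr[OF C'(2)] sec' using pin U(1,2) le by auto
      have len: "hi' (p/y) = lo' (p/y) + (hi (p/y) - lo (p/y))" using U(3)[of "p/y"] pin by simp
      have "a = y * lo (p/y) - q \<and> b = y * hi (p/y) - q" using col unfolding c1 using ab Icc_eq_Icc by metis
      hence "b - a = y * (hi (p/y) - lo (p/y))" by (simp add: algebra_simps)
      hence "y * hi' (p/y) - q = y * lo' (p/y) - q + (b - a)" unfolding len by (simp add: algebra_simps)
      thus ?thesis unfolding c2 by metis
    qed
  qed
qed

section \<open>Determinants, cones and corners\<close>

text \<open>The determinant of three vectors. For points at height 1 it equals
  \<open>orient\<close>, and in general its sign tells on which side of the plane spanned by two of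
  them the third one lies.\<close>

definition trip :: "real^3 \<Rightarrow> real^3 \<Rightarrow> real^3 \<Rightarrow> real" where
  "trip a b c = cross3 a b \<bullet> c"

lemma trip_expand:
  "trip a b c = a$1 * (b$2 * c$3 - b$3 * c$2) + a$2 * (b$3 * c$1 - b$1 * c$3) + a$3 * (b$1 * c$2 - b$2 * c$1)"
  by (simp add: trip_def cross3_def inner_vec_def sum_3 algebra_simps)

lemma trip_rotate: "trip a b c = trip b c a" and trip_swap: "trip a c b = - trip a b c"
  and trip_zero [simp]: "trip a a c = 0" "trip a c c = 0" "trip a c a = 0"
  by (simp_all add: trip_expand algebra_simps)

lemma trip_linear:
  "trip a b (x + y) = trip a b x + trip a b y" "trip a b (r *\<^sub>R x) = r * trip a b x" "trip a b (x - y) = trip a b x - trip a b y"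
  "trip a (x + y) b = trip a x b + trip a y b" "trip a (r *\<^sub>R x) b = r * trip a x b" "trip a (x - y) b = trip a x b - trip a y b"
  by (simp_all add: trip_expand algebra_simps)

text \<open>Cramer's rule with the denominator multiplied out, so that no triple has to be
  excluded.\<close>

lemma trip_cramer:
  "trip a b c *\<^sub>R x = trip x b c *\<^sub>R a + trip a x c *\<^sub>R b + trip a b x *\<^sub>R c"
  unfolding vec_eq_iff forall_3 by (simp add: trip_expand algebra_simps)

definition hcone :: "(real^3) set \<Rightarrow> bool" where
  "hcone K \<longleftrightarrow> polyhedron K \<and> cone K \<and> interior K \<noteq> {} \<and> (\<forall>x\<in>K. x \<noteq> 0 \<longrightarrow> x$3 > 0)"

lemma hcone_closed: "hcone K \<Longrightarrow> closed K" and hcone_convex: "hcone K \<Longrightarrow> convex K" and hcone_cone: "hcone K \<Longrightarrow> cone K"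
  by (auto simp: hcone_def polyhedron_imp_closed polyhedron_imp_convex)

lemma hcone_add: "hcone K \<Longrightarrow> x \<in> K \<Longrightarrow> y \<in> K \<Longrightarrow> x + y \<in> K"
  using hcone_convex hcone_cone convex_cone by blast

lemma hcone_scale: "hcone K \<Longrightarrow> x \<in> K \<Longrightarrow> c \<ge> 0 \<Longrightarrow> c *\<^sub>R x \<in> K"
  using hcone_cone by (auto simp: cone_def)

lemma hcone_zero: "hcone K \<Longrightarrow> 0 \<in> K"
  using hcone_scale[of K _ 0] unfolding hcone_def by (metis all_not_in_conv interior_subset order_refl scaleR_zero_left subsetD)

text \<open>In the frame \<open>q - v\<close>, \<open>p - q\<close>, \<open>v\<close> the section coordinate \<open>u\<close> of a direction at the vertex \<open>v\<close> runs from 0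
  (towards \<open>q\<close>) to 1 (towards \<open>p\<close>), and \<open>cvec v q p\<close> below is the functional normalizing the section.\<close>

definition corner :: "real^3 \<Rightarrow> real^3 \<Rightarrow> real^3 \<Rightarrow> (real^3) set \<Rightarrow> bool" where
  "corner v q p D \<longleftrightarrow> trip v q p \<noteq> 0 \<and> v$3 = 1 \<and> q$3 = 1 \<and> p$3 = 1 \<and>
     (\<forall>x\<in>D. trip v x p / trip v q p \<ge> 0 \<and> trip v q x / trip v q p \<ge> 0)"

definition cvec :: "real^3 \<Rightarrow> real^3 \<Rightarrow> real^3 \<Rightarrow> real^3" where
  "cvec v q p = (1 / trip v q p) *\<^sub>R (cross3 p v + cross3 v q)"

lemma cvec_inner: "cvec v q p \<bullet> x = trip v x p / trip v q p + trip v q x / trip v q p"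
proof -
  have "cross3 p v \<bullet> x = trip v x p" "cross3 v q \<bullet> x = trip v q x"
    by (metis trip_def trip_rotate)+
  thus ?thesis by (simp add: cvec_def inner_add_left add_divide_distrib)
qed

lemma corner_coords:
  assumes "trip v q p \<noteq> 0" "v$3 = 1" "q$3 = 1" "p$3 = 1"
  shows "x = (trip v x p / trip v q p) *\<^sub>R (q - v) + (trip v q x / trip v q p) *\<^sub>R (p - v) + x$3 *\<^sub>R v"
proof -
  define T where "T = trip v q p"
  have T: "T \<noteq> 0" using assms by (simp add: T_def)
  have "T *\<^sub>R x = trip x q p *\<^sub>R v + trip v x p *\<^sub>R q + trip v q x *\<^sub>R p" unfolding T_def by (rule trip_cramer)
  hence "(1/T) *\<^sub>R (T *\<^sub>R x) = (1/T) *\<^sub>R (trip x q p *\<^sub>R v + trip v x p *\<^sub>R q + trip v q x *\<^sub>R p)" by simp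
  hence e: "x = (trip x q p / T) *\<^sub>R v + (trip v x p / T) *\<^sub>R q + (trip v q x / T) *\<^sub>R p" using T by (simp add: scaleR_add_right)
  define a b c where "a = trip x q p / T" and "b = trip v x p / T" and "c = trip v q x / T"
  have e': "x = a *\<^sub>R v + b *\<^sub>R q + c *\<^sub>R p" using e unfolding a_def b_def c_def .
  have "x$3 = a + b + c" by (subst e') (simp add: assms)
  hence "b *\<^sub>R (q - v) + c *\<^sub>R (p - v) + x$3 *\<^sub>R v = a *\<^sub>R v + b *\<^sub>R q + c *\<^sub>R p"
    by (simp add: algebra_simps)
  thus ?thesis using e' unfolding b_def c_def T_def by simp
qed

lemma corner_frame:
  assumes "trip v q p \<noteq> 0" "v$3 = 1" "q$3 = 1" "p$3 = 1"
  shows "frame (q - v) (p - q) v (cvec v q p)"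
  unfolding frame_def
proof (intro conjI allI impI)
  show e: "cvec v q p \<bullet> (q - v) = 1" "cvec v q p \<bullet> (p - q) = 0" "cvec v q p \<bullet> v = 0"
    using assms(1) by (simp_all add: cvec_inner trip_linear)
  fix y x t assume H: "y *\<^sub>R (q - v) + x *\<^sub>R (p - q) + t *\<^sub>R v = 0"
  have "(y *\<^sub>R (q - v) + x *\<^sub>R (p - q) + t *\<^sub>R v) $ 3 = 0" unfolding H by simp
  hence t: "t = 0" using assms by simp
  have "cvec v q p \<bullet> (y *\<^sub>R (q - v) + x *\<^sub>R (p - q) + t *\<^sub>R v) = 0" unfolding H by simp
  hence y: "y = 0" using e by (simp add: inner_add_right)
  have "trip v q (y *\<^sub>R (q - v) + x *\<^sub>R (p - q) + t *\<^sub>R v) = 0" unfolding H by (simp add: trip_expand)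
  hence "x = 0" using assms(1) y t by (simp add: trip_linear)
  thus "y = 0" "x = 0" "t = 0" using y t by auto
qed

lemma corner_point:
  assumes "trip v q p \<noteq> 0" "v$3 = 1" "q$3 = 1" "p$3 = 1"
  shows "trip v ((q - v) + u *\<^sub>R (p - q) + t *\<^sub>R v) p / trip v q p = 1 - u"
    "trip v q ((q - v) + u *\<^sub>R (p - q) + t *\<^sub>R v) / trip v q p = u"
    "((q - v) + u *\<^sub>R (p - q) + t *\<^sub>R v) $ 3 = t"
    "(q - v) + u *\<^sub>R (p - q) + t *\<^sub>R v \<noteq> 0"
proof -
  show a: "trip v ((q - v) + u *\<^sub>R (p - q) + t *\<^sub>R v) p / trip v q p = 1 - u"
    "trip v q ((q - v) + u *\<^sub>R (p - q) + t *\<^sub>R v) / trip v q p = u"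
    using assms by (simp_all add: trip_linear diff_divide_distrib add_divide_distrib)
  show "((q - v) + u *\<^sub>R (p - q) + t *\<^sub>R v) $ 3 = t" using assms by simp
  show "(q - v) + u *\<^sub>R (p - q) + t *\<^sub>R v \<noteq> 0"
  proof
    assume H: "(q - v) + u *\<^sub>R (p - q) + t *\<^sub>R v = 0"
    have "1 - u = 0" "u = 0" using a unfolding H by (simp_all add: trip_expand)
    thus False by simp
  qed
qed

lemma corner_section:
  assumes c: "corner v q p D" and K: "hcone K" "K \<subseteq> D" and m: "(q - v) + u *\<^sub>R (p - q) + t *\<^sub>R v \<in> K"
  shows "0 \<le> u" "u \<le> 1" "0 < t"
proof -
  have a: "trip v q p \<noteq> 0" "v$3 = 1" "q$3 = 1" "p$3 = 1" using c by (auto simp: corner_def)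
  have "trip v ((q - v) + u *\<^sub>R (p - q) + t *\<^sub>R v) p / trip v q p \<ge> 0" "trip v q ((q - v) + u *\<^sub>R (p - q) + t *\<^sub>R v) / trip v q p \<ge> 0"
    using c K(2) m unfolding corner_def by blast+
  thus "0 \<le> u" "u \<le> 1" unfolding corner_point(1,2)[OF a] by auto
  show "0 < t" using K(1) m corner_point(3,4)[OF a, of u t] unfolding hcone_def by metis
qed

lemma corner_cvec_nonneg: "corner v q p D \<Longrightarrow> x \<in> D \<Longrightarrow> cvec v q p \<bullet> x \<ge> 0"
  unfolding corner_def cvec_inner by (metis add_nonneg_nonneg)

lemma corner_cvec_zero:
  assumes c: "corner v q p D" and "x \<in> D" "cvec v q p \<bullet> x = 0"
  shows "x = x$3 *\<^sub>R v"
proof -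
  have a: "trip v q p \<noteq> 0" "v$3 = 1" "q$3 = 1" "p$3 = 1" using c by (auto simp: corner_def)
  have z: "trip v x p / trip v q p = 0" "trip v q x / trip v q p = 0"
    using assms unfolding corner_def cvec_inner by (metis add_nonneg_eq_0_iff)+
  from corner_coords[OF a, of x, unfolded z scaleR_zero_left add_0_left] show ?thesis .
qed

lemma corner_cvec_pos:
  assumes c: "corner v q p D" and K: "hcone K" "K \<subseteq> D" "v \<notin> K" and x: "x \<in> K" "x \<noteq> 0"
  shows "cvec v q p \<bullet> x > 0"
proof (rule ccontr)
  assume "\<not> cvec v q p \<bullet> x > 0"
  hence "cvec v q p \<bullet> x = 0" using corner_cvec_nonneg[OF c, of x] x K by force
  hence e: "x = x$3 *\<^sub>R v" using corner_cvec_zero[OF c] x K by blast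
  have "x$3 > 0" using K x by (auto simp: hcone_def)
  then obtain c where "c > 0" "x = c *\<^sub>R v" using e by blast
  hence "v \<in> K" using cone_scale[OF hcone_cone[OF K(1)], of c v] x(1) by simp
  thus False using K(3) by simp
qed

text \<open>Adding nonnegative multiples of \<open>v\<close> keeps a point in the cone, which makes
  the section closed upwards in \<open>t\<close>.\<close>

lemma corner_ray_section:
  assumes c: "corner v q p D" and K: "hcone K" "K \<subseteq> D" "v \<in> K"
  obtains k1 k2 E where "ray_section K (q - v) (p - q) v k1 k2 E"
proof -
  have a: "trip v q p \<noteq> 0" "v$3 = 1" "q$3 = 1" "p$3 = 1" using c by (auto simp: corner_def)
  note fr = corner_frame[OF a]
  have Kc: "cone K" "interior K \<noteq> {}" "polyhedron K" using K by (auto simp: hcone_def)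
  have pos: "\<forall>x\<in>K. cvec v q p \<bullet> x \<ge> 0" using corner_cvec_nonneg[OF c] K by blast
  obtain u1 t1 e :: real where e: "e > 0"
    "\<forall>u t. \<bar>u - u1\<bar> \<le> e \<longrightarrow> \<bar>t - t1\<bar> \<le> e \<longrightarrow> (q - v) + u *\<^sub>R (p - q) + t *\<^sub>R v \<in> K"
    by (rule section_interior_point[OF fr Kc(1,2) pos])
  have ne: "(q - v) + u1 *\<^sub>R (p - q) + t1 *\<^sub>R v \<in> K" using e by auto
  have up: "(q - v) + u *\<^sub>R (p - q) + t' *\<^sub>R v \<in> K" if "(q - v) + u *\<^sub>R (p - q) + t *\<^sub>R v \<in> K" "t \<le> t'" for u t t'
  proof -
    have "((q - v) + u *\<^sub>R (p - q) + t *\<^sub>R v) + (t' - t) *\<^sub>R v \<in> K"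
      using that(2) by (intro hcone_add[OF K(1) that(1)] hcone_scale[OF K(1,3)]) simp
    thus ?thesis by (simp add: algebra_simps)
  qed
  show thesis
  proof (rule section_ray[OF Kc(3) up _ ne])
    show "0 \<le> u \<and> u \<le> 1 \<and> 0 < t" if "(q - v) + u *\<^sub>R (p - q) + t *\<^sub>R v \<in> K" for u t
      using corner_section[OF c K(1,2) that] by auto
  next
    fix k1 k2 E U
    assume k: "k1 \<le> k2" and s: "\<And>u t. (q - v) + u *\<^sub>R (p - q) + t *\<^sub>R v \<in> K \<longleftrightarrow> k1 \<le> u \<and> u \<le> k2 \<and> E u \<le> t"
      and U: "pl_breaks k1 k2 E U"
    have pE: "(q - v) + u *\<^sub>R (p - q) + E u *\<^sub>R v \<in> K" if "k1 \<le> u" "u \<le> k2" for u using that s by simp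
    have "\<bar>u1 - e - u1\<bar> \<le> e" "\<bar>u1 + e - u1\<bar> \<le> e" "\<bar>t1 - t1\<bar> \<le> e" using e(1) by auto
    hence "(q - v) + (u1 - e) *\<^sub>R (p - q) + t1 *\<^sub>R v \<in> K" "(q - v) + (u1 + e) *\<^sub>R (p - q) + t1 *\<^sub>R v \<in> K"
      using e(2) by blast+
    hence "k1 \<le> u1 - e" "u1 + e \<le> k2" unfolding s by auto
    hence "k1 < k2" using e(1) by linarith
    moreover have "0 \<le> k1" "k2 \<le> 1" using corner_section[OF c K(1,2) pE[of k1]] corner_section[OF c K(1,2) pE[of k2]] k by auto
    moreover have "\<forall>u\<in>{k1..k2}. 0 < E u" using corner_section(3)[OF c K(1,2) pE] by auto
    ultimately have "ray_section K (q - v) (p - q) v k1 k2 E"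
      unfolding ray_section_def using s U by blast
    thus thesis by (rule that)
  qed
qed

section \<open>Transforms at a corner\<close>

lemma ennreal_cancel_square:
  fixes a b c d :: ennreal
  assumes "0 < k" "(ennreal k * a) * (ennreal k * b) = (ennreal k * c) * (ennreal k * d)"
  shows "a * b = c * d"
proof -
  have "(ennreal k * ennreal k) * (a * b) = (ennreal k * ennreal k) * (c * d)" using assms(2) by (simp add: mult_ac)
  moreover have "ennreal k * ennreal k = ennreal (k * k)" using assms(1) by (simp add: ennreal_mult)
  ultimately show ?thesis using assms(1) by (simp add: ennreal_mult_cancel_left)
qed

text \<open>One functional serves all cones in \<open>D\<close>: it takes the values 1,
  \<open>la\<close> and \<open>ta\<close> on the vectors of the frame. For \<open>ta\<close> = 0 it
  vanishes in \<open>D\<close> only on multiples of \<open>v\<close>, and a positive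
  \<open>ta\<close> moves it to functionals that are positive on every cone considered.\<close>

lemma corner_lap:
  assumes c: "corner v q p D"
  obtains \<kappa> where "0 < \<kappa>" "\<forall>la ta. \<bar>la\<bar> < 1/2 \<longrightarrow> 0 \<le> ta \<longrightarrow> (\<exists>\<xi>.
      (\<forall>K. hcone K \<longrightarrow> K \<subseteq> D \<longrightarrow> lap K \<xi> = ennreal \<kappa> * sint K (q - v) (p - q) v la ta) \<and>
      (\<forall>K. hcone K \<longrightarrow> K \<subseteq> D \<longrightarrow> v \<notin> K \<or> 0 < ta \<longrightarrow> (\<forall>x\<in>K. x \<noteq> 0 \<longrightarrow> \<xi> \<bullet> x > 0)))"
proof -
  have a: "trip v q p \<noteq> 0" "v$3 = 1" "q$3 = 1" "p$3 = 1" using c by (auto simp: corner_def)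
  note fr = corner_frame[OF a]
  define e3 where "e3 = (vector [0, 0, 1] :: real^3)"
  have e3: "e3 \<bullet> x = x$3" for x by (simp add: e3_def inner_vec_def sum_3)
  define b where "b = (1 / trip v q p) *\<^sub>R cross3 v q"
  have b: "b \<bullet> x = trip v q x / trip v q p" for x by (simp add: b_def trip_def)
  obtain \<kappa> where k: "0 < \<kappa>"
    "\<And>K \<xi>. closed K \<Longrightarrow> cone K \<Longrightarrow> (\<And>x. x \<in> K \<Longrightarrow> cvec v q p \<bullet> x \<ge> 0) \<Longrightarrow> \<xi> \<bullet> (q - v) = 1 \<Longrightarrow>
      (\<And>u t. (q - v) + u *\<^sub>R (p - q) + t *\<^sub>R v \<in> K \<Longrightarrow> 1 + (\<xi> \<bullet> (p - q)) * u + (\<xi> \<bullet> v) * t > 0) \<Longrightarrow>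
      lap K \<xi> = ennreal \<kappa> * sint K (q - v) (p - q) v (\<xi> \<bullet> (p - q)) (\<xi> \<bullet> v)"
  proof (rule lap_frame[of "q - v" "p - q" v "cvec v q p"])
    show "y = 0 \<and> x = 0 \<and> t = 0" if "y *\<^sub>R (q - v) + x *\<^sub>R (p - q) + t *\<^sub>R v = 0" for y x t
      using fr that unfolding frame_def by blast
  qed (use fr in \<open>auto simp: frame_def\<close>)
  show thesis
  proof (rule that[OF k(1)], intro allI impI)
    fix la ta :: real assume la: "\<bar>la\<bar> < 1/2" and ta: "0 \<le> ta"
    define \<xi> where "\<xi> = cvec v q p + la *\<^sub>R b + ta *\<^sub>R e3"
    have xi: "\<xi> \<bullet> x = cvec v q p \<bullet> x + la * (trip v q x / trip v q p) + ta * x$3" for x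
      by (simp add: \<xi>_def inner_add_left b e3)
    have x0: "\<xi> \<bullet> (q - v) = 1" and x1: "\<xi> \<bullet> (p - q) = la" and xv: "\<xi> \<bullet> v = ta"
      unfolding xi using a by (simp_all add: cvec_inner trip_linear)
    have L: "lap K \<xi> = ennreal \<kappa> * sint K (q - v) (p - q) v la ta" if K: "hcone K" "K \<subseteq> D" for K
    proof -
      have "lap K \<xi> = ennreal \<kappa> * sint K (q - v) (p - q) v (\<xi> \<bullet> (p - q)) (\<xi> \<bullet> v)"
      proof (rule k(2))
        show "closed K" "cone K" using K hcone_closed hcone_cone by auto
        show "cvec v q p \<bullet> x \<ge> 0" if "x \<in> K" for x using corner_cvec_nonneg[OF c] that K by blast
        show "\<xi> \<bullet> (q - v) = 1" by (rule x0)
        fix u t assume m: "(q - v) + u *\<^sub>R (p - q) + t *\<^sub>R v \<in> K"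
        note s = corner_section[OF c K m]
        have "\<bar>la * u\<bar> \<le> 1/2 * 1" unfolding abs_mult using s la by (intro mult_mono) auto
        moreover have "0 \<le> ta * t" using s ta by simp
        ultimately show "1 + (\<xi> \<bullet> (p - q)) * u + (\<xi> \<bullet> v) * t > 0" unfolding x1 xv by linarith
      qed
      thus ?thesis unfolding x1 xv .
    qed
    have P: "\<xi> \<bullet> x > 0" if K: "hcone K" "K \<subseteq> D" "v \<notin> K \<or> 0 < ta" and x: "x \<in> K" "x \<noteq> 0" for K x
    proof -
      have x3: "x$3 > 0" using K x by (auto simp: hcone_def)
      have n: "trip v x p / trip v q p \<ge> 0" "trip v q x / trip v q p \<ge> 0" using c x K unfolding corner_def by blast+
      have "\<bar>la * (trip v q x / trip v q p)\<bar> \<le> 1/2 * (trip v q x / trip v q p)"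
        unfolding abs_mult using n la by (intro mult_mono) auto
      define X Y where "X = trip v x p / trip v q p" and "Y = trip v q x / trip v q p"
      have "\<bar>la * Y\<bar> \<le> 1/2 * Y" "0 \<le> X" using \<open>\<bar>la * (trip v q x / trip v q p)\<bar> \<le> _\<close> n unfolding X_def Y_def by blast+
      hence "1/2 * (X + Y) + ta * x$3 \<le> X + Y + la * Y + ta * x$3" using abs_ge_minus_self[of "la * Y"] by argo
      hence g: "\<xi> \<bullet> x \<ge> 1/2 * (cvec v q p \<bullet> x) + ta * x$3" unfolding xi cvec_inner X_def Y_def .
      show ?thesis
      proof (cases "0 < ta")
        case True
        have "cvec v q p \<bullet> x \<ge> 0" using corner_cvec_nonneg[OF c] x K by blast
        moreover have "ta * x$3 > 0" using True x3 by simp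
        ultimately show ?thesis using g by linarith
      next
        case False
        hence "cvec v q p \<bullet> x > 0" using corner_cvec_pos[OF c K(1,2) _ x] K(3) by auto
        moreover have "ta * x$3 \<ge> 0" using ta x3 by simp
        ultimately show ?thesis using g by linarith
      qed
    qed
    show "\<exists>\<xi>. (\<forall>K. hcone K \<longrightarrow> K \<subseteq> D \<longrightarrow> lap K \<xi> = ennreal \<kappa> * sint K (q - v) (p - q) v la ta) \<and>
      (\<forall>K. hcone K \<longrightarrow> K \<subseteq> D \<longrightarrow> v \<notin> K \<or> 0 < ta \<longrightarrow> (\<forall>x\<in>K. x \<noteq> 0 \<longrightarrow> \<xi> \<bullet> x > 0))"
      using L P by blast
  qed
qed

definition lap_eq where
  "lap_eq A C A' C' \<longleftrightarrow> (\<forall>\<xi>. lap A \<xi> * lap C \<xi> = lap A' \<xi> * lap C' \<xi>)"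

lemma corner_sint_eq:
  assumes c: "corner v q p D" and H: "hcone A" "hcone C" "hcone A'" "hcone C'" "A \<subseteq> D" "C \<subseteq> D" "A' \<subseteq> D" "C' \<subseteq> D"
    and L: "lap_eq A C A' C'" and la: "\<bar>la\<bar> < 1/2" "0 \<le> ta"
  shows "sint A (q - v) (p - q) v la ta * sint C (q - v) (p - q) v la ta = sint A' (q - v) (p - q) v la ta * sint C' (q - v) (p - q) v la ta"
proof -
  obtain \<kappa> where k: "0 < \<kappa>" "\<forall>la ta. \<bar>la\<bar> < 1/2 \<longrightarrow> 0 \<le> ta \<longrightarrow> (\<exists>\<xi>.
      (\<forall>K. hcone K \<longrightarrow> K \<subseteq> D \<longrightarrow> lap K \<xi> = ennreal \<kappa> * sint K (q - v) (p - q) v la ta) \<and>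
      (\<forall>K. hcone K \<longrightarrow> K \<subseteq> D \<longrightarrow> v \<notin> K \<or> 0 < ta \<longrightarrow> (\<forall>x\<in>K. x \<noteq> 0 \<longrightarrow> \<xi> \<bullet> x > 0)))"
    by (rule corner_lap[OF c])
  then obtain \<xi> where x: "\<And>K. hcone K \<Longrightarrow> K \<subseteq> D \<Longrightarrow> lap K \<xi> = ennreal \<kappa> * sint K (q - v) (p - q) v la ta"
    using la by meson
  show ?thesis
    by (rule ennreal_cancel_square[OF k(1)]) (use L in \<open>simp add: lap_eq_def x[symmetric] H\<close>)
qed

lemma corner_sint_finite:
  assumes c: "corner v q p D" and H: "hcone C" "C \<subseteq> D" "v \<notin> C" and la: "\<bar>la\<bar> < 1/2"
  shows "sint C (q - v) (p - q) v la 0 < top"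
proof -
  obtain \<kappa> where k: "0 < \<kappa>" "\<forall>la ta. \<bar>la\<bar> < 1/2 \<longrightarrow> 0 \<le> ta \<longrightarrow> (\<exists>\<xi>.
      (\<forall>K. hcone K \<longrightarrow> K \<subseteq> D \<longrightarrow> lap K \<xi> = ennreal \<kappa> * sint K (q - v) (p - q) v la ta) \<and>
      (\<forall>K. hcone K \<longrightarrow> K \<subseteq> D \<longrightarrow> v \<notin> K \<or> 0 < ta \<longrightarrow> (\<forall>x\<in>K. x \<noteq> 0 \<longrightarrow> \<xi> \<bullet> x > 0)))"
    by (rule corner_lap[OF c])
  then obtain \<xi> where x: "lap C \<xi> = ennreal \<kappa> * sint C (q - v) (p - q) v la 0" "\<And>x. x \<in> C \<Longrightarrow> x \<noteq> 0 \<Longrightarrow> \<xi> \<bullet> x > 0"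
    using la H by (metis order_refl)
  have "\<xi> \<noteq> 0"
  proof -
    obtain z where "z \<in> interior C" using H(1) by (auto simp: hcone_def)
    have "C \<noteq> {0}" using H(1) unfolding hcone_def by (metis interior_singleton)
    then obtain y where "y \<in> C" "y \<noteq> 0" using hcone_zero[OF H(1)] by blast
    from x(2)[OF this] show ?thesis by auto
  qed
  have "lap C \<xi> < top" using lap_finite[OF hcone_closed[OF H(1)] hcone_cone[OF H(1)] x(2) \<open>\<xi> \<noteq> 0\<close>] .
  thus ?thesis unfolding x(1) using k(1) by (auto simp: ennreal_mult_less_top)
qed

text \<open>The range of a cone containing \<open>v\<close> is local information: far up in the
  section, w + T v is a multiple of v + w/T, which is as close to \<open>v\<close> as
  desired.\<close>

lemma coincide_ranges:
  assumes c: "corner v q p D" and H: "hcone A" "hcone A'" "A \<subseteq> D" "A' \<subseteq> D" "v \<in> A" "v \<in> A'"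
    and S: "ray_section A (q - v) (p - q) v a1 a2 E" "ray_section A' (q - v) (p - q) v b1 b2 E'"
    and N: "coincide_near v (A \<inter> {x. x$3 = 1}) (A' \<inter> {x. x$3 = 1})"
  shows "b1 \<le> a1 \<and> a2 \<le> b2"
proof -
  have a: "trip v q p \<noteq> 0" "v$3 = 1" "q$3 = 1" "p$3 = 1" using c by (auto simp: corner_def)
  obtain U where U: "open U" "v \<in> U" "(A \<inter> {x. x$3 = 1}) \<inter> U = (A' \<inter> {x. x$3 = 1}) \<inter> U"
    using N by (auto simp: coincide_near_def)
  have main: "b1 \<le> u \<and> u \<le> b2" if u: "a1 \<le> u" "u \<le> a2" for u
  proof -
    define w where "w = (q - v) + u *\<^sub>R (p - q)"
    obtain r where r: "r > 0" "ball v r \<subseteq> U" using U(1,2) open_contains_ball by blast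
    \<comment> \<open>Large enough for the point to lie in the first cone and for its multiple at
      height 1 to have distance less than \<open>r\<close> from \<open>v\<close>.\<close>
    define T where "T = max (E u) (2 * norm w / r + 1)"
    have "0 \<le> 2 * norm w / r" using r(1) by simp
    moreover have T0: "T \<ge> 2 * norm w / r + 1" by (simp add: T_def)
    ultimately have T: "T > 0" by linarith
    have "w + T *\<^sub>R v \<in> A" using S(1) u unfolding ray_section_def w_def by (simp add: T_def)
    hence m: "(1/T) *\<^sub>R (w + T *\<^sub>R v) \<in> A" using hcone_scale[OF H(1)] T by simp
    have e: "(1/T) *\<^sub>R (w + T *\<^sub>R v) = v + (1/T) *\<^sub>R w" using T by (simp add: algebra_simps)
    have "w$3 = 0" using a by (simp add: w_def)
    hence h: "(v + (1/T) *\<^sub>R w) $ 3 = 1" using a by simp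
    have "norm w / T < r"
    proof -
      have "norm w < r * T" using T0 r(1) mult_left_mono[OF T0, of r] by (simp add: distrib_left) (smt (verit) norm_ge_zero)
      thus ?thesis using T by (simp add: divide_less_eq)
    qed
    hence "v + (1/T) *\<^sub>R w \<in> ball v r" using T by (simp add: dist_norm)
    hence "v + (1/T) *\<^sub>R w \<in> A'" using m h U(3) r unfolding e by blast
    hence "T *\<^sub>R (v + (1/T) *\<^sub>R w) \<in> A'" using hcone_scale[OF H(2)] T by simp
    hence "w + T *\<^sub>R v \<in> A'" using T by (simp add: algebra_simps)
    thus ?thesis using S(2) unfolding ray_section_def w_def by blast
  qed
  have "a1 \<le> a2" using S(1) by (auto simp: ray_section_def)
  thus ?thesis using main[of a1] main[of a2] by auto
qed

lemma coincide_near_sym: "coincide_near v P Q \<Longrightarrow> coincide_near v Q P"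
  by (auto simp: coincide_near_def)

lemma simple_vertex_xray:
  assumes c: "corner v q p D" and H: "hcone A" "hcone C" "hcone A'" "hcone C'" "A \<subseteq> D" "C \<subseteq> D" "A' \<subseteq> D" "C' \<subseteq> D"
    and L: "lap_eq A C A' C'" and v: "v \<in> A" "v \<in> A'" "v \<notin> C" "v \<notin> C'"
    and N: "coincide_near v (A \<inter> {x. x$3 = 1}) (A' \<inter> {x. x$3 = 1})"
  shows "xray_le v C C'"
proof -
  have a: "trip v q p \<noteq> 0" "v$3 = 1" "q$3 = 1" "p$3 = 1" using c by (auto simp: corner_def)
  note fr = corner_frame[OF a]
  obtain a1 a2 E where S: "ray_section A (q - v) (p - q) v a1 a2 E" by (rule corner_ray_section[OF c H(1,5) v(1)])
  obtain b1 b2 E' where S': "ray_section A' (q - v) (p - q) v b1 b2 E'" by (rule corner_ray_section[OF c H(3,7) v(2)])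
  have "b1 = a1" "b2 = a2"
    using coincide_ranges[OF c H(1,3,5,7) v(1,2) S S' N] coincide_ranges[OF c H(3,1,7,5) v(2,1) S' S coincide_near_sym[OF N]] by auto
  note S'' = S'[unfolded this]
  have bdK: "\<exists>d. \<forall>u t. (q - v) + u *\<^sub>R (p - q) + t *\<^sub>R v \<in> K \<longrightarrow> t \<le> d" if K: "hcone K" "K \<subseteq> D" "v \<notin> K" for K
  proof -
    obtain m where m: "m > 0" "\<And>x. x \<in> K \<Longrightarrow> cvec v q p \<bullet> x \<ge> m * norm x"
      using cone_coercive[OF hcone_closed[OF K(1)] hcone_cone[OF K(1)] corner_cvec_pos[OF c K]] by blast
    have "t \<le> 1 / m" if "(q - v) + u *\<^sub>R (p - q) + t *\<^sub>R v \<in> K" for u t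
    proof -
      define x where "x = (q - v) + u *\<^sub>R (p - q) + t *\<^sub>R v"
      have "cvec v q p \<bullet> x = 1" using fr unfolding x_def frame_def by (simp add: inner_add_right)
      hence "m * norm x \<le> 1" using m(2)[of x] that unfolding x_def[symmetric] by simp
      moreover have "t \<le> norm x" using component_le_norm_cart[of x 3] corner_point(3)[OF a, of u t] unfolding x_def by linarith
      ultimately show ?thesis using m(1) by (smt (verit) mult_left_mono pos_le_divide_eq mult.commute)
    qed
    thus ?thesis by blast
  qed
  obtain d1 where d1: "\<forall>u t. (q - v) + u *\<^sub>R (p - q) + t *\<^sub>R v \<in> C \<longrightarrow> t \<le> d1" using bdK[OF H(2,6) v(3)] by blast
  obtain d2 where d2: "\<forall>u t. (q - v) + u *\<^sub>R (p - q) + t *\<^sub>R v \<in> C' \<longrightarrow> t \<le> d2" using bdK[OF H(4,8) v(4)] by blast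
  have bd: "0 \<le> u \<and> u \<le> 1 \<and> 0 \<le> t \<and> t \<le> max d1 d2" if "(q - v) + u *\<^sub>R (p - q) + t *\<^sub>R v \<in> C \<union> C'" for u t
    using that corner_section[OF c H(2,6), of u t] corner_section[OF c H(4,8), of u t] d1[rule_format, of u t] d2[rule_format, of u t] by (auto simp: le_max_iff_disj)
  have sq: "sint C (q - v) (p - q) v la 0 = sint C' (q - v) (p - q) v la 0" if la: "\<bar>la\<bar> < 1/2" for la
  proof (rule simple_vertex_limit[OF S S'' hcone_closed[OF H(2)] hcone_closed[OF H(4)] bd])
    show "sint C (q - v) (p - q) v la 0 < top" by (rule corner_sint_finite[OF c H(2,6) v(3) la])
    show "sint C' (q - v) (p - q) v la 0 < top" by (rule corner_sint_finite[OF c H(4,8) v(4) la])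
    show "\<bar>la\<bar> < 1/2" by (rule la)
    show "sint A (q - v) (p - q) v la ta * sint C (q - v) (p - q) v la ta = sint A' (q - v) (p - q) v la ta * sint C' (q - v) (p - q) v la ta" if "0 < ta" for ta
      using that by (intro corner_sint_eq[OF c H L la]) simp
  qed
  have K: "polyhedron K" "cone K" "interior K \<noteq> {}" "\<forall>x\<in>K. cvec v q p \<bullet> x \<ge> 0" "\<forall>x\<in>K. cvec v q p \<bullet> x = 0 \<longrightarrow> x = 0"
    if "hcone K" "K \<subseteq> D" "v \<notin> K" for K
    using that corner_cvec_pos[OF c that] corner_cvec_nonneg[OF c] by (auto simp: hcone_def) (metis less_irrefl)
  show ?thesis
  proof (rule xray_from_sint[OF fr K[OF H(2,6) v(3)] K[OF H(4,8) v(4)], where R = 1 and \<epsilon> = "1/2" and c = 0 and d = "max d1 d2"])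
    show "\<forall>u t. (q - v) + u *\<^sub>R (p - q) + t *\<^sub>R v \<in> C \<union> C' \<longrightarrow> - 1 \<le> u \<and> u \<le> 1 \<and> 0 \<le> t \<and> t \<le> max d1 d2"
      using bd by force
    show "\<forall>la. \<bar>la\<bar> < 1 / 2 \<longrightarrow> sint C (q - v) (p - q) v la 0 = sint C' (q - v) (p - q) v la 0" using sq by blast
  qed auto
qed

section \<open>Cones with equal X-rays\<close>

text \<open>Points x + f n v of the cone with unbounded f n, divided by f n, converge to
  \<open>v\<close>, which the closed cone would then contain.\<close>

lemma column_bounded_above:
  fixes v :: "real^3"
  assumes K: "closed K" "cone K" and v: "v \<notin> K"
  obtains B where "\<forall>\<tau>. x + \<tau> *\<^sub>R v \<in> K \<longrightarrow> \<tau> \<le> B"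
proof -
  have "\<exists>B. \<forall>\<tau>. x + \<tau> *\<^sub>R v \<in> K \<longrightarrow> \<tau> \<le> B"
  proof (rule ccontr)
    assume "\<not> ?thesis"
    hence "\<forall>n::nat. \<exists>\<tau>. x + \<tau> *\<^sub>R v \<in> K \<and> \<tau> > real (Suc n)" by (meson not_le)
    then obtain f where f: "\<And>n. x + f n *\<^sub>R v \<in> K" "\<And>n. f n > real (Suc n)" by metis
    have pos: "f n > 0" for n using f(2)[of n] by (smt (verit) of_nat_0_le_iff)
    have kx: "v + (1 / f n) *\<^sub>R x \<in> K" for n
    proof -
      have "(1 / f n) *\<^sub>R (x + f n *\<^sub>R v) \<in> K" using f(1)[of n] K(2) pos[of n] unfolding cone_def by (meson less_imp_le zero_le_divide_1_iff)
      thus ?thesis using pos[of n] by (simp add: algebra_simps)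
    qed
    have kl: "(\<lambda>n. v + (1 / f n) *\<^sub>R x) \<longlonglongrightarrow> v + 0 *\<^sub>R x"
    proof -
      have a: "\<forall>n. 0 \<le> 1 / f n"
      proof
        fix n show "0 \<le> 1 / f n" using pos[of n] by simp
      qed
      have b: "\<forall>n. 1 / f n \<le> 1 / real (Suc n)"
      proof
        fix n show "1 / f n \<le> 1 / real (Suc n)"
          by (rule frac_le) (use f(2)[of n] in simp_all)
      qed
      have "(\<lambda>n. 1 / f n) \<longlonglongrightarrow> 0"
        by (rule tendsto_sandwich[OF always_eventually[OF a] always_eventually[OF b] tendsto_const])
           (rule LIMSEQ_Suc[OF lim_const_over_n])
      hence "(\<lambda>n. (1 / f n) *\<^sub>R x) \<longlonglongrightarrow> 0 *\<^sub>R x" by (rule tendsto_scaleR[OF _ tendsto_const])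
      thus ?thesis by (rule tendsto_add[OF tendsto_const])
    qed
    have "v + 0 *\<^sub>R x \<in> K" by (rule closed_sequentially[OF K(1) kx kl])
    thus False using v by simp
  qed
  thus thesis using that by blast
qed

lemma column_interval:
  fixes v :: "real^3"
  assumes K: "closed K" "convex K" "cone K" and v: "v \<notin> K" "- v \<notin> K" and x: "x + \<tau>0 *\<^sub>R v \<in> K"
  obtains lo hi where "lo \<le> hi" "{\<tau>. x + \<tau> *\<^sub>R v \<in> K} = {lo..hi}"
proof -
  obtain B where B: "\<forall>\<tau>. x + \<tau> *\<^sub>R v \<in> K \<longrightarrow> \<tau> \<le> B" by (rule column_bounded_above[OF K(1,3) v(1)])
  obtain B' where B': "\<forall>\<tau>. x + \<tau> *\<^sub>R (- v) \<in> K \<longrightarrow> \<tau> \<le> B'" by (rule column_bounded_above[OF K(1,3) v(2)])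
  define S where "S = {\<tau>. x + \<tau> *\<^sub>R v \<in> K}"
  have "closed S" unfolding S_def
    using continuous_closed_vimage[OF K(1), of "\<lambda>\<tau>. x + \<tau> *\<^sub>R v"] by (simp add: vimage_def continuous_intros)
  moreover have "convex S"
    unfolding convex_def S_def
  proof (intro ballI allI impI, simp only: mem_Collect_eq)
    fix a b p q :: real assume h: "x + a *\<^sub>R v \<in> K" "x + b *\<^sub>R v \<in> K" "0 \<le> p" "0 \<le> q" "p + q = 1"
    have "p *\<^sub>R (x + a *\<^sub>R v) + q *\<^sub>R (x + b *\<^sub>R v) \<in> K" using K(2) h by (intro convexD) auto
    also have "p *\<^sub>R (x + a *\<^sub>R v) + q *\<^sub>R (x + b *\<^sub>R v) = (p + q) *\<^sub>R x + (p *\<^sub>R a + q *\<^sub>R b) *\<^sub>R v" by (simp add: algebra_simps)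
    finally show "x + (p *\<^sub>R a + q *\<^sub>R b) *\<^sub>R v \<in> K" using h(5) by simp
  qed
  moreover have "S \<noteq> {}" using x by (auto simp: S_def)
  moreover have "S \<subseteq> {- B'..B}"
  proof
    fix \<tau> assume "\<tau> \<in> S"
    hence "x + \<tau> *\<^sub>R v \<in> K" "x + (- \<tau>) *\<^sub>R (- v) \<in> K" by (simp_all add: S_def)
    hence "\<tau> \<le> B" "- \<tau> \<le> B'" using B B' by blast+
    thus "\<tau> \<in> {- B'..B}" by simp
  qed
  ultimately obtain k1 k2 where "k1 \<le> k2" "S = {k1..k2}" by (rule compact_convex_real_interval)
  thus thesis using that unfolding S_def by blast
qed

lemma hcone_column:
  assumes K: "hcone K" and v: "v \<notin> K" "v$3 \<ge> 0" "v \<noteq> 0" and x: "x + \<tau>0 *\<^sub>R v \<in> K"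
  obtains lo hi where "lo \<le> hi" "{\<tau>. x + \<tau> *\<^sub>R v \<in> K} = {lo..hi}"
proof -
  have "- v \<notin> K" using K v by (auto simp: hcone_def)
  thus thesis using column_interval[OF hcone_closed[OF K] hcone_convex[OF K] hcone_cone[OF K] v(1) _ x] that by blast
qed

lemma xray_columns:
  assumes K: "hcone K" and v: "v \<notin> K" "v$3 \<ge> 0" "v \<noteq> 0" and X: "xray_le v K K'" and x: "x + \<tau>0 *\<^sub>R v \<in> K"
  obtains lo hi lo' where "lo \<le> hi" "{\<tau>. x + \<tau> *\<^sub>R v \<in> K} = {lo..hi}" "{\<tau>. x + \<tau> *\<^sub>R v \<in> K'} = {lo'..lo' + (hi - lo)}"
proof -
  obtain lo hi where l: "lo \<le> hi" "{\<tau>. x + \<tau> *\<^sub>R v \<in> K} = {lo..hi}" by (rule hcone_column[OF K v x])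
  then obtain lo' where "{\<tau>. x + \<tau> *\<^sub>R v \<in> K'} = {lo'..lo' + (hi - lo)}" using X unfolding xray_le_def by blast
  thus thesis using that l by blast
qed

text \<open>The lowest point of a column of \<open>C\<close> is w + \<tau> z with \<open>w\<close>
  in both cones and \<tau> \<ge> 0. As it is the lowest one, \<tau> is 0 and the point lies in
  \<open>C'\<close>. The same holds with the cones exchanged, so both columns start at one point,
  and their lengths agree.\<close>

lemma sweep:
  assumes C: "hcone C" "C \<subseteq> D" "C' \<subseteq> D" and z: "z \<notin> C" "z$3 \<ge> 0" "z \<noteq> 0" and X: "xray_le z C C'"
    and \<Gamma>: "\<forall>x\<in>\<Gamma>. \<forall>\<tau>. x + \<tau> *\<^sub>R z \<in> \<Gamma>"
    and W: "\<forall>x\<in>D \<inter> \<Gamma>. \<exists>w\<in>W. \<exists>\<tau>\<ge>0. x = w + \<tau> *\<^sub>R z" "W \<subseteq> C" "W \<subseteq> C'"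
  shows "C \<inter> \<Gamma> \<subseteq> C'"
proof
  fix x assume x: "x \<in> C \<inter> \<Gamma>"
  obtain lo hi lo' where l: "lo \<le> hi" "{\<tau>. x + \<tau> *\<^sub>R z \<in> C} = {lo..hi}" "{\<tau>. x + \<tau> *\<^sub>R z \<in> C'} = {lo'..lo' + (hi - lo)}"
    by (rule xray_columns[OF C(1) z X, of x 0]) (use x in simp)
  have c: "x + \<tau> *\<^sub>R z \<in> C \<longleftrightarrow> lo \<le> \<tau> \<and> \<tau> \<le> hi" and c': "x + \<tau> *\<^sub>R z \<in> C' \<longleftrightarrow> lo' \<le> \<tau> \<and> \<tau> \<le> lo' + (hi - lo)" for \<tau>
    using l(2,3) by auto
  have "lo' \<le> lo"
  proof -
    have m: "x + lo *\<^sub>R z \<in> C" using c l(1) by simp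
    have "x + lo *\<^sub>R z \<in> D \<inter> \<Gamma>" using m C x \<Gamma> by blast
    then obtain w \<tau> where w: "w \<in> W" "\<tau> \<ge> 0" "x + lo *\<^sub>R z = w + \<tau> *\<^sub>R z" using W(1) by blast
    have "w = x + (lo - \<tau>) *\<^sub>R z" using w(3) by (simp add: algebra_simps)
    moreover have "w \<in> C" "w \<in> C'" using w W by auto
    ultimately have "lo \<le> lo - \<tau>" "lo' \<le> lo - \<tau>" using c c' by auto
    thus ?thesis using w(2) by linarith
  qed
  moreover have "lo \<le> lo'"
  proof -
    have m: "x + lo' *\<^sub>R z \<in> C'" using c' l(1) by simp
    have "x + lo' *\<^sub>R z \<in> D \<inter> \<Gamma>" using m C x \<Gamma> by blast
    then obtain w \<tau> where w: "w \<in> W" "\<tau> \<ge> 0" "x + lo' *\<^sub>R z = w + \<tau> *\<^sub>R z" using W(1) by blast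
    have "w = x + (lo' - \<tau>) *\<^sub>R z" using w(3) by (simp add: algebra_simps)
    moreover have "w \<in> C" "w \<in> C'" using w W by auto
    ultimately have "lo' \<le> lo' - \<tau>" "lo \<le> lo' - \<tau>" using c c' by auto
    thus ?thesis using w(2) by linarith
  qed
  ultimately have "lo = lo'" by simp
  moreover have "lo \<le> 0 \<and> 0 \<le> hi" using c[of 0] x by simp
  ultimately show "x \<in> C'" using c'[of 0] by simp
qed

text \<open>From a point beyond the chord, moving towards \<open>z\<close> leads across the chord,
  which lies in both cones, into the region of agreement, where both columns end. Equal upper ends
  and equal lengths give equal lower ends.\<close>

lemma chord_finish:
  assumes C: "hcone C" "C \<subseteq> D" and D: "convex D" "cone D"
    and z: "z \<notin> C" "z$3 \<ge> 0" "z \<noteq> 0" "z \<in> D" and X: "xray_le z C C'"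
    and g: "g \<bullet> z > 0" and eq: "\<forall>x. g \<bullet> x \<ge> 0 \<longrightarrow> (x \<in> C \<longleftrightarrow> x \<in> C')"
    and ch: "\<forall>x\<in>D. g \<bullet> x = 0 \<longrightarrow> x \<in> C \<and> x \<in> C'"
  shows "C \<subseteq> C'"
proof
  fix x assume x: "x \<in> C"
  show "x \<in> C'"
  proof (cases "g \<bullet> x \<ge> 0")
    case True thus ?thesis using eq x by blast
  next
    case False
    define t where "t = - (g \<bullet> x) / (g \<bullet> z)"
    have t: "t > 0" using False g unfolding t_def by (intro divide_pos_pos) auto
    have gt: "g \<bullet> (x + s *\<^sub>R z) = (s - t) * (g \<bullet> z)" for s
      using g by (simp add: t_def inner_add_right field_simps)
    have "x + t *\<^sub>R z \<in> D"
    proof -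
      have "t *\<^sub>R z \<in> D" using D(2) z(4) t by (auto simp: cone_def)
      thus ?thesis using D C x convex_cone[of D] by blast
    qed
    hence m: "x + t *\<^sub>R z \<in> C" "x + t *\<^sub>R z \<in> C'" using ch gt[of t] by auto
    obtain lo hi lo' where l: "lo \<le> hi" "{\<tau>. x + \<tau> *\<^sub>R z \<in> C} = {lo..hi}" "{\<tau>. x + \<tau> *\<^sub>R z \<in> C'} = {lo'..lo' + (hi - lo)}"
      by (rule xray_columns[OF C(1) z(1-3) X m(1)])
    have c: "x + \<tau> *\<^sub>R z \<in> C \<longleftrightarrow> lo \<le> \<tau> \<and> \<tau> \<le> hi" and c': "x + \<tau> *\<^sub>R z \<in> C' \<longleftrightarrow> lo' \<le> \<tau> \<and> \<tau> \<le> lo' + (hi - lo)" for \<tau>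
      using l(2,3) by auto
    have e: "x + \<tau> *\<^sub>R z \<in> C \<longleftrightarrow> x + \<tau> *\<^sub>R z \<in> C'" if "\<tau> \<ge> t" for \<tau>
      using eq gt[of \<tau>] that g by simp
    have "t \<le> hi" "t \<le> lo' + (hi - lo)" using m c c' by auto
    have "x + hi *\<^sub>R z \<in> C" using c[of hi] l(1) by simp
    hence h1: "x + hi *\<^sub>R z \<in> C'" using e[OF \<open>t \<le> hi\<close>] by blast
    have "x + (lo' + (hi - lo)) *\<^sub>R z \<in> C'" using c'[of "lo' + (hi - lo)"] l(1) by simp
    hence h2: "x + (lo' + (hi - lo)) *\<^sub>R z \<in> C" using e[OF \<open>t \<le> lo' + (hi - lo)\<close>] by blast
    have "hi \<le> lo' + (hi - lo)" "lo' + (hi - lo) \<le> hi" using c[THEN iffD1, OF h2] c'[THEN iffD1, OF h1] by simp_all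
    hence "lo' = lo" by simp
    moreover have "lo \<le> 0 \<and> 0 \<le> hi" using c[of 0] x by simp
    ultimately show ?thesis using c'[of 0] by simp
  qed
qed

text \<open>Near the vertical functional the transform of \<open>C\<close> is positive and finite
  and can be cancelled, so the transforms of \<open>A\<close> and \<open>A'\<close> agree there. A
  point \<open>x\<close> of \<open>A\<close> outside \<open>A'\<close> is separated from
  \<open>A'\<close> by \<open>a\<close>. Along a direction in the kernel of \<open>a\<close> the
  column of \<open>x\<close> misses \<open>A'\<close>, although the X-rays in this direction
  agree.\<close>

lemma lap_eq_cancel:
  assumes H: "hcone A" "hcone A'" "hcone C" and L: "lap_eq A C A' C"
  shows "A \<subseteq> A'"
proof
  fix x assume x: "x \<in> A"
  show "x \<in> A'"
  proof (rule ccontr)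
    assume nx: "x \<notin> A'"
    define e3 where "e3 = (vector [0, 0, 1] :: real^3)"
    have e3: "e3 \<bullet> y = y$3" for y by (simp add: e3_def inner_vec_def sum_3)
    have coer: "\<exists>c>0. \<forall>y\<in>K. y$3 \<ge> c * norm y" if "hcone K" for K
    proof -
      have "\<And>y. y \<in> K \<Longrightarrow> y \<noteq> 0 \<Longrightarrow> e3 \<bullet> y > 0" using that unfolding e3 hcone_def by blast
      from cone_coercive[OF hcone_closed[OF that] hcone_cone[OF that] this] show ?thesis unfolding e3 by metis
    qed
    obtain c1 c2 c3 where c: "c1 > 0" "\<forall>y\<in>A. y$3 \<ge> c1 * norm y" "c2 > 0" "\<forall>y\<in>A'. y$3 \<ge> c2 * norm y"
      "c3 > 0" "\<forall>y\<in>C. y$3 \<ge> c3 * norm y" using coer[OF H(1)] coer[OF H(2)] coer[OF H(3)] by blast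
    define c0 where "c0 = min c1 (min c2 c3)"
    have c0: "c0 > 0" using c by (simp add: c0_def)
    have cK: "y$3 \<ge> c0 * norm y" if "y \<in> A \<or> y \<in> A' \<or> y \<in> C" for y
    proof -
      have "c0 * norm y \<le> k * norm y" if "c0 \<le> k" for k using that by (intro mult_right_mono) auto
      thus ?thesis using that c unfolding c0_def by (meson min.cobounded1 min.cobounded2 order_trans)
    qed
    obtain a b where ab: "a \<bullet> x < b" "\<And>y. y \<in> A' \<Longrightarrow> a \<bullet> y > b"
      using separating_hyperplane_closed_point[OF hcone_convex[OF H(2)] hcone_closed[OF H(2)] nx] by blast
    have b0: "b < 0" using ab(2)[OF hcone_zero[OF H(2)]] by simp
    \<comment> \<open>A point with negative value could be scaled to the level \<open>b\<close>,
      which \<open>A'\<close> stays strictly above.\<close>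
    have an: "a \<bullet> y \<ge> 0" if "y \<in> A'" for y
    proof (rule ccontr)
      assume "\<not> a \<bullet> y \<ge> 0"
      hence "(b / (a \<bullet> y)) *\<^sub>R y \<in> A'" using b0 by (intro hcone_scale[OF H(2) that]) (simp add: divide_nonpos_neg)
      from ab(2)[OF this] \<open>\<not> a \<bullet> y \<ge> 0\<close> show False by simp
    qed
    \<comment> \<open>Both vectors are horizontal, they are orthogonal, and \<open>v\<close> lies in
      the kernel of \<open>a\<close>. For a vertical \<open>a\<close> any horizontal orthogonal pair
      will do.\<close>
    define d where "d = (if a$1 = 0 \<and> a$2 = 0 then vector [1, 0, 0] else vector [a$1, a$2, 0] :: real^3)"
    define v where "v = (if a$1 = 0 \<and> a$2 = 0 then vector [0, 1, 0] else vector [- a$2, a$1, 0] :: real^3)"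
    have dv: "d \<noteq> 0" "v \<noteq> 0" "d$3 = 0" "v$3 = 0" "d \<bullet> v = 0" "a \<bullet> v = 0"
      by (auto simp: d_def v_def inner_vec_def sum_3 vec_eq_iff forall_3)
    have fr: "frame e3 d v e3"
      unfolding frame_def
    proof (intro conjI allI impI)
      show "e3 \<bullet> e3 = 1" "e3 \<bullet> d = 0" "e3 \<bullet> v = 0" using dv by (simp_all add: e3) (simp add: e3_def)
      fix y s t assume H0: "y *\<^sub>R e3 + s *\<^sub>R d + t *\<^sub>R v = 0"
      have ed: "d \<bullet> e3 = 0" "v \<bullet> e3 = 0" using dv by (simp_all add: inner_commute[of _ e3] e3)
      have "d \<bullet> (y *\<^sub>R e3 + s *\<^sub>R d + t *\<^sub>R v) = 0" "v \<bullet> (y *\<^sub>R e3 + s *\<^sub>R d + t *\<^sub>R v) = 0" unfolding H0 by simp_all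
      hence st: "s = 0" "t = 0" using dv ed by (simp_all add: inner_add_right inner_commute[of v d])
      have "(y *\<^sub>R e3 + s *\<^sub>R d + t *\<^sub>R v) $ 3 = 0" unfolding H0 by simp
      thus "y = 0" "s = 0" "t = 0" using st dv by (simp_all add: e3_def)
    qed
    define R where "R = 1 / c0 / norm d + 1 / c0 / norm v"
    have R: "R > 0" using c0 dv by (simp add: R_def add_pos_pos)
    have bd: "- R \<le> u \<and> u \<le> R \<and> - R \<le> t \<and> t \<le> R" if m: "e3 + u *\<^sub>R d + t *\<^sub>R v \<in> A \<union> A'" for u t
    proof -
      define y where "y = e3 + u *\<^sub>R d + t *\<^sub>R v"
      have "y$3 = 1" using dv by (simp add: y_def e3_def)
      hence n: "norm y \<le> 1 / c0" using cK[of y] m c0 unfolding y_def[symmetric] by (auto simp: field_simps)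
      have i: "d \<bullet> y = u * (norm d)\<^sup>2" "v \<bullet> y = t * (norm v)\<^sup>2"
        using dv e3[of d] e3[of v] by (simp_all add: y_def inner_add_right inner_commute power2_norm_eq_inner)
      have "\<bar>u\<bar> * norm d * norm d \<le> norm y * norm d" using Cauchy_Schwarz_ineq2[of d y] unfolding i by (simp add: abs_mult power2_eq_square mult_ac)
      hence 1: "\<bar>u\<bar> * norm d \<le> 1 / c0" using n dv by simp
      have "\<bar>t\<bar> * norm v * norm v \<le> norm y * norm v" using Cauchy_Schwarz_ineq2[of v y] unfolding i by (simp add: abs_mult power2_eq_square mult_ac)
      hence 2: "\<bar>t\<bar> * norm v \<le> 1 / c0" using n dv by simp
      have "0 < norm d" "0 < norm v" using dv by simp_all
      from pos_le_divide_eq[THEN iffD2, OF this(1) 1] pos_le_divide_eq[THEN iffD2, OF this(2) 2]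
      have "\<bar>u\<bar> \<le> 1 / c0 / norm d" "\<bar>t\<bar> \<le> 1 / c0 / norm v" .
      moreover have "0 \<le> 1 / c0 / norm d" "0 \<le> 1 / c0 / norm v" using c0 by simp_all
      ultimately show ?thesis unfolding R_def by linarith
    qed
    \<comment> \<open>The first bound keeps the kernel away from 0 on the section; the second keeps
      the perturbed functional positive on \<open>C\<close>.\<close>
    define \<epsilon> where "\<epsilon> = min (1 / (2 * R)) (c0 * norm d / 2)"
    have e: "0 < \<epsilon>" "\<epsilon> * R \<le> 1/2" "\<epsilon> \<le> c0 * norm d / 2"
    proof -
      show "0 < \<epsilon>" using R c0 dv by (simp add: \<epsilon>_def)
      have "\<epsilon> \<le> 1 / (2 * R)" by (simp add: \<epsilon>_def)
      thus "\<epsilon> * R \<le> 1/2" using R by (simp add: pos_le_divide_eq mult_ac)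
      show "\<epsilon> \<le> c0 * norm d / 2" by (simp add: \<epsilon>_def)
    qed
    obtain \<kappa> where k: "0 < \<kappa>"
      "\<And>K \<xi>. closed K \<Longrightarrow> cone K \<Longrightarrow> (\<And>y. y \<in> K \<Longrightarrow> e3 \<bullet> y \<ge> 0) \<Longrightarrow> \<xi> \<bullet> e3 = 1 \<Longrightarrow>
        (\<And>u t. e3 + u *\<^sub>R d + t *\<^sub>R v \<in> K \<Longrightarrow> 1 + (\<xi> \<bullet> d) * u + (\<xi> \<bullet> v) * t > 0) \<Longrightarrow>
        lap K \<xi> = ennreal \<kappa> * sint K e3 d v (\<xi> \<bullet> d) (\<xi> \<bullet> v)"
    proof (rule lap_frame[of e3 d v e3])
      show "y = 0 \<and> s = 0 \<and> t = 0" if "y *\<^sub>R e3 + s *\<^sub>R d + t *\<^sub>R v = 0" for y s t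
        using fr that unfolding frame_def by blast
    qed (use fr in \<open>auto simp: frame_def\<close>)
    have sq: "sint A e3 d v la 0 = sint A' e3 d v la 0" if la: "\<bar>la\<bar> < \<epsilon>" for la
    proof -
      define \<xi> where "\<xi> = e3 + (la / (d \<bullet> d)) *\<^sub>R d"
      have xi: "\<xi> \<bullet> e3 = 1" "\<xi> \<bullet> d = la" "\<xi> \<bullet> v = 0"
        using fr dv e3[of d] unfolding frame_def \<xi>_def by (simp_all add: inner_add_left inner_commute[of d e3])
      have Lk: "lap K \<xi> = ennreal \<kappa> * sint K e3 d v la 0" if K: "hcone K" "K = A \<or> K = A'" for K
      proof -
        have "lap K \<xi> = ennreal \<kappa> * sint K e3 d v (\<xi> \<bullet> d) (\<xi> \<bullet> v)"
        proof (rule k(2))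
          show "closed K" "cone K" using K hcone_closed hcone_cone by auto
          show "e3 \<bullet> y \<ge> 0" if "y \<in> K" for y using that K(1) unfolding e3 hcone_def by (cases "y = 0") auto
          show "\<xi> \<bullet> e3 = 1" by (rule xi)
          fix u t assume m: "e3 + u *\<^sub>R d + t *\<^sub>R v \<in> K"
          hence "\<bar>u\<bar> \<le> R" using bd[of u t] K(2) by (auto simp: abs_le_iff)
          hence "\<bar>la * u\<bar> \<le> \<epsilon> * R" unfolding abs_mult using la R e(1) by (intro mult_mono) auto
          thus "1 + (\<xi> \<bullet> d) * u + (\<xi> \<bullet> v) * t > 0" unfolding xi using e(2) by linarith
        qed
        thus ?thesis unfolding xi .
      qed
      have pos: "\<xi> \<bullet> y > 0" if "y \<in> C" "y \<noteq> 0" for y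
      proof -
        have e1: "\<xi> \<bullet> y = y$3 + (la / (norm d)\<^sup>2) * (d \<bullet> y)" by (simp add: \<xi>_def inner_add_left e3 power2_norm_eq_inner)
        have "\<bar>(la / (norm d)\<^sup>2) * (d \<bullet> y)\<bar> \<le> (\<bar>la\<bar> / (norm d)\<^sup>2) * (norm d * norm y)"
          unfolding abs_mult by (intro mult_mono Cauchy_Schwarz_ineq2) auto
        also have "\<dots> = (\<bar>la\<bar> / norm d) * norm y" using dv by (simp add: power2_eq_square)
        also have "\<dots> \<le> (c0 / 2) * norm y"
          using la e(3) dv by (intro mult_right_mono) (auto simp: divide_le_eq)
        also have "\<dots> < c0 * norm y" using c0 that by simp
        also have "\<dots> \<le> y$3" using cK that by blast
        finally have f: "\<bar>(la / (norm d)\<^sup>2) * (d \<bullet> y)\<bar> < y$3" .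
        have "0 < s + r" if "\<bar>r\<bar> < s" for r s :: real using that by linarith
        from this[OF f] show ?thesis unfolding e1 .
      qed
      have "0 < lap C \<xi>" by (rule lap_pos) (use H in \<open>auto simp: hcone_closed hcone_def\<close>)
      moreover have "lap C \<xi> < top"
        by (rule lap_finite[OF hcone_closed[OF H(3)] hcone_cone[OF H(3)] pos]) (use xi in auto)
      ultimately have "lap A \<xi> = lap A' \<xi>"
        using L unfolding lap_eq_def by (metis ennreal_mult_cancel_left less_irrefl mult.commute)
      thus ?thesis unfolding Lk[OF H(1) disjI1[OF refl]] Lk[OF H(2) disjI2[OF refl]] using k(1)
        by (simp add: ennreal_mult_cancel_left)
    qed
    have P: "polyhedron K" "cone K" "interior K \<noteq> {}" "\<forall>y\<in>K. e3 \<bullet> y \<ge> 0" "\<forall>y\<in>K. e3 \<bullet> y = 0 \<longrightarrow> y = 0"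
      if "hcone K" for K
    proof -
      note h = that[unfolded hcone_def]
      show "polyhedron K" "cone K" "interior K \<noteq> {}" using h by simp_all
      show "\<forall>y\<in>K. e3 \<bullet> y \<ge> 0"
      proof
        fix y assume "y \<in> K" thus "e3 \<bullet> y \<ge> 0" using h unfolding e3 by (cases "y = 0") (auto intro: less_imp_le)
      qed
      show "\<forall>y\<in>K. e3 \<bullet> y = 0 \<longrightarrow> y = 0" unfolding e3 using h by force
    qed
    have X: "xray_le v A A'"
      by (rule xray_from_sint[OF fr P[OF H(1)] P[OF H(2)] _ e(1,2)]) (use bd sq in blast)+
    have vA: "v \<notin> A" using H(1) dv unfolding hcone_def by (metis less_irrefl)
    obtain lo hi lo' where l: "lo \<le> hi" "{\<tau>. x + \<tau> *\<^sub>R v \<in> A} = {lo..hi}" "{\<tau>. x + \<tau> *\<^sub>R v \<in> A'} = {lo'..lo' + (hi - lo)}"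
      by (rule xray_columns[OF H(1) vA _ dv(2) X, of x 0]) (use x dv in auto)
    have "lo' \<in> {\<tau>. x + \<tau> *\<^sub>R v \<in> A'}" unfolding l(3) using l(1) by simp
    hence "a \<bullet> (x + lo' *\<^sub>R v) \<ge> 0" using an by simp
    thus False using ab(1) b0 dv(6) by (simp add: inner_add_right)
  qed
qed

section \<open>Germs of columns\<close>

text \<open>For small positive arguments the lexicographically largest pair of value and slope
  dominates.\<close>

lemma max_affine_germ:
  fixes S :: "(real \<times> real) set"
  assumes "finite S" "S \<noteq> {}"
  obtains j \<delta> where "j \<in> S" "\<delta> > 0" "\<forall>\<epsilon>. 0 \<le> \<epsilon> \<longrightarrow> \<epsilon> \<le> \<delta> \<longrightarrow> (\<forall>i\<in>S. fst i + snd i * \<epsilon> \<le> fst j + snd j * \<epsilon>)"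
proof -
  have pair: "\<exists>\<delta>>0. \<forall>\<epsilon>. 0 \<le> \<epsilon> \<longrightarrow> \<epsilon> \<le> \<delta> \<longrightarrow> fst i + snd i * \<epsilon> \<le> fst j + snd j * \<epsilon>"
    if "fst i < fst j \<or> fst i = fst j \<and> snd i \<le> snd j" for i j :: "real \<times> real"
    using that
  proof
    assume h: "fst i < fst j"
    define \<delta> where "\<delta> = (fst j - fst i) / (\<bar>snd i - snd j\<bar> + 1)"
    show ?thesis
    proof (intro exI[of _ \<delta>] conjI allI impI)
      show "\<delta> > 0" using h by (simp add: \<delta>_def)
      fix \<epsilon> :: real assume e: "0 \<le> \<epsilon>" "\<epsilon> \<le> \<delta>"
      have "(snd i - snd j) * \<epsilon> \<le> (\<bar>snd i - snd j\<bar> + 1) * \<epsilon>" using e by (intro mult_right_mono) auto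
      also have "\<dots> \<le> (\<bar>snd i - snd j\<bar> + 1) * \<delta>" using e by (intro mult_left_mono) auto
      also have "\<dots> = fst j - fst i" by (simp add: \<delta>_def)
      finally show "fst i + snd i * \<epsilon> \<le> fst j + snd j * \<epsilon>" by (simp add: left_diff_distrib)
    qed
  next
    assume "fst i = fst j \<and> snd i \<le> snd j"
    thus ?thesis by (intro exI[of _ 1]) (simp add: mult_right_mono)
  qed
  have "\<exists>j\<in>S. \<exists>\<delta>>0. \<forall>\<epsilon>. 0 \<le> \<epsilon> \<longrightarrow> \<epsilon> \<le> \<delta> \<longrightarrow> (\<forall>i\<in>S. fst i + snd i * \<epsilon> \<le> fst j + snd j * \<epsilon>)"
    using assms
  proof (induction S rule: finite_ne_induct)
    case (singleton x)
    show ?case by (intro bexI[of _ x] exI[of _ 1]) auto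
  next
    case (insert x S)
    then obtain j \<delta> where j: "j \<in> S" "\<delta> > 0" "\<forall>\<epsilon>. 0 \<le> \<epsilon> \<longrightarrow> \<epsilon> \<le> \<delta> \<longrightarrow> (\<forall>i\<in>S. fst i + snd i * \<epsilon> \<le> fst j + snd j * \<epsilon>)" by blast
    show ?case
    proof (cases "fst x < fst j \<or> fst x = fst j \<and> snd x \<le> snd j")
      case True
      then obtain \<delta>' where "\<delta>' > 0" "\<forall>\<epsilon>. 0 \<le> \<epsilon> \<longrightarrow> \<epsilon> \<le> \<delta>' \<longrightarrow> fst x + snd x * \<epsilon> \<le> fst j + snd j * \<epsilon>" using pair[of x j] by blast
      thus ?thesis using j by (intro bexI[of _ j] exI[of _ "min \<delta> \<delta>'"]) auto
    next
      case False
      hence "fst j < fst x \<or> fst j = fst x \<and> snd j \<le> snd x" by linarith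
      then obtain \<delta>' where d: "\<delta>' > 0" "\<forall>\<epsilon>. 0 \<le> \<epsilon> \<longrightarrow> \<epsilon> \<le> \<delta>' \<longrightarrow> fst j + snd j * \<epsilon> \<le> fst x + snd x * \<epsilon>" using pair[of j x] by blast
      show ?thesis
      proof (intro bexI[of _ x] exI[of _ "min \<delta> \<delta>'"] conjI allI impI ballI)
        fix \<epsilon> i assume e: "0 \<le> \<epsilon>" "\<epsilon> \<le> min \<delta> \<delta>'" "i \<in> insert x S"
        show "fst i + snd i * \<epsilon> \<le> fst x + snd x * \<epsilon>"
        proof (cases "i = x")
          case False
          hence "fst i + snd i * \<epsilon> \<le> fst j + snd j * \<epsilon>" using j(3) e by simp
          also have "\<dots> \<le> fst x + snd x * \<epsilon>" using d(2) e by simp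
          finally show ?thesis .
        qed simp
      qed (use j d in auto)
    qed
  qed
  thus thesis using that by blast
qed

text \<open>Near the initial column each end is governed by one active inequality and therefore
  moves linearly in \<epsilon>. Inequalities that do not involve \<tau> hold on the initial column
  and at the witness for \<open>\<epsilon>1\<close>, hence in between.\<close>

lemma column_germ:
  fixes c0 e z :: "real^3"
  assumes K: "polyhedron K" and lh: "lo < hi" and c: "\<forall>\<tau>. c0 + \<tau> *\<^sub>R z \<in> K \<longleftrightarrow> lo \<le> \<tau> \<and> \<tau> \<le> hi"
    and w: "0 < \<epsilon>1" "c0 + \<epsilon>1 *\<^sub>R e + \<tau>1 *\<^sub>R z \<in> K"
  obtains s t \<epsilon>0 where "\<epsilon>0 > 0" "\<forall>\<epsilon> \<tau>. 0 \<le> \<epsilon> \<longrightarrow> \<epsilon> \<le> \<epsilon>0 \<longrightarrow> (c0 + \<epsilon> *\<^sub>R e + \<tau> *\<^sub>R z \<in> K \<longleftrightarrow> lo + t * \<epsilon> \<le> \<tau> \<and> \<tau> \<le> hi + s * \<epsilon>)"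
proof -
  obtain I where I: "finite I" and mI: "\<And>u t. c0 + u *\<^sub>R e + t *\<^sub>R z \<in> K \<longleftrightarrow> (\<forall>i\<in>I. fst i * u + fst (snd i) * t \<le> snd (snd i))"
    using polyhedron_section_ineqs[OF K] by blast
  define N where "N = {i\<in>I. fst (snd i) < 0}"
  define P where "P = {i\<in>I. fst (snd i) > 0}"
  define L where "L = (\<lambda>i. (snd (snd i) / fst (snd i), - (fst i / fst (snd i)))) ` N"
  define U where "U = (\<lambda>i. (- (snd (snd i) / fst (snd i)), fst i / fst (snd i))) ` P"
  have m0: "lo \<le> t \<and> t \<le> hi \<longleftrightarrow> (\<forall>i\<in>I. fst (snd i) * t \<le> snd (snd i))" for t
    using mI[of 0 t] c by simp
  have Nne: "N \<noteq> {}"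
  proof
    assume "N = {}"
    hence "\<not> (i \<in> I \<and> fst (snd i) < 0)" for i unfolding N_def by blast
    hence "fst (snd i) \<ge> 0" if "i \<in> I" for i using that by (meson not_le)
    hence "\<forall>i\<in>I. fst (snd i) * (lo - 1) \<le> fst (snd i) * lo" by (intro ballI mult_left_mono) auto
    hence "\<forall>i\<in>I. fst (snd i) * (lo - 1) \<le> snd (snd i)" using m0[of lo] lh by force
    thus False using m0[of "lo - 1"] by simp
  qed
  have Pne: "P \<noteq> {}"
  proof
    assume "P = {}"
    hence "\<not> (i \<in> I \<and> fst (snd i) > 0)" for i unfolding P_def by blast
    hence "fst (snd i) \<le> 0" if "i \<in> I" for i using that by (meson not_le)
    hence "\<forall>i\<in>I. fst (snd i) * (hi + 1) \<le> fst (snd i) * hi" by (intro ballI mult_left_mono_neg) auto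
    hence "\<forall>i\<in>I. fst (snd i) * (hi + 1) \<le> snd (snd i)" using m0[of hi] lh by force
    thus False using m0[of "hi + 1"] by simp
  qed
  obtain j \<delta> where j: "j \<in> L" "\<delta> > 0" "\<forall>\<epsilon>. 0 \<le> \<epsilon> \<longrightarrow> \<epsilon> \<le> \<delta> \<longrightarrow> (\<forall>i\<in>L. fst i + snd i * \<epsilon> \<le> fst j + snd j * \<epsilon>)"
    by (rule max_affine_germ[of L]) (use I Nne in \<open>auto simp: L_def N_def\<close>)
  obtain k \<delta>' where k: "k \<in> U" "\<delta>' > 0" "\<forall>\<epsilon>. 0 \<le> \<epsilon> \<longrightarrow> \<epsilon> \<le> \<delta>' \<longrightarrow> (\<forall>i\<in>U. fst i + snd i * \<epsilon> \<le> fst k + snd k * \<epsilon>)"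
    by (rule max_affine_germ[of U]) (use I Pne in \<open>auto simp: U_def P_def\<close>)
  have ineq: "fst i * \<epsilon> + fst (snd i) * \<tau> \<le> snd (snd i) \<longleftrightarrow> snd (snd i) / fst (snd i) + - (fst i / fst (snd i)) * \<epsilon> \<le> \<tau>"
    if "i \<in> N" for i \<epsilon> \<tau>
  proof -
    have g: "a * \<epsilon> + b * \<tau> \<le> c \<longleftrightarrow> c / b + - (a / b) * \<epsilon> \<le> \<tau>" if "b < 0" for a b c :: real
    proof -
      have "c / b + - (a / b) * \<epsilon> = (c - a * \<epsilon>) / b" using that by (simp add: field_simps)
      thus ?thesis using that by (simp add: neg_divide_le_eq mult.commute algebra_simps)
    qed
    show ?thesis by (rule g) (use that in \<open>simp add: N_def\<close>)
  qed
  have ineq': "fst i * \<epsilon> + fst (snd i) * \<tau> \<le> snd (snd i) \<longleftrightarrow> - (snd (snd i) / fst (snd i)) + fst i / fst (snd i) * \<epsilon> \<le> - \<tau>"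
    if "i \<in> P" for i \<epsilon> \<tau>
  proof -
    have g: "a * \<epsilon> + b * \<tau> \<le> c \<longleftrightarrow> - (c / b) + (a / b) * \<epsilon> \<le> - \<tau>" if "b > 0" for a b c :: real
    proof -
      have "- (c / b) + (a / b) * \<epsilon> = (a * \<epsilon> - c) / b" using that by (simp add: field_simps)
      thus ?thesis using that by (simp add: pos_divide_le_eq mult.commute) linarith
    qed
    show ?thesis by (rule g) (use that in \<open>simp add: P_def\<close>)
  qed
  define \<epsilon>0 where "\<epsilon>0 = min (min \<delta> \<delta>') \<epsilon>1"
  have main: "c0 + \<epsilon> *\<^sub>R e + \<tau> *\<^sub>R z \<in> K \<longleftrightarrow> fst j + snd j * \<epsilon> \<le> \<tau> \<and> fst k + snd k * \<epsilon> \<le> - \<tau>" if e: "0 \<le> \<epsilon>" "\<epsilon> \<le> \<epsilon>0" for \<epsilon> \<tau>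
  proof -
    have "(\<forall>i\<in>L. fst i + snd i * \<epsilon> \<le> \<tau>) \<longleftrightarrow> fst j + snd j * \<epsilon> \<le> \<tau>" using j e unfolding \<epsilon>0_def by force
    hence l: "(\<forall>i\<in>N. fst i * \<epsilon> + fst (snd i) * \<tau> \<le> snd (snd i)) \<longleftrightarrow> fst j + snd j * \<epsilon> \<le> \<tau>"
      unfolding L_def by (simp add: ineq)
    have "(\<forall>i\<in>U. fst i + snd i * \<epsilon> \<le> - \<tau>) \<longleftrightarrow> fst k + snd k * \<epsilon> \<le> - \<tau>" using k e unfolding \<epsilon>0_def by force
    hence u: "(\<forall>i\<in>P. fst i * \<epsilon> + fst (snd i) * \<tau> \<le> snd (snd i)) \<longleftrightarrow> fst k + snd k * \<epsilon> \<le> - \<tau>"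
      unfolding U_def by (simp add: ineq')
    have zz: "fst i * \<epsilon> + fst (snd i) * \<tau> \<le> snd (snd i)" if i: "i \<in> I" "i \<notin> N" "i \<notin> P" for i
    proof -
      have b: "fst (snd i) = 0" using i by (auto simp: N_def P_def)
      have 1: "fst i * \<epsilon>1 \<le> snd (snd i)" using mI[of \<epsilon>1 \<tau>1] w i(1) b by auto
      have 0: "0 \<le> snd (snd i)" using m0[of lo] lh i(1) b by auto
      have "fst i * \<epsilon> \<le> snd (snd i)"
      proof (cases "fst i \<ge> 0")
        case True
        hence "fst i * \<epsilon> \<le> fst i * \<epsilon>1" using e by (intro mult_left_mono) (auto simp: \<epsilon>0_def)
        thus ?thesis using 1 by linarith
      next
        case False
        hence "fst i * \<epsilon> \<le> 0" using e by (simp add: mult_nonpos_nonneg)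
        thus ?thesis using 0 by linarith
      qed
      thus ?thesis using b by simp
    qed
    have "(\<forall>i\<in>I. fst i * \<epsilon> + fst (snd i) * \<tau> \<le> snd (snd i)) \<longleftrightarrow>
      (\<forall>i\<in>N. fst i * \<epsilon> + fst (snd i) * \<tau> \<le> snd (snd i)) \<and> (\<forall>i\<in>P. fst i * \<epsilon> + fst (snd i) * \<tau> \<le> snd (snd i))"
      using zz unfolding N_def P_def by blast
    thus ?thesis unfolding mI l u .
  qed
  have e0: "\<epsilon>0 > 0" using j k w by (simp add: \<epsilon>0_def)
  have z: "lo \<le> \<tau> \<and> \<tau> \<le> hi \<longleftrightarrow> fst j \<le> \<tau> \<and> fst k \<le> - \<tau>" for \<tau> using main[of 0 \<tau>] e0 c by simp
  have "fst j \<le> lo" "hi \<le> - fst k" using z[of lo] z[of hi] lh by auto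
  moreover from this have "lo \<le> fst j" "- fst k \<le> hi" using z[of "fst j"] z[of "- fst k"] lh by auto
  ultimately have lk: "fst j = lo" "fst k = - hi" by auto
  show thesis
  proof (rule that[OF e0], intro allI impI)
    fix \<epsilon> \<tau> assume e: "0 \<le> \<epsilon>" "\<epsilon> \<le> \<epsilon>0"
    show "c0 + \<epsilon> *\<^sub>R e + \<tau> *\<^sub>R z \<in> K \<longleftrightarrow> lo + snd j * \<epsilon> \<le> \<tau> \<and> \<tau> \<le> hi + (- snd k) * \<epsilon>"
      unfolding main[OF e] lk by auto
  qed
qed

lemma eventually_linear_pos:
  fixes c k :: real assumes "c > 0" shows "\<forall>\<^sub>F \<epsilon> in at_right 0. c - k * \<epsilon> > 0"
proof -
  have "((\<lambda>\<epsilon>. c - k * \<epsilon>) \<longlongrightarrow> c - k * 0) (at_right 0)" by (intro tendsto_diff tendsto_mult tendsto_const tendsto_ident_at)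
  from order_tendstoD(1)[OF this, of 0] assms show ?thesis by simp
qed

text \<open>By homogeneity a column in direction \<open>z'\<close> close to \<open>z\<close> is a
  projective image of a family of columns in direction \<open>z\<close>: the parameter \<sigma>
  rescales both the distance \<epsilon> from the plane and the position along \<open>z\<close>.
  Upper ends become lower ends, and the slopes \<open>s\<close> and \<open>t\<close> are divided by
  the positions of the ends.\<close>

lemma germ_transverse_column:
  assumes K: "hcone K" "z' \<notin> K" "z'$3 \<ge> 0" and z': "z' = M *\<^sub>R c0 + \<tau>1 *\<^sub>R z" "M > 0"
    and L: "0 < lo * M - \<tau>1" and lh: "lo < hi" and e0: "\<epsilon>0 > 0"
    and g: "\<forall>\<epsilon> \<tau>. 0 \<le> \<epsilon> \<longrightarrow> \<epsilon> \<le> \<epsilon>0 \<longrightarrow> (c0 + \<epsilon> *\<^sub>R e + \<tau> *\<^sub>R z \<in> K \<longleftrightarrow> lo + t * \<epsilon> \<le> \<tau> \<and> \<tau> \<le> hi + s * \<epsilon>)"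
  shows "\<forall>\<^sub>F \<epsilon> in at_right 0. (1 - s * \<epsilon>) / (hi * M - \<tau>1) \<le> (1 - t * \<epsilon>) / (lo * M - \<tau>1) \<and>
    {\<sigma>. (\<epsilon> *\<^sub>R e + z) + \<sigma> *\<^sub>R z' \<in> K} = {(1 - s * \<epsilon>) / (hi * M - \<tau>1) .. (1 - t * \<epsilon>) / (lo * M - \<tau>1)}"
proof -
  define Lo where "Lo = lo * M - \<tau>1"
  define Hi where "Hi = hi * M - \<tau>1"
  have LH: "0 < Lo" "Lo < Hi" using L lh z'(2) by (simp_all add: Lo_def Hi_def)
  have z0: "z' \<noteq> 0" using K hcone_zero by blast
  have "\<forall>\<^sub>F \<epsilon> in at_right 0. 0 < (\<epsilon>::real)" by (simp add: eventually_at_right_less)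
  moreover have "\<forall>\<^sub>F \<epsilon> in at_right 0. M * \<epsilon>0 - (M * s * \<epsilon>0 + Hi) * \<epsilon> > 0" using z' e0 by (intro eventually_linear_pos) simp
  moreover have "\<forall>\<^sub>F \<epsilon> in at_right 0. (Hi - Lo) - (t * Hi - s * Lo) * \<epsilon> > 0" using LH by (intro eventually_linear_pos) simp
  ultimately show ?thesis
    unfolding Lo_def[symmetric] Hi_def[symmetric]
  proof eventually_elim
    fix \<epsilon> :: real assume e: "0 < \<epsilon>" and h1: "M * \<epsilon>0 - (M * s * \<epsilon>0 + Hi) * \<epsilon> > 0" and h2: "(Hi - Lo) - (t * Hi - s * Lo) * \<epsilon> > 0"
    define A where "A = (1 - s * \<epsilon>) / Hi"
    define B where "B = (1 - t * \<epsilon>) / Lo"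
    have AB: "A < B"
    proof -
      have "(1 - s * \<epsilon>) * Lo < (1 - t * \<epsilon>) * Hi" using h2 by (simp add: algebra_simps)
      thus ?thesis using LH unfolding A_def B_def by (simp add: divide_less_eq less_divide_eq mult.commute)
    qed
    \<comment> \<open>Below this parameter the rescaled distance from the plane exceeds
      \<open>\<epsilon>0\<close> and the germ gives no information.\<close>
    define \<sigma>0 where "\<sigma>0 = \<epsilon> / (\<epsilon>0 * M)"
    have s0: "\<sigma>0 > 0" using e e0 z' by (simp add: \<sigma>0_def)
    have sA: "\<sigma>0 < A"
    proof -
      have "\<epsilon> * Hi < (1 - s * \<epsilon>) * (\<epsilon>0 * M)" using h1 by (simp add: algebra_simps)
      thus ?thesis unfolding A_def \<sigma>0_def using LH e0 z' by (simp add: divide_less_eq less_divide_eq mult.commute mult.left_commute)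
    qed
    have mem: "(\<epsilon> *\<^sub>R e + z) + \<sigma> *\<^sub>R z' \<in> K \<longleftrightarrow> A \<le> \<sigma> \<and> \<sigma> \<le> B" if s: "\<sigma>0 \<le> \<sigma>" for \<sigma>
    proof -
      define \<mu> where "\<mu> = \<sigma> * M"
      have mu: "\<mu> > 0" using s s0 z' by (simp add: \<mu>_def)
      have em: "\<epsilon> / \<mu> \<le> \<epsilon>0"
      proof -
        have "\<epsilon> = \<sigma>0 * (\<epsilon>0 * M)" using e0 z' by (simp add: \<sigma>0_def)
        also have "\<dots> \<le> \<sigma> * (\<epsilon>0 * M)" using s e0 z' by (intro mult_right_mono) auto
        finally show ?thesis using mu by (simp add: divide_le_eq \<mu>_def mult_ac)
      qed
      have "(\<epsilon> *\<^sub>R e + z) + \<sigma> *\<^sub>R z' = \<mu> *\<^sub>R (c0 + (\<epsilon> / \<mu>) *\<^sub>R e + ((1 + \<sigma> * \<tau>1) / \<mu>) *\<^sub>R z)"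
      proof -
        have "\<mu> *\<^sub>R (c0 + (\<epsilon> / \<mu>) *\<^sub>R e + ((1 + \<sigma> * \<tau>1) / \<mu>) *\<^sub>R z) = \<mu> *\<^sub>R c0 + \<epsilon> *\<^sub>R e + (1 + \<sigma> * \<tau>1) *\<^sub>R z"
          using mu by (simp add: scaleR_add_right)
        also have "\<dots> = (\<epsilon> *\<^sub>R e + z) + \<sigma> *\<^sub>R z'" unfolding z'(1) \<mu>_def by (simp add: algebra_simps)
        finally show ?thesis ..
      qed
      hence "(\<epsilon> *\<^sub>R e + z) + \<sigma> *\<^sub>R z' \<in> K \<longleftrightarrow> c0 + (\<epsilon> / \<mu>) *\<^sub>R e + ((1 + \<sigma> * \<tau>1) / \<mu>) *\<^sub>R z \<in> K"
        using cone_scale[OF hcone_cone[OF K(1)] mu] by simp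
      also have "\<dots> \<longleftrightarrow> lo + t * (\<epsilon> / \<mu>) \<le> (1 + \<sigma> * \<tau>1) / \<mu> \<and> (1 + \<sigma> * \<tau>1) / \<mu> \<le> hi + s * (\<epsilon> / \<mu>)"
        using g em mu e by simp
      also have "lo + t * (\<epsilon> / \<mu>) \<le> (1 + \<sigma> * \<tau>1) / \<mu> \<longleftrightarrow> \<sigma> \<le> B"
      proof -
        have "lo + t * (\<epsilon> / \<mu>) = (lo * \<mu> + t * \<epsilon>) / \<mu>" using mu by (simp add: field_simps)
        hence "lo + t * (\<epsilon> / \<mu>) \<le> (1 + \<sigma> * \<tau>1) / \<mu> \<longleftrightarrow> lo * \<mu> + t * \<epsilon> \<le> 1 + \<sigma> * \<tau>1" using mu by (simp add: divide_le_cancel)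
        also have "\<dots> \<longleftrightarrow> \<sigma> * Lo \<le> 1 - t * \<epsilon>" by (simp add: Lo_def \<mu>_def algebra_simps)
        also have "\<dots> \<longleftrightarrow> \<sigma> \<le> B" using LH by (simp add: B_def pos_le_divide_eq)
        finally show ?thesis .
      qed
      also have "(1 + \<sigma> * \<tau>1) / \<mu> \<le> hi + s * (\<epsilon> / \<mu>) \<longleftrightarrow> A \<le> \<sigma>"
      proof -
        have "hi + s * (\<epsilon> / \<mu>) = (hi * \<mu> + s * \<epsilon>) / \<mu>" using mu by (simp add: field_simps)
        hence "(1 + \<sigma> * \<tau>1) / \<mu> \<le> hi + s * (\<epsilon> / \<mu>) \<longleftrightarrow> 1 + \<sigma> * \<tau>1 \<le> hi * \<mu> + s * \<epsilon>" using mu by (simp add: divide_le_cancel)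
        also have "\<dots> \<longleftrightarrow> 1 - s * \<epsilon> \<le> \<sigma> * Hi" by (auto simp: Hi_def \<mu>_def algebra_simps)
        also have "\<dots> \<longleftrightarrow> A \<le> \<sigma>" using LH by (simp add: A_def pos_divide_le_eq)
        finally show ?thesis .
      qed
      finally show ?thesis by blast
    qed
    have mA: "(\<epsilon> *\<^sub>R e + z) + A *\<^sub>R z' \<in> K" using mem[of A] sA AB by simp
    obtain l h where l: "l \<le> h" "{\<tau>. (\<epsilon> *\<^sub>R e + z) + \<tau> *\<^sub>R z' \<in> K} = {l..h}" by (rule hcone_column[OF K(1,2,3) z0 mA])
    have lm: "(\<epsilon> *\<^sub>R e + z) + \<tau> *\<^sub>R z' \<in> K \<longleftrightarrow> l \<le> \<tau> \<and> \<tau> \<le> h" for \<tau> using l(2) by auto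
    have "l \<le> A" "A \<le> h" using mA lm by auto
    \<comment> \<open>The column is an interval that already breaks off just below \<open>A\<close>,
      so it cannot reappear below \<open>\<sigma>0\<close>.\<close>
    moreover have "\<not> l < A"
    proof
      assume "l < A"
      then obtain y where y: "max l \<sigma>0 < y" "y < A" using dense[of "max l \<sigma>0" A] sA by auto
      hence "(\<epsilon> *\<^sub>R e + z) + y *\<^sub>R z' \<in> K" unfolding lm using \<open>A \<le> h\<close> by simp
      thus False using mem[of y] y by simp
    qed
    ultimately have "l = A" by simp
    have f: "(\<epsilon> *\<^sub>R e + z) + \<tau> *\<^sub>R z' \<in> K \<longleftrightarrow> A \<le> \<tau> \<and> \<tau> \<le> B" for \<tau>
    proof (cases "\<sigma>0 \<le> \<tau>")
      case True thus ?thesis by (rule mem)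
    next
      case False thus ?thesis unfolding lm \<open>l = A\<close> using sA by auto
    qed
    have "{\<sigma>. (\<epsilon> *\<^sub>R e + z) + \<sigma> *\<^sub>R z' \<in> K} = {A..B}" by (rule set_eqI) (simp only: f mem_Collect_eq atLeastAtMost_iff)
    with less_imp_le[OF AB] show "(1 - s * \<epsilon>) / Hi \<le> (1 - t * \<epsilon>) / Lo \<and>
        {\<sigma>. (\<epsilon> *\<^sub>R e + z) + \<sigma> *\<^sub>R z' \<in> K} = {(1 - s * \<epsilon>) / Hi..(1 - t * \<epsilon>) / Lo}"
      unfolding A_def B_def by (rule conjI)
  qed
qed

section \<open>Where two cones with equal X-rays first differ\<close>

lemma diff_column:
  assumes C: "hcone C" "z \<notin> C" and C': "hcone C'" "z \<notin> C'" and z: "z$3 \<ge> 0"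
    and X: "xray_le z C C'" "xray_le z C' C" and x: "(x \<in> C) \<noteq> (x \<in> C')"
  obtains lo hi lo' hi' where "lo \<le> hi" "\<forall>\<tau>. x + \<tau> *\<^sub>R z \<in> C \<longleftrightarrow> lo \<le> \<tau> \<and> \<tau> \<le> hi"
    "\<forall>\<tau>. x + \<tau> *\<^sub>R z \<in> C' \<longleftrightarrow> lo' \<le> \<tau> \<and> \<tau> \<le> hi'" "hi' - lo' = hi - lo" "lo \<noteq> lo'"
proof -
  have z0: "z \<noteq> 0" using C hcone_zero by blast
  have "\<exists>lo hi lo' hi'. lo \<le> hi \<and> {\<tau>. x + \<tau> *\<^sub>R z \<in> C} = {lo..hi} \<and> {\<tau>. x + \<tau> *\<^sub>R z \<in> C'} = {lo'..hi'} \<and> hi' - lo' = hi - lo"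
  proof (cases "x \<in> C")
    case True
    obtain lo hi lo' where "lo \<le> hi" "{\<tau>. x + \<tau> *\<^sub>R z \<in> C} = {lo..hi}" "{\<tau>. x + \<tau> *\<^sub>R z \<in> C'} = {lo'..lo' + (hi - lo)}"
      by (rule xray_columns[OF C(1,2) z z0 X(1), of x 0]) (use True in simp)
    thus ?thesis by (intro exI[of _ lo] exI[of _ hi] exI[of _ lo'] exI[of _ "lo' + (hi - lo)"]) simp
  next
    case False
    obtain lo hi lo' where "lo \<le> hi" "{\<tau>. x + \<tau> *\<^sub>R z \<in> C'} = {lo..hi}" "{\<tau>. x + \<tau> *\<^sub>R z \<in> C} = {lo'..lo' + (hi - lo)}"
      by (rule xray_columns[OF C'(1,2) z z0 X(2), of x 0]) (use False x in simp)
    thus ?thesis by (intro exI[of _ lo'] exI[of _ "lo' + (hi - lo)"] exI[of _ lo] exI[of _ hi]) simp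
  qed
  then obtain lo hi lo' hi' where l: "lo \<le> hi" "{\<tau>. x + \<tau> *\<^sub>R z \<in> C} = {lo..hi}" "{\<tau>. x + \<tau> *\<^sub>R z \<in> C'} = {lo'..hi'}" "hi' - lo' = hi - lo" by blast
  have c: "x + \<tau> *\<^sub>R z \<in> C \<longleftrightarrow> lo \<le> \<tau> \<and> \<tau> \<le> hi" "x + \<tau> *\<^sub>R z \<in> C' \<longleftrightarrow> lo' \<le> \<tau> \<and> \<tau> \<le> hi'" for \<tau> using l(2,3) by auto
  have "lo \<noteq> lo'"
  proof
    assume "lo = lo'"
    hence "hi = hi'" using l(4) by simp
    thus False using x c(1)[of 0] c(2)[of 0] \<open>lo = lo'\<close> by auto
  qed
  thus thesis using that[of lo hi lo' hi'] l c by blast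
qed

text \<open>The two columns are shifted copies of one another, so the lowest and the highest point
  of their union belong to exactly one cone. A linear functional that is nonnegative at both is
  nonnegative in between.\<close>

lemma diff_column_nonneg:
  assumes C: "hcone C" "z \<notin> C" and C': "hcone C'" "z \<notin> C'" and z: "z$3 \<ge> 0"
    and X: "xray_le z C C'" "xray_le z C' C" and x: "(x \<in> C) \<noteq> (x \<in> C')"
    and \<beta>: "\<forall>y. (y \<in> C) \<noteq> (y \<in> C') \<longrightarrow> \<beta> \<bullet> y \<ge> 0" and m: "x + \<tau> *\<^sub>R z \<in> C \<union> C'"
  shows "\<beta> \<bullet> (x + \<tau> *\<^sub>R z) \<ge> 0"
proof -
  obtain lo hi lo' hi' where l: "lo \<le> hi" and c: "\<forall>\<tau>. x + \<tau> *\<^sub>R z \<in> C \<longleftrightarrow> lo \<le> \<tau> \<and> \<tau> \<le> hi"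
    and c': "\<forall>\<tau>. x + \<tau> *\<^sub>R z \<in> C' \<longleftrightarrow> lo' \<le> \<tau> \<and> \<tau> \<le> hi'" and e: "hi' - lo' = hi - lo" "lo \<noteq> lo'"
    by (rule diff_column[OF C C' z X x])
  have "(x + min lo lo' *\<^sub>R z \<in> C) \<noteq> (x + min lo lo' *\<^sub>R z \<in> C')" "(x + max hi hi' *\<^sub>R z \<in> C) \<noteq> (x + max hi hi' *\<^sub>R z \<in> C')"
    unfolding c[rule_format] c'[rule_format] using e l by (auto simp: min_def max_def)
  hence p: "0 \<le> \<beta> \<bullet> x + min lo lo' * (\<beta> \<bullet> z)" "0 \<le> \<beta> \<bullet> x + max hi hi' * (\<beta> \<bullet> z)"
    using \<beta> by (auto simp: inner_add_right)
  have t: "min lo lo' \<le> \<tau>" "\<tau> \<le> max hi hi'" using m c[rule_format, of \<tau>] c'[rule_format, of \<tau>] by auto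
  have "0 \<le> \<beta> \<bullet> x + \<tau> * (\<beta> \<bullet> z)"
  proof (cases "\<beta> \<bullet> z \<ge> 0")
    case True
    hence "min lo lo' * (\<beta> \<bullet> z) \<le> \<tau> * (\<beta> \<bullet> z)" using t by (intro mult_right_mono)
    thus ?thesis using p by linarith
  next
    case False
    hence "max hi hi' * (\<beta> \<bullet> z) \<le> \<tau> * (\<beta> \<bullet> z)" using t by (intro mult_right_mono_neg) auto
    thus ?thesis using p by linarith
  qed
  thus ?thesis by (simp add: inner_add_right)
qed

text \<open>The planes p = u m form a pencil, and \<open>u\<close> is the infimum of the quotient
  p/m over all points at which the cones differ. The last conclusion records that this infimum is
  approached.\<close>

lemma first_plane:
  assumes C: "hcone C" and m: "\<forall>x\<in>C \<union> C'. x \<noteq> 0 \<longrightarrow> m \<bullet> x > 0" and C': "hcone C'"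
    and u0: "\<forall>x. p \<bullet> x \<le> u0 * (m \<bullet> x) \<longrightarrow> (x \<in> C \<longleftrightarrow> x \<in> C')" and ne: "C \<noteq> C'"
  obtains u where "u \<ge> u0" "\<forall>y. (y \<in> C) \<noteq> (y \<in> C') \<longrightarrow> (p - u *\<^sub>R m) \<bullet> y \<ge> 0"
    "\<forall>\<epsilon>>0. \<exists>y. (y \<in> C) \<noteq> (y \<in> C') \<and> (p - u *\<^sub>R m) \<bullet> y < \<epsilon> * (m \<bullet> y)"
proof -
  define Df where "Df = {y. (y \<in> C) \<noteq> (y \<in> C')}"
  define r where "r = (\<lambda>y. p \<bullet> y / (m \<bullet> y))"
  have mp: "m \<bullet> y > 0" if "y \<in> Df" for y
  proof -
    have "y \<noteq> 0" using that hcone_zero[OF C] hcone_zero[OF C'] by (auto simp: Df_def)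
    thus ?thesis using m that by (auto simp: Df_def)
  qed
  have lb: "u0 \<le> r y" if "y \<in> Df" for y
    using u0 that mp[OF that] unfolding r_def Df_def by (simp add: le_divide_eq) (meson linear)
  have bdd: "bdd_below (r ` Df)" by (rule bdd_belowI2[OF lb])
  have Dne: "r ` Df \<noteq> {}" using ne by (auto simp: Df_def)
  define u where "u = Inf (r ` Df)"
  show thesis
  proof (rule that[of u])
    show "u0 \<le> u" unfolding u_def using Dne lb by (intro cInf_greatest) auto
    show "\<forall>y. (y \<in> C) \<noteq> (y \<in> C') \<longrightarrow> (p - u *\<^sub>R m) \<bullet> y \<ge> 0"
    proof (intro allI impI)
      fix y assume "(y \<in> C) \<noteq> (y \<in> C')"
      hence y: "y \<in> Df" by (simp add: Df_def)
      hence "u \<le> r y" unfolding u_def using bdd by (intro cInf_lower) auto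
      thus "(p - u *\<^sub>R m) \<bullet> y \<ge> 0" using mp[OF y] by (simp add: r_def le_divide_eq inner_diff_left)
    qed
    show "\<forall>\<epsilon>>0. \<exists>y. (y \<in> C) \<noteq> (y \<in> C') \<and> (p - u *\<^sub>R m) \<bullet> y < \<epsilon> * (m \<bullet> y)"
    proof (intro allI impI)
      fix \<epsilon> :: real assume "\<epsilon> > 0"
      hence "Inf (r ` Df) < u + \<epsilon>" by (simp add: u_def)
      then obtain y where y: "y \<in> Df" "r y < u + \<epsilon>" using cInf_lessD[OF Dne] by blast
      hence "p \<bullet> y < (u + \<epsilon>) * (m \<bullet> y)" using mp[OF y(1)] by (simp add: r_def divide_less_eq)
      thus "\<exists>y. (y \<in> C) \<noteq> (y \<in> C') \<and> (p - u *\<^sub>R m) \<bullet> y < \<epsilon> * (m \<bullet> y)"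
        using y(1) by (intro exI[of _ y]) (simp add: Df_def inner_diff_left algebra_simps)
    qed
  qed
qed

text \<open>Adding a small multiple of \<open>a\<close> moves \<open>x\<close> strictly to the side
  on which the cones agree; closedness of \<open>C'\<close> gives the limit.\<close>

lemma no_diff_on_first_plane:
  assumes C: "hcone C" and C': "hcone C'" and \<alpha>: "\<forall>y. (y \<in> C) \<noteq> (y \<in> C') \<longrightarrow> \<alpha> \<bullet> y \<ge> 0"
    and a: "a \<in> C" "a \<in> C'" "\<alpha> \<bullet> a < 0" and x: "x \<in> C" "\<alpha> \<bullet> x \<le> 0"
  shows "x \<in> C'"
proof -
  have "x + (1 / real (Suc n)) *\<^sub>R a \<in> C'" for n
  proof -
    have i: "x + (1 / real (Suc n)) *\<^sub>R a \<in> C" using hcone_add[OF C x(1) hcone_scale[OF C a(1)]] by simp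
    have "(1 / real (Suc n)) * (\<alpha> \<bullet> a) < 0" by (rule mult_pos_neg[OF _ a(3)]) simp
    hence "\<alpha> \<bullet> (x + (1 / real (Suc n)) *\<^sub>R a) < 0" using x(2) unfolding inner_add_right inner_scaleR_right by linarith
    thus ?thesis using \<alpha> i by (metis not_le)
  qed
  moreover have "(\<lambda>n. x + (1 / real (Suc n)) *\<^sub>R a) \<longlonglongrightarrow> x + 0 *\<^sub>R a"
    by (rule tendsto_add[OF tendsto_const tendsto_scaleR[OF LIMSEQ_Suc[OF lim_const_over_n] tendsto_const]])
  ultimately have "x + 0 *\<^sub>R a \<in> C'" by (rule closed_sequentially[OF hcone_closed[OF C']])
  thus ?thesis by simp
qed

text \<open>If \<open>\<beta>\<close> were negative at \<open>x\<close>, it would be negative on a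
  short segment from \<open>x\<close> into the side where \<open>\<alpha>\<close> is positive. A
  differing point close enough to the first plane has a column that meets this segment up to
  scaling, but on that column \<open>\<beta>\<close> is nonnegative within the cones.\<close>

lemma first_ray:
  assumes C: "hcone C" "z \<notin> C" and C': "hcone C'" "z \<notin> C'" and z: "z$3 \<ge> 0"
    and X: "xray_le z C C'" "xray_le z C' C"
    and ker: "\<forall>x. \<alpha> \<bullet> x = 0 \<longrightarrow> m \<bullet> x = 0 \<longrightarrow> (\<exists>\<tau>. x = \<tau> *\<^sub>R z)" and van: "\<alpha> \<bullet> z = 0" "m \<bullet> z = 0"
    and m: "\<forall>x\<in>C \<union> C'. x \<noteq> 0 \<longrightarrow> m \<bullet> x > 0"
    and ap: "\<forall>y. (y \<in> C) \<noteq> (y \<in> C') \<longrightarrow> \<alpha> \<bullet> y > 0" and ne: "\<forall>\<epsilon>>0. \<exists>y. (y \<in> C) \<noteq> (y \<in> C') \<and> \<alpha> \<bullet> y < \<epsilon> * (m \<bullet> y)"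
    and bt: "\<forall>y. (y \<in> C) \<noteq> (y \<in> C') \<longrightarrow> \<beta> \<bullet> y \<ge> 0" and x: "x \<in> C" "\<alpha> \<bullet> x = 0"
  shows "\<beta> \<bullet> x \<ge> 0"
proof (rule ccontr)
  assume neg: "\<not> \<beta> \<bullet> x \<ge> 0"
  hence x0: "x \<noteq> 0" by auto
  have mx: "m \<bullet> x > 0" using m x x0 by blast
  obtain y1 where y1: "(y1 \<in> C) \<noteq> (y1 \<in> C')" using ne[rule_format, of 1] by auto
  obtain d where d: "d \<in> C" "\<alpha> \<bullet> d > 0"
  proof -
    obtain lo hi lo' hi' where "lo \<le> hi" "\<forall>\<tau>. y1 + \<tau> *\<^sub>R z \<in> C \<longleftrightarrow> lo \<le> \<tau> \<and> \<tau> \<le> hi" by (rule diff_column[OF C C' z X y1])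
    hence "y1 + lo *\<^sub>R z \<in> C" by simp
    moreover have "\<alpha> \<bullet> (y1 + lo *\<^sub>R z) > 0" using ap y1 van by (simp add: inner_add_right)
    ultimately show thesis using that by blast
  qed
  have "d \<noteq> 0" using d by auto
  hence md: "m \<bullet> d > 0" using m d by blast
  \<comment> \<open>Below this parameter \<open>\<beta>\<close> stays negative along x + s
    d.\<close>
  define s0 where "s0 = - (\<beta> \<bullet> x) / (\<bar>\<beta> \<bullet> d\<bar> + 1)"
  have s0: "s0 > 0" using neg by (simp add: s0_def divide_neg_pos)
  have bs: "\<beta> \<bullet> (x + s *\<^sub>R d) < 0" if "0 \<le> s" "s < s0" for s
  proof -
    have "s * (\<beta> \<bullet> d) \<le> s * (\<bar>\<beta> \<bullet> d\<bar> + 1)" using that by (intro mult_left_mono) auto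
    also have "\<dots> < s0 * (\<bar>\<beta> \<bullet> d\<bar> + 1)" using that by (intro mult_strict_right_mono) auto
    also have "\<dots> = - (\<beta> \<bullet> x)" by (simp add: s0_def)
    finally show ?thesis by (simp add: inner_add_right)
  qed
  \<comment> \<open>The quotient of \<open>\<alpha>\<close> by \<open>m\<close> at the end of the
    segment, so that any smaller quotient is attained at some \<open>s\<close> below
    \<open>s0\<close>.\<close>
  define \<epsilon> where "\<epsilon> = s0 * (\<alpha> \<bullet> d) / (m \<bullet> x + s0 * (m \<bullet> d))"
  have den: "m \<bullet> x + s0 * (m \<bullet> d) > 0" using mx md s0 by (simp add: add_pos_pos)
  have "\<epsilon> > 0" using s0 d den by (simp add: \<epsilon>_def)
  then obtain y where y: "(y \<in> C) \<noteq> (y \<in> C')" "\<alpha> \<bullet> y < \<epsilon> * (m \<bullet> y)" using ne by blast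
  have ay: "\<alpha> \<bullet> y > 0" using ap y by blast
  have my: "m \<bullet> y > 0" using y(2) ay \<open>\<epsilon> > 0\<close> by (smt (verit) mult_nonneg_nonpos zero_less_mult_iff)
  define r where "r = (\<alpha> \<bullet> y) / (m \<bullet> y)"
  have r: "0 < r" "r < \<epsilon>" using ay my y(2) by (simp_all add: r_def divide_less_eq)
  text \<open>\<open>x + s d\<close> lies in the same half-plane bounded by the line of \<open>z\<close> as \<open>y\<close>.\<close>
  have q: "(\<alpha> \<bullet> d) - r * (m \<bullet> d) > 0"
  proof -
    have "r * (m \<bullet> x + s0 * (m \<bullet> d)) < s0 * (\<alpha> \<bullet> d)" using r(2) den by (simp add: \<epsilon>_def less_divide_eq)
    moreover have "r * (m \<bullet> x) > 0" using r mx by simp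
    ultimately have "s0 * (r * (m \<bullet> d)) < s0 * (\<alpha> \<bullet> d)" by (simp add: algebra_simps)
    thus ?thesis using s0 by simp
  qed
  define s where "s = r * (m \<bullet> x) / ((\<alpha> \<bullet> d) - r * (m \<bullet> d))"
  have s: "0 \<le> s" using r mx q by (simp add: s_def)
  have "r * (m \<bullet> x + s0 * (m \<bullet> d)) < s0 * (\<alpha> \<bullet> d)" using r(2) den by (simp add: \<epsilon>_def less_divide_eq)
  hence "s < s0" using q by (simp add: s_def divide_less_eq algebra_simps)
  define w where "w = x + s *\<^sub>R d"
  have wC: "w \<in> C" unfolding w_def using hcone_add[OF C(1) x(1) hcone_scale[OF C(1) d(1) s]] .
  have aw: "\<alpha> \<bullet> w = r * (m \<bullet> w)"
  proof -
    have "s * ((\<alpha> \<bullet> d) - r * (m \<bullet> d)) = r * (m \<bullet> x)" using q by (simp add: s_def)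
    thus ?thesis using x(2) by (simp add: w_def inner_add_right algebra_simps)
  qed
  have mw: "m \<bullet> w > 0" unfolding w_def inner_add_right inner_scaleR_right using mx md s by (simp add: add_pos_nonneg)
  define c where "c = (m \<bullet> y) / (m \<bullet> w)"
  have c: "c > 0" using my mw by (simp add: c_def)
  have "m \<bullet> (c *\<^sub>R w - y) = 0" using mw by (simp add: c_def inner_diff_right)
  moreover have "\<alpha> \<bullet> (c *\<^sub>R w - y) = 0" using mw my by (simp add: c_def inner_diff_right aw r_def)
  ultimately obtain \<tau> where "c *\<^sub>R w - y = \<tau> *\<^sub>R z" using ker by blast
  hence e: "y + \<tau> *\<^sub>R z = c *\<^sub>R w" by (simp add: algebra_simps)
  have "c *\<^sub>R w \<in> C" using hcone_scale[OF C(1) wC] c by simp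
  hence "\<beta> \<bullet> (y + \<tau> *\<^sub>R z) \<ge> 0" by (intro diff_column_nonneg[OF C C' z X y(1) bt]) (simp add: e)
  hence "\<beta> \<bullet> w \<ge> 0" using c by (simp add: e zero_le_mult_iff)
  thus False using bs[OF s \<open>s < s0\<close>] unfolding w_def by simp
qed

text \<open>A point of the plane \<open>\<alpha>\<close> = 0 with positive \<open>\<beta>\<close>
  could be moved along \<open>a\<close> until \<open>\<beta>\<close> is 0; there
  \<open>\<alpha>\<close> would be negative, against the second condition.\<close>

lemma common_first_plane:
  assumes C: "hcone C"
    and A: "\<forall>x\<in>C. \<alpha> \<bullet> x = 0 \<longrightarrow> \<beta> \<bullet> x \<ge> 0" and B: "\<forall>x\<in>C. \<beta> \<bullet> x = 0 \<longrightarrow> \<alpha> \<bullet> x \<ge> 0"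
    and a: "a \<in> C" "\<alpha> \<bullet> a < 0" "\<beta> \<bullet> a < 0" and x: "x \<in> C" "\<alpha> \<bullet> x = 0"
  shows "\<beta> \<bullet> x = 0"
proof (rule ccontr)
  assume "\<beta> \<bullet> x \<noteq> 0"
  hence b: "\<beta> \<bullet> x > 0" using A x by force
  define y where "y = x + (- (\<beta> \<bullet> x) / (\<beta> \<bullet> a)) *\<^sub>R a"
  have s: "- (\<beta> \<bullet> x) / (\<beta> \<bullet> a) > 0" using a b by (simp add: divide_pos_neg)
  have "y \<in> C" unfolding y_def by (rule hcone_add[OF C x(1) hcone_scale[OF C a(1) less_imp_le[OF s]]])
  moreover have "\<beta> \<bullet> y = 0" using a by (simp add: y_def inner_add_right inner_diff_right)
  ultimately have "\<alpha> \<bullet> y \<ge> 0" using B by blast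
  moreover have "\<alpha> \<bullet> y < 0" unfolding y_def inner_add_right inner_scaleR_right x(2) using mult_pos_neg[OF s a(2)] by simp
  ultimately show False by simp
qed

text \<open>Points of \<open>C\<close> on both sides of the plane can be pushed into the interior
  without changing side, and the segment between them crosses the plane.\<close>

lemma plane_interior_point:
  assumes C: "hcone C" and a: "a \<in> C" "\<alpha> \<bullet> a < 0" and d: "d \<in> C" "\<alpha> \<bullet> d > 0"
  obtains c where "c \<in> interior C" "\<alpha> \<bullet> c = 0"
proof -
  obtain b where b: "b \<in> interior C" using C by (auto simp: hcone_def)
  have near: "\<exists>x. x \<in> interior C \<and> \<gamma> \<bullet> x > 0" if "y \<in> C" "\<gamma> \<bullet> y > 0" for y \<gamma>
  proof -
    define e where "e = (\<gamma> \<bullet> y) / (2 * (\<bar>\<gamma> \<bullet> (y - b)\<bar> + \<gamma> \<bullet> y))"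
    have e: "0 < e" "e \<le> 1" "e * (\<bar>\<gamma> \<bullet> (y - b)\<bar> + \<gamma> \<bullet> y) = \<gamma> \<bullet> y / 2"
    proof -
      have g: "0 < p / (2 * (r + p)) \<and> p / (2 * (r + p)) \<le> 1 \<and> p / (2 * (r + p)) * (r + p) = p / 2" if "p > 0" "r \<ge> 0" for p r :: real
        using that by (auto simp: field_simps)
      show "0 < e" "e \<le> 1" "e * (\<bar>\<gamma> \<bullet> (y - b)\<bar> + \<gamma> \<bullet> y) = \<gamma> \<bullet> y / 2" unfolding e_def using g[OF that(2), of "\<bar>\<gamma> \<bullet> (y - b)\<bar>"] by auto
    qed
    have "y - e *\<^sub>R (y - b) \<in> interior C" by (rule mem_interior_convex_shrink[OF hcone_convex[OF C] b that(1) e(1,2)])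
    moreover have "\<gamma> \<bullet> (y - e *\<^sub>R (y - b)) > 0"
    proof -
      have "e * (\<gamma> \<bullet> (y - b)) \<le> e * (\<bar>\<gamma> \<bullet> (y - b)\<bar> + \<gamma> \<bullet> y)" using e that by (intro mult_left_mono) auto
      thus ?thesis using e(3) that unfolding inner_diff_right[of \<gamma> y] inner_scaleR_right by linarith
    qed
    ultimately show ?thesis by blast
  qed
  obtain x where x: "x \<in> interior C" "\<alpha> \<bullet> x > 0" using near[OF d] by blast
  obtain y where y: "y \<in> interior C" "\<alpha> \<bullet> y < 0" using near[OF a(1), of "- \<alpha>"] a(2) by auto
  define s where "s = (\<alpha> \<bullet> x) / (\<alpha> \<bullet> x - \<alpha> \<bullet> y)"
  have s: "0 < s" "s < 1" using x y by (simp_all add: s_def)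
  have "(1 - s) *\<^sub>R x + s *\<^sub>R y \<in> interior C"
    using convex_interior[OF hcone_convex[OF C]] x(1) y(1) s by (intro convexD) auto
  moreover have "\<alpha> \<bullet> ((1 - s) *\<^sub>R x + s *\<^sub>R y) = 0"
  proof -
    have "s * (\<alpha> \<bullet> x - \<alpha> \<bullet> y) = \<alpha> \<bullet> x" using x y by (simp add: s_def)
    thus ?thesis by (simp add: inner_add_right algebra_simps)
  qed
  ultimately show thesis using that by blast
qed

lemma diff_point:
  assumes C: "hcone C" "z \<notin> C" and C': "hcone C'" "z \<notin> C'" and z: "z$3 \<ge> 0"
    and X: "xray_le z C C'" "xray_le z C' C" and ne: "C \<noteq> C'" and van: "\<alpha> \<bullet> z = 0"
    and ap: "\<forall>y. (y \<in> C) \<noteq> (y \<in> C') \<longrightarrow> \<alpha> \<bullet> y > 0"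
  obtains d where "d \<in> C" "\<alpha> \<bullet> d > 0"
proof -
  obtain y where y: "(y \<in> C) \<noteq> (y \<in> C')" using ne by auto
  obtain lo hi lo' hi' where "lo \<le> hi" "\<forall>\<tau>. y + \<tau> *\<^sub>R z \<in> C \<longleftrightarrow> lo \<le> \<tau> \<and> \<tau> \<le> hi" by (rule diff_column[OF C C' z X y])
  hence "y + lo *\<^sub>R z \<in> C" by simp
  moreover have "\<alpha> \<bullet> (y + lo *\<^sub>R z) > 0" using ap y van by (simp add: inner_add_right)
  ultimately show thesis using that by blast
qed

lemma interior_ray:
  fixes c z :: "real^3"
  assumes "c \<in> interior C"
  obtains \<epsilon> where "\<epsilon> > 0" "c + \<epsilon> *\<^sub>R z \<in> C" "c - \<epsilon> *\<^sub>R z \<in> C"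
proof -
  obtain r where r: "r > 0" "ball c r \<subseteq> C" using assms mem_interior by blast
  define \<epsilon> where "\<epsilon> = r / (2 * (norm z + 1))"
  have np: "norm z + 1 > 0" by (simp add: add_nonneg_pos)
  have e: "\<epsilon> > 0" using r np by (simp add: \<epsilon>_def)
  have "\<epsilon> * norm z < \<epsilon> * (norm z + 1)" using e by simp
  also have "\<dots> = r / 2"
  proof -
    have "r / (2 * N) * N = r / 2" if "N > 0" for N using that by simp
    from this[OF np] show ?thesis unfolding \<epsilon>_def .
  qed
  finally have "\<epsilon> * norm z < r" using r by simp
  hence "c + \<epsilon> *\<^sub>R z \<in> ball c r" "c - \<epsilon> *\<^sub>R z \<in> ball c r" using e by (simp_all add: dist_norm)
  thus thesis using that e r by blast
qed

text \<open>From an interior point of the cone on the plane, small steps in the directions of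
  \<open>z\<close> and \<open>- z\<close> stay in the cone and on the plane, so
  \<open>\<beta>\<close> vanishes along \<open>z\<close>.\<close>

lemma first_plane_through:
  assumes C: "hcone C" and P: "\<forall>x\<in>C. \<alpha> \<bullet> x = 0 \<longrightarrow> \<beta> \<bullet> x = 0" and c: "c \<in> interior C" "\<alpha> \<bullet> c = 0" and z: "\<alpha> \<bullet> z = 0"
  shows "\<beta> \<bullet> z = 0"
proof -
  obtain \<epsilon> where e: "\<epsilon> > 0" "c + \<epsilon> *\<^sub>R z \<in> C" "c - \<epsilon> *\<^sub>R z \<in> C" by (rule interior_ray[OF c(1)])
  have "\<beta> \<bullet> (c + \<epsilon> *\<^sub>R z) = 0" "\<beta> \<bullet> (c - \<epsilon> *\<^sub>R z) = 0" using P[rule_format, OF e(2)] P[rule_format, OF e(3)] c z by (simp_all add: inner_add_right inner_diff_right)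
  hence "\<epsilon> * (\<beta> \<bullet> z) = 0" unfolding inner_add_right inner_diff_right inner_scaleR_right by linarith
  thus ?thesis using e by simp
qed

text \<open>If the cones differ, consider the first plane of each of the two pencils, through
  \<open>z\<close> and through \<open>w\<close>. By \<open>first_ray\<close> and
  \<open>common_first_plane\<close> they cut the same set out of \<open>C\<close>, so the first of
  them contains \<open>w\<close> too. On it the cones agree, and next to it the ends of the columns
  move linearly. Equal lengths from \<open>z\<close> make the deviations at the two ends equal, and
  equal lengths from \<open>w\<close> make them proportional to \<open>Lw\<close> and
  \<open>Hw\<close>. As these differ, both deviations vanish, and the cones agree beyond the first
  plane.\<close>

lemma two_point:
  assumes C: "hcone C" "z \<notin> C" and C': "hcone C'" "z \<notin> C'" and z: "z$3 \<ge> 0"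
    and w: "w \<notin> C" "w \<notin> C'" "w$3 \<ge> 0"
    and X: "xray_le z C C'" "xray_le z C' C" and Y: "xray_le w C C'" "xray_le w C' C"
    and van: "p \<bullet> z = 0" "m \<bullet> z = 0" and ker: "\<forall>x. p \<bullet> x = 0 \<longrightarrow> m \<bullet> x = 0 \<longrightarrow> (\<exists>\<tau>. x = \<tau> *\<^sub>R z)"
    and van': "q \<bullet> w = 0" "n \<bullet> w = 0" and ker': "\<forall>x. q \<bullet> x = 0 \<longrightarrow> n \<bullet> x = 0 \<longrightarrow> (\<exists>\<tau>. x = \<tau> *\<^sub>R w)"
    and m: "\<forall>x\<in>C \<union> C'. x \<noteq> 0 \<longrightarrow> m \<bullet> x > 0" "m \<bullet> w > 0"
    and n: "\<forall>x\<in>C \<union> C'. x \<noteq> 0 \<longrightarrow> n \<bullet> x > 0" "n \<bullet> z > 0"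
    and u0: "\<forall>x. p \<bullet> x \<le> u0 * (m \<bullet> x) \<longrightarrow> (x \<in> C \<longleftrightarrow> x \<in> C')"
    and v0: "\<forall>x. q \<bullet> x \<le> v0 * (n \<bullet> x) \<longrightarrow> (x \<in> C \<longleftrightarrow> x \<in> C')"
    and a: "a \<in> C" "a \<in> C'" "p \<bullet> a < u0 * (m \<bullet> a)" "q \<bullet> a < v0 * (n \<bullet> a)"
  shows "C = C'"
proof (rule ccontr)
  assume ne: "C \<noteq> C'"
  obtain u where u: "u \<ge> u0" "\<forall>y. (y \<in> C) \<noteq> (y \<in> C') \<longrightarrow> (p - u *\<^sub>R m) \<bullet> y \<ge> 0"
    "\<forall>\<epsilon>>0. \<exists>y. (y \<in> C) \<noteq> (y \<in> C') \<and> (p - u *\<^sub>R m) \<bullet> y < \<epsilon> * (m \<bullet> y)" by (rule first_plane[OF C(1) m(1) C'(1) u0 ne])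
  obtain v where v: "v \<ge> v0" "\<forall>y. (y \<in> C) \<noteq> (y \<in> C') \<longrightarrow> (q - v *\<^sub>R n) \<bullet> y \<ge> 0"
    "\<forall>\<epsilon>>0. \<exists>y. (y \<in> C) \<noteq> (y \<in> C') \<and> (q - v *\<^sub>R n) \<bullet> y < \<epsilon> * (n \<bullet> y)" by (rule first_plane[OF C(1) n(1) C'(1) v0 ne])
  define \<alpha> where "\<alpha> = p - u *\<^sub>R m"
  define \<beta> where "\<beta> = q - v *\<^sub>R n"
  note u = u[folded \<alpha>_def] and v = v[folded \<beta>_def]
  have a0: "a \<noteq> 0" using a by auto
  have \<alpha>a: "\<alpha> \<bullet> a < 0"
  proof -
    have "u0 * (m \<bullet> a) \<le> u * (m \<bullet> a)" using u(1) m(1) a a0 by (intro mult_right_mono) (auto intro: less_imp_le)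
    thus ?thesis using a(3) by (simp add: \<alpha>_def inner_diff_left)
  qed
  have \<beta>a: "\<beta> \<bullet> a < 0"
  proof -
    have "v0 * (n \<bullet> a) \<le> v * (n \<bullet> a)" using v(1) n(1) a a0 by (intro mult_right_mono) (auto intro: less_imp_le)
    thus ?thesis using a(4) by (simp add: \<beta>_def inner_diff_left)
  qed
  have swp: "\<forall>y. (y \<in> C') \<noteq> (y \<in> C) \<longrightarrow> Q y" if "\<forall>y. (y \<in> C) \<noteq> (y \<in> C') \<longrightarrow> Q y" for Q :: "real^3 \<Rightarrow> bool" using that by blast
  have swe: "\<forall>\<epsilon>>0. \<exists>y. (y \<in> C') \<noteq> (y \<in> C) \<and> Q \<epsilon> y" if "\<forall>\<epsilon>>0. \<exists>y. (y \<in> C) \<noteq> (y \<in> C') \<and> Q \<epsilon> y" for Q :: "real \<Rightarrow> real^3 \<Rightarrow> bool" using that by blast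
  have strict: "\<forall>y. (y \<in> C) \<noteq> (y \<in> C') \<longrightarrow> \<gamma> \<bullet> y > 0"
    if g: "\<forall>y. (y \<in> C) \<noteq> (y \<in> C') \<longrightarrow> \<gamma> \<bullet> y \<ge> 0" "\<gamma> \<bullet> a < 0" for \<gamma>
  proof (intro allI impI)
    fix y assume y: "(y \<in> C) \<noteq> (y \<in> C')"
    show "\<gamma> \<bullet> y > 0"
    proof (rule ccontr)
      assume "\<not> \<gamma> \<bullet> y > 0"
      hence le: "\<gamma> \<bullet> y \<le> 0" by simp
      show False using y no_diff_on_first_plane[OF C(1) C'(1) g(1) a(1,2) g(2) _ le]
        no_diff_on_first_plane[OF C'(1) C(1) swp[OF g(1)] a(2,1) g(2) _ le] by blast
    qed
  qed
  note ap = strict[OF u(2) \<alpha>a] and bp = strict[OF v(2) \<beta>a]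
  have \<alpha>z: "\<alpha> \<bullet> z = 0" using van by (simp add: \<alpha>_def inner_diff_left)
  have \<beta>w: "\<beta> \<bullet> w = 0" using van' by (simp add: \<beta>_def inner_diff_left)
  have kz: "\<forall>x. \<alpha> \<bullet> x = 0 \<longrightarrow> m \<bullet> x = 0 \<longrightarrow> (\<exists>\<tau>. x = \<tau> *\<^sub>R z)" using ker by (simp add: \<alpha>_def inner_diff_left)
  have kw: "\<forall>x. \<beta> \<bullet> x = 0 \<longrightarrow> n \<bullet> x = 0 \<longrightarrow> (\<exists>\<tau>. x = \<tau> *\<^sub>R w)" using ker' by (simp add: \<beta>_def inner_diff_left)
  have r1: "\<forall>x\<in>C. \<alpha> \<bullet> x = 0 \<longrightarrow> \<beta> \<bullet> x \<ge> 0"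
    using first_ray[OF C C' z X kz \<alpha>z van(2) m(1) ap u(3) v(2)] by blast
  have r2: "\<forall>x\<in>C. \<beta> \<bullet> x = 0 \<longrightarrow> \<alpha> \<bullet> x \<ge> 0"
    using first_ray[OF C(1) w(1) C'(1) w(2,3) Y kw \<beta>w van'(2) n(1) bp v(3) u(2)] by blast
  have s1: "\<forall>x\<in>C. \<alpha> \<bullet> x = 0 \<longrightarrow> \<beta> \<bullet> x = 0" using common_first_plane[OF C(1) r1 r2 a(1) \<alpha>a \<beta>a] by blast
  have s2: "\<forall>x\<in>C. \<beta> \<bullet> x = 0 \<longrightarrow> \<alpha> \<bullet> x = 0" using common_first_plane[OF C(1) r2 r1 a(1) \<beta>a \<alpha>a] by blast
  obtain d where d: "d \<in> C" "\<alpha> \<bullet> d > 0" by (rule diff_point[OF C C' z X ne \<alpha>z ap])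
  obtain d' where d': "d' \<in> C'" "\<alpha> \<bullet> d' > 0" by (rule diff_point[OF C' C z X(2,1) ne[symmetric] \<alpha>z swp[OF ap]])
  obtain db where db: "db \<in> C" "\<beta> \<bullet> db > 0" by (rule diff_point[OF C(1) w(1) C'(1) w(2,3) Y ne \<beta>w bp])
  obtain c where c: "c \<in> interior C" "\<alpha> \<bullet> c = 0" by (rule plane_interior_point[OF C(1) a(1) \<alpha>a d])
  obtain cb where cb: "cb \<in> interior C" "\<beta> \<bullet> cb = 0" by (rule plane_interior_point[OF C(1) a(1) \<beta>a db])
  have \<alpha>w: "\<alpha> \<bullet> w = 0" by (rule first_plane_through[OF C(1) s2 cb \<beta>w])
  have nzC: "x \<noteq> 0" if "\<alpha> \<bullet> x > 0" for x using that by auto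
  have z0: "z \<noteq> 0" using C hcone_zero by blast
  have c0n: "c \<noteq> 0"
  proof
    assume "c = 0"
    then obtain \<epsilon> where "\<epsilon> > 0" "c + \<epsilon> *\<^sub>R z \<in> C" "c - \<epsilon> *\<^sub>R z \<in> C" using interior_ray[OF c(1)] by blast
    hence "z \<in> C" using cone_scale[OF hcone_cone[OF C(1)], of \<epsilon> z] \<open>c = 0\<close> by simp
    thus False using C by simp
  qed
  have mc: "m \<bullet> c > 0" using m(1) c c0n interior_subset by blast
  \<comment> \<open>Coordinates adapted to the first plane: \<open>c0\<close> lies on it at m = 1,
    and the vector \<open>e\<close> below is transversal to it, with \<open>\<alpha>\<close> = 1 and
    m = 0.\<close>
  define c0 where "c0 = (1 / (m \<bullet> c)) *\<^sub>R c"
  have c0: "\<alpha> \<bullet> c0 = 0" "m \<bullet> c0 = 1" using c mc by (simp_all add: c0_def)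
  have md: "m \<bullet> d > 0" using m(1) d nzC by blast
  have md': "m \<bullet> d' > 0" using m(1) d' nzC by blast
  define e where "e = (1 / (\<alpha> \<bullet> d)) *\<^sub>R (d - (m \<bullet> d) *\<^sub>R c0)"
  have e: "\<alpha> \<bullet> e = 1" "m \<bullet> e = 0" using d c0 by (simp_all add: e_def inner_diff_right)
  have rep: "\<exists>\<tau>. x = (m \<bullet> x) *\<^sub>R (c0 + ((\<alpha> \<bullet> x) / (m \<bullet> x)) *\<^sub>R e + \<tau> *\<^sub>R z)" if x: "m \<bullet> x > 0" for x
  proof -
    define y where "y = (1 / (m \<bullet> x)) *\<^sub>R x - c0 - ((\<alpha> \<bullet> x) / (m \<bullet> x)) *\<^sub>R e"
    have "\<alpha> \<bullet> y = 0" "m \<bullet> y = 0" using x c0 e by (simp_all add: y_def inner_diff_right)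
    then obtain \<tau> where t: "y = \<tau> *\<^sub>R z" using kz by blast
    have "c0 + ((\<alpha> \<bullet> x) / (m \<bullet> x)) *\<^sub>R e + \<tau> *\<^sub>R z = (1 / (m \<bullet> x)) *\<^sub>R x" unfolding t[symmetric] y_def by (simp add: algebra_simps)
    thus ?thesis using x by (intro exI[of _ \<tau>]) simp
  qed
  have wit: "\<exists>\<epsilon> \<tau>. \<epsilon> > 0 \<and> c0 + \<epsilon> *\<^sub>R e + \<tau> *\<^sub>R z \<in> K" if K: "hcone K" "x \<in> K" "\<alpha> \<bullet> x > 0" "m \<bullet> x > 0" for K x
  proof -
    obtain \<tau> where t: "x = (m \<bullet> x) *\<^sub>R (c0 + ((\<alpha> \<bullet> x) / (m \<bullet> x)) *\<^sub>R e + \<tau> *\<^sub>R z)" using rep[OF K(4)] by blast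
    have "c0 + ((\<alpha> \<bullet> x) / (m \<bullet> x)) *\<^sub>R e + \<tau> *\<^sub>R z \<in> K"
      using cone_scale[OF hcone_cone[OF K(1)] K(4), of "c0 + ((\<alpha> \<bullet> x) / (m \<bullet> x)) *\<^sub>R e + \<tau> *\<^sub>R z"] t K(2) by metis
    thus ?thesis using K by (intro exI[of _ "(\<alpha> \<bullet> x) / (m \<bullet> x)"] exI[of _ \<tau>]) simp
  qed
  have pl: "x \<in> C \<longleftrightarrow> x \<in> C'" if "\<alpha> \<bullet> x = 0" for x using ap that by (metis less_irrefl)
  have c0C: "c0 \<in> C" unfolding c0_def using hcone_scale[OF C(1), of c] c interior_subset mc by (metis less_imp_le subsetD zero_le_divide_1_iff)
  obtain lo hi where l: "lo \<le> hi" "{\<tau>. c0 + \<tau> *\<^sub>R z \<in> C} = {lo..hi}"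
    by (rule hcone_column[OF C z z0, of c0 0]) (use c0C in simp)
  have col: "\<forall>\<tau>. c0 + \<tau> *\<^sub>R z \<in> C \<longleftrightarrow> lo \<le> \<tau> \<and> \<tau> \<le> hi" using l(2) by auto
  have col': "\<forall>\<tau>. c0 + \<tau> *\<^sub>R z \<in> C' \<longleftrightarrow> lo \<le> \<tau> \<and> \<tau> \<le> hi" using col pl c0 \<alpha>z by (simp add: inner_add_right)
  have lh: "lo < hi"
  proof -
    obtain \<epsilon> where ee: "\<epsilon> > 0" "c + \<epsilon> *\<^sub>R z \<in> C" "c - \<epsilon> *\<^sub>R z \<in> C" by (rule interior_ray[OF c(1)])
    have "(1 / (m \<bullet> c)) *\<^sub>R (c + \<epsilon> *\<^sub>R z) \<in> C" "(1 / (m \<bullet> c)) *\<^sub>R (c - \<epsilon> *\<^sub>R z) \<in> C"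
      using hcone_scale[OF C(1)] ee mc by (simp_all add: less_imp_le)
    hence "c0 + (\<epsilon> / (m \<bullet> c)) *\<^sub>R z \<in> C" "c0 + (- (\<epsilon> / (m \<bullet> c))) *\<^sub>R z \<in> C" by (simp_all add: c0_def algebra_simps)
    hence "lo \<le> - (\<epsilon> / (m \<bullet> c))" "\<epsilon> / (m \<bullet> c) \<le> hi" using col by blast+
    moreover have "\<epsilon> / (m \<bullet> c) > 0" using ee mc by simp
    ultimately show ?thesis by linarith
  qed
  define M where "M = m \<bullet> w"
  have M: "M > 0" using m(2) by (simp add: M_def)
  have "\<alpha> \<bullet> (w - M *\<^sub>R c0) = 0" "m \<bullet> (w - M *\<^sub>R c0) = 0" using \<alpha>w c0 by (simp_all add: inner_diff_right M_def)
  then obtain \<tau>1 where "w - M *\<^sub>R c0 = \<tau>1 *\<^sub>R z" using kz by blast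
  hence wr: "w = M *\<^sub>R c0 + \<tau>1 *\<^sub>R z" by (simp add: algebra_simps)
  \<comment> \<open>The functional \<open>n\<close> is 0 at \<open>w\<close> and positive at
    \<open>z\<close> and on the cones, which puts the whole column on one side of
    \<open>w\<close>.\<close>
  have Lo: "0 < lo * M - \<tau>1"
  proof -
    have i: "c0 + lo *\<^sub>R z \<in> C" using col lh by simp
    have "m \<bullet> (c0 + lo *\<^sub>R z) = 1" using c0 van by (simp add: inner_add_right)
    hence "c0 + lo *\<^sub>R z \<noteq> 0" by auto
    hence "n \<bullet> (c0 + lo *\<^sub>R z) > 0" using n i by blast
    hence "M * (n \<bullet> c0 + lo * (n \<bullet> z)) > 0" using M by (simp add: inner_add_right)
    moreover have "M * (n \<bullet> c0) + \<tau>1 * (n \<bullet> z) = 0" using van'(2) unfolding wr by (simp add: inner_add_right)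
    ultimately have "(lo * M - \<tau>1) * (n \<bullet> z) > 0" by (simp add: algebra_simps)
    thus ?thesis using n(2) by (simp add: zero_less_mult_iff)
  qed
  have pC: "polyhedron C" "polyhedron C'" using C C' by (auto simp: hcone_def)
  obtain \<epsilon>1 \<tau>1' where "\<epsilon>1 > 0" "c0 + \<epsilon>1 *\<^sub>R e + \<tau>1' *\<^sub>R z \<in> C" using wit[OF C(1) d md] by blast
  then obtain s t \<epsilon>0 where g: "\<epsilon>0 > 0" "\<forall>\<epsilon> \<tau>. 0 \<le> \<epsilon> \<longrightarrow> \<epsilon> \<le> \<epsilon>0 \<longrightarrow> (c0 + \<epsilon> *\<^sub>R e + \<tau> *\<^sub>R z \<in> C \<longleftrightarrow> lo + t * \<epsilon> \<le> \<tau> \<and> \<tau> \<le> hi + s * \<epsilon>)"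
    using column_germ[OF pC(1) lh col] by metis
  obtain \<epsilon>1' \<tau>1'' where "\<epsilon>1' > 0" "c0 + \<epsilon>1' *\<^sub>R e + \<tau>1'' *\<^sub>R z \<in> C'" using wit[OF C'(1) d' md'] by blast
  then obtain s' t' \<epsilon>0' where g': "\<epsilon>0' > 0" "\<forall>\<epsilon> \<tau>. 0 \<le> \<epsilon> \<longrightarrow> \<epsilon> \<le> \<epsilon>0' \<longrightarrow> (c0 + \<epsilon> *\<^sub>R e + \<tau> *\<^sub>R z \<in> C' \<longleftrightarrow> lo + t' * \<epsilon> \<le> \<tau> \<and> \<tau> \<le> hi + s' * \<epsilon>)"
    using column_germ[OF pC(2) lh col'] by metis
  \<comment> \<open>Up to the factor \<open>M\<close>, the positions of the two ends of the column
    relative to the point where the ray of \<open>w\<close> meets its line.\<close>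
  define Lw where "Lw = lo * M - \<tau>1"
  define Hw where "Hw = hi * M - \<tau>1"
  have LH: "0 < Lw" "Lw < Hw" using Lo lh M by (simp_all add: Lw_def Hw_def)
  note T = germ_transverse_column[OF C(1) w(1,3) wr M Lo lh g, folded Lw_def Hw_def]
  note T' = germ_transverse_column[OF C'(1) w(2,3) wr M Lo lh g', folded Lw_def Hw_def]
  have "\<forall>\<^sub>F \<epsilon> in at_right (0::real). 0 < \<epsilon> \<and> s' - t' = s - t \<and> (t' - t) / Lw = (s' - s) / Hw"
  proof -
    have 1: "\<forall>\<^sub>F \<epsilon> in at_right 0. 0 < (\<epsilon>::real)" by (simp add: eventually_at_right_less)
    have 2: "\<forall>\<^sub>F \<epsilon> in at_right 0. \<epsilon>0 - 1 * \<epsilon> > 0" "\<forall>\<^sub>F \<epsilon> in at_right 0. \<epsilon>0' - 1 * \<epsilon> > 0" by (rule eventually_linear_pos[OF g(1)], rule eventually_linear_pos[OF g'(1)])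
    have 3: "\<forall>\<^sub>F \<epsilon> in at_right 0. (hi - lo) - (t - s) * \<epsilon> > 0" using lh by (intro eventually_linear_pos) simp
    from 1 2 3 T T' show ?thesis
    proof eventually_elim
      fix \<epsilon> :: real assume h: "0 < \<epsilon>" "\<epsilon>0 - 1 * \<epsilon> > 0" "\<epsilon>0' - 1 * \<epsilon> > 0" "(hi - lo) - (t - s) * \<epsilon> > 0"
        and t1: "(1 - s * \<epsilon>) / Hw \<le> (1 - t * \<epsilon>) / Lw \<and> {\<sigma>. \<epsilon> *\<^sub>R e + z + \<sigma> *\<^sub>R w \<in> C} = {(1 - s * \<epsilon>) / Hw..(1 - t * \<epsilon>) / Lw}"
        and t2: "(1 - s' * \<epsilon>) / Hw \<le> (1 - t' * \<epsilon>) / Lw \<and> {\<sigma>. \<epsilon> *\<^sub>R e + z + \<sigma> *\<^sub>R w \<in> C'} = {(1 - s' * \<epsilon>) / Hw..(1 - t' * \<epsilon>) / Lw}"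
      have i: "{\<tau>. (c0 + \<epsilon> *\<^sub>R e) + \<tau> *\<^sub>R z \<in> C} = {lo + t * \<epsilon>..hi + s * \<epsilon>}"
        "{\<tau>. (c0 + \<epsilon> *\<^sub>R e) + \<tau> *\<^sub>R z \<in> C'} = {lo + t' * \<epsilon>..hi + s' * \<epsilon>}"
        using g(2)[rule_format, of \<epsilon>] g'(2)[rule_format, of \<epsilon>] h by auto
      have i0: "lo + t * \<epsilon> \<le> hi + s * \<epsilon>" using h(4) by (simp add: algebra_simps)
      obtain l' where l': "{lo + t' * \<epsilon>..hi + s' * \<epsilon>} = {l'..l' + (hi + s * \<epsilon> - (lo + t * \<epsilon>))}"
        using X(1) i i0 unfolding xray_le_def by metis
      hence "hi + s' * \<epsilon> - (lo + t' * \<epsilon>) = hi + s * \<epsilon> - (lo + t * \<epsilon>)" using i0 by (auto simp: Icc_eq_Icc)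
      hence "\<epsilon> * (s' - t') = \<epsilon> * (s - t)" by (simp add: algebra_simps)
      hence A: "s' - t' = s - t" using h(1) by simp
      obtain l'' where l'': "{(1 - s' * \<epsilon>) / Hw..(1 - t' * \<epsilon>) / Lw} = {l''..l'' + ((1 - t * \<epsilon>) / Lw - (1 - s * \<epsilon>) / Hw)}"
        using Y(1) t1 t2 unfolding xray_le_def by metis
      hence "(1 - t' * \<epsilon>) / Lw - (1 - s' * \<epsilon>) / Hw = (1 - t * \<epsilon>) / Lw - (1 - s * \<epsilon>) / Hw" using t1 t2 by (auto simp: Icc_eq_Icc)
      hence "\<epsilon> * ((t' - t) / Lw) = \<epsilon> * ((s' - s) / Hw)" by (simp add: diff_divide_distrib algebra_simps)
      hence "(t' - t) / Lw = (s' - s) / Hw" unfolding mult_cancel_left using h(1) by blast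
      with A h(1) show "0 < \<epsilon> \<and> s' - t' = s - t \<and> (t' - t) / Lw = (s' - s) / Hw" by blast
    qed
  qed
  from eventually_happens'[OF trivial_limit_at_right_real this]
  have st: "s' - t' = s - t" "(t' - t) / Lw = (s' - s) / Hw" by blast+
  have "s' - s = t' - t" using st(1) by linarith
  hence "(t' - t) / Lw = (t' - t) / Hw" using st(2) by simp
  hence "(t' - t) * Hw = (t' - t) * Lw" using LH by (simp add: frac_eq_eq)
  hence "t' - t = 0" unfolding mult_cancel_left using LH by auto
  hence tt: "t' = t" "s' = s" using st(1) by auto
  \<comment> \<open>Differing points approach the first plane, so one of them lies within reach of
    both germs, which are now equal.\<close>
  obtain y where y: "(y \<in> C) \<noteq> (y \<in> C')" "\<alpha> \<bullet> y < min \<epsilon>0 \<epsilon>0' * (m \<bullet> y)" using u(3)[rule_format, of "min \<epsilon>0 \<epsilon>0'"] g(1) g'(1) by auto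
  have ay: "\<alpha> \<bullet> y > 0" using ap y by blast
  hence my: "m \<bullet> y > 0" using m(1) y(1) nzC by blast
  define \<epsilon> where "\<epsilon> = (\<alpha> \<bullet> y) / (m \<bullet> y)"
  have "\<epsilon> < min \<epsilon>0 \<epsilon>0'" unfolding \<epsilon>_def pos_divide_less_eq[OF my] by (rule y(2))
  hence ey: "0 \<le> \<epsilon>" "\<epsilon> \<le> min \<epsilon>0 \<epsilon>0'" using ay my by (simp_all add: \<epsilon>_def)
  obtain \<tau> where t: "y = (m \<bullet> y) *\<^sub>R (c0 + \<epsilon> *\<^sub>R e + \<tau> *\<^sub>R z)" using rep[OF my] unfolding \<epsilon>_def by blast
  define yy where "yy = c0 + \<epsilon> *\<^sub>R e + \<tau> *\<^sub>R z"
  have "yy \<in> C \<longleftrightarrow> yy \<in> C'" unfolding yy_def using g(2) g'(2) tt ey by simp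
  hence "(m \<bullet> y) *\<^sub>R yy \<in> C \<longleftrightarrow> (m \<bullet> y) *\<^sub>R yy \<in> C'" using cone_scale[OF hcone_cone[OF C(1)] my] cone_scale[OF hcone_cone[OF C'(1)] my] by simp
  thus False using y(1) t unfolding yy_def by simp
qed

section \<open>Vertices in convex position\<close>

text \<open>The convex cone generated by a finite \<open>S\<close>; over an infinite set the sum is
  0 by convention.\<close>

definition ccone :: "(real^3) set \<Rightarrow> (real^3) set" where
  "ccone S = {x. \<exists>u. (\<forall>v\<in>S. 0 \<le> u v) \<and> x = (\<Sum>v\<in>S. u v *\<^sub>R v)}"

lemma ccone_incl:
  assumes "finite S" "v \<in> S" shows "v \<in> ccone S"
  unfolding ccone_def mem_Collect_eq
proof (intro exI[of _ "\<lambda>w. if w = v then 1 else 0"] conjI)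
  have "(\<Sum>w\<in>S. (if w = v then 1 else 0) *\<^sub>R w) = (\<Sum>w\<in>S. if w = v then w else 0)" by (rule sum.cong) auto
  also have "\<dots> = v" using assms by (simp add: sum.delta)
  finally show "v = (\<Sum>w\<in>S. (if w = v then 1 else 0) *\<^sub>R w)" ..
qed simp

lemma ccone_add: "x \<in> ccone S \<Longrightarrow> y \<in> ccone S \<Longrightarrow> x + y \<in> ccone S"
proof -
  assume "x \<in> ccone S" "y \<in> ccone S"
  then obtain u w where "\<forall>v\<in>S. 0 \<le> u v" "x = (\<Sum>v\<in>S. u v *\<^sub>R v)" "\<forall>v\<in>S. 0 \<le> w v" "y = (\<Sum>v\<in>S. w v *\<^sub>R v)" by (auto simp: ccone_def)
  thus "x + y \<in> ccone S" unfolding ccone_def mem_Collect_eq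
    by (intro exI[of _ "\<lambda>v. u v + w v"]) (auto simp: scaleR_add_left sum.distrib)
qed

lemma ccone_scale: "x \<in> ccone S \<Longrightarrow> 0 \<le> c \<Longrightarrow> c *\<^sub>R x \<in> ccone S"
proof -
  assume "x \<in> ccone S" "0 \<le> c"
  then obtain u where "\<forall>v\<in>S. 0 \<le> u v" "x = (\<Sum>v\<in>S. u v *\<^sub>R v)" by (auto simp: ccone_def)
  thus "c *\<^sub>R x \<in> ccone S" unfolding ccone_def mem_Collect_eq
    using \<open>0 \<le> c\<close> by (intro exI[of _ "\<lambda>v. c * u v"]) (auto simp: scaleR_sum_right)
qed

lemma ccone_convex_cone: "convex (ccone S)" "cone (ccone S)"
  unfolding convex_def cone_def by (auto intro: ccone_add ccone_scale)

lemma ccone_subset: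
  assumes "hcone K" "S \<subseteq> K" shows "ccone S \<subseteq> K"
proof
  fix x assume "x \<in> ccone S"
  then obtain u where u: "\<forall>v\<in>S. 0 \<le> u v" "x = (\<Sum>v\<in>S. u v *\<^sub>R v)" by (auto simp: ccone_def)
  have "(\<Sum>v\<in>T. u v *\<^sub>R v) \<in> K" if "finite T" "T \<subseteq> S" for T
    using that
  proof (induction T rule: finite_induct)
    case empty show ?case using hcone_zero[OF assms(1)] by simp
  next
    case (insert v T)
    have "u v *\<^sub>R v \<in> K" using insert assms u by (intro hcone_scale) auto
    thus ?case using insert by (simp add: hcone_add[OF assms(1)])
  qed
  thus "x \<in> K" using u hcone_zero[OF assms(1)] by (cases "finite S") auto
qed

lemma ccone_nonneg:
  assumes "x \<in> ccone S" "\<forall>v\<in>S. f \<bullet> v \<ge> 0" shows "f \<bullet> x \<ge> 0"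
proof -
  obtain u where u: "\<forall>v\<in>S. 0 \<le> u v" "x = (\<Sum>v\<in>S. u v *\<^sub>R v)" using assms by (auto simp: ccone_def)
  show ?thesis unfolding u(2) inner_sum_right using u assms by (intro sum_nonneg) simp
qed

lemma ccone_insert:
  assumes "x \<in> ccone (insert v S)" "finite S"
  obtains w \<tau> where "w \<in> ccone S" "\<tau> \<ge> 0" "x = w + \<tau> *\<^sub>R v"
proof (cases "v \<in> S")
  case True
  hence "insert v S = S" by auto
  thus thesis using that[of x 0] assms by simp
next
  case False
  obtain u where u: "\<forall>w\<in>insert v S. 0 \<le> u w" "x = (\<Sum>w\<in>insert v S. u w *\<^sub>R w)" using assms by (auto simp: ccone_def)
  have "x = (\<Sum>w\<in>S. u w *\<^sub>R w) + u v *\<^sub>R v" using u False assms(2) by (simp add: add.commute)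
  moreover have "(\<Sum>w\<in>S. u w *\<^sub>R w) \<in> ccone S" using u by (auto simp: ccone_def)
  ultimately show thesis using that u by auto
qed

lemma ccone_union:
  assumes "x \<in> ccone (S \<union> T)" "finite S" "finite T"
  obtains y y' where "y \<in> ccone S" "y' \<in> ccone T" "x = y + y'"
proof -
  obtain u where u: "\<forall>w\<in>S \<union> T. 0 \<le> u w" "x = (\<Sum>w\<in>S \<union> T. u w *\<^sub>R w)" using assms by (auto simp: ccone_def)
  have "x = (\<Sum>w\<in>S. u w *\<^sub>R w) + (\<Sum>w\<in>T - S. u w *\<^sub>R w)"
    unfolding u(2) using assms sum.union_disjoint[of S "T - S" "\<lambda>w. u w *\<^sub>R w"] by (simp add: Un_Diff_cancel)
  moreover have "(\<Sum>w\<in>S. u w *\<^sub>R w) \<in> ccone S" using u by (auto simp: ccone_def)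
  moreover have "(\<Sum>w\<in>T - S. u w *\<^sub>R w) \<in> ccone T"
    unfolding ccone_def mem_Collect_eq
  proof (intro exI[of _ "\<lambda>w. if w \<in> S then 0 else u w"] conjI)
    have "(\<Sum>w\<in>T. (if w \<in> S then 0 else u w) *\<^sub>R w) = (\<Sum>w\<in>T - S. (if w \<in> S then 0 else u w) *\<^sub>R w)"
      using assms by (intro sum.mono_neutral_right) auto
    also have "\<dots> = (\<Sum>w\<in>T - S. u w *\<^sub>R w)" by (rule sum.cong) auto
    finally show "(\<Sum>w\<in>T - S. u w *\<^sub>R w) = (\<Sum>w\<in>T. (if w \<in> S then 0 else u w) *\<^sub>R w)" ..
  qed (use u in auto)
  ultimately show thesis using that by blast
qed

lemma ccone_mono:
  assumes "S \<subseteq> T" "finite T" shows "ccone S \<subseteq> ccone T"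
proof
  fix x assume "x \<in> ccone S"
  then obtain u where u: "\<forall>w\<in>S. 0 \<le> u w" "x = (\<Sum>w\<in>S. u w *\<^sub>R w)" by (auto simp: ccone_def)
  show "x \<in> ccone T" unfolding ccone_def mem_Collect_eq
  proof (intro exI[of _ "\<lambda>w. if w \<in> S then u w else 0"] conjI)
    have "(\<Sum>w\<in>T. (if w \<in> S then u w else 0) *\<^sub>R w) = (\<Sum>w\<in>S. (if w \<in> S then u w else 0) *\<^sub>R w)"
      using assms by (intro sum.mono_neutral_right) auto
    also have "\<dots> = x" unfolding u(2) by (rule sum.cong) auto
    finally show "x = (\<Sum>w\<in>T. (if w \<in> S then u w else 0) *\<^sub>R w)" ..
  qed (use u in auto)
qed

section \<open>Cyclic orders of vertices, chords and caps\<close>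

lemma trip_inner: "trip a b x = cross3 a b \<bullet> x" by (simp add: trip_def)

text \<open>The orientation \<open>e\<close> is only required to have constant sign, so that the order may be reversed.\<close>

definition convex_order :: "(nat \<Rightarrow> real^3) \<Rightarrow> nat \<Rightarrow> real \<Rightarrow> (real^3) set \<Rightarrow> bool" where
  "convex_order z n e D \<longleftrightarrow> 3 \<le> n \<and> (\<forall>i<n. z i $ 3 = 1) \<and> D = ccone (z ` {..<n}) \<and>
     (\<forall>i j k. i < j \<longrightarrow> j < k \<longrightarrow> k < n \<longrightarrow> e * trip (z i) (z j) (z k) > 0)"

text \<open>The determinant is invariant under cyclic permutation; the cases count how many of the
  three indices wrap around.\<close>

lemma convex_order_rotate:
  assumes o: "convex_order z n e D" and r: "r < n"
  shows "convex_order (\<lambda>i. z ((i + r) mod n)) n e D"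
proof -
  have n: "3 \<le> n" using o by (simp add: convex_order_def)
  have m: "(i + r) mod n = (if i + r < n then i + r else i + r - n)" if "i < n" for i
    using that r by (simp add: mod_if)
  have im: "(\<lambda>i. z ((i + r) mod n)) ` {..<n} = z ` {..<n}"
  proof -
    have "i \<in> (\<lambda>i. (i + r) mod n) ` {..<n}" if "i < n" for i
      using that r by (intro image_eqI[of _ _ "if r \<le> i then i - r else i + n - r"]) auto
    hence "(\<lambda>i. (i + r) mod n) ` {..<n} = {..<n}" using n by auto
    thus ?thesis by (metis image_image)
  qed
  have pos: "e * trip (z i) (z j) (z k) > 0" if "i < j" "j < k" "k < n" for i j k using o that by (auto simp: convex_order_def)
  have "e * trip (z ((i + r) mod n)) (z ((j + r) mod n)) (z ((k + r) mod n)) > 0" if h: "i < j" "j < k" "k < n" for i j k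
  proof -
    have c: "i < n" "j < n" using h by auto
    consider "k + r < n" | "j + r < n" "\<not> k + r < n" | "i + r < n" "\<not> j + r < n" | "\<not> i + r < n" using h by linarith
    thus ?thesis
    proof cases
      case 1
      hence "i + r < n" "j + r < n" using h by auto
      thus ?thesis unfolding m[OF c(1)] m[OF c(2)] m[OF h(3)] using 1 h by (simp add: pos)
    next
      case 2
      have "i + r < n" using 2 h by auto
      have "e * trip (z (k + r - n)) (z (i + r)) (z (j + r)) > 0" by (rule pos) (use 2 h r c in auto)
      thus ?thesis unfolding m[OF c(1)] m[OF c(2)] m[OF h(3)] using 2 \<open>i + r < n\<close> by (simp add: trip_rotate[of "z (i + r)" "z (j + r)" "z (k + r - n)"] trip_rotate[of "z (j + r)" "z (k + r - n)"])
    next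
      case 3
      have "\<not> k + r < n" using 3 h by auto
      have "e * trip (z (j + r - n)) (z (k + r - n)) (z (i + r)) > 0" by (rule pos) (use 3 h r c in auto)
      thus ?thesis unfolding m[OF c(1)] m[OF c(2)] m[OF h(3)] using 3 \<open>\<not> k + r < n\<close> by (simp add: trip_rotate[of "z (i + r)"])
    next
      case 4
      have "\<not> k + r < n" "\<not> j + r < n" using 4 h by auto
      moreover have "e * trip (z (i + r - n)) (z (j + r - n)) (z (k + r - n)) > 0" by (rule pos) (use 4 h r c in auto)
      ultimately show ?thesis unfolding m[OF c(1)] m[OF c(2)] m[OF h(3)] using 4 by simp
    qed
  qed
  thus ?thesis using o n unfolding convex_order_def im by simp
qed

text \<open>Reversal changes the sign of the determinant, which is absorbed into \<open>e\<close>.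
  The index 0 stays fixed.\<close>

lemma convex_order_reflect:
  assumes o: "convex_order z n e D"
  shows "convex_order (\<lambda>i. z ((n - i) mod n)) n (- e) D"
proof -
  have n: "3 \<le> n" using o by (simp add: convex_order_def)
  have im: "(\<lambda>i. z ((n - i) mod n)) ` {..<n} = z ` {..<n}"
  proof -
    have "i \<in> (\<lambda>i. (n - i) mod n) ` {..<n}" if "i < n" for i
      using that by (intro image_eqI[of _ _ "if i = 0 then 0 else n - i"]) auto
    hence "(\<lambda>i. (n - i) mod n) ` {..<n} = {..<n}" using n by auto
    thus ?thesis by (metis image_image)
  qed
  have pos: "e * trip (z i) (z j) (z k) > 0" if "i < j" "j < k" "k < n" for i j k using o that by (auto simp: convex_order_def)
  have "- e * trip (z ((n - i) mod n)) (z ((n - j) mod n)) (z ((n - k) mod n)) > 0" if h: "i < j" "j < k" "k < n" for i j k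
  proof -
    have jk: "(n - j) mod n = n - j" "(n - k) mod n = n - k" using h by auto
    show ?thesis
    proof (cases "i = 0")
      case True
      have "e * trip (z 0) (z (n - k)) (z (n - j)) > 0" by (rule pos) (use h in auto)
      thus ?thesis using True jk by (simp add: trip_swap[of "z 0" "z (n - k)"])
    next
      case False
      hence i: "(n - i) mod n = n - i" using h by auto
      have "e * trip (z (n - k)) (z (n - j)) (z (n - i)) > 0" by (rule pos) (use h False in auto)
      thus ?thesis unfolding jk i trip_rotate[of "z (n - i)"] trip_swap[of "z (n - j)" "z (n - k)" "z (n - i)"]
        using trip_swap[of "z (n - j)" "z (n - i)" "z (n - k)"] trip_rotate[of "z (n - k)"] by simp
    qed
  qed
  thus ?thesis using o n unfolding convex_order_def im by simp
qed

lemma convex_order_edges: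
  assumes o: "convex_order z n e D" and x: "x \<in> D"
  shows "e * trip (z 0) (z 1) x \<ge> 0" "e * trip (z 0) x (z (n - 1)) \<ge> 0"
proof -
  have n: "3 \<le> n" and D: "D = ccone (z ` {..<n})" and pos: "\<And>i j k. i < j \<Longrightarrow> j < k \<Longrightarrow> k < n \<Longrightarrow> e * trip (z i) (z j) (z k) > 0"
    using o by (auto simp: convex_order_def)
  have "(e *\<^sub>R cross3 (z 0) (z 1)) \<bullet> x \<ge> 0"
  proof (rule ccone_nonneg[OF x[unfolded D]], intro ballI)
    fix v assume "v \<in> z ` {..<n}"
    then obtain k where k: "k < n" "v = z k" by auto
    consider "k = 0" | "k = 1" | "k > 1" by linarith
    thus "(e *\<^sub>R cross3 (z 0) (z 1)) \<bullet> v \<ge> 0"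
      using pos[of 0 1 k] k by cases (auto simp: trip_inner[symmetric])
  qed
  thus "e * trip (z 0) (z 1) x \<ge> 0" by (simp add: trip_inner)
  have r: "trip (z 0) y (z (n - 1)) = trip (z (n - 1)) (z 0) y" for y by (metis trip_rotate)
  have "(e *\<^sub>R cross3 (z (n - 1)) (z 0)) \<bullet> x \<ge> 0"
  proof (rule ccone_nonneg[OF x[unfolded D]], intro ballI)
    fix v assume "v \<in> z ` {..<n}"
    then obtain k where k: "k < n" "v = z k" by auto
    consider "k = 0" | "k = n - 1" | "0 < k" "k < n - 1" using k by linarith
    thus "(e *\<^sub>R cross3 (z (n - 1)) (z 0)) \<bullet> v \<ge> 0"
      using pos[of 0 k "n - 1"] k n by cases (auto simp: trip_inner[symmetric] r[unfolded One_nat_def])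
  qed
  thus "e * trip (z 0) x (z (n - 1)) \<ge> 0" unfolding r by (simp add: trip_inner)
qed

lemma convex_order_corner:
  assumes o: "convex_order z n e D"
  shows "corner (z 0) (z 1) (z (n - 1)) D" "corner (z 0) (z (n - 1)) (z 1) D"
proof -
  have n: "3 \<le> n" and pos: "\<And>i j k. i < j \<Longrightarrow> j < k \<Longrightarrow> k < n \<Longrightarrow> e * trip (z i) (z j) (z k) > 0"
    and h: "\<forall>i<n. z i $ 3 = 1" using o by (auto simp: convex_order_def)
  define T where "T = trip (z 0) (z 1) (z (n - 1))"
  have T: "e * T > 0" unfolding T_def by (rule pos) (use n in auto)
  have q: "a / T \<ge> 0" if "e * a \<ge> 0" for a
  proof -
    have "e \<noteq> 0" using T by auto
    hence "a / T = (e * a) / (e * T)" by simp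
    also have "\<dots> \<ge> 0" by (rule divide_nonneg_pos[OF that T])
    finally show ?thesis .
  qed
  have z: "z 0 $ 3 = 1" "z 1 $ 3 = 1" "z (n - 1) $ 3 = 1" using h n by auto
  have D: "trip (z 0) x (z (n - 1)) / T \<ge> 0 \<and> trip (z 0) (z 1) x / T \<ge> 0" if "x \<in> D" for x
    using convex_order_edges[OF o that] q by blast
  show "corner (z 0) (z 1) (z (n - 1)) D" unfolding corner_def T_def[symmetric] using D T z by auto
  have s: "trip (z 0) (z (n - 1)) y = - trip (z 0) y (z (n - 1))" "trip (z 0) y (z 1) = - trip (z 0) (z 1) y" for y
    by (rule trip_swap)+
  show "corner (z 0) (z (n - 1)) (z 1) D" unfolding corner_def s T_def[symmetric] using D T z by auto
qed

lemma convex_order_mem: "convex_order z n e D \<Longrightarrow> i < n \<Longrightarrow> z i \<in> D"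
  unfolding convex_order_def by (metis ccone_incl finite_imageI finite_lessThan imageI lessThan_iff)

lemma ccone_two: "\<alpha> \<ge> 0 \<Longrightarrow> \<beta> \<ge> 0 \<Longrightarrow> \<alpha> *\<^sub>R a + \<beta> *\<^sub>R b \<in> ccone {a, b}"
  by (intro ccone_add ccone_scale ccone_incl) auto

text \<open>The sign of each coefficient is read off a side of the polygon that meets the chord at
  one of its ends. If the chord is itself a side, the other side at that end is taken.\<close>

lemma convex_order_chord:
  assumes o: "convex_order z n e D" and j: "0 < j" "j < n" and x: "x \<in> D" "trip (z 0) (z j) x = 0"
  obtains \<alpha> \<beta> where "\<alpha> \<ge> 0" "\<beta> \<ge> 0" "x = \<alpha> *\<^sub>R z 0 + \<beta> *\<^sub>R z j"
proof -
  have n: "3 \<le> n" and pos: "\<And>i j k. i < j \<Longrightarrow> j < k \<Longrightarrow> k < n \<Longrightarrow> e * trip (z i) (z j) (z k) > 0"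
    using o by (auto simp: convex_order_def)
  obtain k where k: "k < n" "k \<noteq> 0" "k \<noteq> j"
    using n j that by (metis One_nat_def Suc_le_eq le_trans less_numeral_extra(3) numeral_2_eq_2 numeral_3_eq_3 lessI zero_less_Suc Suc_less_eq order_less_trans nat_neq_iff less_Suc_eq)
  have T: "trip (z 0) (z j) (z k) \<noteq> 0"
  proof (cases "j < k")
    case True thus ?thesis using pos[of 0 j k] j k by auto
  next
    case False
    hence "e * trip (z 0) (z k) (z j) > 0" using pos[of 0 k j] j k by auto
    thus ?thesis unfolding trip_swap[of "z 0" "z j"] by auto
  qed
  define T where "T = trip (z 0) (z j) (z k)"
  have "T *\<^sub>R x = trip x (z j) (z k) *\<^sub>R z 0 + trip (z 0) x (z k) *\<^sub>R z j + trip (z 0) (z j) x *\<^sub>R z k" unfolding T_def by (rule trip_cramer)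
  hence "(1/T) *\<^sub>R (T *\<^sub>R x) = (1/T) *\<^sub>R (trip x (z j) (z k) *\<^sub>R z 0 + trip (z 0) x (z k) *\<^sub>R z j)" using x(2) by simp
  then obtain \<alpha> \<beta> where xe: "x = \<alpha> *\<^sub>R z 0 + \<beta> *\<^sub>R z j" using T unfolding T_def[symmetric] by (simp add: scaleR_add_right)
  have b: "\<beta> \<ge> 0"
  proof (cases "j = 1")
    case True
    have "e * trip (z 0) x (z (n - 1)) \<ge> 0" by (rule convex_order_edges(2)[OF o x(1)])
    hence "\<beta> * (e * trip (z 0) (z j) (z (n - 1))) \<ge> 0" unfolding xe trip_linear by (simp add: algebra_simps)
    moreover have "e * trip (z 0) (z j) (z (n - 1)) > 0" by (rule pos) (use True n in auto)
    ultimately show ?thesis by (simp add: zero_le_mult_iff)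
  next
    case False
    have "e * trip (z 0) (z 1) x \<ge> 0" by (rule convex_order_edges(1)[OF o x(1)])
    hence "\<beta> * (e * trip (z 0) (z 1) (z j)) \<ge> 0" unfolding xe trip_linear by (simp add: algebra_simps)
    moreover have "e * trip (z 0) (z 1) (z j) > 0" by (rule pos) (use False j in auto)
    ultimately show ?thesis by (simp add: zero_le_mult_iff)
  qed
  have a: "\<alpha> \<ge> 0"
  proof -
    \<comment> \<open>Rotating the indices by \<open>j\<close> makes the other end of the chord the
      base point.\<close>
    define y where "y = (\<lambda>i. z ((i + j) mod n))"
    have oy: "convex_order y n e D" unfolding y_def by (rule convex_order_rotate[OF o j(2)])
    have y0: "y 0 = z j" and yn: "y (n - j) = z 0" using j by (simp_all add: y_def)
    have posy: "e * trip (y i) (y j) (y k) > 0" if "i < j" "j < k" "k < n" for i j k using oy that by (auto simp: convex_order_def)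
    have xe': "x = \<alpha> *\<^sub>R y (n - j) + \<beta> *\<^sub>R y 0" using xe y0 yn by simp
    show ?thesis
    proof (cases "n - j = 1")
      case True
      have "e * trip (y 0) x (y (n - 1)) \<ge> 0" by (rule convex_order_edges(2)[OF oy x(1)])
      hence "\<alpha> * (e * trip (y 0) (y (n - j)) (y (n - 1))) \<ge> 0" unfolding xe' trip_linear by (simp add: algebra_simps)
      moreover have "e * trip (y 0) (y (n - j)) (y (n - 1)) > 0" by (rule posy) (use True n in auto)
      ultimately show ?thesis by (simp add: zero_le_mult_iff)
    next
      case False
      have "e * trip (y 0) (y 1) x \<ge> 0" by (rule convex_order_edges(1)[OF oy x(1)])
      hence "\<alpha> * (e * trip (y 0) (y 1) (y (n - j))) \<ge> 0" unfolding xe' trip_linear by (simp add: algebra_simps)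
      moreover have "e * trip (y 0) (y 1) (y (n - j)) > 0" by (rule posy) (use False j in auto)
      ultimately show ?thesis by (simp add: zero_le_mult_iff)
    qed
  qed
  show thesis by (rule that[OF a b xe])
qed

text \<open>Split \<open>x\<close> into a part \<open>X\<close> generated by the vertices of the cap
  and a part \<open>Y\<close> generated by the others. As \<open>x\<close> lies on the side of the
  cap, a fraction of \<open>X\<close> balances \<open>Y\<close>; the balanced vector lies on the
  chord and is generated by its two ends.\<close>

lemma convex_order_cap:
  assumes o: "convex_order z n e D" and j: "0 < j" "j < n" and x: "x \<in> D" "e * trip (z 0) (z j) x \<le> 0"
  shows "x \<in> ccone (z ` {0..j})"
proof -
  have n: "3 \<le> n" and pos: "\<And>i j k. i < j \<Longrightarrow> j < k \<Longrightarrow> k < n \<Longrightarrow> e * trip (z i) (z j) (z k) > 0"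
    and D: "D = ccone (z ` {..<n})" using o by (auto simp: convex_order_def)
  have "{..<n} = {0..j} \<union> {j<..<n}" using j by auto
  hence "z ` {..<n} = z ` {0..j} \<union> z ` {j<..<n}" by (metis image_Un)
  hence xu: "x \<in> ccone (z ` {0..j} \<union> z ` {j<..<n})" using x(1) unfolding D by simp
  obtain X Y where X: "X \<in> ccone (z ` {0..j})" and Y: "Y \<in> ccone (z ` {j<..<n})" and xe: "x = X + Y"
    by (rule ccone_union[OF xu]) auto
  have sub: "ccone (z ` {0..j}) \<subseteq> D" "ccone (z ` {j<..<n}) \<subseteq> D" unfolding D by (rule ccone_mono; use j in auto)+
  define r where "r = e * trip (z 0) (z j) Y"
  have r: "r \<ge> 0"
  proof -
    have "(e *\<^sub>R cross3 (z 0) (z j)) \<bullet> Y \<ge> 0"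
      by (rule ccone_nonneg[OF Y]) (use pos[of 0 j] j in \<open>auto simp: trip_inner[symmetric] less_imp_le\<close>)
    thus ?thesis by (simp add: r_def trip_inner)
  qed
  define R where "R = - (e * trip (z 0) (z j) X)"
  have rR: "r \<le> R" using x(2) unfolding xe r_def R_def trip_linear by (simp add: algebra_simps)
  have e0: "e \<noteq> 0" using pos[of 0 1 2] n by auto
  obtain s where s: "0 \<le> s" "s \<le> 1" "s * R = r"
  proof (cases "r = 0")
    case True thus thesis using that[of 0] by simp
  next
    case False
    hence "R > 0" using r rR by linarith
    thus thesis using that[of "r / R"] r rR by simp
  qed
  have "s *\<^sub>R X + Y \<in> D" using X Y sub s unfolding D by (intro ccone_add ccone_scale) auto
  moreover have "e * trip (z 0) (z j) (s *\<^sub>R X + Y) = 0" using s(3) unfolding trip_linear r_def R_def by (simp add: algebra_simps)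
  hence "trip (z 0) (z j) (s *\<^sub>R X + Y) = 0" using e0 by simp
  ultimately obtain \<alpha> \<beta> where ab: "\<alpha> \<ge> 0" "\<beta> \<ge> 0" "s *\<^sub>R X + Y = \<alpha> *\<^sub>R z 0 + \<beta> *\<^sub>R z j" by (rule convex_order_chord[OF o j])
  have "x = (1 - s) *\<^sub>R X + (s *\<^sub>R X + Y)" unfolding xe by (simp add: algebra_simps)
  moreover have "(1 - s) *\<^sub>R X \<in> ccone (z ` {0..j})" using ccone_scale[OF X] s by simp
  moreover have "s *\<^sub>R X + Y \<in> ccone (z ` {0..j})" unfolding ab(3) using ab by (intro ccone_add ccone_scale ccone_incl) auto
  ultimately show ?thesis by (metis ccone_add)
qed

lemma ccone_atLeastAtMost_insert:
  fixes z :: "nat \<Rightarrow> real^3"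
  shows "z ` {0..j} = insert (z 0) (z ` {1..j})" "z ` {0..j} = insert (z j) (z ` {0..<j})"
proof -
  have "{0..j} = insert 0 {1..j}" "{0..j} = insert j {0..<j}" by auto
  thus "z ` {0..j} = insert (z 0) (z ` {1..j})" "z ` {0..j} = insert (z j) (z ` {0..<j})" by (metis image_insert)+
qed

text \<open>A point of the cap is a point of the cone over \<open>z 1\<close>, ...,
  \<open>z j\<close> plus a multiple of \<open>z 0\<close>, which is what sweeping from
  \<open>z 0\<close> requires.\<close>

lemma fan_agree_le:
  assumes o: "convex_order z n e D" and j: "0 < j" "j < n"
    and C: "hcone C" "hcone C'" "C \<subseteq> D" "C' \<subseteq> D" and z: "z 0 \<notin> C" and X: "xray_le (z 0) C C'"
    and W: "\<forall>i. 1 \<le> i \<longrightarrow> i \<le> j \<longrightarrow> z i \<in> C \<and> z i \<in> C'"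
  shows "\<forall>x. e * trip (z 0) (z j) x \<le> 0 \<longrightarrow> x \<in> C \<longrightarrow> x \<in> C'"
proof -
  define G where "G = {x. e * trip (z 0) (z j) x \<le> 0}"
  have z3: "z 0 $ 3 = 1" using o by (auto simp: convex_order_def)
  hence z0: "z 0 $ 3 \<ge> 0" "z 0 \<noteq> 0" by auto
  have "C \<inter> G \<subseteq> C'"
  proof (rule sweep[OF C(1,3,4) z z0 X])
    show "\<forall>x\<in>G. \<forall>\<tau>. x + \<tau> *\<^sub>R z 0 \<in> G" by (simp add: G_def trip_linear)
    show "\<forall>x\<in>D \<inter> G. \<exists>w\<in>ccone (z ` {1..j}). \<exists>\<tau>\<ge>0. x = w + \<tau> *\<^sub>R z 0"
    proof
      fix x assume "x \<in> D \<inter> G"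
      hence "x \<in> ccone (z ` {0..j})" using convex_order_cap[OF o j] by (auto simp: G_def)
      hence "x \<in> ccone (insert (z 0) (z ` {1..j}))" unfolding ccone_atLeastAtMost_insert(1) .
      then obtain w \<tau> where "w \<in> ccone (z ` {1..j})" "\<tau> \<ge> 0" "x = w + \<tau> *\<^sub>R z 0" by (rule ccone_insert) simp
      thus "\<exists>w\<in>ccone (z ` {1..j}). \<exists>\<tau>\<ge>0. x = w + \<tau> *\<^sub>R z 0" by blast
    qed
    have s: "z ` {1..j} \<subseteq> C" "z ` {1..j} \<subseteq> C'" using W by auto
    show "ccone (z ` {1..j}) \<subseteq> C" by (rule ccone_subset[OF C(1) s(1)])
    show "ccone (z ` {1..j}) \<subseteq> C'" by (rule ccone_subset[OF C(2) s(2)])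
  qed
  thus ?thesis by (auto simp: G_def)
qed

section \<open>Angles at a vertex\<close>

text \<open>The sum of \<open>K\<close> and the line of \<open>v\<close>: for \<open>v\<close> in
  \<open>K\<close> it is the angle of the cone at \<open>v\<close>, equivalent to the range in
  \<open>ray_section\<close> but free of a frame.\<close>

definition tangent :: "real^3 \<Rightarrow> (real^3) set \<Rightarrow> (real^3) set" where
  "tangent v K = {x. \<exists>t. x + t *\<^sub>R v \<in> K}"

lemma corner_normal_form:
  assumes c: "corner v q p D" and x: "cvec v q p \<bullet> x > 0"
  shows "x = (cvec v q p \<bullet> x) *\<^sub>R ((q - v) + (trip v q x / trip v q p / (cvec v q p \<bullet> x)) *\<^sub>R (p - q) + (x$3 / (cvec v q p \<bullet> x)) *\<^sub>R v)"
proof -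
  have a: "trip v q p \<noteq> 0" "v$3 = 1" "q$3 = 1" "p$3 = 1" using c by (auto simp: corner_def)
  define X where "X = trip v x p / trip v q p"
  define U where "U = trip v q x / trip v q p"
  have s: "cvec v q p \<bullet> x = X + U" unfolding cvec_inner X_def U_def ..
  have x0: "X + U \<noteq> 0" using x s by simp
  have "x = X *\<^sub>R (q - v) + U *\<^sub>R (p - v) + x$3 *\<^sub>R v" unfolding X_def U_def by (rule corner_coords[OF a])
  also have "\<dots> = (X + U) *\<^sub>R (q - v) + U *\<^sub>R (p - q) + x$3 *\<^sub>R v" by (simp add: algebra_simps)
  also have "\<dots> = (X + U) *\<^sub>R ((q - v) + (U / (X + U)) *\<^sub>R (p - q) + (x$3 / (X + U)) *\<^sub>R v)" using x0 by (simp add: scaleR_add_right)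
  finally show ?thesis unfolding s U_def[symmetric] .
qed

lemma corner_mem_iff:
  assumes c: "corner v q p D" and K: "hcone K" and S: "ray_section K (q - v) (p - q) v k1 k2 E" and x: "cvec v q p \<bullet> x > 0"
  shows "x \<in> K \<longleftrightarrow> k1 \<le> trip v q x / trip v q p / (cvec v q p \<bullet> x) \<and> trip v q x / trip v q p / (cvec v q p \<bullet> x) \<le> k2 \<and>
    E (trip v q x / trip v q p / (cvec v q p \<bullet> x)) \<le> x$3 / (cvec v q p \<bullet> x)"
proof -
  have "x \<in> K \<longleftrightarrow> (q - v) + (trip v q x / trip v q p / (cvec v q p \<bullet> x)) *\<^sub>R (p - q) + (x$3 / (cvec v q p \<bullet> x)) *\<^sub>R v \<in> K"
    using cone_scale[OF hcone_cone[OF K] x] corner_normal_form[OF c x] by metis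
  thus ?thesis using S unfolding ray_section_def by simp
qed

lemma corner_cvec_v: "corner v q p D \<Longrightarrow> cvec v q p \<bullet> (x + t *\<^sub>R v) = cvec v q p \<bullet> x"
  by (simp add: cvec_inner trip_linear)

lemma tangent_ray_section:
  assumes c: "corner v q p D" and K: "hcone K" "K \<subseteq> D" "v \<in> K" and S: "ray_section K (q - v) (p - q) v k1 k2 E"
  shows "tangent v K = {x. (\<exists>s. x = s *\<^sub>R v) \<or> (cvec v q p \<bullet> x > 0 \<and> k1 \<le> trip v q x / trip v q p / (cvec v q p \<bullet> x) \<and> trip v q x / trip v q p / (cvec v q p \<bullet> x) \<le> k2)}"
    (is "_ = ?R")
proof (intro set_eqI iffI)
  fix x assume "x \<in> tangent v K"
  then obtain t where t: "x + t *\<^sub>R v \<in> K" by (auto simp: tangent_def)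
  have nn: "cvec v q p \<bullet> x \<ge> 0" using corner_cvec_nonneg[OF c, of "x + t *\<^sub>R v"] t K unfolding corner_cvec_v[OF c] by blast
  show "x \<in> ?R"
  proof (cases "cvec v q p \<bullet> x = 0")
    case True
    have "x + t *\<^sub>R v \<in> D" using t K by blast
    moreover have "cvec v q p \<bullet> (x + t *\<^sub>R v) = 0" unfolding corner_cvec_v[OF c] by (rule True)
    ultimately have "x + t *\<^sub>R v = ((x + t *\<^sub>R v)$3) *\<^sub>R v" by (rule corner_cvec_zero[OF c])
    hence "x = ((x + t *\<^sub>R v)$3 - t) *\<^sub>R v" by (metis add_diff_cancel_right' scaleR_left_diff_distrib)
    thus ?thesis by blast
  next
    case False
    hence p: "cvec v q p \<bullet> x > 0" using nn by simp
    hence "cvec v q p \<bullet> (x + t *\<^sub>R v) > 0" unfolding corner_cvec_v[OF c] .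
    from corner_mem_iff[OF c K(1) S this] t show ?thesis using p unfolding corner_cvec_v[OF c] by (simp add: trip_linear)
  qed
next
  fix x assume "x \<in> ?R"
  thus "x \<in> tangent v K"
  proof (elim CollectE disjE exE conjE)
    fix s assume "x = s *\<^sub>R v"
    hence "x + (- s) *\<^sub>R v \<in> K" using hcone_zero[OF K(1)] by simp
    thus ?thesis unfolding tangent_def by blast
  next
    define U where "U = trip v q x / trip v q p / (cvec v q p \<bullet> x)"
    assume p: "cvec v q p \<bullet> x > 0" and u: "k1 \<le> trip v q x / trip v q p / (cvec v q p \<bullet> x)" "trip v q x / trip v q p / (cvec v q p \<bullet> x) \<le> k2"
    define t where "t = (cvec v q p \<bullet> x) * E U - x$3"
    have v3: "v$3 = 1" using c by (simp add: corner_def)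
    have p': "cvec v q p \<bullet> (x + t *\<^sub>R v) > 0" unfolding corner_cvec_v[OF c] by (rule p)
    have "x + t *\<^sub>R v \<in> K"
      unfolding corner_mem_iff[OF c K(1) S p'] unfolding corner_cvec_v[OF c]
      using u p v3 by (simp add: trip_linear t_def U_def)
    thus ?thesis unfolding tangent_def by blast
  qed
qed

lemma tangent_ranges:
  assumes c: "corner v q p D" and K: "hcone K" "hcone K'" "K \<subseteq> D" "K' \<subseteq> D" "v \<in> K" "v \<in> K'"
    and S: "ray_section K (q - v) (p - q) v k1 k2 E" and S': "ray_section K' (q - v) (p - q) v k1' k2' E'"
    and T: "tangent v K = tangent v K'"
  shows "k1' = k1 \<and> k2' = k2"
proof -
  have a: "trip v q p \<noteq> 0" "v$3 = 1" "q$3 = 1" "p$3 = 1" using c by (auto simp: corner_def)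
  have g: "(q - v) + u *\<^sub>R (p - q) \<in> tangent v L \<longleftrightarrow> l1 \<le> u \<and> u \<le> l2" if "ray_section L (q - v) (p - q) v l1 l2 F" for L l1 l2 F u
    using that unfolding tangent_def ray_section_def by auto
  have "k1 \<le> u \<and> u \<le> k2 \<longleftrightarrow> k1' \<le> u \<and> u \<le> k2'" for u using g[OF S, of u] g[OF S', of u] T by simp
  from this[of k1] this[of k2] this[of k1'] this[of k2'] show ?thesis using S S' unfolding ray_section_def by auto
qed

text \<open>Replaces \<open>fan_agree_le\<close> when the fan consists of the single vertex
  \<open>v\<close>. The point \<open>b\<close> on the far boundary ray of the common angle takes the
  place of a second vertex, and the maximum of the two boundary values puts it into both cones. The
  region is then swept from \<open>q\<close> over the cone of \<open>v\<close> and
  \<open>b\<close>.\<close>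

lemma near_start_le:
  assumes c: "corner v q p D" and C: "hcone C" "hcone C'" "C \<subseteq> D" "C' \<subseteq> D" and v: "v \<in> C" "v \<in> C'"
    and S: "ray_section C (q - v) (p - q) v k1 k2 E" "ray_section C' (q - v) (p - q) v k1 k2 E'"
    and q: "q \<notin> C" and X: "xray_le q C C'"
    and b: "b = (q - v) + k2 *\<^sub>R (p - q) + (max (E k2) (E' k2)) *\<^sub>R v"
  shows "\<forall>x. trip q b x / trip q v p \<le> 0 \<longrightarrow> x \<in> C \<longrightarrow> x \<in> C'"
proof -
  have a: "trip v q p \<noteq> 0" "v$3 = 1" "q$3 = 1" "p$3 = 1" using c by (auto simp: corner_def)
  define T where "T = trip v q p"
  have T0: "T \<noteq> 0" using a by (simp add: T_def)
  have tq: "trip q v y = - trip v q y" for y by (metis trip_rotate trip_swap)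
  have k: "0 \<le> k1" "k1 < k2" "k2 \<le> 1" using S by (auto simp: ray_section_def)
  have bC: "b \<in> C" "b \<in> C'" using S k unfolding b ray_section_def by auto
  have q0: "q$3 \<ge> 0" "q \<noteq> 0" using a by auto
  have fb: "trip q v b / trip q v p = k2"
    using a unfolding b tq by (simp add: trip_linear diff_divide_distrib add_divide_distrib)
  \<comment> \<open>Cutting \<open>D\<close> down by the common angle at \<open>v\<close> removes
    the points that cannot be reached from the cone of \<open>v\<close> and \<open>b\<close> by
    adding a multiple of \<open>q\<close>.\<close>
  define D' where "D' = {x \<in> D. trip v q x / T \<le> k2 * (cvec v q p \<bullet> x)}"
  have CD: "K \<subseteq> D'" if K: "hcone K" "K \<subseteq> D" "ray_section K (q - v) (p - q) v k1 k2 F" for K F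
  proof
    fix x assume x: "x \<in> K"
    have n: "trip v x p / T \<ge> 0" "trip v q x / T \<ge> 0" using c x K unfolding corner_def T_def by blast+
    show "x \<in> D'"
    proof (cases "cvec v q p \<bullet> x > 0")
      case True
      hence "trip v q x / T / (cvec v q p \<bullet> x) \<le> k2" using corner_mem_iff[OF c K(1,3) True] x unfolding T_def by blast
      hence "trip v q x / T \<le> k2 * (cvec v q p \<bullet> x)" unfolding pos_divide_le_eq[OF True] .
      thus ?thesis using x K by (auto simp: D'_def)
    next
      case False
      hence "trip v q x / T = 0" using n unfolding cvec_inner T_def by linarith
      moreover have "cvec v q p \<bullet> x \<ge> 0" using corner_cvec_nonneg[OF c] x K by blast
      ultimately show ?thesis using x K k by (auto simp: D'_def)
    qed
  qed
  define G where "G = {x. trip q b x / trip q v p \<le> 0}"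
  have "C \<inter> G \<subseteq> C'"
  proof (rule sweep[OF C(1) CD[OF C(1,3) S(1)] CD[OF C(2,4) S(2)] q q0 X])
    show "\<forall>x\<in>G. \<forall>\<tau>. x + \<tau> *\<^sub>R q \<in> G"
    proof -
      have "trip q b q = 0" by simp
      thus ?thesis by (simp add: G_def trip_linear(1,2))
    qed
    show "\<forall>x\<in>D' \<inter> G. \<exists>w\<in>ccone {v, b}. \<exists>\<tau>\<ge>0. x = w + \<tau> *\<^sub>R q"
    proof
      fix x assume x: "x \<in> D' \<inter> G"
      define S where "S = trip q v b"
      have ST: "S = - k2 * T" using fb T0 unfolding S_def T_def tq by (simp add: field_simps)
      have S0: "S \<noteq> 0" using ST k T0 by auto
      have cr: "S *\<^sub>R x = trip x v b *\<^sub>R q + trip q x b *\<^sub>R v + trip q v x *\<^sub>R b" unfolding S_def by (rule trip_cramer)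
      have "x = (trip x v b / S) *\<^sub>R q + (trip q x b / S) *\<^sub>R v + (trip q v x / S) *\<^sub>R b"
      proof -
        have "(1/S) *\<^sub>R (S *\<^sub>R x) = (1/S) *\<^sub>R (trip x v b *\<^sub>R q + trip q x b *\<^sub>R v + trip q v x *\<^sub>R b)" unfolding cr ..
        thus ?thesis using S0 by (simp add: scaleR_add_right)
      qed
      moreover have "trip q v x / S \<ge> 0"
      proof -
        have "trip q v x / S = (trip v q x / T) / k2" unfolding tq ST using k T0 by simp
        moreover have "trip v q x / T \<ge> 0" using c x unfolding corner_def T_def D'_def by blast
        ultimately show ?thesis using k by (metis divide_nonneg_pos le_less_trans)
      qed
      moreover have "trip q x b / S \<ge> 0"
      proof -
        have "trip q x b / S = - (trip q b x / trip q v p) / k2" unfolding ST tq trip_swap[of q x b] T_def using k a by simp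
        moreover have "trip q b x / trip q v p \<le> 0" using x by (simp add: G_def)
        ultimately show ?thesis using k by (metis divide_nonneg_pos le_less_trans neg_0_le_iff_le)
      qed
      moreover have "trip x v b / S \<ge> 0"
      proof -
        have e: "trip x v b = - (trip v x q * (1 - k2) + k2 * trip v x p)"
          unfolding b by (simp add: trip_linear trip_expand algebra_simps)
        have "trip x v b / S = (k2 * (cvec v q p \<bullet> x) - trip v q x / T) / k2"
        proof -
          have "- (- U * (1 - k2) + k2 * Y) / (- k2 * T) = (k2 * (Y / T + U / T) - U / T) / k2" for U Y
            using k T0 by (simp add: field_simps)
          from this[of "trip v q x" "trip v x p"] show ?thesis unfolding e ST cvec_inner T_def[symmetric] trip_swap[of v x q] by simp
        qed
        moreover have "k2 * (cvec v q p \<bullet> x) - trip v q x / T \<ge> 0" using x by (simp add: D'_def)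
        ultimately show ?thesis using k by (metis divide_nonneg_pos le_less_trans)
      qed
      ultimately obtain \<gamma> \<alpha> \<beta> where ab: "\<gamma> \<ge> 0" "\<alpha> \<ge> 0" "\<beta> \<ge> 0" "x = \<gamma> *\<^sub>R q + \<alpha> *\<^sub>R v + \<beta> *\<^sub>R b" by blast
      have "x = (\<alpha> *\<^sub>R v + \<beta> *\<^sub>R b) + \<gamma> *\<^sub>R q" unfolding ab(4) by (simp add: algebra_simps)
      thus "\<exists>w\<in>ccone {v, b}. \<exists>\<tau>\<ge>0. x = w + \<tau> *\<^sub>R q" using ccone_two[OF ab(2,3)] ab(1) by blast
    qed
    have s: "{v, b} \<subseteq> C" "{v, b} \<subseteq> C'" using v bC by auto
    show "ccone {v, b} \<subseteq> C" by (rule ccone_subset[OF C(1) s(1)])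
    show "ccone {v, b} \<subseteq> C'" by (rule ccone_subset[OF C(2) s(2)])
  qed
  thus ?thesis by (auto simp: G_def)
qed

section \<open>Reconstruction\<close>

definition coin :: "real^3 \<Rightarrow> (real^3) set \<Rightarrow> (real^3) set \<Rightarrow> bool" where
  "coin v K K' \<longleftrightarrow> coincide_near v (K \<inter> {x. x$3 = 1}) (K' \<inter> {x. x$3 = 1})"

definition adj :: "nat \<Rightarrow> nat \<Rightarrow> nat \<Rightarrow> bool" where
  "adj n i j \<longleftrightarrow> i < n \<and> j < n \<and> (j = Suc i mod n \<or> i = Suc j mod n)"

definition vertices_covered where
  "vertices_covered A C A' C' z n \<longleftrightarrow>
    (\<forall>i<n. (z i \<in> A \<or> z i \<in> C) \<and> (z i \<in> A' \<or> z i \<in> C') \<and> (z i \<in> A \<and> z i \<in> C \<longleftrightarrow> z i \<in> A' \<and> z i \<in> C'))"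

text \<open>A side of \<open>H\<close> is an edge of a section exactly if both its ends lie in that
  cone (see \<open>edge_iff\<close>), so the condition on edges becomes a condition on
  vertices.\<close>

definition same_edges where
  "same_edges A C A' C' z n \<longleftrightarrow>
    (\<forall>i j. adj n i j \<longrightarrow> (z i \<in> A \<and> z j \<in> A \<or> z i \<in> C \<and> z j \<in> C \<longleftrightarrow> z i \<in> A' \<and> z j \<in> A' \<or> z i \<in> C' \<and> z j \<in> C'))"

definition simple_vertices_coincide where
  "simple_vertices_coincide A C A' C' z n \<longleftrightarrow>
    (\<forall>i<n. \<not> (z i \<in> A \<and> z i \<in> C) \<longrightarrow> (\<forall>P\<in>{A, C}. \<forall>P'\<in>{A', C'}. z i \<in> P \<longrightarrow> z i \<in> P' \<longrightarrow> coin (z i) P P'))"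

text \<open>Collects the data in a form preserved by exchanging the factors on both sides
  (\<open>cfg_roles\<close>) or on one side (\<open>cfg_swap\<close>), and by rotating or reversing
  the vertices.\<close>

definition cfg where
  "cfg A C A' C' D z n e \<longleftrightarrow> hcone A \<and> hcone C \<and> hcone A' \<and> hcone C' \<and> A \<subseteq> D \<and> C \<subseteq> D \<and> A' \<subseteq> D \<and> C' \<subseteq> D \<and>
    lap_eq A C A' C' \<and> convex_order z n e D \<and> vertices_covered A C A' C' z n \<and> same_edges A C A' C' z n \<and> simple_vertices_coincide A C A' C' z n"

lemma lap_eq_sym: "lap_eq A C A' C' \<Longrightarrow> lap_eq A' C' A C" and lap_eq_roles: "lap_eq A C A' C' \<Longrightarrow> lap_eq C A C' A'"
  and lap_eq_swap: "lap_eq A C A' C' \<Longrightarrow> lap_eq A C C' A'"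
  by (simp_all add: lap_eq_def mult.commute)

lemma cfg_hcone: "cfg A C A' C' D z n e \<Longrightarrow> hcone A \<and> hcone C \<and> hcone A' \<and> hcone C' \<and> A \<subseteq> D \<and> C \<subseteq> D \<and> A' \<subseteq> D \<and> C' \<subseteq> D"
  and cfg_lap: "cfg A C A' C' D z n e \<Longrightarrow> lap_eq A C A' C'"
  and cfg_order: "cfg A C A' C' D z n e \<Longrightarrow> convex_order z n e D"
  and cfg_edges: "cfg A C A' C' D z n e \<Longrightarrow> same_edges A C A' C' z n"
  and cfg_coincide: "cfg A C A' C' D z n e \<Longrightarrow> simple_vertices_coincide A C A' C' z n"
  by (simp_all add: cfg_def)

lemma cfg_vertex: "cfg A C A' C' D z n e \<Longrightarrow> i < n \<Longrightarrow> (z i \<in> A \<or> z i \<in> C) \<and> (z i \<in> A' \<or> z i \<in> C') \<and> (z i \<in> A \<and> z i \<in> C \<longleftrightarrow> z i \<in> A' \<and> z i \<in> C')"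
  by (simp add: cfg_def vertices_covered_def)

lemma cfg_coin:
  assumes "cfg A C A' C' D z n e" "i < n" "\<not> (z i \<in> A \<and> z i \<in> C)" "z i \<in> P" "z i \<in> P'" "P = A \<or> P = C" "P' = A' \<or> P' = C'"
  shows "coin (z i) P P'"
  by (rule cfg_coincide[OF assms(1), unfolded simple_vertices_coincide_def, rule_format, OF assms(2,3)]) (use assms in auto)

lemma cfg_roles:
  assumes c: "cfg A C A' C' D z n e" shows "cfg C A C' A' D z n e"
proof -
  have "vertices_covered C A C' A' z n" unfolding vertices_covered_def using cfg_vertex[OF c] by blast
  moreover have "same_edges C A C' A' z n" using cfg_edges[OF c] unfolding same_edges_def by (simp add: disj_commute)
  moreover have "simple_vertices_coincide C A C' A' z n"
    using cfg_coincide[OF c] unfolding simple_vertices_coincide_def insert_commute[of C A] insert_commute[of C' A'] by (simp only: conj_commute)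
  ultimately show ?thesis using c lap_eq_roles[OF cfg_lap[OF c]] by (simp add: cfg_def)
qed

lemma cfg_swap:
  assumes c: "cfg A C A' C' D z n e" shows "cfg A C C' A' D z n e"
proof -
  have "vertices_covered A C C' A' z n" unfolding vertices_covered_def using cfg_vertex[OF c] by blast
  moreover have "same_edges A C C' A' z n" using cfg_edges[OF c] unfolding same_edges_def by (simp add: disj_commute)
  moreover have "simple_vertices_coincide A C C' A' z n"
    using cfg_coincide[OF c] unfolding simple_vertices_coincide_def insert_commute[of C' A'] .
  ultimately show ?thesis using c lap_eq_swap[OF cfg_lap[OF c]] by (simp add: cfg_def)
qed

lemma cfg_reindex:
  assumes c: "cfg A C A' C' D z n e" and o: "convex_order (\<lambda>i. z (f i)) n e' D"
    and f: "\<And>i. i < n \<Longrightarrow> f i < n" "\<And>i j. adj n i j \<Longrightarrow> adj n (f i) (f j)"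
  shows "cfg A C A' C' D (\<lambda>i. z (f i)) n e'"
proof -
  have "vertices_covered A C A' C' (\<lambda>i. z (f i)) n" unfolding vertices_covered_def using cfg_vertex[OF c f(1)] by blast
  moreover have "same_edges A C A' C' (\<lambda>i. z (f i)) n" using cfg_edges[OF c] f(2) unfolding same_edges_def by simp
  moreover have "simple_vertices_coincide A C A' C' (\<lambda>i. z (f i)) n" unfolding simple_vertices_coincide_def
  proof (intro allI impI ballI)
    fix i P P' assume h: "i < n" "\<not> (z (f i) \<in> A \<and> z (f i) \<in> C)" "P \<in> {A, C}" "P' \<in> {A', C'}" "z (f i) \<in> P" "z (f i) \<in> P'"
    show "coin (z (f i)) P P'" by (rule cfg_coin[OF c f(1)[OF h(1)] h(2,5,6)]) (use h in auto)
  qed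
  ultimately show ?thesis using c o by (simp add: cfg_def)
qed

lemma cfg_rotate:
  assumes c: "cfg A C A' C' D z n e" and r: "r < n"
  shows "cfg A C A' C' D (\<lambda>i. z ((i + r) mod n)) n e"
proof (rule cfg_reindex[OF c convex_order_rotate[OF cfg_order[OF c] r]])
  show "(i + r) mod n < n" for i using r by simp
  have "(Suc i mod n + r) mod n = Suc ((i + r) mod n) mod n" for i by (simp add: mod_simps)
  hence 1: "(j + r) mod n = Suc ((i + r) mod n) mod n" if "j = Suc i mod n" for i j using that by simp
  have b: "(i + r) mod n < n" for i using r by simp
  show "adj n ((i + r) mod n) ((j + r) mod n)" if "adj n i j" for i j
    using that 1[of j i] 1[of i j] b unfolding adj_def by blast
qed

lemma cfg_reflect:
  assumes c: "cfg A C A' C' D z n e"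
  shows "cfg A C A' C' D (\<lambda>i. z ((n - i) mod n)) n (- e)"
proof (rule cfg_reindex[OF c convex_order_reflect[OF cfg_order[OF c]]])
  have n: "3 \<le> n" using cfg_order[OF c] by (simp add: convex_order_def)
  show "(n - i) mod n < n" for i using n by simp
  have 1: "(n - i) mod n = Suc ((n - Suc i mod n) mod n) mod n" if i: "i < n" for i
  proof (cases "Suc i = n")
    case True thus ?thesis using n by simp
  next
    case False
    hence "Suc i mod n = Suc i" "n - Suc i < n" "Suc (n - Suc i) = n - i" using i by auto
    thus ?thesis by simp
  qed
  show "adj n ((n - i) mod n) ((n - j) mod n)" if a: "adj n i j" for i j
  proof -
    have b: "(n - i) mod n < n" "(n - j) mod n < n" using n by auto
    from a have "i < n" "j < n" and d: "j = Suc i mod n \<or> i = Suc j mod n" unfolding adj_def by blast+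
    note 1 = 1[OF \<open>i < n\<close>] 1[OF \<open>j < n\<close>]
    from d have "(n - i) mod n = Suc ((n - j) mod n) mod n \<or> (n - j) mod n = Suc ((n - i) mod n) mod n"
    proof
      assume "j = Suc i mod n" from 1(1)[folded this] show ?thesis ..
    next
      assume "i = Suc j mod n" from 1(2)[folded this] show ?thesis ..
    qed
    with b show ?thesis unfolding adj_def by blast
  qed
qed

lemma cfg_finish:
  assumes c: "cfg A C A' C' D z n e" and A: "A = A'"
  shows "C = C'"
proof -
  have l: "lap_eq C A C' A" using lap_eq_roles[OF cfg_lap[OF c]] A by simp
  show ?thesis using lap_eq_cancel[OF _ _ _ l] lap_eq_cancel[OF _ _ _ lap_eq_sym[OF l]] cfg_hcone[OF c] by blast
qed

text \<open>A cone inside \<open>D\<close> that contains all generators of \<open>D\<close> is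
  \<open>D\<close>.\<close>

lemma cfg_all:
  assumes c: "cfg A C A' C' D z n e" and a: "\<forall>i<n. z i \<in> A \<and> z i \<in> A'"
  shows "A = A' \<and> C = C'"
proof -
  have D: "D = ccone (z ` {..<n})" using cfg_order[OF c] by (simp add: convex_order_def)
  have H: "hcone A" "hcone A'" using cfg_hcone[OF c] by auto
  have s: "z ` {..<n} \<subseteq> A" "z ` {..<n} \<subseteq> A'" using a by auto
  have "D \<subseteq> A" "D \<subseteq> A'" unfolding D using ccone_subset[OF H(1) s(1)] ccone_subset[OF H(2) s(2)] .
  hence "A = A'" using cfg_hcone[OF c] by blast
  thus ?thesis using cfg_finish[OF c] by blast
qed

text \<open>At a vertex lying only in \<open>A\<close> and \<open>A'\<close>, the side to a
  neighbour is an edge exactly if the neighbour lies in \<open>A\<close>, and equally for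
  \<open>A'\<close>. Membership in \<open>C\<close> then follows from covering and from the
  condition on shared vertices.\<close>

lemma cfg_step:
  assumes c: "cfg A C A' C' D z n e" and a: "adj n i j" and i: "z i \<in> A" "z i \<notin> C" "z i \<in> A'" "z i \<notin> C'"
  shows "(z j \<in> A \<longleftrightarrow> z j \<in> A') \<and> (z j \<in> C \<longleftrightarrow> z j \<in> C')"
proof -
  have "j < n" using a by (simp add: adj_def)
  from cfg_vertex[OF c this] show ?thesis using cfg_edges[OF c, unfolded same_edges_def, rule_format, OF a] i by blast
qed

lemma cfg_xray:
  assumes c: "cfg A C A' C' D z n e" and i: "i < n" "z i \<in> A" "z i \<notin> C" "z i \<in> A'" "z i \<notin> C'"
  shows "xray_le (z i) C C' \<and> xray_le (z i) C' C"
proof -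
  have co: "coin (z i) A A'" using cfg_coin[OF c i(1)] i by blast
  note r = convex_order_corner(1)[OF convex_order_rotate[OF cfg_order[OF c] i(1)]]
  have 0: "(0 + i) mod n = i" using i by simp
  note r = r[unfolded 0]
  have h: "hcone A" "hcone C" "hcone A'" "hcone C'" "A \<subseteq> D" "C \<subseteq> D" "A' \<subseteq> D" "C' \<subseteq> D" using cfg_hcone[OF c] by auto
  show ?thesis
    using simple_vertex_xray[OF r h cfg_lap[OF c] i(2,4,3,5) co[unfolded coin_def]]
      simple_vertex_xray[OF r h(3,4,1,2,7,8,5,6) lap_eq_sym[OF cfg_lap[OF c]] i(4,2,5,3) coincide_near_sym[OF co[unfolded coin_def]]] by blast
qed

lemma convex_order_cvec_pos:
  assumes o: "convex_order z n e D" and i: "0 < i" "i < n"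
  shows "cvec (z 0) (z 1) (z (n - 1)) \<bullet> z i > 0"
proof (rule ccontr)
  note c = convex_order_corner(1)[OF o]
  have n: "3 \<le> n" and pos: "\<And>i j k. i < j \<Longrightarrow> j < k \<Longrightarrow> k < n \<Longrightarrow> e * trip (z i) (z j) (z k) > 0" and h: "z i $ 3 = 1"
    using o i by (auto simp: convex_order_def)
  assume "\<not> ?thesis"
  hence "cvec (z 0) (z 1) (z (n - 1)) \<bullet> z i = 0" using corner_cvec_nonneg[OF c convex_order_mem[OF o i(2)]] by simp
  from corner_cvec_zero[OF c convex_order_mem[OF o i(2)] this] have "z i = z 0" unfolding h by simp
  moreover have "i = 1 \<or> 1 < i" using i by auto
  ultimately show False using pos[of 0 1 i] pos[of 0 i 2] n i by auto
qed

section \<open>Chains of vertices between simple vertices\<close>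

lemma plane_kernel:
  assumes T: "trip v b y \<noteq> 0" and m: "m \<bullet> v = 0" "m \<bullet> b > 0" and x: "trip v b x = 0" "m \<bullet> x = 0"
  shows "\<exists>\<tau>. x = \<tau> *\<^sub>R v"
proof -
  define T where "T = trip v b y"
  have T0: "T \<noteq> 0" using assms by (simp add: T_def)
  have cr: "T *\<^sub>R x = trip x b y *\<^sub>R v + trip v x y *\<^sub>R b" using trip_cramer[of v b y x] x by (simp add: T_def)
  hence "m \<bullet> (T *\<^sub>R x) = trip v x y * (m \<bullet> b)" using m by (simp add: inner_add_right)
  hence "trip v x y = 0" using x m by simp
  hence "(1/T) *\<^sub>R (T *\<^sub>R x) = (1/T) *\<^sub>R (trip x b y *\<^sub>R v)" using cr by simp
  thus ?thesis using T0 by auto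
qed

text \<open>Supplies the pencil of planes through \<open>z 0\<close> for \<open>two_point\<close>,
  normalized so that agreement is known up to the parameter 0. The plane of this parameter also
  passes through \<open>z j\<close>, or, if \<open>j\<close> is 1, through the point
  \<open>b\<close> of \<open>near_start_le\<close>.\<close>

lemma fan_functional:
  assumes o: "convex_order z n e D" and j: "0 < j" "j < n"
    and C: "hcone C" "hcone C'" "C \<subseteq> D" "C' \<subseteq> D" and z: "z 0 \<notin> C" "z 0 \<notin> C'" and X: "xray_le (z 0) C C'" "xray_le (z 0) C' C"
    and W: "\<forall>i. 1 \<le> i \<longrightarrow> i \<le> j \<longrightarrow> z i \<in> C \<and> z i \<in> C'" and co: "j = 1 \<longrightarrow> coin (z 1) C C'"
  obtains p where "p \<bullet> z 0 = 0" "\<forall>x. p \<bullet> x = 0 \<longrightarrow> cvec (z 0) (z 1) (z (n - 1)) \<bullet> x = 0 \<longrightarrow> (\<exists>\<tau>. x = \<tau> *\<^sub>R z 0)"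
    "\<forall>x. p \<bullet> x \<le> 0 \<longrightarrow> (x \<in> C \<longleftrightarrow> x \<in> C')" "p \<bullet> z 1 < 0" "p \<bullet> z j \<le> 0"
proof -
  define m where "m = cvec (z 0) (z 1) (z (n - 1))"
  have n: "3 \<le> n" and pos: "\<And>i j k. i < j \<Longrightarrow> j < k \<Longrightarrow> k < n \<Longrightarrow> e * trip (z i) (z j) (z k) > 0" and h: "\<forall>i<n. z i $ 3 = 1"
    using o by (auto simp: convex_order_def)
  have e0: "e \<noteq> 0" using pos[of 0 1 2] n by auto
  have m0: "m \<bullet> z 0 = 0" unfolding m_def cvec_inner by simp
  show thesis
  proof (cases "j = 1")
    case False
    define p where "p = e *\<^sub>R cross3 (z 0) (z j)"
    have p: "p \<bullet> x = e * trip (z 0) (z j) x" for x by (simp add: p_def trip_inner)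
    have t: "e * trip (z 0) (z j) (z 1) < 0" using pos[of 0 1 j] False j trip_swap[of "z 0" "z j" "z 1"] by simp
    show thesis
    proof (rule that[of p])
      show "p \<bullet> z 0 = 0" "p \<bullet> z j \<le> 0" "p \<bullet> z 1 < 0" using t by (simp_all add: p)
      have X1: "\<forall>x. e * trip (z 0) (z j) x \<le> 0 \<longrightarrow> x \<in> C \<longrightarrow> x \<in> C'" by (rule fan_agree_le[OF o j C z(1) X(1) W])
      have "\<forall>x. e * trip (z 0) (z j) x \<le> 0 \<longrightarrow> x \<in> C' \<longrightarrow> x \<in> C"
        by (rule fan_agree_le[OF o j C(2,1,4,3) z(2) X(2)]) (use W in blast)
      thus "\<forall>x. p \<bullet> x \<le> 0 \<longrightarrow> (x \<in> C \<longleftrightarrow> x \<in> C')" using X1 by (auto simp: p)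
      have T: "trip (z 0) (z j) (z 1) \<noteq> 0" using t by auto
      have mj: "m \<bullet> z j > 0" unfolding m_def by (rule convex_order_cvec_pos[OF o j])
      show "\<forall>x. p \<bullet> x = 0 \<longrightarrow> cvec (z 0) (z 1) (z (n - 1)) \<bullet> x = 0 \<longrightarrow> (\<exists>\<tau>. x = \<tau> *\<^sub>R z 0)"
        unfolding m_def[symmetric] p using plane_kernel[OF T m0 mj] e0 by auto
    qed
  next
    case True
    have zc: "z 1 \<in> C" "z 1 \<in> C'" using W True by auto
    have r1: "1 < n" using n by simp
    have idx: "(0 + 1) mod n = 1" "(n - 1 + 1) mod n = 0" "(1 + 1) mod n = 2" using n by auto
    note cr = convex_order_corner(2)[OF convex_order_rotate[OF o r1], unfolded idx]
    obtain k1 k2 E where S: "ray_section C (z 0 - z 1) (z 2 - z 0) (z 1) k1 k2 E" by (rule corner_ray_section[OF cr C(1,3) zc(1)])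
    obtain l1 l2 E' where S': "ray_section C' (z 0 - z 1) (z 2 - z 0) (z 1) l1 l2 E'" by (rule corner_ray_section[OF cr C(2,4) zc(2)])
    have cn: "coincide_near (z 1) (C \<inter> {x. x$3 = 1}) (C' \<inter> {x. x$3 = 1})" using co True by (simp add: coin_def)
    have "l1 = k1" "l2 = k2"
      using coincide_ranges[OF cr C zc S S' cn] coincide_ranges[OF cr C(2,1,4,3) zc(2,1) S' S coincide_near_sym[OF cn]] by auto
    note S' = S'[unfolded this]
    have a: "trip (z 1) (z 0) (z 2) \<noteq> 0" "z 1 $ 3 = 1" "z 0 $ 3 = 1" "z 2 $ 3 = 1" using cr by (auto simp: corner_def)
    have k: "0 < k2" "k1 \<le> k2" using S by (auto simp: ray_section_def)
    define b where "b = (z 0 - z 1) + k2 *\<^sub>R (z 2 - z 0) + (max (E k2) (E' k2)) *\<^sub>R z 1"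
    have bC: "b \<in> C" using S k unfolding b_def ray_section_def by auto
    have b0: "b \<noteq> 0" unfolding b_def by (rule corner_point(4)[OF a])
    have bT: "trip (z 0) (z 1) b = k2 * trip (z 0) (z 1) (z 2)" unfolding b_def by (simp add: trip_linear)
    define T where "T = trip (z 0) (z 1) (z 2)"
    have T0: "T \<noteq> 0" using pos[of 0 1 2] n by (auto simp: T_def)
    define p where "p = (1 / T) *\<^sub>R cross3 (z 0) b"
    have p: "p \<bullet> x = trip (z 0) b x / T" for x by (simp add: p_def trip_inner)
    have pz: "p \<bullet> z 1 < 0" unfolding p trip_swap[of "z 0" b "z 1"] bT T_def[symmetric] using T0 k by simp
    show thesis
    proof (rule that[of p])
      show "p \<bullet> z 0 = 0" by (simp add: p)
      show "p \<bullet> z 1 < 0" "p \<bullet> z j \<le> 0" using pz True by auto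
      have "\<forall>x. trip (z 0) b x / T \<le> 0 \<longrightarrow> x \<in> C \<longrightarrow> x \<in> C'"
        unfolding T_def by (rule near_start_le[OF cr C zc S S' z(1) X(1) b_def])
      moreover have "b = (z 0 - z 1) + k2 *\<^sub>R (z 2 - z 0) + (max (E' k2) (E k2)) *\<^sub>R z 1" by (simp add: b_def max.commute)
      hence "\<forall>x. trip (z 0) b x / T \<le> 0 \<longrightarrow> x \<in> C' \<longrightarrow> x \<in> C"
        unfolding T_def by (rule near_start_le[OF cr C(2,1,4,3) zc(2,1) S' S z(2) X(2)])
      ultimately show "\<forall>x. p \<bullet> x \<le> 0 \<longrightarrow> (x \<in> C \<longleftrightarrow> x \<in> C')" by (auto simp: p)
      have Tb: "trip (z 0) b (z 1) \<noteq> 0" unfolding trip_swap[of "z 0" b "z 1"] bT T_def[symmetric] using T0 k by simp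
      have mb: "m \<bullet> b > 0" unfolding m_def by (rule corner_cvec_pos[OF convex_order_corner(1)[OF o] C(1,3) z(1) bC b0])
      show "\<forall>x. p \<bullet> x = 0 \<longrightarrow> cvec (z 0) (z 1) (z (n - 1)) \<bullet> x = 0 \<longrightarrow> (\<exists>\<tau>. x = \<tau> *\<^sub>R z 0)"
        unfolding m_def[symmetric] p using plane_kernel[OF Tb m0 mb] T0 by auto
    qed
  qed
qed

text \<open>\<open>z 1\<close> starts a chain of vertices of \<open>C\<close>. If the chain comes
  back to \<open>z 0\<close>, all of \<open>D\<close> is swept from \<open>z 0\<close>. Otherwise it
  stops before a vertex \<open>z k\<close> that lies in \<open>A\<close> only, and
  \<open>two_point\<close> is applied to \<open>z 0\<close> and \<open>z k\<close>.\<close>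

lemma cfg_alternate:
  assumes c: "cfg A C A' C' D z n e" and mt: "\<forall>i<n. (z i \<in> A \<longleftrightarrow> z i \<in> A') \<and> (z i \<in> C \<longleftrightarrow> z i \<in> C')"
    and z0: "z 0 \<in> A" "z 0 \<notin> C" and z1: "z 1 \<in> C" "z 1 \<notin> A"
  shows "A = A' \<and> C = C'"
proof -
  note o = cfg_order[OF c]
  have n: "3 \<le> n" and h: "\<forall>i<n. z i $ 3 = 1" using o by (auto simp: convex_order_def)
  have H: "hcone A" "hcone C" "hcone A'" "hcone C'" "A \<subseteq> D" "C \<subseteq> D" "A' \<subseteq> D" "C' \<subseteq> D" using cfg_hcone[OF c] by auto
  have X: "xray_le (z i) C C'" "xray_le (z i) C' C" "z i \<notin> C" "z i \<notin> C'" if "i < n" "z i \<notin> C" for i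
    using cfg_xray[OF c that(1)] that mt cfg_vertex[OF c that(1)] by auto
  have x0: "xray_le (z 0) C C'" "xray_le (z 0) C' C" "z 0 \<notin> C" "z 0 \<notin> C'" using X[of 0] z0 n by auto
  have "C = C'"
  proof (cases "\<exists>k. 2 \<le> k \<and> k < n \<and> z k \<notin> C")
    case False
    have W: "\<forall>i. 1 \<le> i \<longrightarrow> i \<le> n - 1 \<longrightarrow> z i \<in> C \<and> z i \<in> C'"
    proof (intro allI impI)
      fix i assume i: "1 \<le> i" "i \<le> n - 1"
      hence "z i \<in> C" using False z1 n by (cases "i = 1") auto
      thus "z i \<in> C \<and> z i \<in> C'" using mt i n by auto
    qed
    have all: "e * trip (z 0) (z (n - 1)) x \<le> 0" if "x \<in> D" for x
      using convex_order_edges(2)[OF o that] trip_swap[of "z 0" "z (n - 1)" x] by simp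
    have j: "0 < n - 1" "n - 1 < n" using n by auto
    have W': "\<forall>i. 1 \<le> i \<longrightarrow> i \<le> n - 1 \<longrightarrow> z i \<in> C' \<and> z i \<in> C" using W by blast
    show ?thesis
      using fan_agree_le[OF o j H(2,4,6,8) x0(3,1) W] fan_agree_le[OF o j H(4,2,8,6) x0(4,2) W'] all H by blast
  next
    case True
    define k where "k = (LEAST k. 2 \<le> k \<and> k < n \<and> z k \<notin> C)"
    have k: "2 \<le> k" "k < n" "z k \<notin> C" using LeastI_ex[OF True] unfolding k_def by auto
    have lk: "z i \<in> C" if "1 \<le> i" "i < k" for i
    proof (cases "i = 1")
      case False
      thus ?thesis using not_less_Least[of i "\<lambda>k. 2 \<le> k \<and> k < n \<and> z k \<notin> C"] that k unfolding k_def[symmetric] by auto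
    qed (use z1 in simp)
    have W: "\<forall>i. 1 \<le> i \<longrightarrow> i \<le> k - 1 \<longrightarrow> z i \<in> C \<and> z i \<in> C'"
    proof (intro allI impI)
      fix i assume i: "1 \<le> i" "i \<le> k - 1"
      hence "z i \<in> C" using lk k by auto
      thus "z i \<in> C \<and> z i \<in> C'" using mt i k by auto
    qed
    have j: "0 < k - 1" "k - 1 < n" using k by auto
    have c1: "z 1 \<in> C'" "1 < n" using mt z1 n by auto
    have co: "coin (z 1) C C'" using cfg_coin[OF c c1(2)] z1 c1 by blast
    obtain p where p: "p \<bullet> z 0 = 0" "\<forall>x. p \<bullet> x = 0 \<longrightarrow> cvec (z 0) (z 1) (z (n - 1)) \<bullet> x = 0 \<longrightarrow> (\<exists>\<tau>. x = \<tau> *\<^sub>R z 0)"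
      "\<forall>x. p \<bullet> x \<le> 0 \<longrightarrow> (x \<in> C \<longleftrightarrow> x \<in> C')" "p \<bullet> z 1 < 0" "p \<bullet> z (k - 1) \<le> 0"
      by (rule fan_functional[OF o j H(2,4,6,8) x0(3,4,1,2) W]) (use co in auto)
    \<comment> \<open>The vertices in reverse order from \<open>z k\<close>, so that the
      construction at \<open>z 0\<close> can be repeated at the other end of the chain.\<close>
    define y where "y = (\<lambda>i. z (((n - i) mod n + k) mod n))"
    have oy: "convex_order y n (- e) D" unfolding y_def
      using convex_order_reflect[OF convex_order_rotate[OF o k(2)]] .
    have yi: "y i = z (k - i)" if "i \<le> k" for i
    proof (cases "i = 0")
      case True thus ?thesis using k by (simp add: y_def)
    next
      case False
      hence "(n - i) mod n = n - i" using that k by simp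
      moreover have "n - i + k = n + (k - i)" using that k by simp
      moreover have "(n + (k - i)) mod n = k - i" using k by simp
      ultimately show ?thesis unfolding y_def by simp
    qed
    have ys: "y 0 = z k" "y 1 = z (k - 1)" "y (k - 1) = z 1" "y k = z 0" using yi[of 0] yi[of 1] yi[of "k - 1"] yi[of k] k by auto
    have Wy: "\<forall>i. 1 \<le> i \<longrightarrow> i \<le> k - 1 \<longrightarrow> y i \<in> C \<and> y i \<in> C'"
    proof (intro allI impI)
      fix i assume i: "1 \<le> i" "i \<le> k - 1"
      hence "1 \<le> k - i" "k - i \<le> k - 1" "i \<le> k" by auto
      thus "y i \<in> C \<and> y i \<in> C'" using W yi[of i] by auto
    qed
    note xk = X[OF k(2,3)]
    have coy: "k - 1 = 1 \<longrightarrow> coin (y 1) C C'" using co ys by auto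
    obtain q where q: "q \<bullet> z k = 0" "\<forall>x. q \<bullet> x = 0 \<longrightarrow> cvec (y 0) (y 1) (y (n - 1)) \<bullet> x = 0 \<longrightarrow> (\<exists>\<tau>. x = \<tau> *\<^sub>R z k)"
      "\<forall>x. q \<bullet> x \<le> 0 \<longrightarrow> (x \<in> C \<longleftrightarrow> x \<in> C')" "q \<bullet> z (k - 1) < 0" "q \<bullet> z 1 \<le> 0"
      by (rule fan_functional[OF oy j H(2,4,6,8) _ _ _ _ Wy coy]) (use xk ys in auto)
    have cn0: "cvec (z 0) (z 1) (z (n - 1)) \<bullet> z 0 = 0" "cvec (y 0) (y 1) (y (n - 1)) \<bullet> z k = 0" unfolding ys(1)[symmetric] cvec_inner by simp_all
    have mp: "\<forall>x\<in>C \<union> C'. x \<noteq> 0 \<longrightarrow> cvec (z 0) (z 1) (z (n - 1)) \<bullet> x > 0"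
      using corner_cvec_pos[OF convex_order_corner(1)[OF o]] H x0 by blast
    have yk: "y 0 \<notin> C" "y 0 \<notin> C'" using xk ys by auto
    have np: "\<forall>x\<in>C \<union> C'. x \<noteq> 0 \<longrightarrow> cvec (y 0) (y 1) (y (n - 1)) \<bullet> x > 0"
      using corner_cvec_pos[OF convex_order_corner(1)[OF oy]] H yk by blast
    have mk: "cvec (z 0) (z 1) (z (n - 1)) \<bullet> z k > 0" by (rule convex_order_cvec_pos[OF o]) (use k in auto)
    have n0: "cvec (y 0) (y 1) (y (n - 1)) \<bullet> z 0 > 0" unfolding ys(4)[symmetric] by (rule convex_order_cvec_pos[OF oy]) (use k in auto)
    have z3: "z 0 $ 3 \<ge> 0" "z k $ 3 \<ge> 0" using h n k by auto
    have p0: "\<forall>x. p \<bullet> x \<le> 0 * (cvec (z 0) (z 1) (z (n - 1)) \<bullet> x) \<longrightarrow> (x \<in> C \<longleftrightarrow> x \<in> C')" using p(3) by simp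
    have q0: "\<forall>x. q \<bullet> x \<le> 0 * (cvec (y 0) (y 1) (y (n - 1)) \<bullet> x) \<longrightarrow> (x \<in> C \<longleftrightarrow> x \<in> C')" using q(3) by simp
    have W1: "z 1 \<in> C" "z 1 \<in> C'" "z (k - 1) \<in> C" "z (k - 1) \<in> C'" using W j by auto
    show ?thesis
    proof (rule two_point[OF H(2) x0(3) H(4) x0(4) z3(1) xk(3,4) z3(2) x0(1,2) xk(1,2) p(1) cn0(1) p(2) q(1) cn0(2) q(2) mp mk np n0 p0 q0])
      \<comment> \<open>Each of \<open>p\<close> and \<open>q\<close> is known to be strictly
        negative at one end of the chain and nonpositive at the other; both are strictly negative at
        the sum.\<close>
      show "z 1 + z (k - 1) \<in> C" "z 1 + z (k - 1) \<in> C'" using hcone_add H W1 by auto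
      show "p \<bullet> (z 1 + z (k - 1)) < 0 * (cvec (z 0) (z 1) (z (n - 1)) \<bullet> (z 1 + z (k - 1)))" using p(4,5) unfolding inner_add_right by linarith
      show "q \<bullet> (z 1 + z (k - 1)) < 0 * (cvec (y 0) (y 1) (y (n - 1)) \<bullet> (z 1 + z (k - 1)))" using q(4,5) unfolding inner_add_right by linarith
    qed
  qed
  thus ?thesis using cfg_finish[OF cfg_roles[OF c]] by blast
qed

section \<open>Shared vertices\<close>

text \<open>Once the angles agree, the first-order identity is linear in the differences of the
  boundary functions, as \<open>kink_localization\<close> requires.\<close>

lemma shared_vertex_identity:
  assumes A: "ray_section A w0 w1 v a1 a2 EA" and C: "ray_section C w0 w1 v c1 c2 EC"
    and A': "ray_section A' w0 w1 v a1 a2 EA'" and C': "ray_section C' w0 w1 v c1 c2 EC'"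
    and la: "\<bar>la\<bar> < 1/2"
    and eq: "\<And>ta. 0 < ta \<Longrightarrow> sint A w0 w1 v la ta * sint C w0 w1 v la ta = sint A' w0 w1 v la ta * sint C' w0 w1 v la ta"
  shows "(a2 - a1) / ((1 + la * a1) * (1 + la * a2)) * integral {c1..c2} (\<lambda>t. (EC t - EC' t) / (1 + la * t)^3)
    + (c2 - c1) / ((1 + la * c1) * (1 + la * c2)) * integral {a1..a2} (\<lambda>t. (EA t - EA' t) / (1 + la * t)^3) = 0"
proof -
  have I: "integral {k1..k2} (\<lambda>t. (E t - E' t) / (1 + la * t)^3) =
      integral {k1..k2} (\<lambda>t. E t / (1 + la * t)^3) - integral {k1..k2} (\<lambda>t. E' t / (1 + la * t)^3)"
    if S: "ray_section K w0 w1 v k1 k2 E" "ray_section K' w0 w1 v k1 k2 E'" for K K' k1 k2 E E'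
  proof -
    have k: "0 \<le> k1" "k1 \<le> k2" "k2 \<le> 1" using S by (auto simp: ray_section_def)
    have nz: "(1 + la * t)^3 \<noteq> 0" if "t \<in> {k1..k2}" for t
    proof -
      have "\<bar>la * t\<bar> \<le> 1/2 * 1" unfolding abs_mult using that k la by (intro mult_mono) auto
      thus ?thesis by auto
    qed
    have c: "continuous_on {k1..k2} E" "continuous_on {k1..k2} E'"
      using S pl_breaks_continuous[OF k(2)] unfolding ray_section_def by blast+
    have "continuous_on {k1..k2} (\<lambda>t. E t / (1 + la * t)^3)" "continuous_on {k1..k2} (\<lambda>t. E' t / (1 + la * t)^3)"
      using nz by (auto intro!: continuous_intros c)
    hence "(\<lambda>t. E t / (1 + la * t)^3) integrable_on {k1..k2}" "(\<lambda>t. E' t / (1 + la * t)^3) integrable_on {k1..k2}"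
      by (auto intro: integrable_continuous_interval)
    from integral_diff[OF this] show ?thesis by (simp add: diff_divide_distrib)
  qed
  show ?thesis unfolding I[OF C C'] I[OF A A'] using shared_vertex_expansion(2)[OF A C A' C' la eq] by (simp add: right_diff_distrib)
qed

lemma corner_trip:
  assumes c: "corner v q p D"
  shows "trip v y x = trip v q p * ((cvec v q p \<bullet> y) * (trip v q x / trip v q p) - (trip v q y / trip v q p) * (cvec v q p \<bullet> x))"
proof -
  have a: "trip v q p \<noteq> 0" "v$3 = 1" "q$3 = 1" "p$3 = 1" using c by (auto simp: corner_def)
  define T where "T = trip v q p"
  have T: "T \<noteq> 0" using a by (simp add: T_def)
  define X where "X = trip v y p / T"
  define U where "U = trip v q y / T"
  have y: "y = X *\<^sub>R (q - v) + U *\<^sub>R (p - v) + y$3 *\<^sub>R v" unfolding X_def U_def T_def by (rule corner_coords[OF a])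
  have "trip v y x = X * trip v q x + U * trip v p x" by (subst y) (simp add: trip_linear)
  also have "\<dots> = T * (X * (trip v q x / T) - U * (trip v x p / T))" using T trip_swap[of v x p] by (simp add: field_simps)
  also have "\<dots> = T * ((X + U) * (trip v q x / T) - U * (trip v x p / T + trip v q x / T))"
  proof -
    have "T * (X * P - U * Q) = T * ((X + U) * P - U * (Q + P))" for P Q by (simp add: algebra_simps)
    thus ?thesis .
  qed
  finally show ?thesis unfolding cvec_inner X_def U_def T_def .
qed

text \<open>\<open>A\<close> and \<open>A'\<close> agree on the cap cut off by the chord from
  \<open>z 0\<close> to \<open>z j\<close>. If the angle of \<open>A\<close> at \<open>z 0\<close>
  does not extend beyond the chord, they are equal. Otherwise the difference for \<open>A\<close>
  vanishes up to \<open>uj\<close>, the difference for \<open>C\<close> vanishes at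
  \<open>uj\<close>, and localization of kinks gives agreement of \<open>C\<close> and
  \<open>C'\<close> on the cap; X-rays from \<open>z 1\<close> then reach beyond the chord.\<close>

lemma cap:
  assumes c: "cfg A C A' C' D z n e"
    and z0: "z 0 \<in> A" "z 0 \<in> C" "z 0 \<in> A'" "z 0 \<in> C'"
    and T: "tangent (z 0) A = tangent (z 0) A'" "tangent (z 0) C = tangent (z 0) C'"
    and z1: "z 1 \<in> A" "z 1 \<notin> C" "z 1 \<in> A'" "z 1 \<notin> C'"
    and j: "2 \<le> j" "j < n" "z j \<in> C" "z j \<in> C'" and zi: "\<forall>i. 1 \<le> i \<longrightarrow> i < j \<longrightarrow> z i \<in> A \<and> z i \<in> A'"
    and zj: "z j \<in> A \<longleftrightarrow> z j \<in> A'"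
  shows "A = A' \<and> C = C'"
proof -
  note o = cfg_order[OF c]
  have n: "3 \<le> n" and h: "\<forall>i<n. z i $ 3 = 1" and pos: "\<And>i j k. i < j \<Longrightarrow> j < k \<Longrightarrow> k < n \<Longrightarrow> e * trip (z i) (z j) (z k) > 0"
    and D: "D = ccone (z ` {..<n})" using o by (auto simp: convex_order_def)
  have H: "hcone A" "hcone C" "hcone A'" "hcone C'" "A \<subseteq> D" "C \<subseteq> D" "A' \<subseteq> D" "C' \<subseteq> D" using cfg_hcone[OF c] by auto
  have h0: "z 0 $ 3 = 1" "z 1 $ 3 = 1" "z j $ 3 = 1" using h n j by auto
  note cr = convex_order_corner(1)[OF o]
  define v where "v = z 0"
  define q where "q = z 1"
  define p where "p = z (n - 1)"
  note cr = cr[folded v_def q_def p_def] and T = T[folded v_def]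
  have zv: "v \<in> A" "v \<in> C" "v \<in> A'" "v \<in> C'" using z0 by (auto simp: v_def)
  have a: "trip v q p \<noteq> 0" "v$3 = 1" "q$3 = 1" "p$3 = 1" using cr by (auto simp: corner_def)
  define m where "m = cvec v q p"
  define U where "U = (\<lambda>x. trip v q x / trip v q p)"
  have eT: "e * trip v q p > 0" unfolding v_def q_def p_def by (rule pos) (use n in auto)
  have mj: "m \<bullet> z j > 0" unfolding m_def v_def q_def p_def by (rule convex_order_cvec_pos[OF o]) (use j in auto)
  \<comment> \<open>The section coordinate of \<open>z j\<close> seen from \<open>z 0\<close>; it
    separates the two sides of the chord.\<close>
  define uj where "uj = U (z j) / (m \<bullet> z j)"
  have tr: "trip v (z j) x = trip v q p * ((m \<bullet> z j) * U x - U (z j) * (m \<bullet> x))" for x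
    unfolding m_def U_def by (rule corner_trip[OF cr])
  have side: "e * trip v (z j) x \<le> 0 \<longleftrightarrow> U x / (m \<bullet> x) \<le> uj" if "m \<bullet> x > 0" for x
  proof -
    have E: "e * trip v (z j) x = (e * trip v q p) * ((m \<bullet> z j) * U x - U (z j) * (m \<bullet> x))" unfolding tr by simp
    have "K * r \<le> 0 \<longleftrightarrow> r \<le> 0" if "K > 0" for K r :: real using that by (simp add: mult_le_0_iff)
    from this[OF eT] have "e * trip v (z j) x \<le> 0 \<longleftrightarrow> (m \<bullet> z j) * U x - U (z j) * (m \<bullet> x) \<le> 0" unfolding E .
    also have "\<dots> \<longleftrightarrow> U x / (m \<bullet> x) \<le> uj" unfolding uj_def using that mj by (simp add: divide_le_eq le_divide_eq mult_ac)
    finally show ?thesis .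
  qed
  obtain a1 a2 EA where SA: "ray_section A (q - v) (p - q) v a1 a2 EA" by (rule corner_ray_section[OF cr H(1,5) zv(1)])
  obtain b1 b2 EA' where SA': "ray_section A' (q - v) (p - q) v b1 b2 EA'" by (rule corner_ray_section[OF cr H(3,7) zv(3)])
  obtain c1 c2 EC where SC: "ray_section C (q - v) (p - q) v c1 c2 EC" by (rule corner_ray_section[OF cr H(2,6) zv(2)])
  obtain d1 d2 EC' where SC': "ray_section C' (q - v) (p - q) v d1 d2 EC'" by (rule corner_ray_section[OF cr H(4,8) zv(4)])
  have "b1 = a1" "b2 = a2" using tangent_ranges[OF cr H(1,3,5,7) zv(1,3) SA SA' T(1)] by auto
  note SA' = SA'[unfolded this]
  have "d1 = c1" "d2 = c2" using tangent_ranges[OF cr H(2,4,6,8) zv(2,4) SC SC' T(2)] by auto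
  note SC' = SC'[unfolded this]
  have ka: "0 \<le> a1" "a1 < a2" "a2 \<le> 1" and kc: "0 \<le> c1" "c1 < c2" "c2 \<le> 1" using SA SC by (auto simp: ray_section_def)
  have mem: "x \<in> K \<longleftrightarrow> k1 \<le> U x / (m \<bullet> x) \<and> U x / (m \<bullet> x) \<le> k2 \<and> E (U x / (m \<bullet> x)) \<le> x$3 / (m \<bullet> x)"
    if "hcone K" "ray_section K (q - v) (p - q) v k1 k2 E" "m \<bullet> x > 0" for K k1 k2 E x
    using corner_mem_iff[OF cr that(1,2)] that(3) unfolding U_def m_def .
  have zero: "x = (x$3) *\<^sub>R v" "x$3 \<ge> 0" if "x \<in> K" "hcone K" "K \<subseteq> D" "\<not> m \<bullet> x > 0" for x K
  proof -
    have "x \<in> D" using that by blast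
    moreover have "m \<bullet> x = 0" using corner_cvec_nonneg[OF cr \<open>x \<in> D\<close>] that(4) unfolding m_def by simp
    ultimately show "x = (x$3) *\<^sub>R v" using corner_cvec_zero[OF cr] unfolding m_def by blast
    show "x$3 \<ge> 0" using that unfolding hcone_def by (metis less_imp_le order_refl zero_index)
  qed
  \<comment> \<open>Either \<open>z j\<close> belongs to the cones and generates the cap together
    with the earlier vertices, or it is simple and the cap is swept from it.\<close>
  have agA: "x \<in> K'" if K: "hcone K" "hcone K'" "K \<subseteq> D" "K' \<subseteq> D" "\<forall>i<j. z i \<in> K \<and> z i \<in> K'" "z j \<in> K \<longleftrightarrow> z j \<in> K'"
      "z j \<notin> K \<longrightarrow> xray_le (z j) K K'" and x: "x \<in> K" "e * trip v (z j) x \<le> 0" for K K' x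
  proof -
    have cc: "y \<in> ccone (z ` {0..j})" if "y \<in> D" "e * trip v (z j) y \<le> 0" for y
      by (rule convex_order_cap[OF o]) (use that j in \<open>auto simp: v_def\<close>)
    show ?thesis
    proof (cases "z j \<in> K")
      case True
      hence "z ` {0..j} \<subseteq> K'" using K(5,6) by (force simp: le_less)
      thus ?thesis using ccone_subset[OF K(2)] cc x K by blast
    next
      case False
      define G where "G = {x. e * trip v (z j) x \<le> 0}"
      have s: "z ` {0..<j} \<subseteq> K" "z ` {0..<j} \<subseteq> K'" using K(5) by auto
      have zj0: "z j $ 3 \<ge> 0" "z j \<noteq> 0" using h0 by auto
      have X: "xray_le (z j) K K'" using False K by blast
      have "K \<inter> G \<subseteq> K'"
      proof (rule sweep[OF K(1,3,4) False zj0 X _ _ ccone_subset[OF K(1) s(1)] ccone_subset[OF K(2) s(2)]])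
        show "\<forall>x\<in>G. \<forall>\<tau>. x + \<tau> *\<^sub>R z j \<in> G" by (simp add: G_def trip_linear)
        show "\<forall>x\<in>D \<inter> G. \<exists>w\<in>ccone (z ` {0..<j}). \<exists>\<tau>\<ge>0. x = w + \<tau> *\<^sub>R z j"
        proof
          fix y assume "y \<in> D \<inter> G"
          hence "y \<in> ccone (insert (z j) (z ` {0..<j}))" using cc unfolding G_def ccone_atLeastAtMost_insert(2)[symmetric] by blast
          then obtain w \<tau> where "w \<in> ccone (z ` {0..<j})" "\<tau> \<ge> 0" "y = w + \<tau> *\<^sub>R z j" by (rule ccone_insert) simp
          thus "\<exists>w\<in>ccone (z ` {0..<j}). \<exists>\<tau>\<ge>0. y = w + \<tau> *\<^sub>R z j" by blast
        qed
      qed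
      thus ?thesis using x by (auto simp: G_def)
    qed
  qed
  have zl: "\<forall>i<j. z i \<in> A \<and> z i \<in> A'"
  proof (intro allI impI)
    fix i assume "i < j"
    thus "z i \<in> A \<and> z i \<in> A'" using zi z0 by (cases "i = 0") auto
  qed
  have Xj: "z j \<notin> A \<longrightarrow> xray_le (z j) A A' \<and> xray_le (z j) A' A"
    using cfg_xray[OF cfg_roles[OF c] j(2,3) _ j(4)] zj by blast
  have A1: "x \<in> A \<longleftrightarrow> x \<in> A'" if "e * trip v (z j) x \<le> 0" for x
    using agA[of A A' x] agA[of A' A x] H zl zj Xj that by blast
  show ?thesis
  proof (cases "a2 \<le> uj")
    case True
    have sd: "e * trip v (z j) x \<le> 0" if K: "x \<in> K" "hcone K" "K \<subseteq> D" "ray_section K (q - v) (p - q) v a1 a2 E" for x K E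
    proof (cases "m \<bullet> x > 0")
      case mx: True
      thus ?thesis using mem[OF K(2,4) mx] K(1) side[OF mx] True by simp
    next
      case False
      have "trip v (z j) x = x$3 * trip v (z j) v" by (subst zero(1)[OF K(1,2,3) False]) (simp add: trip_linear)
      thus ?thesis by simp
    qed
    have "A = A'" using A1 sd[OF _ H(1,5) SA] sd[OF _ H(3,7) SA'] by blast
    thus ?thesis using cfg_finish[OF c] by blast
  next
    case False
    have psi: "m \<bullet> ((q - v) + u *\<^sub>R (p - q) + t *\<^sub>R v) = 1" "U ((q - v) + u *\<^sub>R (p - q) + t *\<^sub>R v) = u" for u t
      using corner_frame[OF a] corner_point(2)[OF a] unfolding frame_def m_def U_def by (simp_all add: inner_add_right)
    have EAeq: "EA u - EA' u = 0" if u: "u \<in> {a1..uj}" for u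
    proof -
      have "e * trip v (z j) ((q - v) + u *\<^sub>R (p - q) + t *\<^sub>R v) \<le> 0" for t using side[of "(q - v) + u *\<^sub>R (p - q) + t *\<^sub>R v"] u unfolding psi by simp
      hence "EA u \<le> t \<longleftrightarrow> EA' u \<le> t" for t using A1[of "(q - v) + u *\<^sub>R (p - q) + t *\<^sub>R v"] SA SA' u False unfolding ray_section_def by auto
      from this[of "EA u"] this[of "EA' u"] show ?thesis by simp
    qed
    have Uj: "U (z j) \<ge> 0" using cr convex_order_mem[OF o j(2)] unfolding U_def corner_def by blast
    hence uj0: "uj \<ge> 0" using mj by (simp add: uj_def)
    have m1: "m \<bullet> z 1 > 0" unfolding m_def v_def q_def p_def by (rule convex_order_cvec_pos[OF o]) (use n in auto)
    have "U (z 1) = 0" unfolding U_def q_def by simp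
    hence a10: "a1 = 0" using mem[OF H(1) SA m1] z1(1) ka by simp
    have cu: "c1 \<le> uj" "uj \<le> c2" using mem[OF H(2) SC mj] j(3) unfolding uj_def by auto
    \<comment> \<open>In the plane of the chord, \<open>D\<close> is the cone over the chord, so the
      boundary of a cone containing \<open>z j\<close> passes through \<open>z j\<close>
      itself.\<close>
    have tj: "F uj = 1 / (m \<bullet> z j)" if K: "hcone K" "K \<subseteq> D" "ray_section K (q - v) (p - q) v c1 c2 F" "z j \<in> K" for K F
    proof (rule antisym)
      show "F uj \<le> 1 / (m \<bullet> z j)" using mem[OF K(1,3) mj] K(4) h0 unfolding uj_def by simp
      define x where "x = (q - v) + uj *\<^sub>R (p - q) + F uj *\<^sub>R v"
      have xK: "x \<in> K" using K(3) cu unfolding x_def ray_section_def by simp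
      have mx: "m \<bullet> x = 1" "U x = uj" unfolding x_def by (rule psi)+
      have "trip v (z j) x = 0" unfolding tr mx uj_def using mj by simp
      then obtain \<alpha> \<beta> where ab: "\<alpha> \<ge> 0" "\<beta> \<ge> 0" "x = \<alpha> *\<^sub>R z 0 + \<beta> *\<^sub>R z j"
        using convex_order_chord[OF o _ j(2), of x] j K xK unfolding v_def by (metis less_le_trans pos2 subsetD)
      have "m \<bullet> z 0 = 0" unfolding m_def v_def cvec_inner by simp
      hence "\<beta> * (m \<bullet> z j) = 1" using mx(1) ab(3) by (simp add: inner_add_right)
      hence b: "\<beta> = 1 / (m \<bullet> z j)" using mj by (simp add: field_simps)
      have "x$3 = \<alpha> + \<beta>" unfolding ab(3) using h0 by simp
      moreover have "x$3 = F uj" unfolding x_def by (rule corner_point(3)[OF a])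
      ultimately show "1 / (m \<bullet> z j) \<le> F uj" using ab b by simp
    qed
    obtain VA where VA: "pl_breaks a1 a2 (\<lambda>t. EA t - EA' t) VA" using pl_breaks_diff SA SA' unfolding ray_section_def by blast
    obtain VC where VC: "pl_breaks c1 c2 (\<lambda>t. EC t - EC' t) VC" using pl_breaks_diff SC SC' unfolding ray_section_def by blast
    have uA: "a1 \<le> uj" "uj \<le> a2" using a10 uj0 False by auto
    have G0: "EC uj - EC' uj = 0" using tj[OF H(2,6) SC j(3)] tj[OF H(4,8) SC' j(4)] by simp
    have I: "(a2 - a1) / ((1 + x * a1) * (1 + x * a2)) * integral {c1..c2} (\<lambda>t. (EC t - EC' t) / (1 + x * t)^3)
      + (c2 - c1) / ((1 + x * c1) * (1 + x * c2)) * integral {a1..a2} (\<lambda>t. (EA t - EA' t) / (1 + x * t)^3) = 0"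
      if x: "0 < x" "x < 1/2" for x
    proof -
      have x': "\<bar>x\<bar> < 1/2" using x by simp
      show ?thesis
        by (rule shared_vertex_identity[OF SA SC SA' SC' x']) (intro corner_sint_eq[OF cr H cfg_lap[OF c] x'], simp)
    qed
    have ECeq: "EC t - EC' t = 0" if "t \<in> {c1..uj}" for t
      by (rule kink_localization[OF ka kc VA VC uA cu EAeq G0 I that])
    have C1: "x \<in> K'" if s: "e * trip v (z j) x \<le> 0" and K: "hcone K" "hcone K'" "K \<subseteq> D" "v \<in> K'" "ray_section K (q - v) (p - q) v c1 c2 F"
        "ray_section K' (q - v) (p - q) v c1 c2 F'" "\<forall>t\<in>{c1..uj}. F t = F' t" and x: "x \<in> K" for x K K' F F'
    proof (cases "m \<bullet> x > 0")
      case True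
      thus ?thesis using side[OF True] s mem[OF K(1,5) True] mem[OF K(2,6) True] K(7) x by auto
    next
      case False
      from zero[OF x K(1,3) this] show ?thesis using hcone_scale[OF K(2,4), of "x$3"] by simp
    qed
    have FF: "\<forall>t\<in>{c1..uj}. EC t = EC' t" using ECeq by auto
    have CC: "x \<in> C \<longleftrightarrow> x \<in> C'" if "e * trip v (z j) x \<le> 0" for x
      using C1[OF that H(2,4,6) zv(4) SC SC' FF] C1[OF that H(4,2,8) zv(2) SC' SC] FF by auto
    define g where "g = (- e) *\<^sub>R cross3 v (z j)"
    have g: "g \<bullet> x = - (e * trip v (z j) x)" for x by (simp add: g_def trip_inner)
    have e0: "e \<noteq> 0" using eT by auto
    have gz: "g \<bullet> z 1 > 0" unfolding g v_def using pos[of 0 1 j] j trip_swap[of "z 0" "z j" "z 1"] by simp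
    have geq: "\<forall>x. g \<bullet> x \<ge> 0 \<longrightarrow> (x \<in> C \<longleftrightarrow> x \<in> C')" using CC by (simp add: g)
    have ch: "\<forall>x\<in>D. g \<bullet> x = 0 \<longrightarrow> x \<in> C \<and> x \<in> C'"
    proof (intro ballI impI)
      fix x assume x: "x \<in> D" "g \<bullet> x = 0"
      hence t0: "trip (z 0) (z j) x = 0" using e0 by (simp add: g v_def)
      obtain \<alpha> \<beta> where ab: "\<alpha> \<ge> 0" "\<beta> \<ge> 0" "x = \<alpha> *\<^sub>R z 0 + \<beta> *\<^sub>R z j"
        by (rule convex_order_chord[OF o _ j(2) x(1) t0]) (use j in auto)
      show "x \<in> C \<and> x \<in> C'" unfolding ab(3) using ab(1,2) z0 j H by (simp add: hcone_add hcone_scale)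
    qed
    have Dc: "convex D" "cone D" unfolding D by (rule ccone_convex_cone)+
    have X1: "xray_le (z 1) C C'" "xray_le (z 1) C' C" using cfg_xray[OF c, of 1] z1 n by auto
    have zz: "z 1 $ 3 \<ge> 0" "z 1 \<noteq> 0" using h0 by auto
    have z1D: "z 1 \<in> D" using z1 H by blast
    have geq': "\<forall>x. g \<bullet> x \<ge> 0 \<longrightarrow> (x \<in> C' \<longleftrightarrow> x \<in> C)" and ch': "\<forall>x\<in>D. g \<bullet> x = 0 \<longrightarrow> x \<in> C' \<and> x \<in> C" using geq ch by blast+
    have "C = C'"
      using chord_finish[OF H(2,6) Dc z1(2) zz z1D X1(1) gz geq ch] chord_finish[OF H(4,8) Dc z1(4) zz z1D X1(2) gz geq' ch'] by blast
    thus ?thesis using cfg_finish[OF cfg_roles[OF c]] by blast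
  qed
qed

text \<open>The points 1/4, -1/4, 1/8 and -1/8 give four independent equations for the four
  coefficients.\<close>

lemma cubic_vanishes:
  fixes d1 d2 d3 d4 :: real
  assumes "\<And>x. \<bar>x\<bar> < 1/2 \<Longrightarrow> d1 * x + d2 * x^2 + d3 * x^3 + d4 * x^4 = 0"
  shows "d1 = 0" "d2 = 0"
proof -
  have "d1 * (1/4) + d2 * (1/4)^2 + d3 * (1/4)^3 + d4 * (1/4)^4 = 0" "d1 * (-1/4) + d2 * (-1/4)^2 + d3 * (-1/4)^3 + d4 * (-1/4)^4 = 0"
    "d1 * (1/8) + d2 * (1/8)^2 + d3 * (1/8)^3 + d4 * (1/8)^4 = 0" "d1 * (-1/8) + d2 * (-1/8)^2 + d3 * (-1/8)^3 + d4 * (-1/8)^4 = 0"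
    by (rule assms; simp)+
  thus "d1 = 0" "d2 = 0" by (simp_all add: power2_eq_square power3_eq_cube power4_eq_xxxx)
qed

text \<open>The possible positions of two angular ranges that overlap in \<open>[x, y]\<close> and cover \<open>[0, 1]\<close>.\<close>

definition complementary_ranges :: "real \<Rightarrow> real \<Rightarrow> real \<Rightarrow> real \<Rightarrow> real \<Rightarrow> real \<Rightarrow> bool" where
  "complementary_ranges x y a1 a2 c1 c2 \<longleftrightarrow>
    a1 = 0 \<and> a2 = 1 \<and> c1 = x \<and> c2 = y \<or> c1 = 0 \<and> c2 = 1 \<and> a1 = x \<and> a2 = y \<or>
    a1 = 0 \<and> a2 = y \<and> c1 = x \<and> c2 = 1 \<or> c1 = 0 \<and> c2 = y \<and> a1 = x \<and> a2 = 1"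

lemma complementary_rangesI:
  assumes "a1 = 0 \<or> c1 = 0" "a2 = 1 \<or> c2 = 1" "a1 \<le> \<tau>" "\<tau> \<le> a2" "c1 \<le> \<tau>" "\<tau> \<le> c2"
  obtains x y where "x \<le> \<tau>" "\<tau> \<le> y" "complementary_ranges x y a1 a2 c1 c2"
proof -
  consider "a1 = 0" "a2 = 1" | "c1 = 0" "c2 = 1" | "a1 = 0" "c2 = 1" | "c1 = 0" "a2 = 1" using assms by blast
  thus thesis
  proof cases
    case 1 thus thesis using that[of c1 c2] assms by (simp add: complementary_ranges_def)
  next
    case 2 thus thesis using that[of a1 a2] assms by (simp add: complementary_ranges_def)
  next
    case 3 thus thesis using that[of c1 a2] assms by (simp add: complementary_ranges_def)
  next
    case 4 thus thesis using that[of a1 c2] assms by (simp add: complementary_ranges_def)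
  qed
qed

text \<open>At 0 the numerators agree, hence so do the denominators as polynomials in
  \<open>la\<close>. Their two lowest symmetric functions give x + y and xy for the two ends that
  are not fixed at 0 or 1, and the common direction \<open>\<tau>\<close> tells which of these is
  the lower one.\<close>

lemma range_match:
  fixes a1 a2 c1 c2 a1' a2' c1' c2' \<tau> :: real
  assumes k: "0 \<le> a1" "a1 < a2" "a2 \<le> 1" "0 \<le> c1" "c1 < c2" "c2 \<le> 1" "0 \<le> a1'" "a1' < a2'" "a2' \<le> 1" "0 \<le> c1'" "c1' < c2'" "c2' \<le> 1"
    and lo: "a1 = 0 \<or> c1 = 0" "a1' = 0 \<or> c1' = 0" and hi: "a2 = 1 \<or> c2 = 1" "a2' = 1 \<or> c2' = 1"
    and t: "a1 \<le> \<tau>" "\<tau> \<le> a2" "c1 \<le> \<tau>" "\<tau> \<le> c2" "a1' \<le> \<tau>" "\<tau> \<le> a2'" "c1' \<le> \<tau>" "\<tau> \<le> c2'"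
    and R: "\<And>la. \<bar>la\<bar> < 1/2 \<Longrightarrow> (a2 - a1) / ((1 + la * a1) * (1 + la * a2)) * ((c2 - c1) / ((1 + la * c1) * (1 + la * c2)))
      = (a2' - a1') / ((1 + la * a1') * (1 + la * a2')) * ((c2' - c1') / ((1 + la * c1') * (1 + la * c2')))"
  shows "a1 = a1' \<and> a2 = a2' \<and> c1 = c1' \<and> c2 = c2' \<or> a1 = c1' \<and> a2 = c2' \<and> c1 = a1' \<and> c2 = a2'"
proof -
  have N: "(a2 - a1) * (c2 - c1) = (a2' - a1') * (c2' - c1')" using R[of 0] by simp
  have N0: "(a2 - a1) * (c2 - c1) > 0" using k by simp
  define P where "P = (\<lambda>la. (1 + la * a1) * (1 + la * a2) * ((1 + la * c1) * (1 + la * c2)))"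
  define P' where "P' = (\<lambda>la. (1 + la * a1') * (1 + la * a2') * ((1 + la * c1') * (1 + la * c2')))"
  have PP: "P la = P' la" if la: "\<bar>la\<bar> < 1/2" for la
  proof -
    have mu: "1 + la * u > 0" if "0 \<le> u" "u \<le> 1" for u
    proof -
      have "\<bar>la * u\<bar> \<le> 1/2 * 1" unfolding abs_mult using that la by (intro mult_mono) auto
      thus ?thesis by linarith
    qed
    have "P la > 0" "P' la > 0" unfolding P_def P'_def using k by (auto intro!: mult_pos_pos mu)
    moreover have "((a2 - a1) * (c2 - c1)) / P la = ((a2 - a1) * (c2 - c1)) / P' la"
      using R[OF la] N unfolding P_def P'_def times_divide_times_eq by simp
    ultimately show ?thesis using k by (simp add: frac_eq_eq)
  qed
  define s1 where "s1 = (a1 + a2 + c1 + c2) - (a1' + a2' + c1' + c2')"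
  define s2 where "s2 = (a1 * a2 + a1 * c1 + a1 * c2 + a2 * c1 + a2 * c2 + c1 * c2) - (a1' * a2' + a1' * c1' + a1' * c2' + a2' * c1' + a2' * c2' + c1' * c2')"
  define s3 where "s3 = (a1 * a2 * c1 + a1 * a2 * c2 + a1 * c1 * c2 + a2 * c1 * c2) - (a1' * a2' * c1' + a1' * a2' * c2' + a1' * c1' * c2' + a2' * c1' * c2')"
  define s4 where "s4 = a1 * a2 * c1 * c2 - a1' * a2' * c1' * c2'"
  have "s1 * la + s2 * la^2 + s3 * la^3 + s4 * la^4 = 0" if "\<bar>la\<bar> < 1/2" for la
  proof -
    have "s1 * la + s2 * la^2 + s3 * la^3 + s4 * la^4 = P la - P' la"
      unfolding s1_def s2_def s3_def s4_def P_def P'_def by (simp add: power2_eq_square power3_eq_cube power4_eq_xxxx algebra_simps)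
    thus ?thesis using PP[OF that] by simp
  qed
  from cubic_vanishes[OF this] have s: "s1 = 0" "s2 = 0" by blast+
  obtain x y where xy: "x \<le> \<tau>" "\<tau> \<le> y" "complementary_ranges x y a1 a2 c1 c2" by (rule complementary_rangesI[OF lo(1) hi(1) t(1-4)])
  obtain x' y' where xy': "x' \<le> \<tau>" "\<tau> \<le> y'" "complementary_ranges x' y' a1' a2' c1' c2'" by (rule complementary_rangesI[OF lo(2) hi(2) t(5-8)])
  have f: "a1 + a2 + c1 + c2 = 1 + x + y \<and> a1 * a2 + a1 * c1 + a1 * c2 + a2 * c1 + a2 * c2 + c1 * c2 = x + y + x * y"
    using xy(3) unfolding complementary_ranges_def by (elim disjE) auto
  have f': "a1' + a2' + c1' + c2' = 1 + x' + y' \<and> a1' * a2' + a1' * c1' + a1' * c2' + a2' * c1' + a2' * c2' + c1' * c2' = x' + y' + x' * y'"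
    using xy'(3) unfolding complementary_ranges_def by (elim disjE) auto
  have sum: "x + y = x' + y'" and prd: "x * y = x' * y'" using s f f' unfolding s1_def s2_def by linarith+
  have "(x - x') * (x - y') = x * x - x * (x' + y') + x' * y'" by (simp add: algebra_simps)
  also have "\<dots> = 0" unfolding sum[symmetric] prd[symmetric] by (simp add: algebra_simps)
  finally have "x = x' \<or> x = y'" by simp
  hence e: "x = x'" "y = y'" using sum xy(1,2) xy'(1,2) by auto
  \<comment> \<open>Nested ranges have the product of lengths y - x, overlapping ones y (1 - x). The
    two are equal only if \<open>x\<close> is 0 or \<open>y\<close> is 1, and then both arrangements
    coincide.\<close>
  have c: "x = 0 \<or> y = 1" if "y - x = y * (1 - x)"
  proof -
    have "x * (y - 1) = 0" using that by (simp add: algebra_simps)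
    thus ?thesis by simp
  qed
  show ?thesis using xy(3) xy'(3) N c unfolding complementary_ranges_def e by (elim disjE) (auto simp: mult.commute)
qed

text \<open>The leading terms at \<open>z 0\<close> are compared for all \<open>la\<close>. The
  second shared vertex \<open>z k\<close> provides a direction that lies in all four ranges, which
  is the \<open>\<tau>\<close> of \<open>range_match\<close>.\<close>

lemma tangent_match:
  assumes c: "cfg A C A' C' D z n e"
    and z0: "z 0 \<in> A" "z 0 \<in> C" "z 0 \<in> A'" "z 0 \<in> C'"
    and k: "0 < k" "k < n" "z k \<in> A" "z k \<in> C" "z k \<in> A'" "z k \<in> C'"
  shows "tangent (z 0) A = tangent (z 0) A' \<and> tangent (z 0) C = tangent (z 0) C' \<or>
    tangent (z 0) A = tangent (z 0) C' \<and> tangent (z 0) C = tangent (z 0) A'"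
proof -
  note o = cfg_order[OF c]
  have n: "3 \<le> n" using o by (auto simp: convex_order_def)
  have H: "hcone A" "hcone C" "hcone A'" "hcone C'" "A \<subseteq> D" "C \<subseteq> D" "A' \<subseteq> D" "C' \<subseteq> D" using cfg_hcone[OF c] by auto
  note cr = convex_order_corner(1)[OF o]
  define v where "v = z 0"
  define q where "q = z 1"
  define p where "p = z (n - 1)"
  note cr = cr[folded v_def q_def p_def]
  have zv: "v \<in> A" "v \<in> C" "v \<in> A'" "v \<in> C'" using z0 by (auto simp: v_def)
  have a: "trip v q p \<noteq> 0" using cr by (auto simp: corner_def)
  define m where "m = cvec v q p"
  have mpos: "m \<bullet> z i > 0" if "0 < i" "i < n" for i
    unfolding m_def v_def q_def p_def by (rule convex_order_cvec_pos[OF o that])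
  define U where "U = (\<lambda>x. trip v q x / trip v q p / (m \<bullet> x))"
  obtain a1 a2 EA where SA: "ray_section A (q - v) (p - q) v a1 a2 EA" by (rule corner_ray_section[OF cr H(1,5) zv(1)])
  obtain b1 b2 EA' where SA': "ray_section A' (q - v) (p - q) v b1 b2 EA'" by (rule corner_ray_section[OF cr H(3,7) zv(3)])
  obtain c1 c2 EC where SC: "ray_section C (q - v) (p - q) v c1 c2 EC" by (rule corner_ray_section[OF cr H(2,6) zv(2)])
  obtain d1 d2 EC' where SC': "ray_section C' (q - v) (p - q) v d1 d2 EC'" by (rule corner_ray_section[OF cr H(4,8) zv(4)])
  have rg: "0 \<le> k1 \<and> k1 < k2 \<and> k2 \<le> 1" if "ray_section K (q - v) (p - q) v k1 k2 E" for K k1 k2 E using that by (auto simp: ray_section_def)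
  have mem: "k1 \<le> U x \<and> U x \<le> k2" if "hcone K" "ray_section K (q - v) (p - q) v k1 k2 E" "m \<bullet> x > 0" "x \<in> K" for K k1 k2 E x
    using corner_mem_iff[OF cr that(1,2)] that(3,4) unfolding U_def m_def by blast
  have Uq: "U (z 1) = 0" by (simp add: U_def q_def)
  have Up: "U (z (n - 1)) = 1" using a mpos[of "n - 1"] n unfolding U_def m_def p_def[symmetric] cvec_inner by simp
  have l: "k1 = 0" if "hcone K" "ray_section K (q - v) (p - q) v k1 k2 E" "z 1 \<in> K" for K k1 k2 E
    using mem[OF that(1,2) mpos that(3)] Uq rg[OF that(2)] n by simp
  have u: "k2 = 1" if "hcone K" "ray_section K (q - v) (p - q) v k1 k2 E" "z (n - 1) \<in> K" for K k1 k2 E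
    using mem[OF that(1,2) mpos that(3)] Up rg[OF that(2)] n by simp
  have v1: "z 1 \<in> A \<or> z 1 \<in> C" "z 1 \<in> A' \<or> z 1 \<in> C'" "z (n - 1) \<in> A \<or> z (n - 1) \<in> C" "z (n - 1) \<in> A' \<or> z (n - 1) \<in> C'"
    using cfg_vertex[OF c, of 1] cfg_vertex[OF c, of "n - 1"] n by auto
  have R: "(a2 - a1) / ((1 + la * a1) * (1 + la * a2)) * ((c2 - c1) / ((1 + la * c1) * (1 + la * c2)))
      = (b2 - b1) / ((1 + la * b1) * (1 + la * b2)) * ((d2 - d1) / ((1 + la * d1) * (1 + la * d2)))" if la: "\<bar>la\<bar> < 1/2" for la
    by (rule shared_vertex_expansion(1)[OF SA SC SA' SC' la]) (intro corner_sint_eq[OF cr H cfg_lap[OF c] la], simp)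
  have "a1 = b1 \<and> a2 = b2 \<and> c1 = d1 \<and> c2 = d2 \<or> a1 = d1 \<and> a2 = d2 \<and> c1 = b1 \<and> c2 = b2"
  proof (rule range_match[where \<tau> = "U (z k)", OF _ _ _ _ _ _ _ _ _ _ _ _ _ _ _ _ _ _ _ _ _ _ _ _ R])
    show "a1 = 0 \<or> c1 = 0" "b1 = 0 \<or> d1 = 0" using v1 l[OF H(1) SA] l[OF H(2) SC] l[OF H(3) SA'] l[OF H(4) SC'] by blast+
    show "a2 = 1 \<or> c2 = 1" "b2 = 1 \<or> d2 = 1" using v1 u[OF H(1) SA] u[OF H(2) SC] u[OF H(3) SA'] u[OF H(4) SC'] by blast+
  qed (use mem[OF H(1) SA mpos[OF k(1,2)] k(3)] mem[OF H(2) SC mpos[OF k(1,2)] k(4)] mem[OF H(3) SA' mpos[OF k(1,2)] k(5)]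
      mem[OF H(4) SC' mpos[OF k(1,2)] k(6)] rg[OF SA] rg[OF SC] rg[OF SA'] rg[OF SC'] in auto)
  thus ?thesis
    unfolding v_def[symmetric] tangent_ray_section[OF cr H(1,5) zv(1) SA] tangent_ray_section[OF cr H(2,6) zv(2) SC]
      tangent_ray_section[OF cr H(3,7) zv(3) SA'] tangent_ray_section[OF cr H(4,8) zv(4) SC'] by (elim disjE conjE) simp_all
qed

lemma tangent_full:
  assumes c: "corner v q p D" and K: "hcone K" "K \<subseteq> D" and q: "q \<in> tangent v K" and p: "p \<in> tangent v K"
  shows "tangent v K = {x. trip v x p / trip v q p \<ge> 0 \<and> trip v q x / trip v q p \<ge> 0}"
proof (intro set_eqI iffI)
  fix x assume "x \<in> tangent v K"
  then obtain t where "x + t *\<^sub>R v \<in> D" using K by (auto simp: tangent_def)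
  hence "trip v (x + t *\<^sub>R v) p / trip v q p \<ge> 0" "trip v q (x + t *\<^sub>R v) / trip v q p \<ge> 0" using c unfolding corner_def by blast+
  thus "x \<in> {x. trip v x p / trip v q p \<ge> 0 \<and> trip v q x / trip v q p \<ge> 0}" by (simp add: trip_linear)
next
  have a: "trip v q p \<noteq> 0" "v$3 = 1" "q$3 = 1" "p$3 = 1" using c by (auto simp: corner_def)
  fix x assume x: "x \<in> {x. trip v x p / trip v q p \<ge> 0 \<and> trip v q x / trip v q p \<ge> 0}"
  define X where "X = trip v x p / trip v q p"
  define U where "U = trip v q x / trip v q p"
  have XU: "X \<ge> 0" "U \<ge> 0" using x by (auto simp: X_def U_def)
  have xe: "x = X *\<^sub>R (q - v) + U *\<^sub>R (p - v) + x$3 *\<^sub>R v" unfolding X_def U_def by (rule corner_coords[OF a])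
  obtain s t where st: "q + s *\<^sub>R v \<in> K" "p + t *\<^sub>R v \<in> K" using q p by (auto simp: tangent_def)
  have "X *\<^sub>R (q + s *\<^sub>R v) + U *\<^sub>R (p + t *\<^sub>R v) \<in> K" by (rule hcone_add[OF K(1) hcone_scale[OF K(1) st(1) XU(1)] hcone_scale[OF K(1) st(2) XU(2)]])
  also have "X *\<^sub>R (q + s *\<^sub>R v) + U *\<^sub>R (p + t *\<^sub>R v) = (X *\<^sub>R (q - v) + U *\<^sub>R (p - v) + x$3 *\<^sub>R v) + (X * s + U * t + X + U - x$3) *\<^sub>R v"
    by (simp add: algebra_simps)
  finally show "x \<in> tangent v K" unfolding xe[symmetric] tangent_def by blast
qed

lemma tangent_mem: "x \<in> K \<Longrightarrow> x \<in> tangent v K"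
  unfolding tangent_def by (auto intro: exI[of _ 0])

section \<open>Propagation along the polygon\<close>

text \<open>The first vertex of \<open>C\<close> after \<open>z 1\<close> serves as \<open>j\<close>
  in \<open>cap\<close>; by \<open>cfg_step\<close> all vertices before it are of the type of
  \<open>z 1\<close>. If there is none, \<open>A\<close> and \<open>A'\<close> contain every
  vertex.\<close>

lemma cap_start:
  assumes c: "cfg A C A' C' D z n e"
    and z0: "z 0 \<in> A" "z 0 \<in> C" "z 0 \<in> A'" "z 0 \<in> C'"
    and T: "tangent (z 0) A = tangent (z 0) A'" "tangent (z 0) C = tangent (z 0) C'"
    and z1: "z 1 \<in> A" "z 1 \<notin> C" "z 1 \<in> A'" "z 1 \<notin> C'"
  shows "A = A' \<and> C = C'"
proof -
  have n: "3 \<le> n" using cfg_order[OF c] by (auto simp: convex_order_def)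
  have ad: "adj n i (Suc i)" if "Suc i < n" for i using that by (simp add: adj_def)
  have ch: "z i \<in> A \<and> z i \<notin> C \<and> z i \<in> A' \<and> z i \<notin> C'" if "1 \<le> i" "i < n" "\<forall>l. 1 \<le> l \<longrightarrow> l \<le> i \<longrightarrow> z l \<notin> C" for i
    using that
  proof (induction i rule: dec_induct)
    case base show ?case using z1 by simp
  next
    case (step i)
    have p: "z i \<in> A \<and> z i \<notin> C \<and> z i \<in> A' \<and> z i \<notin> C'" using step by auto
    have "z (Suc i) \<notin> C" using step.prems by simp
    moreover have "z (Suc i) \<in> A" using cfg_vertex[OF c step.prems(1)] \<open>z (Suc i) \<notin> C\<close> by blast
    ultimately show ?case using cfg_step[OF c ad[OF step.prems(1)]] p by blast
  qed
  show ?thesis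
  proof (cases "\<exists>j. 2 \<le> j \<and> j < n \<and> z j \<in> C")
    case False
    have "z i \<in> A \<and> z i \<in> A'" if "i < n" for i
    proof (cases "i = 0")
      case True thus ?thesis using z0 by simp
    next
      case i0: False
      have "\<forall>l. 1 \<le> l \<longrightarrow> l \<le> i \<longrightarrow> z l \<notin> C"
      proof (intro allI impI)
        fix l assume "1 \<le> l" "l \<le> i"
        thus "z l \<notin> C" using False that z1 by (cases "l = 1") auto
      qed
      thus ?thesis using ch[of i] i0 that by auto
    qed
    thus ?thesis using cfg_all[OF c] by blast
  next
    case True
    define j where "j = (LEAST j. 2 \<le> j \<and> j < n \<and> z j \<in> C)"
    have j: "2 \<le> j" "j < n" "z j \<in> C" using LeastI_ex[OF True] unfolding j_def by auto
    have no: "z l \<notin> C" if "1 \<le> l" "l < j" for l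
    proof (cases "l = 1")
      case True thus ?thesis using z1 by simp
    next
      case False
      thus ?thesis using not_less_Least[of l "\<lambda>j. 2 \<le> j \<and> j < n \<and> z j \<in> C"] that j unfolding j_def[symmetric] by auto
    qed
    have ci: "z i \<in> A \<and> z i \<notin> C \<and> z i \<in> A' \<and> z i \<notin> C'" if "1 \<le> i" "i < j" for i using ch[of i] no that j by auto
    have j1: "1 \<le> j - 1" "j - 1 < j" "Suc (j - 1) = j" using j by auto
    have "(z j \<in> A \<longleftrightarrow> z j \<in> A') \<and> (z j \<in> C \<longleftrightarrow> z j \<in> C')"
      using cfg_step[OF c ad[of "j - 1"]] ci[OF j1(1,2)] j j1(3) by auto
    thus ?thesis using cap[OF c z0 T z1 j(1,2,3)] ci j by blast
  qed
qed

definition matched where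
  "matched A C A' C' x \<longleftrightarrow> x \<in> A \<and> x \<notin> C \<and> x \<in> A' \<and> x \<notin> C' \<or> x \<in> C \<and> x \<notin> A \<and> x \<in> C' \<and> x \<notin> A'"

lemma cap_matched:
  assumes c: "cfg A C A' C' D z n e"
    and z0: "z 0 \<in> A" "z 0 \<in> C" "z 0 \<in> A'" "z 0 \<in> C'"
    and T: "tangent (z 0) A = tangent (z 0) A'" "tangent (z 0) C = tangent (z 0) C'"
    and z1: "matched A C A' C' (z 1) \<or> matched A C A' C' (z (n - 1))"
  shows "A = A' \<and> C = C'"
proof -
  have one: "A = A' \<and> C = C'" if "cfg A C A' C' D y n e'" "y 0 = z 0" "matched A C A' C' (y 1)" for y e'
  proof -
    note y0 = that(2)
    have z0': "y 0 \<in> A" "y 0 \<in> C" "y 0 \<in> A'" "y 0 \<in> C'" using z0 y0 by auto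
    have T': "tangent (y 0) A = tangent (y 0) A'" "tangent (y 0) C = tangent (y 0) C'" using T y0 by auto
    from that(3) show ?thesis unfolding matched_def
      using cap_start[OF that(1) z0' T'] cap_start[OF cfg_roles[OF that(1)] z0'(2,1,4,3) T'(2,1)] by blast
  qed
  have n: "3 \<le> n" using cfg_order[OF c] by (auto simp: convex_order_def)
  have "(n - 0) mod n = 0" "(n - 1) mod n = n - 1" using n by auto
  thus ?thesis using one[OF c] one[OF cfg_reflect[OF c]] z1 by auto
qed

text \<open>\<open>tangent_match\<close> fixes a naming at \<open>z 0\<close>. If neither neighbour
  is matched under it, both neighbours lie in the angles of both cones, which then fill the whole
  corner and are equal. The exchanged naming is therefore compatible with the angles as well, and
  under it \<open>z 1\<close> is matched.\<close>

lemma two_shared: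
  assumes c: "cfg A C A' C' D z n e"
    and z0: "z 0 \<in> A" "z 0 \<in> C" "z 0 \<in> A'" "z 0 \<in> C'" and z1: "\<not> (z 1 \<in> A \<and> z 1 \<in> C)"
    and k: "0 < k" "k < n" "z k \<in> A" "z k \<in> C"
  shows "A = A' \<and> C = C' \<or> A = C' \<and> C = A'"
proof -
  have main: "X = A' \<and> Y = C' \<or> X = C' \<and> Y = A'"
    if c: "cfg X Y A' C' D z n e" and z0: "z 0 \<in> X" "z 0 \<in> Y" "z 0 \<in> A'" "z 0 \<in> C'" and z1: "\<not> (z 1 \<in> X \<and> z 1 \<in> Y)"
      and T: "tangent (z 0) X = tangent (z 0) A'" "tangent (z 0) Y = tangent (z 0) C'" for X Y A' C'
  proof (cases "matched X Y A' C' (z 1) \<or> matched X Y A' C' (z (n - 1))")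
    case True thus ?thesis using cap_matched[OF c z0 T] by blast
  next
    case False
    have n: "3 \<le> n" using cfg_order[OF c] by (auto simp: convex_order_def)
    note cr = convex_order_corner(1)[OF cfg_order[OF c]]
    have H: "hcone X" "hcone Y" "X \<subseteq> D" "Y \<subseteq> D" using cfg_hcone[OF c] by auto
    have 1: "z 1 \<in> tangent (z 0) X \<and> z 1 \<in> tangent (z 0) Y"
      using False z1 cfg_vertex[OF c, of 1] n T tangent_mem[of "z 1" _ "z 0"] unfolding matched_def by auto
    have 2: "z (n - 1) \<in> tangent (z 0) X \<and> z (n - 1) \<in> tangent (z 0) Y"
      using False cfg_vertex[OF c, of "n - 1"] n T tangent_mem[of "z (n - 1)" _ "z 0"] unfolding matched_def by auto
    have "tangent (z 0) X = tangent (z 0) Y" using tangent_full[OF cr H(1,3)] tangent_full[OF cr H(2,4)] 1 2 by simp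
    hence T': "tangent (z 0) X = tangent (z 0) C'" "tangent (z 0) Y = tangent (z 0) A'" using T by auto
    have "matched X Y C' A' (z 1)" using False z1 cfg_vertex[OF c, of 1] n unfolding matched_def by auto
    thus ?thesis using cap_matched[OF cfg_swap[OF c] z0(1,2,4,3) T'] by blast
  qed
  have kk: "z k \<in> A'" "z k \<in> C'" using cfg_vertex[OF c k(2)] k by auto
  from tangent_match[OF c z0 k kk] show ?thesis
    using main[OF c z0 z1] main[OF cfg_swap[OF c] z0(1,2,4,3) z1] by blast
qed

text \<open>Index 0 is reserved for the vertex that may be shared. \<open>z 1\<close> decides the
  naming, and \<open>cfg_step\<close> carries the matching on to the last vertex and from there to
  \<open>z 0\<close>. Then either the type changes between two neighbours, or all vertices from
  \<open>z 1\<close> on have one type; in that case \<open>z 0\<close> joins them or is the only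
  vertex of the other cone.\<close>

lemma few_shared:
  assumes c: "cfg A C A' C' D z n e" and ns: "\<forall>i. 0 < i \<longrightarrow> i < n \<longrightarrow> \<not> (z i \<in> A \<and> z i \<in> C)"
  shows "A = A' \<and> C = C' \<or> A = C' \<and> C = A'"
proof -
  have main: "A = P \<and> C = Q" if c: "cfg A C P Q D z n e" and m1: "matched A C P Q (z 1)" for P Q
  proof -
    have n: "3 \<le> n" using cfg_order[OF c] by (auto simp: convex_order_def)
    have stp: "matched A C P Q (z j)" if "adj n i j" "matched A C P Q (z i)" "\<not> (z j \<in> A \<and> z j \<in> C)" for i j
    proof -
      have jn: "j < n" using that by (simp add: adj_def)
      have "(z j \<in> A \<longleftrightarrow> z j \<in> P) \<and> (z j \<in> C \<longleftrightarrow> z j \<in> Q)"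
        using cfg_step[OF c that(1)] cfg_step[OF cfg_roles[OF c] that(1)] that(2) unfolding matched_def by blast
      thus ?thesis using that(3) cfg_vertex[OF c jn] unfolding matched_def by blast
    qed
    have mi: "matched A C P Q (z i)" if "1 \<le> i" "i < n" for i
      using that
    proof (induction i rule: dec_induct)
      case base show ?case using m1 by simp
    next
      case (step i)
      have "adj n i (Suc i)" using step.prems by (simp add: adj_def)
      thus ?case using stp[of i "Suc i"] step ns by auto
    qed
    have "adj n (n - 1) 0" using n by (simp add: adj_def)
    moreover have "matched A C P Q (z (n - 1))" using mi n by simp
    ultimately have m0: "(z 0 \<in> A \<longleftrightarrow> z 0 \<in> P) \<and> (z 0 \<in> C \<longleftrightarrow> z 0 \<in> Q)"
      using cfg_step[OF c] cfg_step[OF cfg_roles[OF c]] unfolding matched_def by blast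
    have mt: "\<forall>i<n. (z i \<in> A \<longleftrightarrow> z i \<in> P) \<and> (z i \<in> C \<longleftrightarrow> z i \<in> Q)"
    proof (intro allI impI)
      fix i assume "i < n"
      thus "(z i \<in> A \<longleftrightarrow> z i \<in> P) \<and> (z i \<in> C \<longleftrightarrow> z i \<in> Q)" using m0 mi[of i] unfolding matched_def by (cases "i = 0") auto
    qed
    show ?thesis
    proof (cases "\<exists>i. 1 \<le> i \<and> Suc i < n \<and> (z i \<in> A) \<noteq> (z (Suc i) \<in> A)")
      case True
      then obtain i where i: "1 \<le> i" "Suc i < n" "(z i \<in> A) \<noteq> (z (Suc i) \<in> A)" by blast
      define y where "y = (\<lambda>l. z ((l + i) mod n))"
      have cy: "cfg A C P Q D y n e" unfolding y_def by (rule cfg_rotate[OF c]) (use i in auto)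
      have y: "y 0 = z i" "y 1 = z (Suc i)" using i by (simp_all add: y_def)
      have my: "\<forall>l<n. (y l \<in> A \<longleftrightarrow> y l \<in> P) \<and> (y l \<in> C \<longleftrightarrow> y l \<in> Q)" using mt n unfolding y_def by simp
      have my': "\<forall>l<n. (y l \<in> C \<longleftrightarrow> y l \<in> Q) \<and> (y l \<in> A \<longleftrightarrow> y l \<in> P)" using my by blast
      have "matched A C P Q (z i)" "matched A C P Q (z (Suc i))" using mi i by auto
      thus ?thesis using cfg_alternate[OF cy my] cfg_alternate[OF cfg_roles[OF cy] my'] i(3) unfolding y matched_def by blast
    next
      case False
      have same: "z i \<in> A \<longleftrightarrow> z 1 \<in> A" if "1 \<le> i" "i < n" for i
        using that by (induction i rule: dec_induct) (use False in auto)
      have mt': "\<forall>l<n. (z l \<in> C \<longleftrightarrow> z l \<in> Q) \<and> (z l \<in> A \<longleftrightarrow> z l \<in> P)" using mt by blast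
      show ?thesis
      proof (cases "z 1 \<in> A")
        case True
        hence nc: "z 1 \<notin> C" using m1 unfolding matched_def by blast
        have 1: "z i \<in> A \<and> z i \<in> P" if "1 \<le> i" "i < n" for i using same[OF that] mt that True by blast
        show ?thesis
        proof (cases "z 0 \<in> A")
          case z0: True
          have "\<forall>i<n. z i \<in> A \<and> z i \<in> P"
          proof (intro allI impI)
            fix i assume "i < n" thus "z i \<in> A \<and> z i \<in> P" using 1[of i] z0 m0 by (cases "i = 0") auto
          qed
          thus ?thesis by (rule cfg_all[OF c])
        next
          case z0: False
          hence "z 0 \<in> C" using cfg_vertex[OF c, of 0] n by auto
          thus ?thesis using cfg_alternate[OF cfg_roles[OF c] mt' _ z0 True nc] by blast
        qed
      next
        case F1: False
        hence nc: "z 1 \<in> C" using m1 unfolding matched_def by blast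
        have 1: "z i \<in> C \<and> z i \<in> Q" if "1 \<le> i" "i < n" for i using same[OF that] mt that F1 cfg_vertex[OF c that(2)] by blast
        show ?thesis
        proof (cases "z 0 \<in> C")
          case z0: True
          have "\<forall>i<n. z i \<in> C \<and> z i \<in> Q"
          proof (intro allI impI)
            fix i assume "i < n" thus "z i \<in> C \<and> z i \<in> Q" using 1[of i] z0 m0 by (cases "i = 0") auto
          qed
          thus ?thesis using cfg_all[OF cfg_roles[OF c]] by blast
        next
          case z0: False
          hence "z 0 \<in> A" using cfg_vertex[OF c, of 0] n by auto
          thus ?thesis using cfg_alternate[OF c mt _ z0 nc F1] by blast
        qed
      qed
    qed
  qed
  have n: "3 \<le> n" using cfg_order[OF c] by (auto simp: convex_order_def)
  have "matched A C A' C' (z 1) \<or> matched A C C' A' (z 1)"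
    using cfg_vertex[OF c, of 1] ns[rule_format, of 1] n unfolding matched_def by auto
  thus ?thesis using main[OF c] main[OF cfg_swap[OF c]] by blast
qed

text \<open>With two shared vertices, either all vertices are shared or going around the polygon
  meets a shared vertex followed by an unshared one, where \<open>two_shared\<close> starts.
  Otherwise a rotation moves the only candidate for a shared vertex to index 0.\<close>

lemma cfg_unique:
  assumes c: "cfg A C A' C' D z n e"
  shows "A = A' \<and> C = C' \<or> A = C' \<and> C = A'"
proof -
  have n: "3 \<le> n" using cfg_order[OF c] by (auto simp: convex_order_def)
  define S where "S = (\<lambda>i. z i \<in> A \<and> z i \<in> C)"
  show ?thesis
  proof (cases "\<exists>i<n. \<exists>j<n. i \<noteq> j \<and> S i \<and> S j")
    case False
    obtain r where r: "r < n" "\<forall>i<n. i \<noteq> r \<longrightarrow> \<not> S i"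
    proof (cases "\<exists>i<n. S i")
      case True thus thesis using that False by blast
    next
      case False thus thesis using that[of 0] n by auto
    qed
    define y where "y = (\<lambda>l. z ((l + r) mod n))"
    have cy: "cfg A C A' C' D y n e" unfolding y_def by (rule cfg_rotate[OF c r(1)])
    have "\<not> (y i \<in> A \<and> y i \<in> C)" if i: "0 < i" "i < n" for i
    proof -
      have "(i + r) mod n = (if i + r < n then i + r else i + r - n)" using i r(1) by (simp add: mod_if)
      hence "(i + r) mod n \<noteq> r" using i by (auto split: if_splits)
      moreover have "(i + r) mod n < n" using n by simp
      ultimately show ?thesis using r(2) unfolding y_def S_def by blast
    qed
    thus ?thesis using few_shared[OF cy] by blast
  next
    case True
    then obtain i0 j0 where ij: "i0 < n" "j0 < n" "i0 \<noteq> j0" "S i0" "S j0" by blast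
    show ?thesis
    proof (cases "\<exists>i<n. S i \<and> \<not> S (Suc i mod n)")
      case False
      have all: "S ((i0 + d) mod n)" for d
      proof (induction d)
        case 0 thus ?case using ij by simp
      next
        case (Suc d)
        have "(i0 + d) mod n < n" using n by simp
        hence "S (Suc ((i0 + d) mod n) mod n)" using Suc False by blast
        thus ?case by (simp add: mod_simps)
      qed
      have "S i" if "i < n" for i
      proof -
        have "(i0 + (i + n - i0)) mod n = i" using that ij by simp
        thus ?thesis using all[of "i + n - i0"] by simp
      qed
      hence "\<forall>i<n. z i \<in> A \<and> z i \<in> A'" using cfg_vertex[OF c] unfolding S_def by blast
      thus ?thesis using cfg_all[OF c] by blast
    next
      case True
      then obtain r where r: "r < n" "S r" "\<not> S (Suc r mod n)" by blast
      define y where "y = (\<lambda>l. z ((l + r) mod n))"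
      have cy: "cfg A C A' C' D y n e" unfolding y_def by (rule cfg_rotate[OF c r(1)])
      have y: "y 0 = z r" "y 1 = z (Suc r mod n)" using r by (simp_all add: y_def)
      obtain j where j: "j < n" "j \<noteq> r" "S j" using ij by metis
      define k where "k = (if r < j then j - r else j + n - r)"
      have k: "0 < k" "k < n" "y k = z j" using j r by (auto simp: k_def y_def)
      have "y 0 \<in> A \<and> y 0 \<in> C" "\<not> (y 1 \<in> A \<and> y 1 \<in> C)" "y k \<in> A \<and> y k \<in> C" using r j y k unfolding S_def by auto
      moreover from this have "y 0 \<in> A' \<and> y 0 \<in> C'" using cfg_vertex[OF cy, of 0] n by auto
      ultimately show ?thesis using two_shared[OF cy _ _ _ _ _ k(1,2)] by blast
    qed
  qed
qed

section \<open>From the geometric hypotheses to a configuration\<close>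

lemma orient_trip: "a$3 = 1 \<Longrightarrow> b$3 = 1 \<Longrightarrow> c$3 = 1 \<Longrightarrow> orient a b c = trip a b c"
  by (simp add: orient_def trip_expand algebra_simps)

lemma hconeI:
  assumes "polyhedron K" "cone K" "interior K \<noteq> {}" "K \<subseteq> {x. x$3 \<ge> 0}" "K \<inter> {x. x$3 = 0} = {0}"
  shows "hcone K"
  unfolding hcone_def using assms by (auto simp: order_less_le)

lemma hcone_uminus:
  assumes "polyhedron B" "cone B" "interior B \<noteq> {}" "uminus ` B \<subseteq> {x. x$3 \<ge> 0}" "B \<inter> {x. x$3 = 0} = {0}"
  shows "hcone (uminus ` B)"
proof (rule hconeI)
  show "polyhedron (uminus ` B)" using assms(1) by (rule polyhedron_negations)
  show "cone (uminus ` B)" using assms(2) unfolding cone_def by (auto simp: image_iff)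
  show "interior (uminus ` B) \<noteq> {}" using assms(3) by (simp add: interior_negations)
  show "uminus ` B \<subseteq> {x. x$3 \<ge> 0}" by (rule assms(4))
  show "uminus ` B \<inter> {x. x$3 = 0} = {0}"
  proof -
    have "x \<in> uminus ` B \<inter> {x. x$3 = 0} \<longleftrightarrow> - x \<in> B \<inter> {x. x$3 = 0}" for x by (auto simp: image_iff) (metis minus_minus)
    thus ?thesis unfolding assms(5) by auto
  qed
qed

lemma hcone_normalize:
  assumes "hcone K" "x \<in> K" "x \<noteq> 0"
  shows "x$3 > 0" "(1 / x$3) *\<^sub>R x \<in> K \<inter> {x. x$3 = 1}"
proof -
  show p: "x$3 > 0" using assms by (simp add: hcone_def)
  show "(1 / x$3) *\<^sub>R x \<in> K \<inter> {x. x$3 = 1}" using hcone_scale[OF assms(1,2), of "1 / x$3"] p by simp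
qed

lemma hcone_section_compact:
  assumes K: "hcone K" shows "compact (K \<inter> {x. x$3 = 1})"
proof -
  define e3 where "e3 = (vector [0, 0, 1] :: real^3)"
  have e3: "e3 \<bullet> y = y$3" for y by (simp add: e3_def inner_vec_def sum_3)
  have "\<And>y. y \<in> K \<Longrightarrow> y \<noteq> 0 \<Longrightarrow> e3 \<bullet> y > 0" using K unfolding e3 hcone_def by blast
  then obtain c where c: "c > 0" "\<And>y. y \<in> K \<Longrightarrow> e3 \<bullet> y \<ge> c * norm y"
    using cone_coercive[OF hcone_closed[OF K] hcone_cone[OF K]] by blast
  have "K \<inter> {x. x$3 = 1} \<subseteq> cball 0 (1 / c)"
  proof
    fix y assume "y \<in> K \<inter> {x. x$3 = 1}"
    hence "c * norm y \<le> 1" using c(2)[of y] unfolding e3 by simp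
    thus "y \<in> cball 0 (1 / c)" using c(1) by (simp add: pos_le_divide_eq mult.commute)
  qed
  hence "bounded (K \<inter> {x. x$3 = 1})" using bounded_subset bounded_cball by blast
  moreover have "closed {x. e3 \<bullet> x = 1}" by (rule closed_hyperplane)
  hence "closed (K \<inter> {x. x$3 = 1})" using hcone_closed[OF K] unfolding e3 by (rule closed_Int[rotated])
  ultimately show ?thesis by (simp add: compact_eq_bounded_closed)
qed

lemma convex_hull_ccone: "finite S \<Longrightarrow> convex hull S \<subseteq> ccone S"
  by (intro hull_minimal ccone_convex_cone) (auto intro: ccone_incl)

text \<open>The plane through \<open>z 0\<close> and \<open>z 1\<close> supports \<open>D\<close>,
  hence the section, and meets \<open>D\<close> at height 1 in the segment between them.\<close>

lemma convex_order_edge_of: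
  assumes o: "convex_order z n e D" and K: "hcone K" "K \<subseteq> D"
  shows "closed_segment (z 0) (z 1) edge_of (K \<inter> {x. x$3 = 1}) \<longleftrightarrow> z 0 \<in> K \<and> z 1 \<in> K"
proof
  assume "closed_segment (z 0) (z 1) edge_of (K \<inter> {x. x$3 = 1})"
  hence "closed_segment (z 0) (z 1) \<subseteq> K" unfolding edge_of_def by (auto dest: face_of_imp_subset)
  thus "z 0 \<in> K \<and> z 1 \<in> K" by auto
next
  assume z: "z 0 \<in> K \<and> z 1 \<in> K"
  have n: "3 \<le> n" and h: "z 0 $ 3 = 1" "z 1 $ 3 = 1" and pos: "e * trip (z 0) (z 1) (z 2) > 0"
    using o by (auto simp: convex_order_def)
  define e3 where "e3 = (vector [0, 0, 1] :: real^3)"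
  have e3: "e3 \<bullet> y = y$3" for y by (simp add: e3_def inner_vec_def sum_3)
  define S where "S = K \<inter> {x. x$3 = 1}"
  have cS: "convex S" unfolding S_def using convex_Int[OF hcone_convex[OF K(1)] convex_hyperplane[of e3 1]] by (simp add: e3)
  define g where "g = e *\<^sub>R cross3 (z 0) (z 1)"
  have g: "g \<bullet> x = e * trip (z 0) (z 1) x" for x by (simp add: g_def trip_inner)
  have e0: "e \<noteq> 0" using pos by auto
  have "(S \<inter> {x. g \<bullet> x = 0}) face_of S"
    by (rule face_of_Int_supporting_hyperplane_ge[OF cS]) (use convex_order_edges(1)[OF o] K in \<open>auto simp: g S_def\<close>)
  moreover have "S \<inter> {x. g \<bullet> x = 0} = closed_segment (z 0) (z 1)"
  proof
    show "S \<inter> {x. g \<bullet> x = 0} \<subseteq> closed_segment (z 0) (z 1)"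
    proof
      fix x assume x: "x \<in> S \<inter> {x. g \<bullet> x = 0}"
      hence "x \<in> D" "trip (z 0) (z 1) x = 0" using K e0 by (auto simp: S_def g)
      then obtain \<alpha> \<beta> where ab: "\<alpha> \<ge> 0" "\<beta> \<ge> 0" "x = \<alpha> *\<^sub>R z 0 + \<beta> *\<^sub>R z 1"
        using convex_order_chord[OF o, of 1 x] n by auto
      have "\<alpha> + \<beta> = 1" using x h unfolding ab(3) S_def by simp
      hence "\<alpha> = 1 - \<beta>" by simp
      hence "\<beta> \<le> 1" "x = (1 - \<beta>) *\<^sub>R z 0 + \<beta> *\<^sub>R z 1" using ab by auto
      thus "x \<in> closed_segment (z 0) (z 1)" using ab(2) unfolding closed_segment_def by blast
    qed
    show "closed_segment (z 0) (z 1) \<subseteq> S \<inter> {x. g \<bullet> x = 0}"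
    proof (rule closed_segment_subset)
      show "z 0 \<in> S \<inter> {x. g \<bullet> x = 0}" "z 1 \<in> S \<inter> {x. g \<bullet> x = 0}" using z h by (auto simp: S_def g)
      show "convex (S \<inter> {x. g \<bullet> x = 0})" by (rule convex_Int[OF cS convex_hyperplane])
    qed
  qed
  moreover have "z 0 \<noteq> z 1" using pos by auto
  hence "aff_dim (closed_segment (z 0) (z 1)) = 1" by (simp add: segment_convex_hull aff_dim_convex_hull aff_dim_2)
  ultimately show "closed_segment (z 0) (z 1) edge_of (K \<inter> {x. x$3 = 1})" unfolding edge_of_def S_def by simp
qed

lemma edge_iff:
  assumes o: "convex_order z n e D" and K: "hcone K" "K \<subseteq> D" and i: "i < n"
  shows "closed_segment (z i) (z (Suc i mod n)) edge_of (K \<inter> {x. x$3 = 1}) \<longleftrightarrow> z i \<in> K \<and> z (Suc i mod n) \<in> K"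
  using convex_order_edge_of[OF convex_order_rotate[OF o i] K] i by simp

text \<open>The Laplace transform of a cone is finite precisely on the interior of its dual cone, so a
  product of two transforms determines the cone generated by the union.\<close>

lemma lap_top_point:
  assumes "hcone K" "hcone L" "x \<in> K" "x \<noteq> 0" "\<xi> \<bullet> x \<le> 0"
  shows "lap K \<xi> * lap L \<xi> = top"
proof -
  have "lap K \<xi> = top" by (rule lap_top[OF hcone_closed hcone_convex hcone_cone]) (use assms in \<open>auto simp: hcone_def\<close>)
  moreover have "lap L \<xi> > 0" by (rule lap_pos[OF hcone_closed]) (use assms in \<open>auto simp: hcone_def\<close>)
  ultimately show ?thesis by (simp add: ennreal_top_mult)
qed

lemma lap_finite_product:
  assumes "hcone K" "hcone L" "\<xi> \<noteq> 0" "\<forall>x\<in>K \<union> L. x \<noteq> 0 \<longrightarrow> \<xi> \<bullet> x > 0"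
  shows "lap K \<xi> * lap L \<xi> < top"
proof -
  have "lap K \<xi> < top" "lap L \<xi> < top" using lap_finite[OF hcone_closed hcone_cone] assms by auto
  thus ?thesis by (simp add: ennreal_mult_less_top)
qed

text \<open>A point \<open>y\<close> outside \<open>S\<close> is separated by an affine functional.
  Made homogeneous with the height coordinate, it is positive on \<open>A\<close> and
  \<open>C\<close> and negative at \<open>y\<close>, so one product is finite and the other
  infinite.\<close>

lemma lap_eq_hull:
  assumes H: "hcone A" "hcone C" "hcone A'" "hcone C'" and L: "lap_eq A C A' C'"
    and S: "compact S" "convex S" and sub: "A \<inter> {x. x$3 = 1} \<subseteq> S" "C \<inter> {x. x$3 = 1} \<subseteq> S"
  shows "A' \<inter> {x. x$3 = 1} \<subseteq> S"
proof
  fix y assume y: "y \<in> A' \<inter> {x. x$3 = 1}"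
  show "y \<in> S"
  proof (rule ccontr)
    assume "y \<notin> S"
    then obtain a b where ab: "a \<bullet> y < b" "\<forall>x\<in>S. a \<bullet> x > b"
      using separating_hyperplane_closed_point[OF S(2) compact_imp_closed[OF S(1)]] by blast
    define e3 where "e3 = (vector [0, 0, 1] :: real^3)"
    have e3: "e3 \<bullet> y = y$3" for y by (simp add: e3_def inner_vec_def sum_3)
    define \<xi> where "\<xi> = a - b *\<^sub>R e3"
    have xi: "\<xi> \<bullet> x = a \<bullet> x - b * x$3" for x by (simp add: \<xi>_def inner_diff_left e3)
    have yn: "\<xi> \<bullet> y < 0" using ab(1) y by (simp add: xi)
    have y0: "y \<noteq> 0" using y by auto
    have pos: "\<forall>x\<in>A \<union> C. x \<noteq> 0 \<longrightarrow> \<xi> \<bullet> x > 0"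
    proof (intro ballI impI)
      fix x assume x: "x \<in> A \<union> C" "x \<noteq> 0"
      have "x$3 > 0 \<and> (1 / x$3) *\<^sub>R x \<in> S" using x hcone_normalize[OF H(1)] hcone_normalize[OF H(2)] sub by blast
      hence n: "x$3 > 0" "a \<bullet> ((1 / x$3) *\<^sub>R x) > b" using ab(2) by auto
      hence "b < (a \<bullet> x) / x$3" by simp
      hence "b * x$3 < a \<bullet> x" using n(1) by (simp add: pos_less_divide_eq)
      thus "\<xi> \<bullet> x > 0" by (simp add: xi)
    qed
    have "\<xi> \<noteq> 0" using yn by auto
    from lap_finite_product[OF H(1,2) this pos] have "lap A \<xi> * lap C \<xi> < top" .
    moreover have "lap A' \<xi> * lap C' \<xi> = top" by (rule lap_top_point[OF H(3,4) _ y0]) (use y yn in auto)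
    ultimately show False using L unfolding lap_eq_def by simp
  qed
qed

text \<open>The functional exposing \<open>v\<close> vanishes at \<open>v\<close>, so the product is
  infinite if one of the cones contains \<open>v\<close>; it is positive on cones that miss
  \<open>v\<close>, whose product is finite.\<close>

lemma lap_eq_vertex:
  assumes H: "hcone A" "hcone C" "hcone A'" "hcone C'" "A' \<subseteq> D" "C' \<subseteq> D" and L: "lap_eq A C A' C'"
    and c: "corner v q p D" and v: "v \<in> A \<or> v \<in> C"
  shows "v \<in> A' \<or> v \<in> C'"
proof (rule ccontr)
  assume n: "\<not> (v \<in> A' \<or> v \<in> C')"
  have v0: "v \<noteq> 0" using c by (auto simp: corner_def)
  have pos: "\<forall>x\<in>A' \<union> C'. x \<noteq> 0 \<longrightarrow> cvec v q p \<bullet> x > 0"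
    using corner_cvec_pos[OF c H(3,5)] corner_cvec_pos[OF c H(4,6)] n by blast
  have z: "cvec v q p \<bullet> v \<le> 0" by (simp add: cvec_inner)
  have nz: "cvec v q p \<noteq> 0"
  proof
    assume "cvec v q p = 0"
    hence "x = 0" if "x \<in> A'" for x using pos that by auto
    hence "A' \<subseteq> {0}" by auto
    hence "interior A' \<subseteq> interior {0}" by (rule interior_mono)
    thus False using H(3) by (auto simp: hcone_def)
  qed
  have f: "lap A' (cvec v q p) * lap C' (cvec v q p) < top" by (rule lap_finite_product[OF H(3,4) nz pos])
  have "lap A (cvec v q p) * lap C (cvec v q p) = top"
    using v lap_top_point[OF H(1,2) _ v0 z] lap_top_point[OF H(2,1) _ v0 z] by (auto simp: mult.commute)
  thus False using f L unfolding lap_eq_def by simp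
qed

theorem proposition5p1:
  fixes A A' B B' F F' G G' H :: "(real^3) set"
    and n :: nat and z :: "nat \<Rightarrow> real^3"
  assumes "polyhedron A" "cone A" "interior A \<noteq> {}"
    and "polyhedron A'" "cone A'" "interior A' \<noteq> {}"
    and "polyhedron B" "cone B" "interior B \<noteq> {}"
    and "polyhedron B'" "cone B'" "interior B' \<noteq> {}"
    and "A \<subseteq> {x. x$3 \<ge> 0}" "A' \<subseteq> {x. x$3 \<ge> 0}"
    and "uminus ` B \<subseteq> {x. x$3 \<ge> 0}" "uminus ` B' \<subseteq> {x. x$3 \<ge> 0}"
    and "A \<inter> {x. x$3 = 0} = {0}" "A' \<inter> {x. x$3 = 0} = {0}"
    and "B \<inter> {x. x$3 = 0} = {0}" "B' \<inter> {x. x$3 = 0} = {0}"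
    and "F = A \<inter> {x. x$3 = 1}" "F' = A' \<inter> {x. x$3 = 1}"
    and "G = uminus ` B \<inter> {x. x$3 = 1}" "G' = uminus ` B' \<inter> {x. x$3 = 1}"
    and "cross_covariogram A B = cross_covariogram A' B'"
    and "H = convex hull (F \<union> G)"
    and "ccw_vertices H n z"
    and "\<And>i. i < n \<Longrightarrow> z i \<in> F \<inter> G \<longleftrightarrow> z i \<in> F' \<inter> G'"
    and "\<And>i. i < n \<Longrightarrow>
           closed_segment (z i) (z (Suc i mod n)) edge_of F \<or>
           closed_segment (z i) (z (Suc i mod n)) edge_of G \<longleftrightarrow>
           closed_segment (z i) (z (Suc i mod n)) edge_of F' \<or>
           closed_segment (z i) (z (Suc i mod n)) edge_of G'"
    and "\<And>i P P'. i < n \<Longrightarrow> z i \<notin> F \<inter> G \<Longrightarrow>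
           P \<in> {F, G} \<Longrightarrow> z i \<in> P \<Longrightarrow> P' \<in> {F', G'} \<Longrightarrow> z i \<in> P' \<Longrightarrow> coincide_near (z i) P P'"
  shows "(A = A' \<and> B = B') \<or> (A = uminus ` B' \<and> B = uminus ` A')"
proof -
  note poly = assms(1-12) and half = assms(13-20) and sec = assms(21-24) and cov = assms(25) and Hd = assms(26) and ccw = assms(27)
    and sh = assms(28) and ed = assms(29) and co = assms(30)
  define C where "C = uminus ` B"
  define C' where "C' = uminus ` B'"
  have hA: "hcone A" by (rule hconeI[OF poly(1-3) half(1,5)])
  have hA': "hcone A'" by (rule hconeI[OF poly(4-6) half(2,6)])
  have hC: "hcone C" unfolding C_def by (rule hcone_uminus[OF poly(7-9) half(3,7)])
  have hC': "hcone C'" unfolding C'_def by (rule hcone_uminus[OF poly(10-12) half(4,8)])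
  note FG = sec[folded C_def C'_def]
  have clo: "closed A" "closed A'" "closed B" "closed B'" using poly by (auto intro: polyhedron_imp_closed)
  have L: "lap_eq A C A' C'" unfolding lap_eq_def C_def C'_def
    using lap_mult[OF clo(1,3)] lap_mult[OF clo(2,4)] cov by simp
  have cpt: "compact (F \<union> G)" unfolding FG by (intro compact_Un hcone_section_compact hA hC)
  have cH: "compact H" "convex H" unfolding Hd using compact_convex_hull[OF cpt] by auto
  have ext: "z ` {..<n} = {v. v extreme_point_of H}" using ccw unfolding ccw_vertices_def bij_betw_def by blast
  have KM: "H = convex hull (z ` {..<n})" unfolding ext by (rule Krein_Milman_Minkowski[OF cH])
  have zFG: "z i \<in> F \<union> G" if "i < n" for i
  proof -
    have "z i extreme_point_of H" using ext that by blast
    thus ?thesis unfolding Hd by (rule extreme_point_of_convex_hull)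
  qed
  have h: "z i $ 3 = 1" if "i < n" for i using zFG[OF that] unfolding FG by auto
  define D where "D = ccone (z ` {..<n})"
  have HD: "H \<subseteq> D" unfolding KM D_def by (rule convex_hull_ccone) simp
  have inD: "K \<subseteq> D" if K: "hcone K" "K \<inter> {x. x$3 = 1} \<subseteq> H" for K
  proof
    fix x assume x: "x \<in> K"
    show "x \<in> D"
    proof (cases "x = 0")
      case True
      have "0 \<in> D" unfolding D_def ccone_def by (auto intro: exI[of _ "\<lambda>_. 0"])
      thus ?thesis using True by simp
    next
      case False
      note nz = hcone_normalize[OF K(1) x False]
      have "(1 / x$3) *\<^sub>R x \<in> D" using nz(2) K(2) HD by blast
      hence "x$3 *\<^sub>R ((1 / x$3) *\<^sub>R x) \<in> D" unfolding D_def by (rule ccone_scale) (use nz in simp)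
      thus ?thesis using nz(1) by simp
    qed
  qed
  have sF: "A \<inter> {x. x$3 = 1} \<subseteq> H" "C \<inter> {x. x$3 = 1} \<subseteq> H" unfolding Hd FG by (auto intro: hull_inc)
  \<comment> \<open>The inclusion of the sections of \<open>A'\<close> and \<open>C'\<close> in
    \<open>H\<close> is derived from the product of the transforms.\<close>
  have sF': "A' \<inter> {x. x$3 = 1} \<subseteq> H" "C' \<inter> {x. x$3 = 1} \<subseteq> H"
    by (rule lap_eq_hull[OF hA hC hA' hC' L cH sF])
       (rule lap_eq_hull[OF hA hC hC' hA' lap_eq_swap[OF L] cH sF])
  have AD: "A \<subseteq> D" "C \<subseteq> D" "A' \<subseteq> D" "C' \<subseteq> D" using inD hA hC hA' hC' sF sF' by auto
  \<comment> \<open>Fewer than three generators would put \<open>D\<close>, and with it the interior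
    of \<open>A\<close>, into a proper subspace.\<close>
  have n: "3 \<le> n"
  proof (rule ccontr)
    assume "\<not> 3 \<le> n"
    hence "card (z ` {..<n}) < 3" using card_image_le[of "{..<n}" z] by simp
    hence "dim (z ` {..<n}) < DIM(real^3)" using dim_le_card'[of "z ` {..<n}"] by simp
    hence "interior (span (z ` {..<n})) = {}" by (intro empty_interior_lowdim) simp
    moreover have "D \<subseteq> span (z ` {..<n})"
    proof
      fix x assume "x \<in> D"
      then obtain u where "x = (\<Sum>v\<in>z ` {..<n}. u v *\<^sub>R v)" unfolding D_def ccone_def by blast
      thus "x \<in> span (z ` {..<n})" by (simp only:) (rule span_sum, rule span_scale, rule span_base)
    qed
    hence "interior A \<subseteq> interior (span (z ` {..<n}))" using AD by (intro interior_mono) auto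
    ultimately show False using poly(3) by auto
  qed
  have o: "convex_order z n 1 D"
    unfolding convex_order_def D_def[symmetric]
  proof (intro conjI allI impI)
    fix i j k assume ijk: "i < j" "j < k" "k < n"
    hence "orient (z i) (z j) (z k) > 0" using ccw unfolding ccw_vertices_def by blast
    thus "1 * trip (z i) (z j) (z k) > 0" using orient_trip[of "z i" "z j" "z k"] h ijk by simp
  qed (use n h in auto)
  have zK: "z i \<in> F \<longleftrightarrow> z i \<in> A" "z i \<in> G \<longleftrightarrow> z i \<in> C" "z i \<in> F' \<longleftrightarrow> z i \<in> A'" "z i \<in> G' \<longleftrightarrow> z i \<in> C'" if "i < n" for i
    using h[OF that] unfolding FG by auto
  have cov': "z i \<in> A' \<or> z i \<in> C'" if i: "i < n" for i
  proof (rule lap_eq_vertex[OF hA hC hA' hC' AD(3,4) L])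
    have "(0 + i) mod n = i" using i by simp
    from convex_order_corner(1)[OF convex_order_rotate[OF o i], unfolded this]
    show "corner (z i) (z ((1 + i) mod n)) (z ((n - 1 + i) mod n)) D" .
    show "z i \<in> A \<or> z i \<in> C" using zFG[OF i] zK[OF i] by auto
  qed
  have vc: "vertices_covered A C A' C' z n" unfolding vertices_covered_def
    using zFG zK cov' sh by blast
  have edge: "z i \<in> A \<and> z (Suc i mod n) \<in> A \<or> z i \<in> C \<and> z (Suc i mod n) \<in> C \<longleftrightarrow> z i \<in> A' \<and> z (Suc i mod n) \<in> A' \<or> z i \<in> C' \<and> z (Suc i mod n) \<in> C'"
    if i: "i < n" for i
    using ed[OF i] unfolding FG edge_iff[OF o hA AD(1) i] edge_iff[OF o hC AD(2) i] edge_iff[OF o hA' AD(3) i] edge_iff[OF o hC' AD(4) i] .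
  have se: "same_edges A C A' C' z n" unfolding same_edges_def
  proof (intro allI impI)
    fix i j assume "adj n i j"
    hence "i < n" "j < n" "j = Suc i mod n \<or> i = Suc j mod n" by (auto simp: adj_def)
    thus "z i \<in> A \<and> z j \<in> A \<or> z i \<in> C \<and> z j \<in> C \<longleftrightarrow> z i \<in> A' \<and> z j \<in> A' \<or> z i \<in> C' \<and> z j \<in> C'"
      using edge[of i] edge[of j] by blast
  qed
  have sc: "simple_vertices_coincide A C A' C' z n" unfolding simple_vertices_coincide_def
  proof (intro allI impI ballI)
    fix i P P' assume i: "i < n" and ns: "\<not> (z i \<in> A \<and> z i \<in> C)" and P: "P \<in> {A, C}" "P' \<in> {A', C'}" "z i \<in> P" "z i \<in> P'"
    have "z i \<notin> F \<inter> G" using ns zK[OF i] by blast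
    moreover have "P \<inter> {x. x$3 = 1} \<in> {F, G}" "P' \<inter> {x. x$3 = 1} \<in> {F', G'}" using P(1,2) unfolding FG by auto
    moreover have "z i \<in> P \<inter> {x. x$3 = 1}" "z i \<in> P' \<inter> {x. x$3 = 1}" using P(3,4) h[OF i] by auto
    ultimately show "coin (z i) P P'" unfolding coin_def using co[OF i] by blast
  qed
  have "cfg A C A' C' D z n 1" unfolding cfg_def using hA hC hA' hC' AD L o vc se sc by blast
  from cfg_unique[OF this] have "A = A' \<and> C = C' \<or> A = C' \<and> C = A'" .
  moreover have "B = B'" if "C = C'" using that unfolding C_def C'_def by (simp add: inj_image_eq_iff)
  moreover have "B = uminus ` C" unfolding C_def by (simp add: image_image)
  ultimately show ?thesis unfolding C'_def by auto
qed

end
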